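(* Let $(u_h,\boldsymbol{\sigma}_h)\in V_h\times\boldsymbol{\Sigma}_h$ solve $$B_h(u_h,\boldsymbol{\sigma}_h;v_h,\boldsymbol{\tau}_h)=(f,v_h)_\Omega+\langle g,v_h\rangle_\Gamma\qquad\forall (v_h,\boldsymbol{\tau}_h)\in V_h\times\boldsymbol{\Sigma}_h.$$ Then $$\|(u_h,\boldsymbol{\sigma}_h)\|_{DG}\lesssim\gamma_2k^{-1}M(f,g),\qquad M(f,g):=\|f\|_{L^2(\Omega)}+\|g\|_{L^2(\Gamma)}.$$
   Context: $A\lesssim B$ means $A\le CB$ with a constant $C>0$ independent of $h$ and $k$. Let $\Omega\subset\mathbb{R}^d$ ($d=2,3$) be a bounded domain with boundary $\Gamma=\partial\Omega$ and outward unit normal $\mathbf{n}_\Omega$, strictly star-shaped with respect to a point $x_\Omega\in\Omega$, i.e. there is $c_\Omega>0$ with $(x-x_\Omega)\cdot\mathbf{n}_\Omega\ge c_\Omega$ for all $x\in\partial\Omega$. $\mathcal{T}_h$ is a family of partitions of $\Omega$ into triangles/tetrahedra, parameterized by $h>0$ and satisfying the minimal angle condition; $h_K=\operatorname{diam}(K)$, $h=\max_{K}h_K$, $h_e=\operatorname{diam}(e)$ for an edge/face $e$; $\mathcal{E}_h^I$ is the set of interior edges/faces. $k>0$ is the wave number, $\beta,\delta>0$ are given penalty parameters (possibly chosen depending on the mesh), and $f\in L^2(\Omega)$, $g\in L^2(\Gamma)$. All functions are complex-valued. $(u,v)_\Omega=\int_\Omega u\bar v\,dx$, $\langle u,v\rangle_e=\int_e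 u\bar v\,ds$, $\langle u,v\rangle_\Gamma=\int_\Gamma u\bar v\,ds$ (with dot products for vector functions); $\mathbf{i}=\sqrt{-1}$. $\nabla_h$ is the piecewise gradient, $\nabla_h|_K=\nabla|_K$ for $K\in\mathcal{T}_h$. On an interior edge/face $e$ shared by $K_1,K_2$ with outward unit normals $\mathbf{n}_1,\mathbf{n}_2$: $\{v\}=\frac12(v_1+v_2)$ and $[[v]]=v_1\mathbf{n}_1+v_2\mathbf{n}_2$ for scalar $v$; $\{\mathbf{v}\}=\frac12(\mathbf{v}_1+\mathbf{v}_2)$ and $[[\mathbf{v}]]=\mathbf{v}_1\cdot\mathbf{n}_1+\mathbf{v}_2\cdot\mathbf{n}_2$ for vector $\mathbf{v}$. $V_h$ is the space of (discontinuous) functions in $L^2(\Omega)$ whose real and imaginary parts restricted to each $K\in\mathcal{T}_h$ are polynomials of degree $\le 1$; $\boldsymbol{\Sigma}_h$ is the space of vector fields in $(L^2(\Omega))^d$ whose real and imaginary parts restricted to each $K$ lie in $(P_1(K))^d$. The sesquilinear form (LDG method #2) is $$B_h(w_h,\boldsymbol{\chi}_h;v_h,\boldsymbol{\tau}_h)=(\boldsymbol{\chi}_h,\nabla_h v_h)_\Omega-k^2(w_h,v_h)_\Omega+\mathbf{i}k\langle w_h,v_h\rangle_\Gamma-\sum_{e\in\mathcal{E}_h^I}\langle\{\boldsymbol{\chi}_h\}-\mathbf{i}\beta[[w_h]],[[v_h]]\rangle_e$$ $$-\sum_{e\in\mathcal{E}_h^I}\Bigl(\mathbf{i}\delta\langle[[\boldsymbol{\chi}_h]],[[\boldsymbol{\tau}_h]]\rangle_e-\langle[[w_h]],\{\boldsymbol{\tau}_h\}\rangle_e\Bigr)+(\boldsymbol{\chi}_h,\boldsymbol{\tau}_h)_\Omega-(\nabla_h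 w_h,\boldsymbol{\tau}_h)_\Omega.$$ Further, $$\gamma_2:=k+\max_{e\in\mathcal{E}_h^I}\Bigl(\frac{k^2+1}{\beta h_e}+\frac{\beta+\delta}{h_e}+\frac{\delta}{h_e^3}+\frac{1}{\beta h_e^3}\Bigr),$$ $$\|(w_h,\boldsymbol{\chi}_h)\|_{DG}:=\Bigl(k^2\|w_h\|_{L^2(\Omega)}^2+k^2\|w_h\|_{L^2(\Gamma)}^2+\|\boldsymbol{\chi}_h\|_{L^2(\Omega)}^2+c_\Omega\|\nabla_h w_h\|_{L^2(\Gamma)}^2\Bigr)^{1/2}.$$ *)

theory Defs
  imports "HOL-Analysis.Analysis"
begin

section \<open>Domains and meshes\<close>

text \<open>
  The unit outward normal at a boundary point is the normal of the tangent half-space. At points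
  where the boundary has no tangent hyperplane (vertices and edges of a polyhedral domain) no
  vector satisfies this predicate.
\<close>

definition outward_unit_normal :: "'a::euclidean_space set \<Rightarrow> 'a \<Rightarrow> 'a \<Rightarrow> bool" where
  "outward_unit_normal \<Omega> x n \<longleftrightarrow> norm n = 1 \<and>
     (\<forall>\<epsilon>>0. \<exists>r>0. \<forall>y\<in>ball x r.
        (n \<bullet> (y - x) < - \<epsilon> * norm (y - x) \<longrightarrow> y \<in> \<Omega>) \<and>
        (n \<bullet> (y - x) > \<epsilon> * norm (y - x) \<longrightarrow> y \<notin> \<Omega>))"

text \<open>
  The equation excludes slits: the domain lies on one side of its boundary, which is implicit in
  speaking of the outward normal on the whole boundary.
\<close>

definition bounded_domain :: "'a::euclidean_space set \<Rightarrow> bool" where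
  "bounded_domain \<Omega> \<longleftrightarrow> open \<Omega> \<and> connected \<Omega> \<and> bounded \<Omega> \<and> \<Omega> \<noteq> {} \<and> interior (closure \<Omega>) = \<Omega>"

definition strictly_star_shaped :: "'a::euclidean_space set \<Rightarrow> 'a \<Rightarrow> real \<Rightarrow> bool" where
  "strictly_star_shaped \<Omega> x\<^sub>\<Omega> c\<^sub>\<Omega> \<longleftrightarrow> x\<^sub>\<Omega> \<in> \<Omega> \<and> c\<^sub>\<Omega> > 0 \<and>
     (\<forall>x\<in>frontier \<Omega>. \<forall>n. outward_unit_normal \<Omega> x n \<longrightarrow> (x - x\<^sub>\<Omega>) \<bullet> n \<ge> c\<^sub>\<Omega>)"

text \<open>
  A mesh is a set of closed full-dimensional simplices; \<^const>\<open>triangulation\<close> says that there are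
  finitely many and that any two of them meet in a common (possibly empty) face.
\<close>

definition mesh_of :: "'a::euclidean_space set \<Rightarrow> 'a set set \<Rightarrow> bool" where
  "mesh_of \<Omega> T \<longleftrightarrow> triangulation T \<and> (\<forall>K\<in>T. int DIM('a) simplex K) \<and> \<Union>T = closure \<Omega>"

definition facet_normal :: "'a::euclidean_space set \<Rightarrow> 'a set \<Rightarrow> 'a" where
  "facet_normal K e = (THE n. norm n = 1 \<and> (\<exists>c. e \<subseteq> {x. n \<bullet> x = c} \<and> K \<subseteq> {x. n \<bullet> x \<le> c}))"

definition vec_angle :: "'a::real_inner \<Rightarrow> 'a \<Rightarrow> real" where
  "vec_angle a b = arccos (a \<bullet> b / (norm a * norm b))"

text \<open>
  The angles of a simplex: the planar angles of its triangular faces, and the dihedral angles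
  between its facets (supplements of the angles between the outward normals). For a triangle both
  kinds are its three interior angles.
\<close>

definition angles_ge :: "real \<Rightarrow> 'a::euclidean_space set \<Rightarrow> bool" where
  "angles_ge \<theta> K \<longleftrightarrow>
     (\<forall>a b c. a extreme_point_of K \<and> b extreme_point_of K \<and> c extreme_point_of K \<and>
              a \<noteq> b \<and> a \<noteq> c \<and> b \<noteq> c \<longrightarrow> vec_angle (b - a) (c - a) \<ge> \<theta>) \<and>
     (\<forall>e e'. e facet_of K \<and> e' facet_of K \<and> e \<noteq> e' \<longrightarrow>
              pi - vec_angle (facet_normal K e) (facet_normal K e') \<ge> \<theta>)"

definition minimal_angle_condition :: "'a::euclidean_space set set set \<Rightarrow> bool" where
  "minimal_angle_condition \<T> \<longleftrightarrow> (\<exists>\<theta>>0. \<forall>T\<in>\<T>. \<forall>K\<in>T. angles_ge \<theta> K)"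

definition interior_faces :: "'a::euclidean_space set set \<Rightarrow> 'a set set" where
  "interior_faces T = {e. \<exists>K\<^sub>1\<in>T. \<exists>K\<^sub>2\<in>T. K\<^sub>1 \<noteq> K\<^sub>2 \<and> e facet_of K\<^sub>1 \<and> e facet_of K\<^sub>2}"


section \<open>Integrals, inner products and norms\<close>

text \<open>
  Surface measure on a facet \<open>e\<close>. Within distance 1/2 of the hyperplane \<open>affine hull e\<close> lies a slab
  of thickness 1, so by Fubini the image of the Lebesgue measure on this slab under the orthogonal
  projection onto the hyperplane is the Lebesgue measure of the hyperplane, of dimension
  \<open>DIM('a) - 1\<close>.
\<close>

definition face_measure :: "'a::euclidean_space set \<Rightarrow> 'a measure" where
  "face_measure e = completion (restrict_space
     (distr (restrict_space lborel {x. infdist x (affine hull e) \<le> 1/2}) borel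
            (closest_point (affine hull e))) e)"

text \<open>
  Integrals over the boundary of the domain are sums over the facets contained in it. Each of
  these facets belongs to exactly one element \<open>K\<close>, which is passed to the integrand because traces
  are taken from within \<open>K\<close>.
\<close>

definition boundary_integral ::
  "'a::euclidean_space set \<Rightarrow> 'a set set \<Rightarrow> ('a set \<Rightarrow> 'a \<Rightarrow> 'b::{banach, second_countable_topology}) \<Rightarrow> 'b"
  where "boundary_integral \<Omega> T F =
     (\<Sum>K\<in>T. \<Sum>e | e facet_of K \<and> e \<subseteq> frontier \<Omega>. LINT x|face_measure e. F K x)"

definition cdot :: "complex^'n \<Rightarrow> complex^'n \<Rightarrow> complex" where
  "cdot a b = (\<Sum>i\<in>UNIV. a $ i * cnj (b $ i))"

definition L2_inner :: "'a measure \<Rightarrow> ('a \<Rightarrow> complex) \<Rightarrow> ('a \<Rightarrow> complex) \<Rightarrow> complex" where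
  "L2_inner M u v = (LINT x|M. u x * cnj (v x))"

definition L2_vinner :: "'a measure \<Rightarrow> ('a \<Rightarrow> complex^'n) \<Rightarrow> ('a \<Rightarrow> complex^'n) \<Rightarrow> complex" where
  "L2_vinner M u v = (LINT x|M. cdot (u x) (v x))"

definition L2_norm :: "'a measure \<Rightarrow> ('a \<Rightarrow> 'b::{banach, second_countable_topology}) \<Rightarrow> real" where
  "L2_norm M u = sqrt (LINT x|M. (norm (u x))\<^sup>2)"

definition L2 :: "'a measure \<Rightarrow> ('a \<Rightarrow> 'b::{banach, second_countable_topology}) set" where
  "L2 M = {u. u \<in> borel_measurable M \<and> integrable M (\<lambda>x. (norm (u x))\<^sup>2)}"

definition L2_boundary :: "'a::euclidean_space set \<Rightarrow> 'a set set \<Rightarrow> ('a \<Rightarrow> complex) set" where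
  "L2_boundary \<Omega> T = {g. \<forall>K\<in>T. \<forall>e. e facet_of K \<and> e \<subseteq> frontier \<Omega> \<longrightarrow> g \<in> L2 (face_measure e)}"

definition L2_boundary_norm :: "'a::euclidean_space set \<Rightarrow> 'a set set \<Rightarrow> ('a \<Rightarrow> complex) \<Rightarrow> real" where
  "L2_boundary_norm \<Omega> T g = sqrt (boundary_integral \<Omega> T (\<lambda>K x. (norm (g x))\<^sup>2))"


section \<open>Discontinuous finite element spaces\<close>

definition P1 :: "('a::real_inner \<Rightarrow> real) set" where
  "P1 = {p. \<exists>a b. p = (\<lambda>x. a + b \<bullet> x)}"

text \<open>
  Members of the discontinuous spaces are prescribed on the interiors of the elements only. Their
  values on the mesh skeleton, a null set, are arbitrary and do not enter below: domain integrals
  ignore them, and boundary values are always one-sided limits (\<open>trace_from\<close>).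
\<close>

definition V\<^sub>h :: "'a::euclidean_space set set \<Rightarrow> ('a \<Rightarrow> complex) set" where
  "V\<^sub>h T = {v. \<forall>K\<in>T. \<exists>p\<in>P1. \<exists>q\<in>P1. \<forall>x\<in>interior K. v x = Complex (p x) (q x)}"

definition \<Sigma>\<^sub>h :: "(real^'n) set set \<Rightarrow> (real^'n \<Rightarrow> complex^'n) set" where
  "\<Sigma>\<^sub>h T = {\<tau>. \<forall>i. (\<lambda>x. \<tau> x $ i) \<in> V\<^sub>h T}"

definition trace_from :: "'a::euclidean_space set \<Rightarrow> ('a \<Rightarrow> 'b::t2_space) \<Rightarrow> 'a \<Rightarrow> 'b" where
  "trace_from K v x = Lim (at x within interior K) v"

text \<open>The pointwise gradient; off the mesh skeleton it is the piecewise gradient.\<close>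

definition grad :: "(real^'n \<Rightarrow> complex) \<Rightarrow> real^'n \<Rightarrow> complex^'n" where
  "grad v x = (\<chi> i. frechet_derivative v (at x) (axis i 1))"

text \<open>
  On an interior face the sums below have two terms, one for each of the elements sharing the face.
\<close>

definition average :: "'a::euclidean_space set set \<Rightarrow> 'a set \<Rightarrow> ('a \<Rightarrow> 'b::real_normed_vector) \<Rightarrow> 'a \<Rightarrow> 'b" where
  "average T e v x = (1/2) *\<^sub>R (\<Sum>K | K \<in> T \<and> e facet_of K. trace_from K v x)"

definition jump :: "(real^'n) set set \<Rightarrow> (real^'n) set \<Rightarrow> (real^'n \<Rightarrow> complex) \<Rightarrow> real^'n \<Rightarrow> complex^'n" where
  "jump T e v x =
     (\<Sum>K | K \<in> T \<and> e facet_of K. \<chi> i. trace_from K v x * complex_of_real (facet_normal K e $ i))"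

definition vjump :: "(real^'n) set set \<Rightarrow> (real^'n) set \<Rightarrow> (real^'n \<Rightarrow> complex^'n) \<Rightarrow> real^'n \<Rightarrow> complex" where
  "vjump T e \<tau> x =
     (\<Sum>K | K \<in> T \<and> e facet_of K. \<Sum>i\<in>UNIV. trace_from K \<tau> x $ i * complex_of_real (facet_normal K e $ i))"


section \<open>The LDG method\<close>

definition B\<^sub>h :: "(real^'n) set \<Rightarrow> (real^'n) set set \<Rightarrow> real \<Rightarrow> real \<Rightarrow> real \<Rightarrow>
    (real^'n \<Rightarrow> complex) \<Rightarrow> (real^'n \<Rightarrow> complex^'n) \<Rightarrow>
    (real^'n \<Rightarrow> complex) \<Rightarrow> (real^'n \<Rightarrow> complex^'n) \<Rightarrow> complex" where
  "B\<^sub>h \<Omega> T k \<beta> \<delta> w \<rho> v \<tau> =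
     L2_vinner (lebesgue_on \<Omega>) \<rho> (grad v)
     - complex_of_real (k\<^sup>2) * L2_inner (lebesgue_on \<Omega>) w v
     + \<i> * complex_of_real k * boundary_integral \<Omega> T (\<lambda>K x. trace_from K w x * cnj (trace_from K v x))
     - (\<Sum>e\<in>interior_faces T.
          L2_vinner (face_measure e)
            (\<lambda>x. average T e \<rho> x - (\<i> * complex_of_real \<beta>) *s jump T e w x) (jump T e v))
     - (\<Sum>e\<in>interior_faces T.
          \<i> * complex_of_real \<delta> * L2_inner (face_measure e) (vjump T e \<rho>) (vjump T e \<tau>)
          - L2_vinner (face_measure e) (jump T e w) (average T e \<tau>))
     + L2_vinner (lebesgue_on \<Omega>) \<rho> \<tau>
     - L2_vinner (lebesgue_on \<Omega>) (grad w) \<tau>"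

definition LDG_rhs :: "(real^'n) set \<Rightarrow> (real^'n) set set \<Rightarrow> (real^'n \<Rightarrow> complex) \<Rightarrow>
    (real^'n \<Rightarrow> complex) \<Rightarrow> (real^'n \<Rightarrow> complex) \<Rightarrow> complex" where
  "LDG_rhs \<Omega> T f g v =
     L2_inner (lebesgue_on \<Omega>) f v + boundary_integral \<Omega> T (\<lambda>K x. g x * cnj (trace_from K v x))"

text \<open>The maximum over an empty set of interior faces (a mesh with a single element) is read as 0.\<close>

definition \<gamma>\<^sub>2 :: "'a::euclidean_space set set \<Rightarrow> real \<Rightarrow> real \<Rightarrow> real \<Rightarrow> real" where
  "\<gamma>\<^sub>2 T k \<beta> \<delta> = k + Max (insert 0 ((\<lambda>e.
       (k\<^sup>2 + 1) / (\<beta> * diameter e) + (\<beta> + \<delta>) / diameter e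
       + \<delta> / diameter e ^ 3 + 1 / (\<beta> * diameter e ^ 3)) ` interior_faces T))"

definition DG_norm :: "(real^'n) set \<Rightarrow> real \<Rightarrow> (real^'n) set set \<Rightarrow> real \<Rightarrow>
    (real^'n \<Rightarrow> complex) \<Rightarrow> (real^'n \<Rightarrow> complex^'n) \<Rightarrow> real" where
  "DG_norm \<Omega> c\<^sub>\<Omega> T k w \<rho> = sqrt (
       k\<^sup>2 * (L2_norm (lebesgue_on \<Omega>) w)\<^sup>2
     + k\<^sup>2 * boundary_integral \<Omega> T (\<lambda>K x. (norm (trace_from K w x))\<^sup>2)
     + (L2_norm (lebesgue_on \<Omega>) \<rho>)\<^sup>2
     + c\<^sub>\<Omega> * boundary_integral \<Omega> T (\<lambda>K x. (norm (trace_from K (grad w) x))\<^sup>2))"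

end

(* The elementwise multiplier (x - x0) . grad u of Rellich-Morawetz type is an admissible test function
   because u is piecewise affine, and strict star-shapedness makes the resulting boundary term control
   the gradient on the boundary. The energy identity (test with (u, -sigma)) bounds the jumps and the
   boundary values of u through its imaginary part, and the residual sigma - grad u is bounded by testing
   the vector equation with the residual itself. Trace and inverse inequalities turn the face terms into
   jumps weighted by powers of h_e, which gamma_2 absorbs. *)

theory Submission
  imports Defs
begin

section \<open>Integrals over cones and their base facets\<close>

text \<open>The obstacle is the interior-face part of the Rellich identity, where the averaged
  gradient times the jump of the multiplier meets the jump of the squared gradient. Their common
  normal part cancels. What remains contains only the tangential jump of the gradient, which an
  inverse estimate on the face bounds by the jump of \<open>u\<close> over \<open>h\<close>; with
  the trace estimate of the averaged gradient this costs \<open>1 / h ^ 3\<close>, the origin of the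
  last term of \<open>\<gamma>\<^sub>2\<close>. Integrals are made explicit: slicing an element as a
  cone over a facet ties volume to surface integrals, so that trace inequality, inverse inequality
  and divergence theorem become relations between vertex values of affine functions. The penalties
  are free, so a lower bound on \<open>\<gamma>\<^sub>2\<close> has to come from the competition of
  \<open>\<beta> / h\<close> with \<open>1 / (\<beta> * h ^ 3)\<close>; it fails without interior
  faces, which forces a separate case. Neither the energy nor the Rellich identity closes alone:
  each bounds its quantity by the other one, and the two quadratic inequalities are solved
  together.\<close>

lemma nn_integral_lborel_affine:
  fixes t :: "'a::euclidean_space"
  assumes [measurable]: "f \<in> borel_measurable borel" and c: "c \<noteq> 0"
  shows "(\<integral>\<^sup>+x. f x \<partial>lborel) = ennreal (\<bar>c\<bar> ^ DIM('a)) * (\<integral>\<^sup>+x. f (t + c *\<^sub>R x) \<partial>lborel)"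
  by (subst lborel_affine[OF c, of t])
     (simp add: nn_integral_density nn_integral_distr nn_integral_cmult ennreal_power)

lemma closest_point_hyperplane:
  fixes n :: "'a::euclidean_space"
  assumes "norm n = 1"
  shows "closest_point {y. n \<bullet> y = c} x = x - (n \<bullet> x - c) *\<^sub>R n"
proof -
  have nn: "n \<bullet> n = 1" using assms by (simp add: norm_eq_1)
  have "x - (n \<bullet> x - c) *\<^sub>R n = closest_point {y. n \<bullet> y = c} x"
  proof (rule closest_point_unique)
    show "convex {y. n \<bullet> y = c}" by (rule convex_hyperplane)
    show "closed {y. n \<bullet> y = c}" by (rule closed_hyperplane)
    show "x - (n \<bullet> x - c) *\<^sub>R n \<in> {y. n \<bullet> y = c}"
      by (simp add: inner_diff_right nn)
    show "\<forall>z\<in>{y. n \<bullet> y = c}. dist x (x - (n \<bullet> x - c) *\<^sub>R n) \<le> dist x z"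
    proof clarify
      fix z assume "c = n \<bullet> z"
      have "\<bar>n \<bullet> (x - z)\<bar> \<le> norm n * norm (x - z)" by (rule Cauchy_Schwarz_ineq2)
      then show "dist x (x - (n \<bullet> x - n \<bullet> z) *\<^sub>R n) \<le> dist x z"
        using assms by (simp add: dist_norm inner_diff_right)
    qed
  qed
  then show ?thesis ..
qed

lemma infdist_hyperplane:
  fixes n :: "'a::euclidean_space"
  assumes "norm n = 1"
  shows "infdist x {y. n \<bullet> y = c} = \<bar>n \<bullet> x - c\<bar>"
proof -
  have ne: "{y. n \<bullet> y = c} \<noteq> {}"
  proof -
    have "n \<bullet> (c *\<^sub>R n) = c" using assms by (simp add: norm_eq_1)
    then show ?thesis by blast
  qed
  have "infdist x {y. n \<bullet> y = c} = dist x (closest_point {y. n \<bullet> y = c} x)"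
    using setdist_closest_point[OF closed_hyperplane ne] by (simp add: infdist_eq_setdist)
  then show ?thesis using assms by (simp add: closest_point_hyperplane dist_norm)
qed

lemma space_face_measure: "space (face_measure e) = e"
  by (simp add: face_measure_def space_restrict_space)

lemma measurable_face_measureI:
  assumes "f \<in> borel_measurable borel"
  shows "f \<in> borel_measurable (face_measure e)"
  unfolding face_measure_def
  by (intro measurable_completion measurable_restrict_space1) (use assms in simp)

text \<open>The slab in the definition of \<open>face_measure\<close> meets every normal line in a
  segment of length 1, so a surface integral is a Lebesgue integral of the integrand extended
  constantly along the normal.\<close>

lemma nn_integral_face_measure:
  fixes n :: "'a::euclidean_space"
  assumes n: "norm n = 1" and hull: "affine hull e = {y. n \<bullet> y = c}"
    and e[measurable]: "e \<in> sets borel" and [measurable]: "\<phi> \<in> borel_measurable borel"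
  shows "(\<integral>\<^sup>+y. \<phi> y \<partial>face_measure e) =
    (\<integral>\<^sup>+x. \<phi> (x - (n \<bullet> x - c) *\<^sub>R n) * indicator e (x - (n \<bullet> x - c) *\<^sub>R n)
       * indicator {-1/2..1/2} (n \<bullet> x - c) \<partial>lborel)"
proof -
  have slab: "{x. infdist x (affine hull e) \<le> 1/2} = {x. \<bar>n \<bullet> x - c\<bar> \<le> 1/2}"
    unfolding hull infdist_hyperplane[OF n] ..
  have cp: "closest_point (affine hull e) = (\<lambda>x. x - (n \<bullet> x - c) *\<^sub>R n)"
    unfolding hull closest_point_hyperplane[OF n] by (rule refl)
  let ?S = "{x. \<bar>n \<bullet> x - c\<bar> \<le> 1/2}"
  have S[measurable]: "?S \<in> sets borel" by measurable
  have \<pi>: "(\<lambda>x. x - (n \<bullet> x - c) *\<^sub>R n) \<in> borel_measurable (restrict_space lborel ?S)"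
    by (rule measurable_restrict_space1) measurable
  have "(\<integral>\<^sup>+y. \<phi> y \<partial>face_measure e) =
      (\<integral>\<^sup>+y. \<phi> y * indicator e y \<partial>distr (restrict_space lborel ?S) borel (\<lambda>x. x - (n \<bullet> x - c) *\<^sub>R n))"
    unfolding face_measure_def nn_integral_completion slab cp
    by (subst nn_integral_restrict_space) auto
  also have "\<dots> = (\<integral>\<^sup>+x. \<phi> (x - (n \<bullet> x - c) *\<^sub>R n) * indicator e (x - (n \<bullet> x - c) *\<^sub>R n)
       \<partial>restrict_space lborel ?S)"
    by (subst nn_integral_distr[OF \<pi>]) auto
  also have "\<dots> = (\<integral>\<^sup>+x. \<phi> (x - (n \<bullet> x - c) *\<^sub>R n) * indicator e (x - (n \<bullet> x - c) *\<^sub>R n) * indicator ?S x \<partial>lborel)"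
    by (subst nn_integral_restrict_space) auto
  also have "\<dots> = (\<integral>\<^sup>+x. \<phi> (x - (n \<bullet> x - c) *\<^sub>R n) * indicator e (x - (n \<bullet> x - c) *\<^sub>R n)
       * indicator {-1/2..1/2} (n \<bullet> x - c) \<partial>lborel)"
  proof (intro nn_integral_cong)
    fix x
    have "\<bar>n \<bullet> x - c\<bar> \<le> 1/2 \<longleftrightarrow> n \<bullet> x - c \<in> {-1/2..1/2}"
      unfolding abs_le_iff atLeastAtMost_iff by linarith
    then have "indicator ?S x = (indicator {-1/2..1/2} (n \<bullet> x - c) :: ennreal)"
      by (simp only: indicator_def mem_Collect_eq)
    then show "\<phi> (x - (n \<bullet> x - c) *\<^sub>R n) * indicator e (x - (n \<bullet> x - c) *\<^sub>R n) * indicator ?S x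
      = \<phi> (x - (n \<bullet> x - c) *\<^sub>R n) * indicator e (x - (n \<bullet> x - c) *\<^sub>R n)
       * indicator {-1/2..1/2} (n \<bullet> x - c)" by (simp only:)
  qed
  finally show ?thesis .
qed

text \<open>Polar coordinates with apex \<open>p\<close>: the slice at relative height
  \<open>r\<close> is a copy of the base scaled by \<open>r\<close>, which gives
  \<open>r ^ (DIM('a) - 1)\<close>, homogeneity of \<open>\<phi>\<close> gives \<open>r ^ m\<close>,
  and the height contributes \<open>a\<close>. Since surface measure is itself a Lebesgue integral
  over a slab, everything reduces to Fubini and affine substitutions in the full space.\<close>

lemma nn_integral_cone:
  fixes p n :: "'a::euclidean_space" and \<phi> :: "'a \<Rightarrow> ennreal" and \<omega> :: "real \<Rightarrow> ennreal"
  assumes l_def: "l = (\<lambda>z. (n \<bullet> (z - p)) / a)" and n: "norm n = 1" and a: "a > 0" and hull: "affine hull e = {y. n \<bullet> y = n \<bullet> p + a}"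
    and e[measurable]: "e \<in> sets borel" and K[measurable]: "K \<in> sets borel"
    and \<phi>[measurable]: "\<phi> \<in> borel_measurable borel" and \<omega>[measurable]: "\<omega> \<in> borel_measurable borel"
    and hom: "\<And>r y. 0 < r \<Longrightarrow> r \<le> 1 \<Longrightarrow> y \<in> e \<Longrightarrow> \<phi> (p + r *\<^sub>R (y - p)) = ennreal (r ^ m) * \<phi> y"
    and Kl: "\<And>z. z \<in> K \<Longrightarrow> 0 \<le> l z \<and> l z \<le> 1"
    and Ke: "\<And>r y. 0 < r \<Longrightarrow> r \<le> 1 \<Longrightarrow> n \<bullet> y = n \<bullet> p + a \<Longrightarrow> p + r *\<^sub>R (y - p) \<in> K \<longleftrightarrow> y \<in> e"
  shows "(\<integral>\<^sup>+z. \<omega> (l z) * \<phi> z * indicator K z \<partial>lborel) =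
    ennreal a * (\<integral>\<^sup>+r. ennreal (r ^ (DIM('a) - 1 + m)) * \<omega> r * indicator {0..1} r \<partial>lborel)
      * (\<integral>\<^sup>+y. \<phi> y \<partial>face_measure e)"
proof -
  let ?c = "n \<bullet> p + a"
  let ?\<pi> = "\<lambda>x. x - (n \<bullet> x - ?c) *\<^sub>R n"
  let ?d = "DIM('a)"
  have nn: "n \<bullet> n = 1" using n by (simp add: norm_eq_1)
  have [measurable]: "l \<in> borel_measurable borel" unfolding l_def by measurable
  \<comment> \<open>Here \<open>z\<close> is a point of the cone and \<open>\<tau>\<close> an offset
    along the normal from its slice. The slab around the slice has thickness \<open>l z\<close>, and
    \<open>1 / l z\<close> normalises it.\<close>
  define H where "H = (\<lambda>z \<tau>. indicator {0<..1} (l z) * ennreal (1 / l z) * \<omega> (l z) * indicator K z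
      * indicator {-1/2..1/2} (\<tau> / l z) * \<phi> z :: ennreal)"
  have [measurable]: "(\<lambda>x. H (f x) (g x)) \<in> borel_measurable M"
    if [measurable]: "f \<in> borel_measurable M" "g \<in> borel_measurable M" for f g and M :: "'b measure"
    unfolding H_def by measurable
  define I where "I = (\<integral>\<^sup>+y. \<phi> y \<partial>face_measure e)"
  have I: "I = (\<integral>\<^sup>+x. \<phi> (?\<pi> x) * indicator e (?\<pi> x) * indicator {-1/2..1/2} (n \<bullet> x - ?c) \<partial>lborel)"
    unfolding I_def by (rule nn_integral_face_measure[OF n hull e \<phi>])
  have np: "n \<bullet> ?\<pi> x = ?c" for x by (simp add: inner_diff_right nn)
  \<comment> \<open>For fixed \<open>r\<close> the point \<open>x\<close> is projected to the slice
    at height \<open>r\<close>; scaling about \<open>p\<close> by \<open>r\<close> maps the slab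
    around the base to the slab around the slice.\<close>
  have slice: "(\<integral>\<^sup>+x. H (x - (n \<bullet> (x - p) - r * a) *\<^sub>R n) (n \<bullet> (x - p) - r * a) \<partial>lborel)
      = ennreal (r ^ (?d - 1 + m)) * \<omega> r * indicator {0<..1} r * I" for r
  proof (cases "0 < r \<and> r \<le> 1")
    case False
    have "l (x - (n \<bullet> (x - p) - r * a) *\<^sub>R n) = r" for x
      using a nn by (simp add: l_def inner_diff_right algebra_simps)
    then show ?thesis using False by (simp add: H_def)
  next
    case True
    then have r: "0 < r" "r \<le> 1" by auto
    let ?h = "\<lambda>x. H (x - (n \<bullet> (x - p) - r * a) *\<^sub>R n) (n \<bullet> (x - p) - r * a)"
    have pt: "ennreal (r ^ ?d) * ?h ((p - r *\<^sub>R p) + r *\<^sub>R x)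
        = ennreal (r ^ (?d - 1 + m)) * \<omega> r * (\<phi> (?\<pi> x) * indicator e (?\<pi> x) * indicator {-1/2..1/2} (n \<bullet> x - ?c))" for x
    proof -
      let ?x = "(p - r *\<^sub>R p) + r *\<^sub>R x"
      have tau: "n \<bullet> (?x - p) - r * a = r * (n \<bullet> x - ?c)"
        by (simp add: inner_diff_right inner_add_right algebra_simps)
      have z: "?x - (r * (n \<bullet> x - ?c)) *\<^sub>R n = p + r *\<^sub>R (?\<pi> x - p)"
        by (simp add: algebra_simps)
      have lz: "l (p + r *\<^sub>R (?\<pi> x - p)) = r"
        unfolding l_def by (simp only: add_diff_cancel_left' inner_scaleR_right inner_diff_right[of n "?\<pi> x" p] np) (use a in simp)
      have ph: "\<phi> (p + r *\<^sub>R (?\<pi> x - p)) = ennreal (r ^ m) * \<phi> (?\<pi> x)" if "?\<pi> x \<in> e"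
        using hom r that by blast
      have Kz: "indicator K (p + r *\<^sub>R (?\<pi> x - p)) = (indicator e (?\<pi> x) :: ennreal)"
        using Ke[OF r np[of x]] by (simp add: indicator_def)
      have pw: "ennreal (r ^ ?d) * ennreal (1 / r) * ennreal (r ^ m) = ennreal (r ^ (?d - 1 + m))"
      proof -
        obtain D where "?d = Suc D" using gr0_conv_Suc[of ?d] DIM_positive by blast
        then have "r ^ ?d * (1 / r) * r ^ m = r ^ (?d - 1 + m)"
          using r by (simp add: power_add)
        then show ?thesis using r by (simp flip: ennreal_mult)
      qed
      have "?h ?x = ennreal (1 / r) * \<omega> r * indicator e (?\<pi> x) * indicator {-1/2..1/2} (n \<bullet> x - ?c)
          * (ennreal (r ^ m) * \<phi> (?\<pi> x))"
        unfolding tau z H_def lz Kz using r ph by (auto simp: indicator_def)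
      then show ?thesis unfolding pw[symmetric] by (simp add: ac_simps)
    qed
    have "(\<integral>\<^sup>+x. ?h x \<partial>lborel) = ennreal (\<bar>r\<bar> ^ ?d) * (\<integral>\<^sup>+x. ?h ((p - r *\<^sub>R p) + r *\<^sub>R x) \<partial>lborel)"
      by (rule nn_integral_lborel_affine) (use r in auto)
    also have "\<dots> = (\<integral>\<^sup>+x. ennreal (r ^ ?d) * ?h ((p - r *\<^sub>R p) + r *\<^sub>R x) \<partial>lborel)"
      using r by (simp add: nn_integral_cmult)
    also have "\<dots> = ennreal (r ^ (?d - 1 + m)) * \<omega> r * I"
      unfolding pt I by (subst nn_integral_cmult) auto
    finally show ?thesis using r by simp
  qed
  have "(\<integral>\<^sup>+r. ennreal (r ^ (?d - 1 + m)) * \<omega> r * indicator {0..1} r \<partial>lborel) * I =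
      (\<integral>\<^sup>+r. ennreal (r ^ (?d - 1 + m)) * \<omega> r * indicator {0<..1} r \<partial>lborel) * I"
  proof -
    have "AE r in lborel. r \<noteq> (0::real)" by (rule AE_lborel_singleton)
    then have "(\<integral>\<^sup>+r. ennreal (r ^ (?d - 1 + m)) * \<omega> r * indicator {0..1} r \<partial>lborel) =
      (\<integral>\<^sup>+r. ennreal (r ^ (?d - 1 + m)) * \<omega> r * indicator {0<..1} r \<partial>lborel)"
      by (intro nn_integral_cong_AE) (auto simp: indicator_def)
    then show ?thesis by simp
  qed
  also have "\<dots> = (\<integral>\<^sup>+r. ennreal (r ^ (?d - 1 + m)) * \<omega> r * indicator {0<..1} r * I \<partial>lborel)"
    by (subst nn_integral_multc) auto
  also have "\<dots> = (\<integral>\<^sup>+r. \<integral>\<^sup>+x. H (x - (n \<bullet> (x - p) - r * a) *\<^sub>R n) (n \<bullet> (x - p) - r * a) \<partial>lborel \<partial>lborel)"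
    unfolding slice ..
  also have "\<dots> = (\<integral>\<^sup>+x. \<integral>\<^sup>+r. H (x - (n \<bullet> (x - p) - r * a) *\<^sub>R n) (n \<bullet> (x - p) - r * a) \<partial>lborel \<partial>lborel)"
    by (rule lborel_pair.Fubini') (measurable)
  \<comment> \<open>For fixed \<open>x\<close> the height \<open>r\<close> is exchanged for the
    offset \<open>\<tau> = n \<bullet> (x - p) - r * a\<close>.\<close>
  also have "\<dots> = (\<integral>\<^sup>+x. ennreal (1 / a) * (\<integral>\<^sup>+\<tau>. H (x - \<tau> *\<^sub>R n) \<tau> \<partial>lborel) \<partial>lborel)"
  proof (intro nn_integral_cong)
    fix x
    have "(\<integral>\<^sup>+r. H (x - (n \<bullet> (x - p) - r * a) *\<^sub>R n) (n \<bullet> (x - p) - r * a) \<partial>lborel)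
      = \<bar>- 1 / a\<bar> * (\<integral>\<^sup>+\<tau>. H (x - (n \<bullet> (x - p) - (n \<bullet> (x - p) / a + (-1/a) * \<tau>) * a) *\<^sub>R n)
           (n \<bullet> (x - p) - (n \<bullet> (x - p) / a + (-1/a) * \<tau>) * a) \<partial>lborel)"
      by (rule nn_integral_real_affine) (use a in auto)
    also have "\<dots> = ennreal (1 / a) * (\<integral>\<^sup>+\<tau>. H (x - \<tau> *\<^sub>R n) \<tau> \<partial>lborel)"
    proof -
      have "n \<bullet> (x - p) - (n \<bullet> (x - p) / a + (-1/a) * \<tau>) * a = \<tau>" for \<tau>
        using a by (simp add: field_simps)
      then show ?thesis using a by simp
    qed
    finally show "(\<integral>\<^sup>+r. H (x - (n \<bullet> (x - p) - r * a) *\<^sub>R n) (n \<bullet> (x - p) - r * a) \<partial>lborel)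
      = ennreal (1 / a) * (\<integral>\<^sup>+\<tau>. H (x - \<tau> *\<^sub>R n) \<tau> \<partial>lborel)" .
  qed
  also have "\<dots> = ennreal (1 / a) * (\<integral>\<^sup>+x. \<integral>\<^sup>+\<tau>. H (x - \<tau> *\<^sub>R n) \<tau> \<partial>lborel \<partial>lborel)"
    by (subst nn_integral_cmult) auto
  also have "(\<integral>\<^sup>+x. \<integral>\<^sup>+\<tau>. H (x - \<tau> *\<^sub>R n) \<tau> \<partial>lborel \<partial>lborel)
      = (\<integral>\<^sup>+\<tau>. \<integral>\<^sup>+x. H (x - \<tau> *\<^sub>R n) \<tau> \<partial>lborel \<partial>lborel)"
    by (rule lborel_pair.Fubini'[symmetric]) (measurable)
  also have "\<dots> = (\<integral>\<^sup>+\<tau>. \<integral>\<^sup>+z. H z \<tau> \<partial>lborel \<partial>lborel)"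
  proof (rule nn_integral_cong)
    fix \<tau>
    show "(\<integral>\<^sup>+x. H (x - \<tau> *\<^sub>R n) \<tau> \<partial>lborel) = (\<integral>\<^sup>+z. H z \<tau> \<partial>lborel)"
      using nn_integral_lborel_affine[of "\<lambda>z. H z \<tau>" 1 "- (\<tau> *\<^sub>R n)"]
      by (simp add: add.commute[of "- (\<tau> *\<^sub>R n)"])
  qed
  also have "\<dots> = (\<integral>\<^sup>+z. \<integral>\<^sup>+\<tau>. H z \<tau> \<partial>lborel \<partial>lborel)"
    by (rule lborel_pair.Fubini'[symmetric]) (measurable)
  also have "\<dots> = (\<integral>\<^sup>+z. \<omega> (l z) * \<phi> z * indicator K z \<partial>lborel)"
  proof (rule nn_integral_cong_AE)
    \<comment> \<open>The hyperplane through the apex, where \<open>l\<close> vanishes and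
      \<open>1 / l z\<close> degenerates, is a null set.\<close>
    have "n \<noteq> 0" using n by auto
    then have "{z. n \<bullet> z = n \<bullet> p} \<in> null_sets lebesgue"
      using negligible_hyperplane[of n "n \<bullet> p"] by (simp add: negligible_iff_null_sets)
    then have "{z. n \<bullet> z = n \<bullet> p} \<in> null_sets lborel"
      by (subst (asm) null_sets_completion_iff) auto
    then have "AE z in lborel. z \<notin> {z. n \<bullet> z = n \<bullet> p}"
      by (rule AE_not_in)
    then show "AE z in lborel. (\<integral>\<^sup>+\<tau>. H z \<tau> \<partial>lborel) = \<omega> (l z) * \<phi> z * indicator K z"
    proof eventually_elim
      case (elim z)
      then have lz0: "l z \<noteq> 0" using a by (auto simp: l_def inner_diff_right)
      show ?case
      proof (cases "z \<in> K")
        case False then show ?thesis by (simp add: H_def)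
      next
        case True
        then have lz: "0 < l z" "l z \<le> 1" using Kl[of z] lz0 by auto
        have "(\<integral>\<^sup>+\<tau>. H z \<tau> \<partial>lborel) = (\<integral>\<^sup>+\<tau>. (ennreal (1 / l z) * \<omega> (l z) * \<phi> z) * indicator {- l z/2..l z/2} \<tau> \<partial>lborel)"
          by (intro nn_integral_cong) (use True lz in \<open>auto simp: H_def indicator_def field_simps ac_simps\<close>)
        also have "\<dots> = (ennreal (1 / l z) * \<omega> (l z) * \<phi> z) * ennreal (l z)"
          using lz by (subst nn_integral_cmult_indicator) auto
        also have "\<dots> = (ennreal (1 / l z) * ennreal (l z)) * \<omega> (l z) * \<phi> z"
          by (simp add: ac_simps)
        also have "ennreal (1 / l z) * ennreal (l z) = 1"
          using lz by (simp flip: ennreal_mult)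
        finally show ?thesis using True by simp
      qed
    qed
  qed
  finally have *: "(\<integral>\<^sup>+r. ennreal (r ^ (?d - 1 + m)) * \<omega> r * indicator {0..1} r \<partial>lborel) * I =
     ennreal (1 / a) * (\<integral>\<^sup>+z. \<omega> (l z) * \<phi> z * indicator K z \<partial>lborel)" .
  have aa: "ennreal a * ennreal (1 / a) = 1" using a by (simp flip: ennreal_mult)
  let ?X = "\<integral>\<^sup>+z. \<omega> (l z) * \<phi> z * indicator K z \<partial>lborel"
  have "?X = ennreal a * (ennreal (1 / a) * ?X)"
    using aa by (simp add: mult.assoc[symmetric])
  then show ?thesis
    unfolding *[symmetric] I_def[symmetric] by (simp only: mult.assoc)
qed

section \<open>Barycentric coordinates\<close>

text \<open>The gradient of the barycentric coordinate of \<open>p\<close>. Its norm is the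
  reciprocal of the height of \<open>p\<close> over the opposite facet, and heights enter all
  estimates in this form.\<close>

definition bgrad :: "'a::euclidean_space set \<Rightarrow> 'a \<Rightarrow> 'a" where
  "bgrad C p = (SOME g. \<forall>q\<in>C - {p}. g \<bullet> (p - q) = 1)"

definition bary :: "'a::euclidean_space set \<Rightarrow> 'a \<Rightarrow> 'a \<Rightarrow> real" where
  "bary C p x = 1 + bgrad C p \<bullet> (x - p)"

definition complex_affine :: "('a::real_inner \<Rightarrow> complex) \<Rightarrow> bool" where
  "complex_affine f \<longleftrightarrow> (\<exists>p\<in>P1. \<exists>q\<in>P1. f = (\<lambda>x. Complex (p x) (q x)))"

locale full_simplex =
  fixes C :: "'a::euclidean_space set"
  assumes indep: "\<not> affine_dependent C" and card_C: "card C = DIM('a) + 1"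
begin

abbreviation K where "K \<equiv> convex hull C"
abbreviation facet where "facet p \<equiv> convex hull (C - {p})"

lemma finite_C: "finite C"
  using aff_independent_finite[OF indep] .

lemma hull_C: "affine hull C = UNIV"
  using affine_independent_span_eq[OF indep] card_C by simp

text \<open>The choice in \<open>bgrad\<close> has a witness: the hyperplane
  \<open>a \<bullet> x = b\<close> through the other vertices misses \<open>p\<close> by affine
  independence, and \<open>a\<close> divided by \<open>a \<bullet> p - b\<close> is as
  required.\<close>

lemma bgrad_inner:
  assumes p: "p \<in> C" and q: "q \<in> C" "q \<noteq> p"
  shows "bgrad C p \<bullet> (p - q) = 1"
proof -
  have ind: "\<not> affine_dependent (C - {p})" using indep affine_independent_Diff by blast
  have "card (C - {p}) = DIM('a)" using p card_C finite_C by simp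
  then have "aff_dim (C - {p}) = DIM('a) - 1"
    using aff_dim_affine_independent[OF ind] DIM_positive[where 'a='a] by linarith
  then obtain a b where ab: "a \<noteq> 0" "affine hull (C - {p}) = {x. a \<bullet> x = b}"
    unfolding aff_dim_eq_hyperplane by blast
  have "p \<notin> affine hull (C - {p})" using indep p by (auto simp: affine_dependent_def)
  then have nz: "a \<bullet> p - b \<noteq> 0" using ab by simp
  have "\<forall>q\<in>C - {p}. (a /\<^sub>R (a \<bullet> p - b)) \<bullet> (p - q) = 1"
  proof
    fix q assume "q \<in> C - {p}"
    then have "q \<in> affine hull (C - {p})" by (rule hull_inc)
    then have "a \<bullet> q = b" using ab by simp
    then show "(a /\<^sub>R (a \<bullet> p - b)) \<bullet> (p - q) = 1" using nz by (simp add: inner_diff_right flip: right_diff_distrib)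
  qed
  then have "\<exists>g. \<forall>q\<in>C - {p}. g \<bullet> (p - q) = 1" ..
  then have "\<forall>q\<in>C - {p}. bgrad C p \<bullet> (p - q) = 1"
    unfolding bgrad_def by (rule someI_ex)
  then show ?thesis using q by blast
qed

lemma bary_vertex: "p \<in> C \<Longrightarrow> q \<in> C \<Longrightarrow> bary C p q = (if p = q then 1 else 0)"
  using bgrad_inner[of p q] by (auto simp: bary_def inner_diff_right)

lemma bary_sum:
  assumes "p \<in> C" "sum c C = 1"
  shows "bary C p (\<Sum>q\<in>C. c q *\<^sub>R q) = c p"
proof -
  have "bary C p (\<Sum>q\<in>C. c q *\<^sub>R q) = (\<Sum>q\<in>C. c q * bary C p q)"
  proof -
    have "(\<Sum>q\<in>C. c q * bary C p q) = sum c C * (1 - bgrad C p \<bullet> p) + (\<Sum>q\<in>C. c q * (bgrad C p \<bullet> q))"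
      unfolding bary_def sum_distrib_right sum.distrib[symmetric]
      by (intro sum.cong) (auto simp: inner_diff_right algebra_simps)
    then show ?thesis using assms by (simp add: bary_def inner_diff_right inner_sum_right)
  qed
  also have "\<dots> = (\<Sum>q\<in>C. if p = q then c q else 0)"
    using assms by (intro sum.cong) (auto simp: bary_vertex)
  also have "\<dots> = c p" using assms finite_C by simp
  finally show ?thesis .
qed

lemma bary_expansion:
  shows sum_bary: "(\<Sum>q\<in>C. bary C q x) = 1"
    and bary_repr: "(\<Sum>q\<in>C. bary C q x *\<^sub>R q) = x"
proof -
  have "x \<in> affine hull C" using hull_C by simp
  then obtain c where c: "sum c C = 1" "(\<Sum>q\<in>C. c q *\<^sub>R q) = x"
    unfolding affine_hull_finite[OF finite_C] by blast
  then have "bary C q x = c q" if "q \<in> C" for q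
    using bary_sum[OF that c(1)] by simp
  then have "(\<Sum>q\<in>C. bary C q x) = sum c C" "(\<Sum>q\<in>C. bary C q x *\<^sub>R q) = (\<Sum>q\<in>C. c q *\<^sub>R q)"
    by (auto intro!: sum.cong)
  with c show "(\<Sum>q\<in>C. bary C q x) = 1" "(\<Sum>q\<in>C. bary C q x *\<^sub>R q) = x" by auto
qed

lemma P1_expansion:
  assumes "f \<in> P1" shows "f x = (\<Sum>q\<in>C. bary C q x * f q)"
proof -
  obtain a b where f: "f = (\<lambda>x. a + b \<bullet> x)" using assms by (auto simp: P1_def)
  have "(\<Sum>q\<in>C. bary C q x * f q) = a * (\<Sum>q\<in>C. bary C q x) + b \<bullet> (\<Sum>q\<in>C. bary C q x *\<^sub>R q)"
    by (simp add: f algebra_simps sum.distrib sum_distrib_left inner_sum_right)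
  then show ?thesis by (simp add: sum_bary bary_repr f)
qed

lemma complex_affine_expansion:
  assumes "complex_affine f" shows "f x = (\<Sum>q\<in>C. of_real (bary C q x) * f q)"
proof -
  obtain g h where gh: "g \<in> P1" "h \<in> P1" "f = (\<lambda>x. Complex (g x) (h x))"
    using assms by (auto simp: complex_affine_def)
  show ?thesis
    unfolding gh(3) complex_eq_iff using P1_expansion[OF gh(1), of x] P1_expansion[OF gh(2), of x] by simp
qed

lemma mem_K_iff: "x \<in> K \<longleftrightarrow> (\<forall>q\<in>C. 0 \<le> bary C q x)"
proof
  assume "x \<in> K"
  then obtain c where c: "\<forall>q\<in>C. 0 \<le> c q" "sum c C = 1" "(\<Sum>q\<in>C. c q *\<^sub>R q) = x"
    unfolding convex_hull_finite[OF finite_C] by blast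
  then show "\<forall>q\<in>C. 0 \<le> bary C q x" using bary_sum[OF _ c(2)] by auto
next
  assume "\<forall>q\<in>C. 0 \<le> bary C q x"
  then show "x \<in> K" unfolding convex_hull_finite[OF finite_C] mem_Collect_eq
    using sum_bary[of x] bary_repr[of x] by (intro exI[of _ "\<lambda>q. bary C q x"]) simp
qed

lemma mem_interior_iff: "x \<in> interior K \<longleftrightarrow> (\<forall>q\<in>C. 0 < bary C q x)"
proof -
  have "x \<in> interior K \<longleftrightarrow> (\<exists>u. (\<forall>q\<in>C. 0 < u q) \<and> sum u C = 1 \<and> (\<Sum>q\<in>C. u q *\<^sub>R q) = x)"
    using interior_convex_hull_explicit_minimal[OF indep] card_C by simp
  also have "\<dots> \<longleftrightarrow> (\<forall>q\<in>C. 0 < bary C q x)"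
  proof
    assume "\<exists>u. (\<forall>q\<in>C. 0 < u q) \<and> sum u C = 1 \<and> (\<Sum>q\<in>C. u q *\<^sub>R q) = x"
    then obtain u where u: "\<forall>q\<in>C. 0 < u q" "sum u C = 1" "(\<Sum>q\<in>C. u q *\<^sub>R q) = x" by blast
    show "\<forall>q\<in>C. 0 < bary C q x" using bary_sum[OF _ u(2)] u by auto
  next
    assume "\<forall>q\<in>C. 0 < bary C q x"
    then show "\<exists>u. (\<forall>q\<in>C. 0 < u q) \<and> sum u C = 1 \<and> (\<Sum>q\<in>C. u q *\<^sub>R q) = x"
      using sum_bary[of x] bary_repr[of x] by (intro exI[of _ "\<lambda>q. bary C q x"]) simp
  qed
  finally show ?thesis .
qed

lemma ex_other: "p \<in> C \<Longrightarrow> \<exists>q\<in>C. q \<noteq> p"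
proof -
  assume "p \<in> C"
  then have "card (C - {p}) > 0" using card_C finite_C by simp
  then show ?thesis by (auto simp: card_gt_0_iff)
qed

lemma bgrad_nonzero:
  assumes "p \<in> C" shows "bgrad C p \<noteq> 0"
proof
  obtain q where "q \<in> C" "q \<noteq> p" using ex_other[OF assms] by blast
  then have "bgrad C p \<bullet> (p - q) = 1" by (rule bgrad_inner[OF assms])
  moreover assume "bgrad C p = 0"
  ultimately show False by simp
qed

lemma sum_bgrad: "(\<Sum>q\<in>C. bgrad C q) = 0"
proof -
  have "(\<Sum>q\<in>C. bgrad C q) \<bullet> y = 0" for y
  proof -
    have "(\<Sum>q\<in>C. bary C q y) - (\<Sum>q\<in>C. bary C q 0) = (\<Sum>q\<in>C. bgrad C q \<bullet> y)"
      unfolding sum_subtractf[symmetric] by (intro sum.cong) (auto simp: bary_def inner_diff_right)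
    then show ?thesis by (simp add: sum_bary inner_sum_left)
  qed
  then show ?thesis by (metis inner_eq_zero_iff)
qed

lemma affine_hull_facet: assumes p: "p \<in> C"
  shows "affine hull (facet p) = {x. bary C p x = 0}"
proof -
  have "x \<in> affine hull (C - {p}) \<longleftrightarrow> bary C p x = 0" for x
  proof
    assume "x \<in> affine hull (C - {p})"
    then obtain u where u: "sum u (C - {p}) = 1" "(\<Sum>q\<in>C-{p}. u q *\<^sub>R q) = x"
      unfolding affine_hull_finite[OF finite_Diff[OF finite_C]] by blast
    let ?u = "\<lambda>q. if q = p then 0 else u q"
    have "sum ?u C = 1" "(\<Sum>q\<in>C. ?u q *\<^sub>R q) = x"
      using u unfolding sum.remove[OF finite_C p] by (auto intro!: sum.cong)
    then show "bary C p x = 0" using bary_sum[OF p, of ?u] by simp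
  next
    assume 0: "bary C p x = 0"
    then have "sum (\<lambda>q. bary C q x) (C - {p}) = 1" "(\<Sum>q\<in>C-{p}. bary C q x *\<^sub>R q) = x"
      using sum_bary[of x] bary_repr[of x] unfolding sum.remove[OF finite_C p] by auto
    then show "x \<in> affine hull (C - {p})"
      unfolding affine_hull_finite[OF finite_Diff[OF finite_C]] mem_Collect_eq
      by (intro exI[of _ "\<lambda>q. bary C q x"]) simp
  qed
  then show ?thesis by auto
qed

lemma mem_facet_iff: assumes p: "p \<in> C"
  shows "x \<in> facet p \<longleftrightarrow> x \<in> K \<and> bary C p x = 0"
proof
  assume x: "x \<in> facet p"
  then have "x \<in> affine hull (facet p)" by (rule hull_inc)
  moreover have "facet p \<subseteq> K" by (rule hull_mono) auto
  ultimately show "x \<in> K \<and> bary C p x = 0" using affine_hull_facet[OF p] x by auto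
next
  assume x: "x \<in> K \<and> bary C p x = 0"
  then have "sum (\<lambda>q. bary C q x) (C - {p}) = 1" "(\<Sum>q\<in>C-{p}. bary C q x *\<^sub>R q) = x"
    using sum_bary[of x] bary_repr[of x] unfolding sum.remove[OF finite_C p] by auto
  moreover have "\<forall>q\<in>C - {p}. 0 \<le> bary C q x" using x mem_K_iff[of x] by simp
  ultimately show "x \<in> facet p"
    unfolding convex_hull_finite[OF finite_Diff[OF finite_C]] mem_Collect_eq
    by (intro exI[of _ "\<lambda>q. bary C q x"]) simp
qed

lemma compact_K: "compact K" "compact (facet p)"
  using finite_C by (auto intro!: finite_imp_compact_convex_hull)

lemma bary_add: "bary C q (p + r *\<^sub>R (y - p)) = (1 - r) * bary C q p + r * bary C q y"
  by (simp add: bary_def inner_diff_right inner_add_right algebra_simps)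

lemma bary_le_1: assumes "p \<in> C" "x \<in> K" shows "bary C p x \<le> 1"
proof -
  have "bary C p x \<le> (\<Sum>q\<in>C. bary C q x)"
    using assms finite_C mem_K_iff[of x] by (intro member_le_sum) simp_all
  then show ?thesis by (simp add: sum_bary)
qed

lemma bary_measurable[measurable]: "bary C p \<in> borel_measurable borel"
  unfolding bary_def by measurable

lemma continuous_bary: "continuous_on S (bary C p)"
  unfolding bary_def by (intro continuous_intros)

text \<open>The coordinate of \<open>p\<close> decreases towards the opposite facet, so minus its
  gradient points out of the simplex there; \<open>facet_normal_eq\<close> identifies the result
  with \<open>facet_normal\<close>.\<close>

definition normal :: "'a \<Rightarrow> 'a" where
  "normal p = - (bgrad C p /\<^sub>R norm (bgrad C p))"

lemma norm_normal: "p \<in> C \<Longrightarrow> norm (normal p) = 1"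
  using bgrad_nonzero by (simp add: normal_def)

lemma normal_inner: "p \<in> C \<Longrightarrow> normal p \<bullet> (x - y) = (bary C p y - bary C p x) / norm (bgrad C p)"
  using bgrad_nonzero[of p] by (simp add: normal_def bary_def inner_diff_right field_simps)

lemma hull_facet_normal: assumes p: "p \<in> C"
  shows "affine hull (facet p) = {y. normal p \<bullet> y = normal p \<bullet> p + 1 / norm (bgrad C p)}"
proof -
  have "bary C p y = 0 \<longleftrightarrow> normal p \<bullet> y = normal p \<bullet> p + 1 / norm (bgrad C p)" for y
  proof -
    have "normal p \<bullet> y - normal p \<bullet> p = 1 / norm (bgrad C p) - bary C p y / norm (bgrad C p)"
      using normal_inner[OF p, of y p] bary_vertex[OF p p] by (simp add: inner_diff_right diff_divide_distrib)
    then show ?thesis using bgrad_nonzero[OF p] by auto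
  qed
  then show ?thesis using affine_hull_facet[OF p] by auto
qed

text \<open>The simplex is a cone over each of its facets: the apex is the opposite vertex, the
  height is \<open>1 / norm (bgrad C p)\<close>, and the relative distance from the apex is
  \<open>1 - bary C p z\<close>.\<close>

lemma nn_integral_simplex:
  assumes p: "p \<in> C" and [measurable]: "\<phi> \<in> borel_measurable borel" "\<omega> \<in> borel_measurable borel"
    and hom: "\<And>r y. 0 < r \<Longrightarrow> r \<le> 1 \<Longrightarrow> y \<in> facet p \<Longrightarrow> \<phi> (p + r *\<^sub>R (y - p)) = ennreal (r ^ m) * \<phi> y"
    and \<omega>: "\<And>r. 0 \<le> r \<Longrightarrow> r \<le> 1 \<Longrightarrow> 0 \<le> \<omega> r"
    and I: "(\<integral>\<^sup>+r. ennreal (r ^ (DIM('a) - 1 + m) * \<omega> r) * indicator {0..1} r \<partial>lborel) = ennreal I"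
  shows "(\<integral>\<^sup>+z. ennreal (\<omega> (1 - bary C p z)) * \<phi> z * indicator K z \<partial>lborel) =
    ennreal (1 / norm (bgrad C p)) * ennreal I * (\<integral>\<^sup>+y. \<phi> y \<partial>face_measure (facet p))"
proof -
  have g: "norm (bgrad C p) > 0" using bgrad_nonzero[OF p] by simp
  have l: "normal p \<bullet> (z - p) / (1 / norm (bgrad C p)) = 1 - bary C p z" for z
    using g by (simp add: normal_inner[OF p] bary_vertex[OF p p])
  have "(\<integral>\<^sup>+z. ennreal (\<omega> (1 - bary C p z)) * \<phi> z * indicator K z \<partial>lborel) =
    ennreal (1 / norm (bgrad C p)) *
      (\<integral>\<^sup>+r. ennreal (r ^ (DIM('a) - 1 + m)) * ennreal (\<omega> r) * indicator {0..1} r \<partial>lborel)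
      * (\<integral>\<^sup>+y. \<phi> y \<partial>face_measure (facet p))"
  proof (rule nn_integral_cone[where n = "normal p" and p = p and \<omega> = "\<lambda>r. ennreal (\<omega> r)" and l = "\<lambda>z. 1 - bary C p z"])
    show "facet p \<in> sets borel" "K \<in> sets borel" using compact_K borel_compact by auto
    show "0 \<le> 1 - bary C p z \<and> 1 - bary C p z \<le> 1" if "z \<in> K" for z
      using that bary_le_1[OF p that] mem_K_iff[of z] p by simp
    show "p + r *\<^sub>R (y - p) \<in> K \<longleftrightarrow> y \<in> facet p"
      if r: "0 < r" "r \<le> 1" and y: "normal p \<bullet> y = normal p \<bullet> p + 1 / norm (bgrad C p)" for r y
    proof -
      have y0: "bary C p y = 0" using hull_facet_normal[OF p] affine_hull_facet[OF p] y by blast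
      have "0 \<le> bary C q (p + r *\<^sub>R (y - p)) \<longleftrightarrow> 0 \<le> bary C q y" if "q \<in> C" for q
        using r y0 that p unfolding bary_add by (cases "q = p") (auto simp: bary_vertex zero_le_mult_iff)
      then show ?thesis unfolding mem_facet_iff[OF p] mem_K_iff using y0 by simp
    qed
    show "affine hull (facet p) = {y. normal p \<bullet> y = normal p \<bullet> p + 1 / norm (bgrad C p)}"
      by (rule hull_facet_normal[OF p])
  qed (use g norm_normal[OF p] l hom in auto)
  also have "(\<integral>\<^sup>+r. ennreal (r ^ (DIM('a) - 1 + m)) * ennreal (\<omega> r) * indicator {0..1} r \<partial>lborel) = ennreal I"
    unfolding I[symmetric] by (intro nn_integral_cong) (auto simp: ennreal_mult \<omega> indicator_def)
  finally show ?thesis .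
qed

end

section \<open>Second moments of a simplex and of its facets\<close>

text \<open>The Beta integrals that the radial weights \<open>1\<close>, \<open>1 - r\<close> and
  its square produce in the cone formula.\<close>

lemma nn_integral_power_01:
  shows "(\<integral>\<^sup>+r. ennreal (r ^ k * 1) * indicator {0..1} r \<partial>lborel) = ennreal (1 / (real k + 1))"
    and "(\<integral>\<^sup>+r. ennreal (r ^ k * (1 - r)) * indicator {0..1} r \<partial>lborel) =
      ennreal (1 / ((real k + 1) * (real k + 2)))"
    and "(\<integral>\<^sup>+r. ennreal (r ^ k * (1 - r)\<^sup>2) * indicator {0..1} r \<partial>lborel) =
      ennreal (2 / ((real k + 1) * (real k + 2) * (real k + 3)))"
proof -
  have D: "((\<lambda>r. r ^ (k + j + 1) / c) has_field_derivative (real (k + j + 1) * x ^ (k + j) / c)) (at x)"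
    for j and c x :: real
    using DERIV_cdivide[OF DERIV_pow[of "k + j + 1" x UNIV], of c] by simp
  let ?E = "\<lambda>r::real. r ^ (k + 0 + 1) / (real k + 1)"
  have "(\<integral>\<^sup>+r. ennreal (r ^ k) * indicator {0..1} r \<partial>lborel) = ennreal (?E 1 - ?E 0)"
  proof (rule nn_integral_FTC_Icc)
    fix x :: real
    have "real (k + 0 + 1) * x ^ (k + 0) / (real k + 1) = x ^ k" by (simp add: divide_simps algebra_simps)
    then show "(?E has_field_derivative x ^ k) (at x)" using D[of 0 "real k + 1" x] by (simp only:)
  qed auto
  then show "(\<integral>\<^sup>+r. ennreal (r ^ k * 1) * indicator {0..1} r \<partial>lborel) = ennreal (1 / (real k + 1))"
    by simp
  let ?F = "\<lambda>r::real. r ^ (k + 0 + 1) / (real k + 1) - r ^ (k + 1 + 1) / (real k + 2)"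
  have "(\<integral>\<^sup>+r. ennreal (r ^ k * (1 - r)) * indicator {0..1} r \<partial>lborel) = ennreal (?F 1 - ?F 0)"
  proof (rule nn_integral_FTC_Icc)
    fix x :: real
    have "real (k + 0 + 1) * x ^ (k + 0) / (real k + 1) - real (k + 1 + 1) * x ^ (k + 1) / (real k + 2) = x ^ k * (1 - x)"
    proof -
      have "real (k + 0 + 1) / (real k + 1) = 1" "real (k + 1 + 1) / (real k + 2) = 1"
        by (simp_all add: divide_simps)
      then show ?thesis
        unfolding times_divide_eq_left[symmetric] by (simp add: algebra_simps)
    qed
    then show "(?F has_field_derivative x ^ k * (1 - x)) (at x)"
      using DERIV_diff[OF D[of 0 "real k + 1" x] D[of 1 "real k + 2" x]] by (simp only:)
  qed auto
  also have "?F 1 - ?F 0 = 1 / ((real k + 1) * (real k + 2))"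
    by (simp add: divide_simps)
  finally show "(\<integral>\<^sup>+r. ennreal (r ^ k * (1 - r)) * indicator {0..1} r \<partial>lborel) =
      ennreal (1 / ((real k + 1) * (real k + 2)))" .
  let ?G = "\<lambda>r::real. r ^ (k + 0 + 1) / (real k + 1) - r ^ (k + 1 + 1) / ((real k + 2) / 2) + r ^ (k + 2 + 1) / (real k + 3)"
  have "(\<integral>\<^sup>+r. ennreal (r ^ k * (1 - r)\<^sup>2) * indicator {0..1} r \<partial>lborel) = ennreal (?G 1 - ?G 0)"
  proof (rule nn_integral_FTC_Icc)
    fix x :: real
    have "real (k + 0 + 1) * x ^ (k + 0) / (real k + 1) - real (k + 1 + 1) * x ^ (k + 1) / ((real k + 2) / 2)
        + real (k + 2 + 1) * x ^ (k + 2) / (real k + 3) = x ^ k * (1 - x)\<^sup>2"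
    proof -
      have "real (k + 0 + 1) / (real k + 1) = 1" "real (k + 1 + 1) / ((real k + 2) / 2) = 2" "real (k + 2 + 1) / (real k + 3) = 1"
        by (simp_all add: divide_simps)
      then show ?thesis
        unfolding times_divide_eq_left[symmetric] by (simp add: algebra_simps power2_eq_square)
    qed
    then show "(?G has_field_derivative x ^ k * (1 - x)\<^sup>2) (at x)"
      using DERIV_add[OF DERIV_diff[OF D[of 0 "real k + 1" x] D[of 1 "(real k + 2) / 2" x]] D[of 2 "real k + 3" x]]
      by (simp only:)
  qed auto
  also have "?G 1 - ?G 0 = 2 / ((real k + 1) * (real k + 2) * (real k + 3))"
    by (simp add: divide_simps) (simp add: algebra_simps)
  finally show "(\<integral>\<^sup>+r. ennreal (r ^ k * (1 - r)\<^sup>2) * indicator {0..1} r \<partial>lborel) =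
      ennreal (2 / ((real k + 1) * (real k + 2) * (real k + 3)))" .
qed

lemma ennreal_eq_mult_cancel:
  assumes "ennreal X = ennreal c * Y" "c > 0"
  shows "Y = ennreal (X / c)"
proof -
  have "ennreal (1 / c) * ennreal X = (ennreal (1 / c) * ennreal c) * Y"
    unfolding assms(1) by (simp only: mult.assoc)
  also have "ennreal (1 / c) * ennreal c = 1" using assms(2) by (simp flip: ennreal_mult)
  finally have "Y = ennreal (1 / c) * ennreal X" by simp
  also have "\<dots> = ennreal (1 / c * X)" using assms(2) by (subst ennreal_mult') auto
  finally show ?thesis by simp
qed

lemma ennreal_mult3:
  "0 \<le> a \<Longrightarrow> 0 \<le> b \<Longrightarrow> 0 \<le> c \<Longrightarrow> ennreal a * ennreal b * ennreal c = ennreal (a * b * c)"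
  by (simp add: ennreal_mult)

context full_simplex
begin

definition vol :: real where "vol = measure lborel K"
text \<open>Volume is base times height over the dimension, solved for the base;
  \<open>nn_integral_bary\<close> shows that this is the surface measure of the facet.\<close>

definition area :: "'a \<Rightarrow> real" where "area p = real DIM('a) * vol * norm (bgrad C p)"

lemma K_borel[measurable]: "K \<in> sets borel" "facet p \<in> sets borel"
  using compact_K borel_compact by auto

lemma emeasure_K: "emeasure lborel K = ennreal vol"
  unfolding vol_def
  using emeasure_bounded_finite[OF compact_imp_bounded[OF compact_K(1)]]
  by (intro emeasure_eq_ennreal_measure) simp

lemma vol_nonneg: "vol \<ge> 0" by (simp add: vol_def)

lemma bary_homogeneous:
  assumes "p \<in> C" "q \<in> C" "q \<noteq> p"
  shows "bary C q (p + r *\<^sub>R (y - p)) = r * bary C q y"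
  using assms by (simp add: bary_add bary_vertex)

text \<open>With weight 1 the cone formula is read backwards and gives the measure of the facet from
  the volume. With the weights \<open>1 - r\<close> and its square it is read forwards and gives the
  first two moments of the coordinate of the apex.\<close>

lemma nn_integral_bary:
  assumes p: "p \<in> C"
  shows "(\<integral>\<^sup>+y. 1 \<partial>face_measure (facet p)) = ennreal (area p)"
    and "(\<integral>\<^sup>+z. ennreal (bary C p z) * indicator K z \<partial>lborel) = ennreal (vol / (real DIM('a) + 1))"
    and "(\<integral>\<^sup>+z. ennreal ((bary C p z)\<^sup>2) * indicator K z \<partial>lborel) =
      ennreal (2 * vol / ((real DIM('a) + 1) * (real DIM('a) + 2)))"
proof -
  let ?d = "real DIM('a)" and ?g = "norm (bgrad C p)"
  have g: "?g > 0" using bgrad_nonzero[OF p] by simp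
  have d: "real (DIM('a) - 1) + 1 = ?d" "real (DIM('a) - 1) + 2 = ?d + 1" "real (DIM('a) - 1) + 3 = ?d + 2"
    using DIM_positive[where 'a='a] by (auto simp: of_nat_diff Suc_le_eq)
  have dpos: "?d > 0" by simp
  have "(\<integral>\<^sup>+z. ennreal 1 * 1 * indicator K z \<partial>lborel) =
     ennreal (1 / ?g) * ennreal (1 / ?d) * (\<integral>\<^sup>+y. 1 \<partial>face_measure (facet p))"
    using nn_integral_simplex[OF p, of "\<lambda>_. 1" "\<lambda>_. 1" 0 "1 / ?d"] nn_integral_power_01(1)[of "DIM('a) - 1"] d by simp
  moreover have "ennreal (1 / ?g * (1 / ?d)) = ennreal (1 / ?g) * ennreal (1 / ?d)"
    using g by (intro ennreal_mult) auto
  ultimately have "ennreal vol = ennreal (1 / ?g * (1 / ?d)) * (\<integral>\<^sup>+y. 1 \<partial>face_measure (facet p))"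
    using emeasure_K by (simp only:) simp
  then have "(\<integral>\<^sup>+y. 1 \<partial>face_measure (facet p)) = ennreal (vol / (1 / ?g * (1 / ?d)))"
    using g dpos by (intro ennreal_eq_mult_cancel) auto
  also have "vol / (1 / ?g * (1 / ?d)) = area p" by (simp add: area_def)
  finally show A: "(\<integral>\<^sup>+y. 1 \<partial>face_measure (facet p)) = ennreal (area p)" .
  have an: "area p \<ge> 0" by (simp add: area_def vol_nonneg)
  have "(\<integral>\<^sup>+z. ennreal (1 - (1 - bary C p z)) * 1 * indicator K z \<partial>lborel) =
     ennreal (1 / ?g) * ennreal (1 / (?d * (?d + 1))) * (\<integral>\<^sup>+y. 1 \<partial>face_measure (facet p))"
    by (rule nn_integral_simplex[OF p, where m = 0 and \<omega> = "\<lambda>r. 1 - r"])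
      (use nn_integral_power_01(2)[of "DIM('a) - 1"] d in auto)
  also have "\<dots> = ennreal (1 / ?g * (1 / (?d * (?d + 1))) * area p)"
    unfolding A by (rule ennreal_mult3) (use g an in auto)
  also have "1 / ?g * (1 / (?d * (?d + 1))) * area p = vol / (?d + 1)"
    using g dpos by (simp add: area_def divide_simps)
  finally show "(\<integral>\<^sup>+z. ennreal (bary C p z) * indicator K z \<partial>lborel) = ennreal (vol / (?d + 1))" by simp
  have "(\<integral>\<^sup>+z. ennreal ((1 - (1 - bary C p z))\<^sup>2) * 1 * indicator K z \<partial>lborel) =
     ennreal (1 / ?g) * ennreal (2 / (?d * (?d + 1) * (?d + 2))) * (\<integral>\<^sup>+y. 1 \<partial>face_measure (facet p))"
    by (rule nn_integral_simplex[OF p, where m = 0 and \<omega> = "\<lambda>r. (1 - r)\<^sup>2"])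
      (use nn_integral_power_01(3)[of "DIM('a) - 1", unfolded d] in auto)
  also have "\<dots> = ennreal (1 / ?g * (2 / (?d * (?d + 1) * (?d + 2))) * area p)"
    unfolding A by (rule ennreal_mult3) (use g an in auto)
  also have "1 / ?g * (2 / (?d * (?d + 1) * (?d + 2))) * area p = 2 * vol / ((?d + 1) * (?d + 2))"
    using g dpos by (simp add: area_def divide_simps)
  finally show "(\<integral>\<^sup>+z. ennreal ((bary C p z)\<^sup>2) * indicator K z \<partial>lborel) =
      ennreal (2 * vol / ((?d + 1) * (?d + 2)))" by simp
qed

text \<open>For \<open>p \<noteq> q\<close> the coordinate of \<open>q\<close> is homogeneous of
  degree 1 from the apex \<open>p\<close>. Its known volume integral determines its integral over
  the facet opposite to \<open>p\<close>, and the weight \<open>1 - r\<close> then inserts the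
  factor \<open>bary C p\<close>.\<close>

lemma nn_integral_bary_mult:
  assumes p: "p \<in> C" and q: "q \<in> C"
  shows "(\<integral>\<^sup>+z. ennreal (bary C p z * bary C q z) * indicator K z \<partial>lborel) =
      ennreal ((if p = q then 2 else 1) * vol / ((real DIM('a) + 1) * (real DIM('a) + 2)))"
proof (cases "p = q")
  case True
  then show ?thesis using nn_integral_bary(3)[OF p] by (simp add: power2_eq_square)
next
  case False
  let ?d = "real DIM('a)" and ?g = "norm (bgrad C p)"
  have g: "?g > 0" using bgrad_nonzero[OF p] by simp
  have d: "real DIM('a) > 0" by simp
  let ?F = "\<integral>\<^sup>+y. ennreal (bary C q y) \<partial>face_measure (facet p)"
  have dd: "DIM('a) - 1 + 1 = DIM('a)" using DIM_positive[where 'a='a] by simp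
  have hom: "ennreal (bary C q (p + r *\<^sub>R (y - p))) = ennreal (r ^ 1) * ennreal (bary C q y)"
    if "0 < r" for r y
    using that bary_homogeneous[OF p q] False by (simp add: ennreal_mult')
  have "(\<integral>\<^sup>+z. ennreal 1 * ennreal (bary C q z) * indicator K z \<partial>lborel) =
     ennreal (1 / ?g) * ennreal (1 / (?d + 1)) * ?F"
    by (rule nn_integral_simplex[OF p, where m = 1 and \<omega> = "\<lambda>r. 1"])
      (use nn_integral_power_01(1)[of "DIM('a)"] dd hom in auto)
  moreover have "ennreal (1 / ?g * (1 / (?d + 1))) = ennreal (1 / ?g) * ennreal (1 / (?d + 1))"
    using g by (intro ennreal_mult) auto
  ultimately have "ennreal (vol / (?d + 1)) = ennreal (1 / ?g * (1 / (?d + 1))) * ?F"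
    using nn_integral_bary(2)[OF q] by (simp only:) simp
  then have F: "?F = ennreal (vol / (?d + 1) / (1 / ?g * (1 / (?d + 1))))"
    using g d by (intro ennreal_eq_mult_cancel) auto
  have "(\<integral>\<^sup>+z. ennreal (1 - (1 - bary C p z)) * ennreal (bary C q z) * indicator K z \<partial>lborel) =
     ennreal (1 / ?g) * ennreal (1 / ((?d + 1) * (?d + 2))) * ?F"
    by (rule nn_integral_simplex[OF p, where m = 1 and \<omega> = "\<lambda>r. 1 - r"])
      (use nn_integral_power_01(2)[of "DIM('a)"] dd hom in auto)
  also have "\<dots> = ennreal (1 / ?g * (1 / ((?d + 1) * (?d + 2))) * (vol / (?d + 1) / (1 / ?g * (1 / (?d + 1)))))"
    unfolding F by (rule ennreal_mult3) (use g vol_nonneg in auto)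
  also have "1 / ?g * (1 / ((?d + 1) * (?d + 2))) * (vol / (?d + 1) / (1 / ?g * (1 / (?d + 1)))) = vol / ((?d + 1) * (?d + 2))"
    using g d by (simp add: divide_simps)
  finally have *: "(\<integral>\<^sup>+z. ennreal (bary C p z) * ennreal (bary C q z) * indicator K z \<partial>lborel) = ennreal (vol / ((?d + 1) * (?d + 2)))"
    by simp
  have "(\<integral>\<^sup>+z. ennreal (bary C p z * bary C q z) * indicator K z \<partial>lborel) =
    (\<integral>\<^sup>+z. ennreal (bary C p z) * ennreal (bary C q z) * indicator K z \<partial>lborel)"
    by (intro nn_integral_cong) (auto simp: indicator_def ennreal_mult' mem_K_iff p)
  then show ?thesis using * False by simp
qed

text \<open>The product of the two coordinates has degree 2 from the apex \<open>p\<close>, so its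
  facet integral is read off from its volume integral. The result is the volume formula with the
  dimension lowered by one.\<close>

lemma nn_integral_facet_bary_mult:
  assumes p: "p \<in> C" and q: "q \<in> C" "q \<noteq> p" and s: "s \<in> C" "s \<noteq> p"
  shows "(\<integral>\<^sup>+z. ennreal (bary C q z * bary C s z) \<partial>face_measure (facet p)) =
      ennreal ((if q = s then 2 else 1) * area p / (real DIM('a) * (real DIM('a) + 1)))"
proof -
  let ?d = "real DIM('a)" and ?g = "norm (bgrad C p)"
  have g: "?g > 0" using bgrad_nonzero[OF p] by simp
  have d: "real DIM('a) > 0" by simp
  let ?m = "if q = s then 2 else 1 :: real"
  let ?F = "\<integral>\<^sup>+y. ennreal (bary C q y * bary C s y) \<partial>face_measure (facet p)"
  have dd: "DIM('a) - 1 + 2 = DIM('a) + 1" using DIM_positive[where 'a='a] by simp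
  have rd: "real (DIM('a) + 1) + 1 = ?d + 2" by simp
  have hom: "ennreal (bary C q (p + r *\<^sub>R (y - p)) * bary C s (p + r *\<^sub>R (y - p))) = ennreal (r ^ 2) * ennreal (bary C q y * bary C s y)"
    if "0 < r" for r y
    using that bary_homogeneous[OF p q] bary_homogeneous[OF p s]
    by (simp add: power2_eq_square ac_simps flip: ennreal_mult')
  have "(\<integral>\<^sup>+z. ennreal 1 * ennreal (bary C q z * bary C s z) * indicator K z \<partial>lborel) =
     ennreal (1 / ?g) * ennreal (1 / (?d + 2)) * ?F"
    by (rule nn_integral_simplex[OF p, where m = 2 and \<omega> = "\<lambda>r. 1"])
      (use nn_integral_power_01(1)[of "DIM('a) + 1", unfolded rd] dd hom in auto)
  moreover have "ennreal (1 / ?g * (1 / (?d + 2))) = ennreal (1 / ?g) * ennreal (1 / (?d + 2))"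
    using g by (intro ennreal_mult) auto
  ultimately have "ennreal (?m * vol / ((?d + 1) * (?d + 2))) = ennreal (1 / ?g * (1 / (?d + 2))) * ?F"
    using nn_integral_bary_mult[OF q(1) s(1)] by (simp only: mult_1_left ennreal_1)
  then have "?F = ennreal (?m * vol / ((?d + 1) * (?d + 2)) / (1 / ?g * (1 / (?d + 2))))"
    using g d by (intro ennreal_eq_mult_cancel) auto
  also have "?m * vol / ((?d + 1) * (?d + 2)) / (1 / ?g * (1 / (?d + 2))) = ?m * area p / (?d * (?d + 1))"
    using g d by (simp add: area_def divide_simps)
  finally show ?thesis .
qed

end

section \<open>Algebra of complex-valued affine functions\<close>

lemma P1I: "(\<lambda>x. a + b \<bullet> x) \<in> P1"
  by (auto simp: P1_def)

lemma P1_add: assumes "f \<in> P1" "g \<in> P1" shows "(\<lambda>x. f x + g x) \<in> P1"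
proof -
  obtain a b a' b' where "f = (\<lambda>x. a + b \<bullet> x)" "g = (\<lambda>x. a' + b' \<bullet> x)"
    using assms by (auto simp: P1_def)
  then have "(\<lambda>x. f x + g x) = (\<lambda>x. (a + a') + (b + b') \<bullet> x)" by (simp add: algebra_simps)
  then show ?thesis by (simp only: P1I)
qed

lemma P1_scale: assumes "f \<in> P1" shows "(\<lambda>x. c * f x) \<in> P1"
proof -
  obtain a b where "f = (\<lambda>x. a + b \<bullet> x)" using assms by (auto simp: P1_def)
  then have "(\<lambda>x. c * f x) = (\<lambda>x. (c * a) + (c *\<^sub>R b) \<bullet> x)" by (simp add: algebra_simps)
  then show ?thesis by (simp only: P1I)
qed

lemma P1_const: "(\<lambda>x. c) \<in> P1"
  using P1I[of c 0] by simp

lemma P1_inner: "(\<lambda>x. b \<bullet> x) \<in> P1"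
  using P1I[of 0 b] by simp

lemma complex_affine_iff: "complex_affine f \<longleftrightarrow> (\<lambda>x. Re (f x)) \<in> P1 \<and> (\<lambda>x. Im (f x)) \<in> P1"
proof
  assume *: "(\<lambda>x. Re (f x)) \<in> P1 \<and> (\<lambda>x. Im (f x)) \<in> P1"
  have "f = (\<lambda>x. Complex (Re (f x)) (Im (f x)))" by simp
  with * show "complex_affine f" unfolding complex_affine_def
    by (intro bexI[of _ "\<lambda>x. Re (f x)"] bexI[of _ "\<lambda>x. Im (f x)"]) simp_all
qed (auto simp: complex_affine_def)

lemma complex_affine_add:
  "complex_affine f \<Longrightarrow> complex_affine g \<Longrightarrow> complex_affine (\<lambda>x. f x + g x)"
  by (simp add: complex_affine_iff P1_add)

lemma complex_affine_scale: "complex_affine f \<Longrightarrow> complex_affine (\<lambda>x. c * f x)"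
  using P1_add[OF P1_scale[of "\<lambda>x. Re (f x)" "Re c"] P1_scale[of "\<lambda>x. Im (f x)" "- Im c"]]
    P1_add[OF P1_scale[of "\<lambda>x. Im (f x)" "Re c"] P1_scale[of "\<lambda>x. Re (f x)" "Im c"]]
  by (simp add: complex_affine_iff)

lemma complex_affine_const: "complex_affine (\<lambda>x. c)"
  by (simp add: complex_affine_iff P1_const)

lemma complex_affine_diff:
  "complex_affine f \<Longrightarrow> complex_affine g \<Longrightarrow> complex_affine (\<lambda>x. f x - g x)"
  using complex_affine_add[of f "\<lambda>x. (-1) * g x"] complex_affine_scale[of g "-1"] by simp

lemma complex_affine_sum:
  "(\<And>i. i \<in> I \<Longrightarrow> complex_affine (f i)) \<Longrightarrow> complex_affine (\<lambda>x. \<Sum>i\<in>I. f i x)"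
  by (induction I rule: infinite_finite_induct) (auto simp: complex_affine_const complex_affine_add)

lemma complex_affine_inner: "complex_affine (\<lambda>x. complex_of_real (b \<bullet> x))"
  by (simp add: complex_affine_iff P1_const P1_inner)

lemma complex_affine_continuous: "complex_affine f \<Longrightarrow> continuous_on S f"
  unfolding complex_affine_def P1_def Complex_eq by (auto intro!: continuous_intros)

text \<open>The matrix with \<open>2 * c\<close> on the diagonal and \<open>c\<close> elsewhere is
  \<open>c\<close> times the sum of the identity and the all-ones matrix; the two parts give the two
  summands.\<close>

lemma cnj_mult_add_expand:
  "(\<Sum>q\<in>S. \<Sum>r\<in>S. F q * cnj (H r) * of_real ((if q = r then 2 else 1) * c)) =
    of_real c * ((\<Sum>q\<in>S. F q * cnj (H q)) + (\<Sum>q\<in>S. F q) * cnj (\<Sum>q\<in>S. H q))"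
  if "finite S" for F H :: "'a \<Rightarrow> complex"
proof -
  have "(\<Sum>q\<in>S. \<Sum>r\<in>S. F q * cnj (H r) * of_real ((if q = r then 2 else 1) * c)) =
    (\<Sum>q\<in>S. \<Sum>r\<in>S. of_real c * (F q * cnj (H r)) + (if q = r then of_real c * (F q * cnj (H r)) else 0))"
    by (intro sum.cong) auto
  also have "\<dots> = of_real c * ((\<Sum>q\<in>S. F q) * cnj (\<Sum>q\<in>S. H q)) + (\<Sum>q\<in>S. of_real c * (F q * cnj (H q)))"
  proof -
    have "(\<Sum>q\<in>S. \<Sum>r\<in>S. of_real c * (F q * cnj (H r))) = of_real c * ((\<Sum>q\<in>S. F q) * cnj (\<Sum>q\<in>S. H q))"
      unfolding cnj_sum unfolding sum_product unfolding sum_distrib_left by (rule refl)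
    then show ?thesis using that by (simp add: sum.distrib)
  qed
  finally show ?thesis by (simp add: sum_distrib_left algebra_simps)
qed

text \<open>What elements with Lebesgue measure and facets with surface measure have in common:
  continuous functions are bounded, hence integrable. The measurable sets of both are completions of
  Borel sets, which is why Borel measurability is only assumed to carry over.\<close>

locale compact_measure = finite_measure M for M :: "'a::euclidean_space measure" +
  assumes compact_space: "compact (space M)"
    and borel_imp: "\<And>f :: 'a \<Rightarrow> complex. f \<in> borel_measurable borel \<Longrightarrow> f \<in> borel_measurable M"
begin

lemma integrable_continuous:
  fixes f :: "'a \<Rightarrow> complex"
  assumes "continuous_on UNIV f" shows "integrable M f"
proof -
  have "bounded (f ` space M)"
    using assms compact_space by (intro compact_imp_bounded compact_continuous_image)
      (auto intro: continuous_on_subset)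
  then obtain B where "\<And>x. x \<in> space M \<Longrightarrow> norm (f x) \<le> B" by (auto simp: bounded_iff)
  then show ?thesis
    using borel_imp[OF borel_measurable_continuous_onI[OF assms]] by (intro integrable_const_bound[of _ B]) auto
qed

lemma integrable_continuous_real:
  fixes f :: "'a \<Rightarrow> real"
  assumes "continuous_on UNIV f" shows "integrable M f"
proof -
  have "integrable M (\<lambda>x. Re (of_real (f x)))"
    using assms by (intro integrable_Re integrable_continuous continuous_intros)
  then show ?thesis by simp
qed

text \<open>The expansions are required on the space of the measure only: on a facet the index set
  \<open>S\<close> consists of the vertices of that facet, as the coordinate of the opposite vertex
  vanishes there.\<close>

lemma affine_moments:
  assumes S: "finite S" and l: "\<And>q. q \<in> S \<Longrightarrow> continuous_on UNIV (l q)"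
    and mom: "\<And>q r. q \<in> S \<Longrightarrow> r \<in> S \<Longrightarrow> (LINT x|M. l q x * l r x) = (if q = r then 2 else 1) * c"
    and f: "\<And>x. x \<in> space M \<Longrightarrow> f x = (\<Sum>q\<in>S. of_real (l q x) * f q)"
    and h: "\<And>x. x \<in> space M \<Longrightarrow> h x = (\<Sum>q\<in>S. of_real (l q x) * h q)"
  shows "(LINT x|M. f x * cnj (h x)) =
    of_real c * ((\<Sum>q\<in>S. f q * cnj (h q)) + (\<Sum>q\<in>S. f q) * cnj (\<Sum>q\<in>S. h q))"
proof -
  have int: "integrable M (\<lambda>x. f q * cnj (h r) * of_real (l q x * l r x))" if "q \<in> S" "r \<in> S" for q r
    using l that by (intro integrable_continuous continuous_intros)
  have "(LINT x|M. f x * cnj (h x)) = (LINT x|M. (\<Sum>q\<in>S. \<Sum>r\<in>S. f q * cnj (h r) * of_real (l q x * l r x)))"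
  proof (rule Bochner_Integration.integral_cong[OF refl])
    fix x assume "x \<in> space M"
    then show "f x * cnj (h x) = (\<Sum>q\<in>S. \<Sum>r\<in>S. f q * cnj (h r) * of_real (l q x * l r x))"
      by (subst f, simp, subst h, simp) (simp add: sum_product algebra_simps)
  qed
  also have "\<dots> = (\<Sum>q\<in>S. \<Sum>r\<in>S. f q * cnj (h r) * of_real (LINT x|M. l q x * l r x))"
    using int by (simp add: Bochner_Integration.integral_sum Bochner_Integration.integrable_sum
       del: of_real_mult)
  also have "\<dots> = (\<Sum>q\<in>S. \<Sum>r\<in>S. f q * cnj (h r) * of_real ((if q = r then 2 else 1) * c))"
    by (intro sum.cong refl) (simp only: mom)
  finally show ?thesis by (simp only: cnj_mult_add_expand[OF S])
qed

end

section \<open>Mass matrices of an element and of its facets\<close>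

context full_simplex
begin

lemma compact_measure_K: "compact_measure (lebesgue_on K)"
proof (intro compact_measure.intro finite_measureI compact_measure_axioms.intro)
  show "emeasure (lebesgue_on K) (space (lebesgue_on K)) \<noteq> \<infinity>"
    by (simp add: emeasure_restrict_space emeasure_K)
  show "compact (space (lebesgue_on K))" by (simp add: compact_K)
  show "f \<in> borel_measurable (lebesgue_on K)" if "f \<in> borel_measurable borel" for f :: "'a \<Rightarrow> complex"
    by (intro measurable_restrict_space1 measurable_completion) (use that in simp)
qed

lemma emeasure_facet: assumes "p \<in> C" shows "emeasure (face_measure (facet p)) (facet p) = ennreal (area p)"
  using nn_integral_bary(1)[OF assms] sets.top[of "face_measure (facet p)"]
  by (simp add: space_face_measure)

lemma compact_measure_facet: assumes "p \<in> C" shows "compact_measure (face_measure (facet p))"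
proof (intro compact_measure.intro finite_measureI compact_measure_axioms.intro)
  show "emeasure (face_measure (facet p)) (space (face_measure (facet p))) \<noteq> \<infinity>"
    using emeasure_facet[OF assms] by (simp add: space_face_measure)
  show "compact (space (face_measure (facet p)))" by (simp add: space_face_measure compact_K)
qed (rule measurable_face_measureI)

lemma measure_facet: assumes "p \<in> C" shows "measure (face_measure (facet p)) (facet p) = area p"
  using emeasure_facet[OF assms] by (simp add: measure_def area_def vol_nonneg)

lemma integral_bary_mult:
  assumes "p \<in> C" "q \<in> C"
  shows "(LINT x|lebesgue_on K. bary C p x * bary C q x) =
      (if p = q then 2 else 1) * (vol / ((real DIM('a) + 1) * (real DIM('a) + 2)))"
proof -
  have "(\<integral>\<^sup>+x. ennreal (bary C p x * bary C q x) \<partial>lebesgue_on K) =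
     (\<integral>\<^sup>+x. ennreal (bary C p x * bary C q x) * indicator K x \<partial>lborel)"
    by (subst nn_integral_restrict_space) (auto simp: nn_integral_completion)
  then have *: "(\<integral>\<^sup>+x. ennreal (bary C p x * bary C q x) \<partial>lebesgue_on K) =
     ennreal ((if p = q then 2 else 1) * vol / ((real DIM('a) + 1) * (real DIM('a) + 2)))"
    using nn_integral_bary_mult[OF assms] by (simp only:)
  have "(LINT x|lebesgue_on K. bary C p x * bary C q x) =
      enn2real (\<integral>\<^sup>+x. ennreal (bary C p x * bary C q x) \<partial>lebesgue_on K)"
  proof (rule integral_eq_nn_integral)
    show "(\<lambda>x. bary C p x * bary C q x) \<in> borel_measurable (lebesgue_on K)"
      by (intro measurable_restrict_space1 measurable_completion) simp
    show "AE x in lebesgue_on K. 0 \<le> bary C p x * bary C q x"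
      by (rule AE_I2) (use assms mem_K_iff in auto)
  qed
  then show ?thesis unfolding * by (simp add: vol_nonneg)
qed

lemma integral_facet_bary_mult:
  assumes p: "p \<in> C" and q: "q \<in> C - {p}" and r: "r \<in> C - {p}"
  shows "(LINT x|face_measure (facet p). bary C q x * bary C r x) =
      (if q = r then 2 else 1) * (area p / (real DIM('a) * (real DIM('a) + 1)))"
proof -
  have *: "(\<integral>\<^sup>+x. ennreal (bary C q x * bary C r x) \<partial>face_measure (facet p)) =
     ennreal ((if q = r then 2 else 1) * area p / (real DIM('a) * (real DIM('a) + 1)))"
    using nn_integral_facet_bary_mult[OF p, of q r] q r by simp
  have "(LINT x|face_measure (facet p). bary C q x * bary C r x) =
      enn2real (\<integral>\<^sup>+x. ennreal (bary C q x * bary C r x) \<partial>face_measure (facet p))"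
  proof (rule integral_eq_nn_integral)
    show "(\<lambda>x. bary C q x * bary C r x) \<in> borel_measurable (face_measure (facet p))"
      by (intro measurable_face_measureI) simp
    show "AE x in face_measure (facet p). 0 \<le> bary C q x * bary C r x"
    proof (rule AE_I2)
      fix x assume "x \<in> space (face_measure (facet p))"
      then have "x \<in> K" using mem_facet_iff[OF p] by (simp add: space_face_measure)
      then show "0 \<le> bary C q x * bary C r x" using q r mem_K_iff[of x] by simp
    qed
  qed
  then show ?thesis unfolding * by (simp add: vol_nonneg area_def)
qed

lemma mass_K:
  assumes "complex_affine f" "complex_affine h"
  shows "(LINT x|lebesgue_on K. f x * cnj (h x)) =
    of_real (vol / ((real DIM('a) + 1) * (real DIM('a) + 2))) *
      ((\<Sum>q\<in>C. f q * cnj (h q)) + (\<Sum>q\<in>C. f q) * cnj (\<Sum>q\<in>C. h q))"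
  using assms
  by (intro compact_measure.affine_moments[OF compact_measure_K, where l = "bary C"] finite_C continuous_bary
     integral_bary_mult complex_affine_expansion)

lemma mass_facet:
  assumes p: "p \<in> C" and "complex_affine f" "complex_affine h"
  shows "(LINT x|face_measure (facet p). f x * cnj (h x)) =
    of_real (area p / (real DIM('a) * (real DIM('a) + 1))) *
      ((\<Sum>q\<in>C-{p}. f q * cnj (h q)) + (\<Sum>q\<in>C-{p}. f q) * cnj (\<Sum>q\<in>C-{p}. h q))"
proof -
  have *: "g x = (\<Sum>q\<in>C-{p}. of_real (bary C q x) * g q)"
    if "complex_affine g" "x \<in> space (face_measure (facet p))" for g x
    using complex_affine_expansion[OF that(1), of x] that(2) mem_facet_iff[OF p]
    by (simp add: space_face_measure sum.remove[OF finite_C p])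
  show ?thesis
    using assms finite_C
    by (intro compact_measure.affine_moments[OF compact_measure_facet, where l = "bary C"] continuous_bary
       integral_facet_bary_mult *) auto
qed

lemma norm2_K:
  assumes "complex_affine f"
  shows "(LINT x|lebesgue_on K. (norm (f x))\<^sup>2) =
    vol / ((real DIM('a) + 1) * (real DIM('a) + 2)) * ((\<Sum>q\<in>C. (norm (f q))\<^sup>2) + (norm (\<Sum>q\<in>C. f q))\<^sup>2)"
proof -
  have "complex_of_real (LINT x|lebesgue_on K. (norm (f x))\<^sup>2) = (LINT x|lebesgue_on K. f x * cnj (f x))"
    by (simp only: complex_norm_square integral_complex_of_real[symmetric])
  also have "\<dots> = complex_of_real (vol / ((real DIM('a) + 1) * (real DIM('a) + 2)) * ((\<Sum>q\<in>C. (norm (f q))\<^sup>2) + (norm (\<Sum>q\<in>C. f q))\<^sup>2))"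
    by (simp add: mass_K[OF assms assms] complex_norm_square del: of_real_power)
  finally show ?thesis unfolding of_real_eq_iff .
qed

lemma norm2_facet:
  assumes "p \<in> C" "complex_affine f"
  shows "(LINT x|face_measure (facet p). (norm (f x))\<^sup>2) =
    area p / (real DIM('a) * (real DIM('a) + 1)) * ((\<Sum>q\<in>C-{p}. (norm (f q))\<^sup>2) + (norm (\<Sum>q\<in>C-{p}. f q))\<^sup>2)"
proof -
  have "complex_of_real (LINT x|face_measure (facet p). (norm (f x))\<^sup>2) = (LINT x|face_measure (facet p). f x * cnj (f x))"
    by (simp only: complex_norm_square integral_complex_of_real[symmetric])
  also have "\<dots> = complex_of_real (area p / (real DIM('a) * (real DIM('a) + 1)) * ((\<Sum>q\<in>C-{p}. (norm (f q))\<^sup>2) + (norm (\<Sum>q\<in>C-{p}. f q))\<^sup>2))"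
    by (simp add: mass_facet[OF assms assms(2)] complex_norm_square del: of_real_power)
  finally show ?thesis unfolding of_real_eq_iff .
qed

section \<open>Trace, inverse and Rellich-type relations on one simplex\<close>

lemma norm_sum_le_card:
  fixes f :: "'b \<Rightarrow> complex"
  shows "(norm (\<Sum>q\<in>S. f q))\<^sup>2 \<le> real (card S) * (\<Sum>q\<in>S. (norm (f q))\<^sup>2)"
proof -
  have "(norm (\<Sum>q\<in>S. f q))\<^sup>2 \<le> (\<Sum>q\<in>S. 1 * norm (f q))\<^sup>2"
    by (intro power_mono) (auto intro: norm_sum)
  also have "\<dots> \<le> (\<Sum>q\<in>S. 1\<^sup>2) * (\<Sum>q\<in>S. (norm (f q))\<^sup>2)"
    by (rule Cauchy_Schwarz_ineq_sum)
  finally show ?thesis by simp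
qed

lemma card_facet: "p \<in> C \<Longrightarrow> card (C - {p}) = DIM('a)"
  using card_C finite_C by simp

lemma area_nonneg: "area p \<ge> 0"
  by (simp add: area_def vol_nonneg)

text \<open>The squared sum in the mass matrix formula is nonnegative, and dropping it bounds vertex
  values by the norm. Cauchy-Schwarz applied to the squared sum yields the reverse bounds further
  below.\<close>

lemma vertex_values_le_norm2_K:
  assumes "complex_affine f"
  shows "vol * (\<Sum>q\<in>C. (norm (f q))\<^sup>2) \<le>
    (real DIM('a) + 1) * (real DIM('a) + 2) * (LINT x|lebesgue_on K. (norm (f x))\<^sup>2)"
  unfolding norm2_K[OF assms] using vol_nonneg
  by (simp add: mult_left_mono)

lemma vertex_values_le_norm2_facet:
  assumes "p \<in> C" "complex_affine f"
  shows "area p * (\<Sum>q\<in>C-{p}. (norm (f q))\<^sup>2) \<le>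
    real DIM('a) * (real DIM('a) + 1) * (LINT x|face_measure (facet p). (norm (f x))\<^sup>2)"
  unfolding norm2_facet[OF assms] using area_nonneg[of p]
  by (simp add: mult_left_mono)

lemma norm2_facet_le_vertex_values:
  assumes p: "p \<in> C" and f: "complex_affine f"
  shows "real DIM('a) * (LINT x|face_measure (facet p). (norm (f x))\<^sup>2) \<le> area p * (\<Sum>q\<in>C-{p}. (norm (f q))\<^sup>2)"
proof -
  let ?d = "real DIM('a)" and ?S = "\<Sum>q\<in>C-{p}. (norm (f q))\<^sup>2"
  have d: "?d > 0" by simp
  have "?S + (norm (\<Sum>q\<in>C-{p}. f q))\<^sup>2 \<le> (?d + 1) * ?S"
    using norm_sum_le_card[of f "C - {p}"] card_facet[OF p] by (simp add: algebra_simps)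
  then have "area p / (?d + 1) * (?S + (norm (\<Sum>q\<in>C-{p}. f q))\<^sup>2) \<le> area p / (?d + 1) * ((?d + 1) * ?S)"
    using area_nonneg[of p] by (intro mult_left_mono) auto
  also have "area p / (?d + 1) * ((?d + 1) * ?S) = area p * ?S" by (simp add: divide_simps)
  also have "area p / (?d + 1) * (?S + (norm (\<Sum>q\<in>C-{p}. f q))\<^sup>2) = ?d * (LINT x|face_measure (facet p). (norm (f x))\<^sup>2)"
    unfolding norm2_facet[OF p f] using d by simp
  finally show ?thesis .
qed

lemma norm2_K_le_vertex_values:
  assumes f: "complex_affine f"
  shows "(real DIM('a) + 1) * (LINT x|lebesgue_on K. (norm (f x))\<^sup>2) \<le> vol * (\<Sum>q\<in>C. (norm (f q))\<^sup>2)"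
proof -
  let ?d = "real DIM('a)" and ?S = "\<Sum>q\<in>C. (norm (f q))\<^sup>2"
  have "?S + (norm (\<Sum>q\<in>C. f q))\<^sup>2 \<le> (?d + 2) * ?S"
    using norm_sum_le_card[of f C] card_C by (simp add: algebra_simps)
  then have "vol / (?d + 2) * (?S + (norm (\<Sum>q\<in>C. f q))\<^sup>2) \<le> vol / (?d + 2) * ((?d + 2) * ?S)"
    using vol_nonneg by (intro mult_left_mono) auto
  also have "vol / (?d + 2) * ((?d + 2) * ?S) = vol * ?S" by (simp add: divide_simps)
  also have "vol / (?d + 2) * (?S + (norm (\<Sum>q\<in>C. f q))\<^sup>2) = (?d + 1) * (LINT x|lebesgue_on K. (norm (f x))\<^sup>2)"
    unfolding norm2_K[OF f] by simp
  finally show ?thesis .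
qed

text \<open>Both norms are compared with vertex values. The ratio of facet area to volume is
  \<open>DIM('a) * norm (bgrad C p)\<close>, so the inverse height is the only geometric quantity in
  the constant.\<close>

lemma trace_inequality:
  assumes p: "p \<in> C" and f: "complex_affine f"
  shows "(LINT x|face_measure (facet p). (norm (f x))\<^sup>2) \<le>
    (real DIM('a) + 1) * (real DIM('a) + 2) * norm (bgrad C p) * (LINT x|lebesgue_on K. (norm (f x))\<^sup>2)"
proof -
  let ?d = "real DIM('a)" and ?g = "norm (bgrad C p)"
  have d: "?d > 0" by simp
  have "?d * (LINT x|face_measure (facet p). (norm (f x))\<^sup>2) \<le> area p * (\<Sum>q\<in>C-{p}. (norm (f q))\<^sup>2)"
    by (rule norm2_facet_le_vertex_values[OF p f])
  also have "\<dots> \<le> area p * (\<Sum>q\<in>C. (norm (f q))\<^sup>2)"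
    using area_nonneg[of p] finite_C by (intro mult_left_mono sum_mono2) auto
  also have "\<dots> = ?d * ?g * (vol * (\<Sum>q\<in>C. (norm (f q))\<^sup>2))" by (simp add: area_def)
  also have "\<dots> \<le> ?d * ?g * ((?d + 1) * (?d + 2) * (LINT x|lebesgue_on K. (norm (f x))\<^sup>2))"
    using vertex_values_le_norm2_K[OF f] by (intro mult_left_mono) auto
  finally have "?d * (LINT x|face_measure (facet p). (norm (f x))\<^sup>2) \<le>
     ?d * ((?d + 1) * (?d + 2) * ?g * (LINT x|lebesgue_on K. (norm (f x))\<^sup>2))" by (simp add: ac_simps)
  then show ?thesis using d by simp
qed

text \<open>A direction tangential to the facet leaves the coordinate of \<open>p\<close> unchanged,
  so the increment of \<open>f\<close> involves only vertex values on that facet, and these are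
  controlled by the surface norm.\<close>

lemma tangential_inverse_inequality:
  assumes p: "p \<in> C" and f: "complex_affine f" and t: "bgrad C p \<bullet> t = 0"
  shows "area p * (norm (f (x + t) - f x))\<^sup>2 \<le>
    real DIM('a) * (real DIM('a) + 1) * (\<Sum>q\<in>C-{p}. (norm (bgrad C q))\<^sup>2) * (norm t)\<^sup>2
      * (LINT x|face_measure (facet p). (norm (f x))\<^sup>2)"
proof -
  have "f (x + t) - f x = (\<Sum>q\<in>C. of_real (bary C q (x + t) - bary C q x) * f q)"
    using complex_affine_expansion[OF f, of "x + t"] complex_affine_expansion[OF f, of x]
    by (simp add: sum_subtractf[symmetric] left_diff_distrib)
  also have "\<dots> = (\<Sum>q\<in>C-{p}. of_real (bgrad C q \<bullet> t) * f q)"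
    unfolding sum.remove[OF finite_C p] by (simp add: t bary_def inner_add_right inner_diff_right)
  finally have D: "f (x + t) - f x = (\<Sum>q\<in>C-{p}. of_real (bgrad C q \<bullet> t) * f q)" .
  have "norm (f (x + t) - f x) \<le> (\<Sum>q\<in>C-{p}. (norm (bgrad C q) * norm t) * norm (f q))"
    unfolding D
  proof (rule order_trans[OF norm_sum sum_mono])
    fix q
    have "\<bar>bgrad C q \<bullet> t\<bar> \<le> norm (bgrad C q) * norm t" by (rule Cauchy_Schwarz_ineq2)
    then show "norm (of_real (bgrad C q \<bullet> t) * f q) \<le> (norm (bgrad C q) * norm t) * norm (f q)"
      by (simp add: norm_mult mult_right_mono)
  qed
  then have "(norm (f (x + t) - f x))\<^sup>2 \<le> (\<Sum>q\<in>C-{p}. (norm (bgrad C q) * norm t) * norm (f q))\<^sup>2"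
    by (intro power_mono) auto
  also have "\<dots> \<le> (\<Sum>q\<in>C-{p}. (norm (bgrad C q) * norm t)\<^sup>2) * (\<Sum>q\<in>C-{p}. (norm (f q))\<^sup>2)"
    by (rule Cauchy_Schwarz_ineq_sum)
  also have "(\<Sum>q\<in>C-{p}. (norm (bgrad C q) * norm t)\<^sup>2) = (\<Sum>q\<in>C-{p}. (norm (bgrad C q))\<^sup>2) * (norm t)\<^sup>2"
    by (simp add: power_mult_distrib sum_distrib_right)
  finally have "area p * (norm (f (x + t) - f x))\<^sup>2 \<le>
      area p * ((\<Sum>q\<in>C-{p}. (norm (bgrad C q))\<^sup>2) * (norm t)\<^sup>2 * (\<Sum>q\<in>C-{p}. (norm (f q))\<^sup>2))"
    by (intro mult_left_mono area_nonneg)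
  also have "\<dots> = (\<Sum>q\<in>C-{p}. (norm (bgrad C q))\<^sup>2) * (norm t)\<^sup>2 * (area p * (\<Sum>q\<in>C-{p}. (norm (f q))\<^sup>2))"
    by (simp only: ac_simps)
  also have "\<dots> \<le> (\<Sum>q\<in>C-{p}. (norm (bgrad C q))\<^sup>2) * (norm t)\<^sup>2 *
      (real DIM('a) * (real DIM('a) + 1) * (LINT x|face_measure (facet p). (norm (f x))\<^sup>2))"
    by (intro mult_left_mono vertex_values_le_norm2_facet[OF p f] mult_nonneg_nonneg sum_nonneg) auto
  finally show ?thesis by (simp only: ac_simps)
qed

text \<open>The weight of a facet is the constant value of \<open>(y - x\<^sub>0) \<bullet> n\<close> on it, so this is the divergence
  theorem for the field \<open>(x - x\<^sub>0) \<bar>f\<bar>\<^sup>2\<close>. For affine \<open>f\<close> it is an identity between vertex values.\<close>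

lemma rellich_identity:
  assumes f: "complex_affine f"
  shows "(\<Sum>p\<in>C. bary C p x0 / norm (bgrad C p) * (LINT x|face_measure (facet p). (norm (f x))\<^sup>2)) =
    real DIM('a) * (LINT x|lebesgue_on K. (norm (f x))\<^sup>2)
      + 2 * Re (LINT x|lebesgue_on K. f x * cnj (f x - f x0))"
proof -
  let ?d = "real DIM('a)" and ?b = "\<lambda>p. bary C p x0"
  define S where "S = (\<Sum>q\<in>C. f q)"
  define Q where "Q = (\<Sum>q\<in>C. (norm (f q))\<^sup>2)"
  \<comment> \<open>Both sides turn out to be \<open>vol / (real DIM('a) + 1) * E\<close>.\<close>
  define E where "E = Q + (norm S)\<^sup>2 - 2 * Re (S * cnj (f x0))"
  have d: "?d > 0" by simp
  have fd: "complex_affine (\<lambda>x. f x - f x0)"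
    using f by (intro complex_affine_diff complex_affine_const)
  \<comment> \<open>The facet sums are the full sums without \<open>f p\<close>. Expanding the
    square leaves a term linear in \<open>f p\<close>, and the weights \<open>?b p\<close> add these
    terms up to the value \<open>f x0\<close>.\<close>
  have facet: "?b p / norm (bgrad C p) * (LINT x|face_measure (facet p). (norm (f x))\<^sup>2) =
      vol / (?d + 1) * (?b p * (Q + (norm S)\<^sup>2) - 2 * Re (S * cnj (of_real (?b p) * f p)))" if p: "p \<in> C" for p
  proof -
    have g: "norm (bgrad C p) > 0" using bgrad_nonzero[OF p] by simp
    have "(\<Sum>q\<in>C-{p}. f q) = S - f p" "(\<Sum>q\<in>C-{p}. (norm (f q))\<^sup>2) = Q - (norm (f p))\<^sup>2"
      using sum.remove[OF finite_C p, of f] sum.remove[OF finite_C p, of "\<lambda>q. (norm (f q))\<^sup>2"]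
      by (simp_all add: S_def Q_def)
    moreover have "(norm (S - f p))\<^sup>2 = (norm S)\<^sup>2 + (norm (f p))\<^sup>2 - 2 * Re (S * cnj (f p))"
      unfolding cmod_power2 by (simp add: power2_eq_square algebra_simps)
    ultimately have "(LINT x|face_measure (facet p). (norm (f x))\<^sup>2) =
        area p / (?d * (?d + 1)) * (Q + (norm S)\<^sup>2 - 2 * Re (S * cnj (f p)))"
      unfolding norm2_facet[OF p f] by simp
    also have "area p / (?d * (?d + 1)) = norm (bgrad C p) * (vol / (?d + 1))"
      using d by (simp add: area_def)
    finally have "?b p / norm (bgrad C p) * (LINT x|face_measure (facet p). (norm (f x))\<^sup>2) =
      vol / (?d + 1) * (?b p * (Q + (norm S)\<^sup>2 - 2 * Re (S * cnj (f p))))"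
      using g by simp
    then show ?thesis by (simp add: algebra_simps)
  qed
  have "(\<Sum>p\<in>C. ?b p / norm (bgrad C p) * (LINT x|face_measure (facet p). (norm (f x))\<^sup>2)) =
      vol / (?d + 1) * (\<Sum>p\<in>C. ?b p * (Q + (norm S)\<^sup>2) - 2 * Re (S * cnj (of_real (?b p) * f p)))"
    unfolding sum_distrib_left by (intro sum.cong refl facet)
  also have "(\<Sum>p\<in>C. ?b p * (Q + (norm S)\<^sup>2) - 2 * Re (S * cnj (of_real (?b p) * f p))) =
      (\<Sum>p\<in>C. ?b p) * (Q + (norm S)\<^sup>2) - 2 * Re (S * cnj (\<Sum>p\<in>C. of_real (?b p) * f p))"
    by (simp only: sum_subtractf sum_distrib_right[symmetric] sum_distrib_left[symmetric] Re_sum[symmetric] cnj_sum)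
  also have "\<dots> = E" by (simp add: sum_bary E_def complex_affine_expansion[OF f, of x0, symmetric])
  finally have lhs: "(\<Sum>p\<in>C. ?b p / norm (bgrad C p) * (LINT x|face_measure (facet p). (norm (f x))\<^sup>2)) =
      vol / (?d + 1) * E" .
  have "(\<Sum>q\<in>C. f q * cnj (f q - f x0)) = of_real Q - S * cnj (f x0)"
    by (simp add: Q_def S_def right_diff_distrib sum_subtractf sum_distrib_right complex_norm_square del: of_real_power)
  moreover have "(\<Sum>q\<in>C. f q - f x0) = S - of_real (?d + 1) * f x0"
    using card_C by (simp add: S_def sum_subtractf)
  ultimately have "(LINT x|lebesgue_on K. f x * cnj (f x - f x0)) =
    of_real (vol / ((?d + 1) * (?d + 2))) * (of_real Q - S * cnj (f x0) + S * cnj (S - of_real (?d + 1) * f x0))"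
    unfolding mass_K[OF f fd] S_def[symmetric] by simp
  also have "of_real Q - S * cnj (f x0) + S * cnj (S - of_real (?d + 1) * f x0) =
      of_real (Q + (norm S)\<^sup>2) - of_real (?d + 2) * (S * cnj (f x0))"
    by (simp add: algebra_simps complex_norm_square del: of_real_power)
  finally have I: "(LINT x|lebesgue_on K. f x * cnj (f x - f x0)) =
      of_real (vol / ((?d + 1) * (?d + 2))) * (of_real (Q + (norm S)\<^sup>2) - of_real (?d + 2) * (S * cnj (f x0)))" .
  have R: "Re (of_real a * (of_real b - of_real c * z)) = a * (b - c * Re z)" for a b c z
    by simp
  have *: "Re (LINT x|lebesgue_on K. f x * cnj (f x - f x0)) =
      vol / ((?d + 1) * (?d + 2)) * (Q + (norm S)\<^sup>2 - (?d + 2) * Re (S * cnj (f x0)))"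
    unfolding I by (rule R)
  have "?d * (LINT x|lebesgue_on K. (norm (f x))\<^sup>2) + 2 * Re (LINT x|lebesgue_on K. f x * cnj (f x - f x0)) =
      vol / ((?d + 1) * (?d + 2)) * ((?d + 2) * E)"
  proof -
    have "d * (v * (Q' + n)) + 2 * (v * (Q' + n - (d + 2) * r)) = v * ((d + 2) * (Q' + n - 2 * r))"
      for d v Q' n r :: real
      by (simp add: algebra_simps)
    then show ?thesis unfolding * norm2_K[OF f] S_def[symmetric] Q_def[symmetric] E_def .
  qed
  also have "\<dots> = vol / (?d + 1) * E" by (simp add: divide_simps)
  finally show ?thesis using lhs by simp
qed

text \<open>Every vertex lies on \<open>DIM('a)\<close> facets, so the vertex values of the facets
  together dominate those of the simplex. Passing from volume to area costs the height, which is at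
  most the bound \<open>E\<close> for the edges. It serves meshes without interior faces, where
  boundary values have to control \<open>u\<close> inside.\<close>

lemma norm2_K_le_facets:
  assumes f: "complex_affine f" and E: "\<And>p q. p \<in> C \<Longrightarrow> q \<in> C \<Longrightarrow> norm (p - q) \<le> E"
  shows "(LINT x|lebesgue_on K. (norm (f x))\<^sup>2) \<le> E * (\<Sum>p\<in>C. LINT x|face_measure (facet p). (norm (f x))\<^sup>2)"
proof -
  let ?d = "real DIM('a)"
  let ?Q = "\<lambda>S. \<Sum>q\<in>S. (norm (f q))\<^sup>2" and ?I = "\<lambda>p. LINT x|face_measure (facet p). (norm (f x))\<^sup>2"
  have d: "?d \<ge> 1" using DIM_positive[where 'a='a] by linarith
  have "(\<Sum>p\<in>C. ?Q (C - {p})) = (\<Sum>p\<in>C. ?Q C - (norm (f p))\<^sup>2)"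
    using finite_C by (intro sum.cong refl) (simp add: sum.remove)
  also have "\<dots> = ?d * ?Q C" using card_C by (simp add: sum_subtractf algebra_simps)
  finally have Q: "?Q C \<le> (\<Sum>p\<in>C. ?Q (C - {p}))"
    using mult_right_mono[OF d, of "?Q C"] by (simp add: sum_nonneg)
  have p: "vol * ?Q (C - {p}) \<le> (?d + 1) * (E * ?I p)" if p: "p \<in> C" for p
  proof -
    obtain q where q: "q \<in> C" "q \<noteq> p" using ex_other[OF p] by blast
    have "1 \<le> norm (bgrad C p) * norm (p - q)"
      using Cauchy_Schwarz_ineq2[of "bgrad C p" "p - q"] bgrad_inner[OF p q] by simp
    also have "\<dots> \<le> norm (bgrad C p) * E" using E[OF p q(1)] by (intro mult_left_mono) auto
    finally have g: "1 \<le> norm (bgrad C p) * E" .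
    have E0: "0 \<le> E" using E[OF p p] by simp
    have "?d * (vol * ?Q (C - {p})) * 1 \<le> ?d * (vol * ?Q (C - {p})) * (norm (bgrad C p) * E)"
      using g vol_nonneg by (intro mult_left_mono mult_nonneg_nonneg sum_nonneg) auto
    also have "\<dots> = E * (area p * ?Q (C - {p}))" by (simp add: area_def)
    also have "\<dots> \<le> E * (?d * (?d + 1) * ?I p)"
      by (intro mult_left_mono vertex_values_le_norm2_facet[OF p f] E0)
    finally have "?d * (vol * ?Q (C - {p})) \<le> ?d * ((?d + 1) * (E * ?I p))" by (simp add: ac_simps)
    then show ?thesis by (rule mult_left_le_imp_le) (use d in linarith)
  qed
  have "(?d + 1) * (LINT x|lebesgue_on K. (norm (f x))\<^sup>2) \<le> vol * ?Q C" by (rule norm2_K_le_vertex_values[OF f])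
  also have "\<dots> \<le> vol * (\<Sum>p\<in>C. ?Q (C - {p}))" by (rule mult_left_mono[OF Q vol_nonneg])
  also have "\<dots> \<le> (\<Sum>p\<in>C. (?d + 1) * (E * ?I p))" unfolding sum_distrib_left by (intro sum_mono) (use p in \<open>simp add: sum_distrib_left\<close>)
  also have "\<dots> = (?d + 1) * (E * (\<Sum>p\<in>C. ?I p))" by (simp add: sum_distrib_left)
  finally show ?thesis by (rule mult_left_le_imp_le) (use d in linarith)
qed

end

section \<open>Shape regularity from the minimal angle condition\<close>

text \<open>Balls are convex, so a distance bound at the points of \<open>S\<close> passes to the
  hull; this is used once for each of the two arguments.\<close>

lemma diameter_convex_hull_le:
  fixes S :: "'a::real_normed_vector set"
  assumes "S \<noteq> {}" and D: "\<And>a b. a \<in> S \<Longrightarrow> b \<in> S \<Longrightarrow> dist a b \<le> D"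
  shows "diameter (convex hull S) \<le> D"
proof (rule diameter_le)
  show "convex hull S \<noteq> {} \<or> 0 \<le> D" using assms by simp
  fix x y assume x: "x \<in> convex hull S" and y: "y \<in> convex hull S"
  have "a \<in> cball x D" if "a \<in> S" for a
  proof -
    have "convex hull S \<subseteq> cball a D"
      using D that by (intro hull_minimal) (auto simp: convex_cball)
    then show ?thesis using x by (auto simp: dist_commute)
  qed
  then have "convex hull S \<subseteq> cball x D"
    by (intro hull_minimal) (auto simp: convex_cball)
  then show "norm (x - y) \<le> D" using y by (auto simp: dist_norm)
qed

lemma cos_le_of_vec_angle:
  assumes "vec_angle v w \<ge> \<theta>" "0 \<le> \<theta>" "v \<noteq> 0" "w \<noteq> 0"
  shows "v \<bullet> w \<le> cos \<theta> * (norm v * norm w)"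
proof -
  let ?x = "v \<bullet> w / (norm v * norm w)"
  have pos: "norm v * norm w > 0" using assms by simp
  have "\<bar>v \<bullet> w\<bar> \<le> norm v * norm w" by (rule Cauchy_Schwarz_ineq2)
  then have "\<bar>?x\<bar> \<le> 1" using pos by (simp add: abs_divide)
  then have x: "-1 \<le> ?x" "?x \<le> 1" by linarith+
  have "cos (arccos ?x) \<le> cos \<theta>"
    using assms x arccos_ubound[OF x] by (intro cos_monotone_0_pi_le) (auto simp: vec_angle_def)
  then have "?x \<le> cos \<theta>" using x by (simp add: cos_arccos)
  then show ?thesis using pos by (simp add: pos_divide_le_eq)
qed

text \<open>The distance of \<open>v\<close> from the line along \<open>w\<close> is
  \<open>norm v\<close> times the sine of the angle between them. Acuteness is what allows squaring
  the cosine bound; for an obtuse angle its supplement would decide.\<close>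

lemma dist_line_ge:
  fixes v w :: "'a::real_inner"
  assumes ang: "vec_angle v w \<ge> \<theta>" and \<theta>: "0 \<le> \<theta>" "\<theta> \<le> pi / 2" and nz: "v \<noteq> 0" "w \<noteq> 0"
    and acute: "v \<bullet> w \<ge> 0"
  shows "sin \<theta> * norm v \<le> norm (v - t *\<^sub>R w)"
proof -
  have "v \<bullet> w \<le> cos \<theta> * (norm v * norm w)"
    by (rule cos_le_of_vec_angle[OF ang \<theta>(1) nz])
  then have "(v \<bullet> w)\<^sup>2 \<le> (cos \<theta> * (norm v * norm w))\<^sup>2" using acute by (intro power_mono)
  then have 1: "(v \<bullet> w)\<^sup>2 \<le> (cos \<theta>)\<^sup>2 * (norm v)\<^sup>2 * (norm w)\<^sup>2" by (simp add: power_mult_distrib)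
  have sq: "(norm (v - t *\<^sub>R w))\<^sup>2 = (norm v)\<^sup>2 - 2 * t * (v \<bullet> w) + t\<^sup>2 * (norm w)\<^sup>2"
    unfolding power2_norm_eq_inner by (simp add: inner_commute power2_eq_square algebra_simps)
  have wpos: "(norm w)\<^sup>2 > 0" using nz by simp
  \<comment> \<open>Completing the square in \<open>t\<close>.\<close>
  have "(norm w)\<^sup>2 * (norm (v - t *\<^sub>R w))\<^sup>2 =
      (norm v)\<^sup>2 * (norm w)\<^sup>2 - (v \<bullet> w)\<^sup>2 + (t * (norm w)\<^sup>2 - v \<bullet> w)\<^sup>2"
    unfolding sq by (simp add: power2_eq_square algebra_simps)
  also have "\<dots> \<ge> (norm v)\<^sup>2 * (norm w)\<^sup>2 - (cos \<theta>)\<^sup>2 * (norm v)\<^sup>2 * (norm w)\<^sup>2"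
    using 1 zero_le_power2[of "t * (norm w)\<^sup>2 - v \<bullet> w"] by linarith
  also have "(norm v)\<^sup>2 * (norm w)\<^sup>2 - (cos \<theta>)\<^sup>2 * (norm v)\<^sup>2 * (norm w)\<^sup>2 = (norm w)\<^sup>2 * (sin \<theta> * norm v)\<^sup>2"
    by (simp add: sin_squared_eq power_mult_distrib algebra_simps)
  finally have "(sin \<theta> * norm v)\<^sup>2 \<le> (norm (v - t *\<^sub>R w))\<^sup>2"
    using wpos by (simp add: mult_le_cancel_left_pos)
  then show ?thesis by (rule power2_le_imp_le) simp
qed

text \<open>If the angle is obtuse, the law of cosines makes the opposite side at least as long as
  the adjacent one.\<close>

lemma opposite_edge_ge:
  fixes a b c :: "'a::real_inner"
  assumes ang: "vec_angle (b - a) (c - a) \<ge> \<theta>" and \<theta>: "0 \<le> \<theta>" "\<theta> \<le> pi / 2" and "a \<noteq> b" "a \<noteq> c"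
  shows "sin \<theta> * norm (b - a) \<le> norm (b - c)"
proof (cases "(b - a) \<bullet> (c - a) \<ge> 0")
  case True
  then show ?thesis using dist_line_ge[OF ang \<theta>, of 1] assms by simp
next
  case False
  let ?v = "b - a" and ?w = "c - a"
  have "(norm (?v - ?w))\<^sup>2 = (norm ?v)\<^sup>2 + (norm ?w)\<^sup>2 - 2 * (?v \<bullet> ?w)"
    unfolding power2_norm_eq_inner by (simp add: inner_commute algebra_simps)
  then have "(norm ?v)\<^sup>2 \<le> (norm (?v - ?w))\<^sup>2" using False zero_le_power2[of "norm ?w"] by linarith
  then have "norm ?v \<le> norm (?v - ?w)" by (rule power2_le_imp_le) simp
  moreover have "sin \<theta> * norm ?v \<le> norm ?v"
    using \<theta> by (intro mult_left_le_one_le sin_ge_zero) auto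
  ultimately show ?thesis by simp
qed

context full_simplex
begin

text \<open>The affine function \<open>c - n \<bullet> x\<close> vanishes at all vertices but
  \<open>p\<close>, hence it is a multiple of the barycentric coordinate of
  \<open>p\<close>.\<close>

lemma normal_of_facet_hyperplane:
  assumes p: "p \<in> C" and c: "facet p \<subseteq> {x. n \<bullet> x = c}"
  shows "n = - (c - n \<bullet> p) *\<^sub>R bgrad C p"
proof -
  define \<alpha> where "\<alpha> = c - n \<bullet> p"
  have vals: "c - n \<bullet> q = (if q = p then \<alpha> else 0)" if "q \<in> C" for q
  proof (cases "q = p")
    case False
    then have "q \<in> facet p" using that by (intro hull_inc) simp
    then show ?thesis using c False by auto
  qed (simp add: \<alpha>_def)
  have f: "c - n \<bullet> x = \<alpha> * bary C p x" for x
  proof -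
    have "(\<lambda>x. c - n \<bullet> x) \<in> P1" using P1I[of c "- n"] by simp
    then have "c - n \<bullet> x = (\<Sum>q\<in>C. bary C q x * (c - n \<bullet> q))" by (rule P1_expansion)
    also have "\<dots> = (\<Sum>q\<in>C. if q = p then \<alpha> * bary C p x else 0)"
      by (intro sum.cong refl) (simp add: vals)
    also have "\<dots> = \<alpha> * bary C p x" using p finite_C by simp
    finally show ?thesis .
  qed
  have "n \<bullet> x = (- \<alpha> *\<^sub>R bgrad C p) \<bullet> x" for x
    using f[of x] f[of 0] by (simp add: bary_def inner_diff_right algebra_simps)
  then show ?thesis unfolding \<alpha>_def by (metis vector_eq_rdot)
qed

lemma facet_normal_eq:
  assumes p: "p \<in> C"
  shows "facet_normal K (facet p) = normal p"
  unfolding facet_normal_def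
proof (rule the_equality)
  let ?g = "norm (bgrad C p)"
  have g: "?g > 0" using bgrad_nonzero[OF p] by simp
  have sub: "facet p \<subseteq> affine hull (facet p)" by (rule hull_subset)
  have le: "normal p \<bullet> x \<le> normal p \<bullet> p + 1 / ?g" if "x \<in> K" for x
  proof -
    have "(1 - bary C p x) / ?g \<le> 1 / ?g" using that p g mem_K_iff by (intro divide_right_mono) auto
    then show ?thesis using normal_inner[OF p, of x p] bary_vertex[OF p p] by (simp add: inner_diff_right)
  qed
  show "norm (normal p) = 1 \<and> (\<exists>c. facet p \<subseteq> {x. normal p \<bullet> x = c} \<and> K \<subseteq> {x. normal p \<bullet> x \<le> c})"
    using norm_normal[OF p] sub le unfolding hull_facet_normal[OF p] by blast
  fix n assume n: "norm n = 1 \<and> (\<exists>c. facet p \<subseteq> {x. n \<bullet> x = c} \<and> K \<subseteq> {x. n \<bullet> x \<le> c})"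
  then obtain c where c: "facet p \<subseteq> {x. n \<bullet> x = c}" "K \<subseteq> {x. n \<bullet> x \<le> c}" by blast
  define \<alpha> where "\<alpha> = c - n \<bullet> p"
  have "p \<in> K" using p by (simp add: hull_inc)
  then have \<alpha>0: "\<alpha> \<ge> 0" using c by (auto simp: \<alpha>_def)
  have nn: "n = - \<alpha> *\<^sub>R bgrad C p" unfolding \<alpha>_def by (rule normal_of_facet_hyperplane[OF p c(1)])
  then have "\<alpha> * ?g = 1" using n \<alpha>0 by simp
  then have "\<alpha> = inverse ?g" using g by (simp add: field_simps)
  then show "n = normal p" by (simp add: nn normal_def)
qed

lemma facet_of_K: "e facet_of K \<longleftrightarrow> (\<exists>p\<in>C. e = facet p)"
proof -
  have "facet p \<noteq> {}" if "p \<in> C" for p using ex_other[OF that] by auto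
  then show ?thesis unfolding facet_of_convex_hull_affine_independent[OF indep] by blast
qed

lemma facet_inj: assumes "p \<in> C" "q \<in> C" "facet p = facet q" shows "p = q"
proof (rule ccontr)
  assume "p \<noteq> q"
  then have "q \<in> facet p" using assms by (intro hull_inc) simp
  then have "bary C q q = 0" using mem_facet_iff[OF assms(2)] assms by simp
  then show False using assms by (simp add: bary_vertex)
qed

text \<open>Edges with a common vertex differ at most by the factor \<open>sin \<theta>\<close>.
  Arbitrary edges \<open>ab\<close> and \<open>cd\<close> are linked by \<open>bc\<close>, which
  costs this factor twice.\<close>

lemma edge_ratio:
  assumes ang: "angles_ge \<theta> K" and \<theta>: "0 \<le> \<theta>" "\<theta> \<le> pi / 2"
    and C: "a \<in> C" "b \<in> C" "c \<in> C" "d \<in> C" "c \<noteq> d"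
  shows "(sin \<theta>)\<^sup>2 * dist a b \<le> dist c d"
proof -
  let ?s = "sin \<theta>"
  have s: "0 \<le> ?s" "?s \<le> 1" using \<theta> by (auto intro!: sin_ge_zero)
  have step: "?s * dist x y \<le> dist y z"
    if "x \<in> C" "y \<in> C" "z \<in> C" "y \<noteq> z" for x y z
  proof (cases "x = y \<or> x = z")
    case True
    then show ?thesis using s by (auto simp: dist_commute mult_left_le_one_le)
  next
    case False
    then have "vec_angle (y - x) (z - x) \<ge> \<theta>"
      using ang that unfolding angles_ge_def extreme_point_of_convex_hull_affine_independent[OF indep] by blast
    then show ?thesis using opposite_edge_ge[OF _ \<theta>, of y x z] False
      by (auto simp: dist_norm norm_minus_commute)
  qed
  show ?thesis
  proof (cases "b = c")
    case True
    then have "?s * dist a b \<le> dist c d" using step C by simp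
    moreover have "?s * (?s * dist a b) \<le> ?s * dist a b"
      using s by (intro mult_left_le_one_le mult_nonneg_nonneg) auto
    ultimately show ?thesis by (simp add: power2_eq_square)
  next
    case False
    have "?s * (?s * dist a b) \<le> ?s * dist b c"
      using step[of a b c] C False s by (intro mult_left_mono) auto
    also have "\<dots> \<le> dist c d" using step[of b c d] C by simp
    finally show ?thesis by (simp add: power2_eq_square)
  qed
qed

text \<open>The inner products that belong to the angles at \<open>q\<close> and \<open>r\<close>
  add up to the squared length of \<open>qr\<close>, so one of the two angles is not obtuse and
  \<open>dist_line_ge\<close> applies there.\<close>

lemma edge_le_dist_line:
  assumes ang: "angles_ge \<theta> K" and \<theta>: "0 \<le> \<theta>" "\<theta> \<le> pi / 2"
    and C: "p \<in> C" "q \<in> C" "r \<in> C" "p \<noteq> q" "p \<noteq> r" "q \<noteq> r"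
    and y: "y = u *\<^sub>R q + v *\<^sub>R r" "u + v = 1"
  shows "\<exists>q'\<in>C. q' \<noteq> p \<and> sin \<theta> * dist p q' \<le> dist p y"
proof -
  have angle: "vec_angle (p - b) (c - b) \<ge> \<theta>" if "b \<in> C" "c \<in> C" "p \<noteq> b" "p \<noteq> c" "b \<noteq> c" for b c
    using ang that C unfolding angles_ge_def extreme_point_of_convex_hull_affine_independent[OF indep] by blast
  have sum: "(p - q) \<bullet> (r - q) + (p - r) \<bullet> (q - r) = (norm (r - q))\<^sup>2"
    unfolding power2_norm_eq_inner by (simp add: inner_commute algebra_simps)
  have uv: "u = 1 - v" using y by simp
  show ?thesis
  proof (cases "(p - q) \<bullet> (r - q) \<ge> 0")
    case True
    have "sin \<theta> * norm (p - q) \<le> norm ((p - q) - v *\<^sub>R (r - q))"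
      using True C by (intro dist_line_ge angle \<theta>) auto
    also have "(p - q) - v *\<^sub>R (r - q) = p - y" by (simp add: y uv algebra_simps)
    finally show ?thesis using C by (auto simp: dist_norm)
  next
    case False
    then have acute: "(p - r) \<bullet> (q - r) \<ge> 0" using sum zero_le_power2[of "norm (r - q)"] by linarith
    have "sin \<theta> * norm (p - r) \<le> norm ((p - r) - u *\<^sub>R (q - r))"
      using acute C by (intro dist_line_ge angle \<theta>) auto
    also have "(p - r) - u *\<^sub>R (q - r) = p - y" by (simp add: y uv algebra_simps)
    finally show ?thesis using C by (auto simp: dist_norm)
  qed
qed

text \<open>In dimension 3 the height over a facet is estimated in two steps: some dihedral angle at that
  facet is not obtuse, since the gradients of the barycentric coordinates sum up to zero, and in the
  second facet at such a dihedral angle one planar angle at the common edge is not obtuse.\<close>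

lemma bgrad_le:
  assumes ang: "angles_ge \<theta> K" and \<theta>: "0 < \<theta>" "\<theta> \<le> pi / 2"
    and dim: "DIM('a) = 2 \<or> DIM('a) = 3" and p: "p \<in> C"
  shows "\<exists>q\<in>C. q \<noteq> p \<and> (sin \<theta>)\<^sup>2 * dist p q * norm (bgrad C p) \<le> 1"
proof -
  let ?s = "sin \<theta>" and ?g = "bgrad C p"
  have \<theta>0: "0 \<le> \<theta>" using \<theta> by simp
  have s: "0 < ?s" "?s \<le> 1" using \<theta> by (auto intro!: sin_gt_zero)
  have g: "norm ?g > 0" using bgrad_nonzero[OF p] by simp
  have rest: "card (C - {p}) = DIM('a)" by (rule card_facet[OF p])
  have repr: "(\<Sum>q\<in>C-{p}. bary C q y) = 1 - bary C p y" "(\<Sum>q\<in>C-{p}. bary C q y *\<^sub>R q) = y - bary C p y *\<^sub>R p" for y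
    using sum_bary[of y] bary_repr[of y] unfolding sum.remove[OF finite_C p] by (auto simp: algebra_simps)
  from dim show ?thesis
  proof
    assume "DIM('a) = 2"
    then obtain q r where qr: "C - {p} = {q, r}" "q \<noteq> r" using rest card_2_iff by metis
    \<comment> \<open>The foot of the perpendicular from \<open>p\<close> to the opposite
      edge.\<close>
    let ?y = "p - (1 / (norm ?g)\<^sup>2) *\<^sub>R ?g"
    have "bary C p ?y = 0" using g by (simp add: bary_def power2_norm_eq_inner)
    then have "bary C q ?y + bary C r ?y = 1" "?y = bary C q ?y *\<^sub>R q + bary C r ?y *\<^sub>R r"
      using repr[of ?y] qr by auto
    then obtain q' where q': "q' \<in> C" "q' \<noteq> p" "?s * dist p q' \<le> dist p ?y"
      using edge_le_dist_line[OF ang \<theta>0 \<theta>(2) p, of q r ?y] qr by blast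
    have "dist p ?y = 1 / norm ?g" using g by (simp add: dist_norm power2_eq_square)
    then have "?s * dist p q' * norm ?g \<le> 1" using q'(3) g by (simp add: pos_le_divide_eq)
    moreover have "?s * (?s * dist p q' * norm ?g) \<le> ?s * dist p q' * norm ?g"
      using s by (intro mult_left_le_one_le mult_nonneg_nonneg) auto
    ultimately show ?thesis using q' by (intro bexI[of _ q']) (auto simp: power2_eq_square ac_simps)
  next
    assume d3: "DIM('a) = 3"
    \<comment> \<open>The other gradients add up to \<open>- ?g\<close>, so one of them has a
      negative inner product with \<open>?g\<close>, which means an acute dihedral angle.\<close>
    have "(?g + (\<Sum>i\<in>C-{p}. bgrad C i)) \<bullet> ?g = 0"
      using sum_bgrad unfolding sum.remove[OF finite_C p] by simp
    then have "(\<Sum>i\<in>C-{p}. bgrad C i \<bullet> ?g) = - (?g \<bullet> ?g)"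
      by (simp add: inner_add_left inner_sum_left)
    then have "(\<Sum>i\<in>C-{p}. bgrad C i \<bullet> ?g) < 0" using g by simp
    then obtain i where i: "i \<in> C" "i \<noteq> p" and neg: "bgrad C i \<bullet> ?g < 0"
      using sum_nonneg[of "C - {p}" "\<lambda>i. bgrad C i \<bullet> ?g"] by fastforce
    let ?gi = "bgrad C i"
    have gi: "norm ?gi > 0" using bgrad_nonzero[OF i(1)] by simp
    define c where "c = ?gi \<bullet> ?g"
    have "facet p \<noteq> facet i" using facet_inj p i by blast
    then have "pi - vec_angle (normal p) (normal i) \<ge> \<theta>"
      using ang facet_of_K p i facet_normal_eq[OF p] facet_normal_eq[OF i(1)]
      unfolding angles_ge_def by metis
    then have "arccos (normal p \<bullet> normal i) \<le> pi - \<theta>"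
      using norm_normal[OF p] norm_normal[OF i(1)] by (simp add: vec_angle_def)
    moreover have np: "\<bar>normal p \<bullet> normal i\<bar> \<le> 1"
      using Cauchy_Schwarz_ineq2[of "normal p" "normal i"] norm_normal[OF p] norm_normal[OF i(1)] by simp
    ultimately have "cos (pi - \<theta>) \<le> cos (arccos (normal p \<bullet> normal i))"
      using \<theta> arccos_lbound[of "normal p \<bullet> normal i"] by (intro cos_monotone_0_pi_le) auto
    then have "- cos \<theta> \<le> normal p \<bullet> normal i" using np by (simp add: cos_arccos_abs)
    also have "normal p \<bullet> normal i = c / (norm ?g * norm ?gi)"
      using g gi by (simp add: normal_def c_def inner_commute field_simps)
    finally have "- c \<le> cos \<theta> * (norm ?g * norm ?gi)"
      using g gi by (simp add: pos_le_divide_eq)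
    then have "(- c)\<^sup>2 \<le> (cos \<theta> * (norm ?g * norm ?gi))\<^sup>2"
      using neg by (intro power_mono) (auto simp: c_def)
    then have c2: "c\<^sup>2 / (norm ?gi)\<^sup>2 \<le> (cos \<theta>)\<^sup>2 * (norm ?g)\<^sup>2"
      using gi by (simp add: power_mult_distrib pos_divide_le_eq ac_simps)
    \<comment> \<open>The part of \<open>?g\<close> tangential to the facet opposite to
      \<open>i\<close>, that is, the in-plane gradient of the coordinate of \<open>p\<close>. The
      lower bound on the dihedral angle prevents it from being small compared with
      \<open>?g\<close>.\<close>
    define h where "h = ?g - (c / (norm ?gi)\<^sup>2) *\<^sub>R ?gi"
    have gih: "?gi \<bullet> h = 0" using gi by (simp add: h_def c_def inner_diff_right power2_norm_eq_inner)
    have gh: "?g \<bullet> h = (norm ?g)\<^sup>2 - c\<^sup>2 / (norm ?gi)\<^sup>2"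
      by (simp add: h_def c_def inner_diff_right dot_square_norm inner_commute power2_eq_square)
    have hh: "(norm h)\<^sup>2 = ?g \<bullet> h"
    proof -
      have "h \<bullet> h = ?g \<bullet> h - (c / (norm ?gi)\<^sup>2) * (?gi \<bullet> h)"
        by (subst (1) h_def) (simp add: inner_diff_left)
      then show ?thesis by (simp add: gih power2_norm_eq_inner)
    qed
    have "(?s * norm ?g)\<^sup>2 \<le> (norm h)\<^sup>2"
      unfolding hh gh using c2 by (simp add: power_mult_distrib sin_squared_eq algebra_simps)
    then have hs: "?s * norm ?g \<le> norm h" by (rule power2_le_imp_le) simp
    have hpos: "norm h > 0" using hs s g by (meson less_le_trans mult_pos_pos)
    \<comment> \<open>The foot of the perpendicular from \<open>p\<close> to the common edge of the
      two facets; moving from \<open>p\<close> along \<open>h\<close> stays in the plane of the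
      facet opposite to \<open>i\<close>.\<close>
    let ?y = "p - (1 / (norm h)\<^sup>2) *\<^sub>R h"
    have y0: "bary C p ?y = 0"
      using hpos by (simp add: bary_def hh[symmetric])
    have yi: "bary C i ?y = 0"
      using gih bary_vertex[OF i(1) p] i by (simp add: bary_def inner_diff_right)
    have "card (C - {p} - {i}) = 2" using rest d3 i finite_C by simp
    then obtain q r where qr: "C - {p} - {i} = {q, r}" "q \<noteq> r" using card_2_iff by metis
    have iC: "i \<in> C - {p}" "finite (C - {p})" using i finite_C by auto
    have "bary C q ?y + bary C r ?y = 1" "?y = bary C q ?y *\<^sub>R q + bary C r ?y *\<^sub>R r"
      using repr[of ?y] qr(2) y0 yi unfolding sum.remove[OF iC(2,1)] qr(1) by auto
    moreover have "q \<in> C" "r \<in> C" "p \<noteq> q" "p \<noteq> r" using qr by auto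
    ultimately obtain q' where q': "q' \<in> C" "q' \<noteq> p" "?s * dist p q' \<le> dist p ?y"
      using edge_le_dist_line[OF ang \<theta>0 \<theta>(2) p, of q r ?y] qr(2) by blast
    have "dist p ?y = 1 / norm h" using hpos by (simp add: dist_norm power2_eq_square)
    then have 1: "?s * dist p q' * norm h \<le> 1" using q'(3) hpos by (simp add: pos_le_divide_eq)
    have "?s * dist p q' * (?s * norm ?g) \<le> ?s * dist p q' * norm h"
      using hs s by (intro mult_left_mono) auto
    then have "?s\<^sup>2 * dist p q' * norm ?g \<le> 1" using 1 by (simp add: power2_eq_square ac_simps)
    then show ?thesis using q' by blast
  qed
qed

text \<open>\<open>bgrad_le\<close> compares the height with some edge at \<open>p\<close>, and
  \<open>edge_ratio\<close> compares that edge with the edges of \<open>e\<close>, which bound its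
  diameter. Each comparison costs \<open>(sin \<theta>)\<^sup>2\<close>, hence the fourth
  power.\<close>

lemma shape_regular:
  assumes ang: "angles_ge \<theta> K" and \<theta>: "0 < \<theta>" "\<theta> \<le> pi / 2"
    and dim: "DIM('a) = 2 \<or> DIM('a) = 3" and e: "e facet_of K"
  shows "p \<in> C \<Longrightarrow> (sin \<theta>) ^ 4 * (norm (bgrad C p) * diameter e) \<le> 1"
    and "e' facet_of K \<Longrightarrow> (sin \<theta>)\<^sup>2 * diameter e \<le> diameter e'"
    and "diameter e > 0"
proof -
  let ?s = "sin \<theta>"
  have \<theta>0: "0 \<le> \<theta>" using \<theta> by simp
  have s: "0 < ?s" using \<theta> by (auto intro!: sin_gt_zero)
  have le: "?s\<^sup>2 * diameter e \<le> dist c d" if "c \<in> C" "d \<in> C" "c \<noteq> d" for c d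
  proof -
    obtain r where r: "r \<in> C" "e = facet r" using e facet_of_K by blast
    have "dist a b \<le> dist c d / ?s\<^sup>2" if "a \<in> C - {r}" "b \<in> C - {r}" for a b
    proof -
      have "?s\<^sup>2 * dist a b \<le> dist c d"
        using edge_ratio[OF ang \<theta>0 \<theta>(2)] that \<open>c \<in> C\<close> \<open>d \<in> C\<close> \<open>c \<noteq> d\<close> by blast
      then show ?thesis using s by (simp add: pos_le_divide_eq ac_simps)
    qed
    moreover have "C - {r} \<noteq> {}" using ex_other[OF r(1)] by auto
    ultimately have "diameter e \<le> dist c d / ?s\<^sup>2" unfolding r(2) by (intro diameter_convex_hull_le)
    then show ?thesis using s by (simp add: pos_le_divide_eq ac_simps)
  qed
  have edge: "\<exists>c\<in>C. \<exists>d\<in>C. c \<noteq> d \<and> dist c d \<le> diameter f" if f: "f facet_of K" for f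
  proof -
    obtain r where r: "r \<in> C" "f = facet r" using f unfolding facet_of_K by blast
    \<comment> \<open>In dimension at least 2 a facet has two distinct vertices and so contains an
      edge.\<close>
    have "DIM('a) \<ge> 2" using dim by linarith
    then have "2 \<le> card (C - {r})" using card_facet[OF r(1)] by (simp only:)
    then obtain S where S: "S \<subseteq> C - {r}" "card S = 2" by (rule obtain_subset_with_card_n)
    then obtain c d where "S = {c, d}" and "c \<noteq> d" by (auto simp: card_2_iff)
    with S have cd: "c \<in> C - {r}" "d \<in> C - {r}" "c \<noteq> d" by auto
    have "dist c d \<le> diameter f"
      unfolding r(2) using cd by (intro diameter_bounded_bound compact_imp_bounded compact_K hull_inc) auto
    then show ?thesis using cd by blast
  qed
  show "e' facet_of K \<Longrightarrow> ?s\<^sup>2 * diameter e \<le> diameter e'"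
    using edge[of e'] le by (meson order_trans)
  show "diameter e > 0" using edge[OF e] by (meson less_le_trans zero_less_dist_iff)
  show "?s ^ 4 * (norm (bgrad C p) * diameter e) \<le> 1" if p: "p \<in> C"
  proof -
    obtain q where q: "q \<in> C" "q \<noteq> p" "?s\<^sup>2 * dist p q * norm (bgrad C p) \<le> 1"
      using bgrad_le[OF ang \<theta> dim p] by blast
    have "?s\<^sup>2 * norm (bgrad C p) * (?s\<^sup>2 * diameter e) \<le> ?s\<^sup>2 * norm (bgrad C p) * dist p q"
      using le[OF p q(1)] q(2) by (intro mult_left_mono) auto
    also have "\<dots> \<le> 1" using q(3) by (simp add: ac_simps)
    finally show ?thesis by (simp add: ac_simps power_numeral_reduce power2_eq_square)
  qed
qed

end

section \<open>Facets of a mesh\<close>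

definition verts :: "'a::euclidean_space set \<Rightarrow> 'a set" where
  "verts K = {x. x extreme_point_of K}"

lemma full_simplex_verts:
  assumes "int DIM('a) simplex (K::'a::euclidean_space set)"
  shows "full_simplex (verts K)" "convex hull (verts K) = K"
proof -
  obtain C where C: "\<not> affine_dependent C" "int (card C) = int DIM('a) + 1" "K = convex hull C"
    using assms by (auto simp: simplex_def)
  then have "verts K = C"
    unfolding verts_def by (simp add: extreme_point_of_convex_hull_affine_independent)
  moreover have "full_simplex C" using C by (simp add: full_simplex_def)
  ultimately show "full_simplex (verts K)" "convex hull (verts K) = K" using C by auto
qed

context full_simplex
begin

lemma interior_K_nonempty: "interior K \<noteq> {}"
  using interior_convex_hull_eq_empty[of C] card_C indep by simp

lemma closure_interior_K: "closure (interior K) = K"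
  using convex_closure_interior[OF convex_convex_hull interior_K_nonempty] compact_K(1)
  by (simp add: compact_imp_closed)

lemma aff_dim_K: "aff_dim K = int DIM('a)"
  by (simp add: aff_dim_convex_hull aff_dim_eq_full hull_C)

lemma rel_interior_facet_bary:
  assumes p: "p \<in> C" and x: "x \<in> rel_interior (facet p)"
  shows "bary C p x = 0" "\<And>q. q \<in> C - {p} \<Longrightarrow> bary C q x > 0"
proof -
  have "\<not> affine_dependent (C - {p})" using indep affine_independent_Diff by blast
  then obtain u where u: "\<forall>q\<in>C-{p}. 0 < u q" "sum u (C-{p}) = 1" "(\<Sum>q\<in>C-{p}. u q *\<^sub>R q) = x"
    using x by (auto simp: rel_interior_convex_hull_explicit)
  let ?u = "\<lambda>q. if q = p then 0 else u q"
  have s: "sum ?u C = 1" "(\<Sum>q\<in>C. ?u q *\<^sub>R q) = x"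
    using u unfolding sum.remove[OF finite_C p] by (auto intro!: sum.cong)
  show "bary C p x = 0" using bary_sum[OF p s(1)] s(2) by simp
  show "bary C q x > 0" if "q \<in> C - {p}" for q
    using bary_sum[of q ?u] s that u(1) by simp
qed

text \<open>At a relative interior point of the facet all other coordinates are positive and stay so
  nearby; only the sign of the coordinate of \<open>p\<close> decides.\<close>

lemma locally_halfspace:
  assumes p: "p \<in> C" and x: "x \<in> rel_interior (facet p)"
  shows "\<exists>r>0. \<forall>y\<in>ball x r. (y \<in> K \<longleftrightarrow> 0 \<le> bary C p y) \<and> (y \<in> interior K \<longleftrightarrow> 0 < bary C p y)"
proof -
  have "\<forall>q\<in>C-{p}. eventually (\<lambda>y. bary C q y > 0) (nhds x)"
  proof
    fix q assume q: "q \<in> C - {p}"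
    have "isCont (bary C q) x" using continuous_bary[of UNIV q] by (simp add: continuous_on_eq_continuous_at)
    then have "(bary C q \<longlongrightarrow> bary C q x) (nhds x)" by (simp add: isCont_def tendsto_at_iff_tendsto_nhds)
    then show "eventually (\<lambda>y. bary C q y > 0) (nhds x)"
      using rel_interior_facet_bary(2)[OF p x q] by (rule order_tendstoD)
  qed
  then have "eventually (\<lambda>y. \<forall>q\<in>C-{p}. bary C q y > 0) (nhds x)"
    using finite_C by (intro eventually_ball_finite) auto
  then obtain r where r: "r > 0" "\<And>y q. dist y x < r \<Longrightarrow> q \<in> C - {p} \<Longrightarrow> bary C q y > 0"
    unfolding eventually_nhds_metric by blast
  have "(y \<in> K \<longleftrightarrow> 0 \<le> bary C p y) \<and> (y \<in> interior K \<longleftrightarrow> 0 < bary C p y)" if "y \<in> ball x r" for y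
  proof -
    have "bary C q y > 0" if "q \<in> C" "q \<noteq> p" for q
      using r(2)[of y q] \<open>y \<in> ball x r\<close> that by (simp add: dist_commute)
    then show ?thesis unfolding mem_K_iff mem_interior_iff using p by (metis less_imp_le)
  qed
  then show ?thesis using r(1) by blast
qed

lemma bary_normal: "p \<in> C \<Longrightarrow> bary C p y = bary C p x - norm (bgrad C p) * (normal p \<bullet> (y - x))"
  using normal_inner[of p y x] bgrad_nonzero[of p] by (simp add: field_simps)

text \<open>An element is the closure of its interior, so each of its points is a limit point of the
  interior and the one-sided limit is unique.\<close>

lemma trace_from_affine:
  assumes f: "\<And>y. y \<in> interior K \<Longrightarrow> v y = f y" and cont: "continuous_on UNIV f" and x: "x \<in> K"
  shows "trace_from K v x = (f x :: 'b::t2_space)"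
  unfolding trace_from_def
proof (rule tendsto_Lim)
  have "x islimpt interior K"
  proof (cases "x \<in> interior K")
    case True
    then show ?thesis using interior_limit_point[of x "interior K"] by simp
  next
    case False
    then show ?thesis using x closure_interior_K by (metis UnE closure_def mem_Collect_eq)
  qed
  then show "\<not> trivial_limit (at x within interior K)" by (simp add: trivial_limit_within)
  have "(f \<longlongrightarrow> f x) (at x within interior K)"
    using cont by (metis UNIV_I continuous_on_def tendsto_within_subset subset_UNIV)
  then show "(v \<longlongrightarrow> f x) (at x within interior K)"
    by (rule Lim_transform_eventually) (auto simp: eventually_at_filter f)
qed

end

section \<open>Conforming meshes: boundary facets, shared facets and their normals\<close>

locale mesh =
  fixes \<Omega> :: "'a::euclidean_space set" and T :: "'a set set"
  assumes domain: "bounded_domain \<Omega>" and mesh: "mesh_of \<Omega> T"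
begin

lemma finite_T: "finite T" using mesh by (simp add: mesh_of_def triangulation_def)
lemma Union_T: "\<Union>T = closure \<Omega>" using mesh by (simp add: mesh_of_def)
lemma open_\<Omega>: "open \<Omega>" using domain by (simp add: bounded_domain_def)
lemma regular_\<Omega>: "interior (closure \<Omega>) = \<Omega>" using domain by (simp add: bounded_domain_def)

lemma full_simplex_K: "K \<in> T \<Longrightarrow> full_simplex (verts K)"
  and hull_verts: "K \<in> T \<Longrightarrow> convex hull (verts K) = K"
  using mesh full_simplex_verts by (auto simp: mesh_of_def)

lemma K_facts:
  assumes "K \<in> T"
  shows K_compact: "compact K" and K_convex: "convex K" and K_interior: "interior K \<noteq> {}"
    and K_aff_dim: "aff_dim K = int DIM('a)"
proof -
  interpret full_simplex "verts K" using full_simplex_K[OF assms] .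
  show "compact K" "convex K" "interior K \<noteq> {}" "aff_dim K = int DIM('a)"
    using compact_K(1) convex_convex_hull[of "verts K"] interior_K_nonempty aff_dim_K
    unfolding hull_verts[OF assms] by auto
qed

lemma facet_iff: "K \<in> T \<Longrightarrow> e facet_of K \<longleftrightarrow> (\<exists>p\<in>verts K. e = convex hull (verts K - {p}))"
  using full_simplex.facet_of_K[OF full_simplex_K] hull_verts by metis

lemma inter_face: "K \<in> T \<Longrightarrow> K' \<in> T \<Longrightarrow> K \<inter> K' face_of K"
  using mesh by (auto simp: mesh_of_def triangulation_def)

lemma interior_disjoint:
  assumes K: "K \<in> T" "K' \<in> T" "K \<noteq> K'" shows "interior K \<inter> K' = {}"
proof (rule ccontr)
  assume "interior K \<inter> K' \<noteq> {}"
  then have "(K \<inter> K') \<inter> interior K \<noteq> {}" using interior_subset by blast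
  then have "K \<inter> K' = K" using face_of_disjoint_interior[OF inter_face[OF K(1,2)]] by blast
  then have sub: "K \<subseteq> K'" by blast
  then have "K face_of K'" using inter_face[OF K(2,1)] by (simp add: inf.absorb2)
  then have "K \<inter> interior K' = {}" using face_of_disjoint_interior K(3) by blast
  moreover have "interior K \<subseteq> K \<inter> interior K'" using sub interior_mono interior_subset by blast
  ultimately show False using K_interior[OF K(1)] by blast
qed

lemma interior_subset_\<Omega>: "K \<in> T \<Longrightarrow> interior K \<subseteq> \<Omega>"
  using Union_T interior_mono[of K "closure \<Omega>"] regular_\<Omega> by blast

text \<open>Conformity makes \<open>K \<inter> K'\<close> a common face. It meets the relative
  interior of \<open>e\<close> and thus contains \<open>e\<close>; it is also a proper face of
  \<open>K\<close>, so comparing dimensions leaves only equality with \<open>e\<close>.\<close>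

lemma shared_facet_of_point:
  assumes K: "K \<in> T" "K' \<in> T" "K \<noteq> K'" and e: "e facet_of K" and x: "x \<in> rel_interior e" "x \<in> K'"
  shows "e facet_of K'"
proof -
  let ?F = "K \<inter> K'"
  have eK: "e face_of K" using e by (rule facet_of_imp_face_of)
  have xe: "x \<in> e" using x rel_interior_subset by blast
  then have xF: "x \<in> ?F" using x eK face_of_imp_subset by blast
  have F: "?F face_of K" "?F face_of K'" using inter_face[OF K(1,2)] inter_face[OF K(2,1)] unfolding Int_commute[of K' K] by simp_all
  have eF: "e \<subseteq> ?F"
    using subset_of_face_of[OF F(1) face_of_imp_subset[OF eK]] xF x(1) by blast
  have FK: "?F \<noteq> K"
    using interior_disjoint[OF K] K_interior[OF K(1)] interior_subset[of K] by blast
  have conv: "convex ?F" using F face_of_imp_convex K_convex K by blast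
  have "aff_dim ?F < aff_dim K"
    using face_of_aff_dim_lt[OF K_convex[OF K(1)] F(1)] FK by blast
  moreover have "aff_dim e = aff_dim K - 1" using e by (simp add: facet_of_def)
  moreover have "aff_dim e \<le> aff_dim ?F" using eF by (rule aff_dim_subset)
  ultimately have dim: "aff_dim e = aff_dim ?F" by linarith
  have "e face_of ?F" using face_of_subset[OF eK eF] by blast
  then have "e = ?F" using face_of_aff_dim_lt[OF conv, of e] dim by force
  moreover have "aff_dim e = aff_dim K' - 1" using e K_aff_dim K by (simp add: facet_of_def)
  ultimately show ?thesis using F(2) xe by (auto simp: facet_of_def)
qed

lemma rel_interior_facet:
  assumes "K \<in> T" "e facet_of K" shows "rel_interior e \<noteq> {}"
proof -
  have "convex e" "e \<noteq> {}"
    using assms face_of_imp_convex facet_of_imp_face_of K_convex facet_of_def by (blast, auto simp: facet_of_def)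
  then show ?thesis by (simp add: rel_interior_eq_empty)
qed

lemma boundary_neighbourhood:
  assumes K: "K \<in> T" and e: "e facet_of K" and x: "x \<in> rel_interior e"
    and only: "\<And>K'. K' \<in> T \<Longrightarrow> e facet_of K' \<Longrightarrow> K' = K"
  shows "\<exists>r>0. \<forall>y\<in>ball x r. y \<in> closure \<Omega> \<longleftrightarrow> y \<in> K"
proof -
  let ?R = "\<Union>(T - {K})"
  have "closed ?R" using finite_T K_compact by (intro closed_Union) (auto simp: compact_imp_closed)
  moreover have "x \<notin> ?R" using shared_facet_of_point[OF K _ _ e x] only by blast
  ultimately obtain r where "r > 0" "ball x r \<subseteq> - ?R"
    by (metis ComplI open_Compl open_contains_ball)
  then have "\<forall>y\<in>ball x r. y \<in> closure \<Omega> \<longleftrightarrow> y \<in> K" using K unfolding Union_T[symmetric] by blast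
  then show ?thesis using \<open>r > 0\<close> by blast
qed

text \<open>Near a relative interior point of an unshared facet the closed domain coincides with a
  single element, and that element looks like a half-space there.\<close>

lemma boundary_facet_normal:
  assumes K: "K \<in> T" and e: "e facet_of K" and x: "x \<in> rel_interior e"
    and only: "\<And>K'. K' \<in> T \<Longrightarrow> e facet_of K' \<Longrightarrow> K' = K"
  shows "outward_unit_normal \<Omega> x (facet_normal K e)" "x \<in> frontier \<Omega>"
proof -
  interpret full_simplex "verts K" using full_simplex_K[OF K] .
  obtain p where p: "p \<in> verts K" "e = convex hull (verts K - {p})" using e facet_iff[OF K] by blast
  have n: "facet_normal K e = normal p" using facet_normal_eq[OF p(1)] p(2) hull_verts[OF K] by simp
  obtain r1 where r1: "r1 > 0" "\<And>y. y \<in> ball x r1 \<Longrightarrow> y \<in> closure \<Omega> \<longleftrightarrow> y \<in> K"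
    using boundary_neighbourhood[OF K e x only] by blast
  obtain r2 where r2: "r2 > 0" "\<And>y. y \<in> ball x r2 \<Longrightarrow> y \<in> K \<longleftrightarrow> 0 \<le> bary (verts K) p y"
     "\<And>y. y \<in> ball x r2 \<Longrightarrow> y \<in> interior K \<longleftrightarrow> 0 < bary (verts K) p y"
    using locally_halfspace[OF p(1), of x] x p(2) unfolding hull_verts[OF K] by blast
  define r where "r = min r1 r2"
  have g: "norm (bgrad (verts K) p) > 0" using bgrad_nonzero[OF p(1)] by simp
  have b: "bary (verts K) p y = - (norm (bgrad (verts K) p) * (normal p \<bullet> (y - x)))" for y
    using bary_normal[OF p(1), of y x] rel_interior_facet_bary(1)[OF p(1)] x p(2) by simp
  have inside: "y \<in> \<Omega>" if "y \<in> ball x r" "normal p \<bullet> (y - x) < 0" for y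
    using r2(3)[of y] that g interior_subset_\<Omega>[OF K] b[of y] by (auto simp: r_def mult_less_0_iff)
  have outside: "y \<notin> closure \<Omega>" if "y \<in> ball x r" "normal p \<bullet> (y - x) > 0" for y
    using r2(2)[of y] r1(2)[of y] that g b[of y] by (auto simp: r_def mult_le_0_iff)
  have rpos: "r > 0" using r1 r2 by (simp add: r_def)
  have en: "0 \<le> \<epsilon> * norm (y - x)" if "\<epsilon> > 0" for y \<epsilon> using that by simp
  show "outward_unit_normal \<Omega> x (facet_normal K e)"
    unfolding outward_unit_normal_def n
  proof (intro conjI allI impI exI[of _ r] ballI norm_normal[OF p(1)] rpos)
    fix \<epsilon> :: real and y assume "\<epsilon> > 0" and y: "y \<in> ball x r"
    note en = en[OF this(1), of y]
    show "y \<in> \<Omega>" if "normal p \<bullet> (y - x) < - \<epsilon> * norm (y - x)"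
      using inside[OF y] that en by linarith
    show "y \<notin> \<Omega>" if "normal p \<bullet> (y - x) > \<epsilon> * norm (y - x)"
      using outside[OF y] that en closure_subset[of \<Omega>] by (meson in_mono le_less_trans)
  qed
  have "x \<in> closure \<Omega>"
  proof -
    have "x \<in> e" using x rel_interior_subset by blast
    then show ?thesis using e K Union_T facet_of_imp_subset by blast
  qed
  moreover have "x \<notin> \<Omega>"
  proof
    assume "x \<in> \<Omega>"
    then obtain s where s: "s > 0" "ball x s \<subseteq> \<Omega>" using open_\<Omega> open_contains_ball by blast
    define t where "t = min r s / 2"
    have t: "t > 0" "t < r" "t < s" using rpos s by (auto simp: t_def min_def)
    let ?y = "x + t *\<^sub>R normal p"
    have "dist x ?y = t" using t norm_normal[OF p(1)] by (simp add: dist_norm)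
    then have "?y \<in> ball x r" "?y \<in> ball x s" using t by auto
    moreover have "normal p \<bullet> (?y - x) > 0" using t norm_normal[OF p(1)] by (simp add: norm_eq_1)
    ultimately show False using outside[of ?y] s closure_subset[of \<Omega>] by blast
  qed
  ultimately show "x \<in> frontier \<Omega>" using open_\<Omega> by (simp add: frontier_def interior_open)
qed

lemma unshared_facet_subset_frontier:
  assumes K: "K \<in> T" and e: "e facet_of K"
    and only: "\<And>K'. K' \<in> T \<Longrightarrow> e facet_of K' \<Longrightarrow> K' = K"
  shows "e \<subseteq> frontier \<Omega>"
proof -
  have "rel_interior e \<subseteq> frontier \<Omega>" using boundary_facet_normal(2)[OF K e _ only] by blast
  then have "closure (rel_interior e) \<subseteq> frontier \<Omega>" by (intro closure_minimal) auto
  moreover have "convex e" using e K_convex[OF K] face_of_imp_convex facet_of_imp_face_of by blast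
  ultimately show ?thesis using convex_closure_rel_interior[of e] closure_subset[of e] by blast
qed

text \<open>The two unit normals span the same line. Equal normals would put a point of the interior
  of one element into the other, so they are opposite. The two half-spaces then fill a ball, and
  \<open>interior (closure \<Omega>) = \<Omega>\<close> places its centre in the domain; this is
  where slits are excluded.\<close>

lemma shared_facet:
  assumes K: "K1 \<in> T" "K2 \<in> T" "K1 \<noteq> K2" and e: "e facet_of K1" "e facet_of K2"
  shows "facet_normal K2 e = - facet_normal K1 e" "\<not> e \<subseteq> frontier \<Omega>"
proof -
  interpret A: full_simplex "verts K1" using full_simplex_K[OF K(1)] .
  interpret B: full_simplex "verts K2" using full_simplex_K[OF K(2)] .
  obtain p where p: "p \<in> verts K1" "e = convex hull (verts K1 - {p})" using e facet_iff[OF K(1)] by blast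
  obtain q where q: "q \<in> verts K2" "e = convex hull (verts K2 - {q})" using e facet_iff[OF K(2)] by blast
  have nA: "facet_normal K1 e = A.normal p" using A.facet_normal_eq[OF p(1)] p(2) hull_verts[OF K(1)] by simp
  have nB: "facet_normal K2 e = B.normal q" using B.facet_normal_eq[OF q(1)] q(2) hull_verts[OF K(2)] by simp
  obtain x where x: "x \<in> rel_interior e" using rel_interior_facet[OF K(1) e(1)] by blast
  obtain r1 where r1: "r1 > 0" "\<And>y. y \<in> ball x r1 \<Longrightarrow> y \<in> K1 \<longleftrightarrow> 0 \<le> bary (verts K1) p y"
     "\<And>y. y \<in> ball x r1 \<Longrightarrow> y \<in> interior K1 \<longleftrightarrow> 0 < bary (verts K1) p y"
    using A.locally_halfspace[OF p(1), of x] x p(2) unfolding hull_verts[OF K(1)] by blast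
  obtain r2 where r2: "r2 > 0" "\<And>y. y \<in> ball x r2 \<Longrightarrow> y \<in> K2 \<longleftrightarrow> 0 \<le> bary (verts K2) q y"
    using B.locally_halfspace[OF q(1), of x] x q(2) unfolding hull_verts[OF K(2)] by blast
  define r where "r = min r1 r2"
  have rpos: "r > 0" using r1 r2 by (simp add: r_def)
  have gA: "norm (bgrad (verts K1) p) > 0" using A.bgrad_nonzero[OF p(1)] by simp
  have gB: "norm (bgrad (verts K2) q) > 0" using B.bgrad_nonzero[OF q(1)] by simp
  have bA: "bary (verts K1) p y = - (norm (bgrad (verts K1) p) * (A.normal p \<bullet> (y - x)))" for y
    using A.bary_normal[OF p(1), of y x] A.rel_interior_facet_bary(1)[OF p(1)] x p(2) by simp
  have bB: "bary (verts K2) q y = - (norm (bgrad (verts K2) q) * (B.normal q \<bullet> (y - x)))" for y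
    using B.bary_normal[OF q(1), of y x] B.rel_interior_facet_bary(1)[OF q(1)] x q(2) by simp
  have "e \<subseteq> {y. B.normal q \<bullet> y = B.normal q \<bullet> q + 1 / norm (bgrad (verts K2) q)}"
    using B.hull_facet_normal[OF q(1)] hull_subset[of e affine] q(2) by auto
  then obtain c where "B.normal q = - (c - B.normal q \<bullet> p) *\<^sub>R bgrad (verts K1) p"
    using A.normal_of_facet_hyperplane[OF p(1)] p(2) by blast
  then obtain s where s: "B.normal q = s *\<^sub>R A.normal p"
  proof -
    assume eq: "B.normal q = - (c - B.normal q \<bullet> p) *\<^sub>R bgrad (verts K1) p" and
      thesis: "\<And>s. B.normal q = s *\<^sub>R A.normal p \<Longrightarrow> thesis"
    have "B.normal q = ((c - B.normal q \<bullet> p) * norm (bgrad (verts K1) p)) *\<^sub>R A.normal p"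
      by (subst (1) eq) (use gA in \<open>simp add: A.normal_def mult.assoc scaleR_minus_left[symmetric] del: scaleR_minus_left\<close>)
    then show ?thesis by (rule thesis)
  qed
  then have "\<bar>s\<bar> = 1" using A.norm_normal[OF p(1)] B.norm_normal[OF q(1)] by simp
  moreover have "s \<noteq> 1"
  proof
    assume "s = 1"
    then have eq: "B.normal q = A.normal p" using s by simp
    let ?y = "x - (r / 2) *\<^sub>R A.normal p"
    have "dist x ?y = r / 2" using rpos A.norm_normal[OF p(1)] by (simp add: dist_norm)
    then have y: "?y \<in> ball x r1" "?y \<in> ball x r2" using rpos by (auto simp: r_def)
    have "A.normal p \<bullet> (?y - x) = - (r / 2)" using A.norm_normal[OF p(1)] by (simp add: norm_eq_1)
    then have "?y \<in> interior K1" "?y \<in> K2"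
      using r1(3)[OF y(1)] r2(2)[OF y(2)] bA[of ?y] bB[of ?y] eq gA gB rpos by auto
    then show False using interior_disjoint[OF K] by blast
  qed
  ultimately have "s = -1" by linarith
  then have opp: "B.normal q = - A.normal p" using s by simp
  then show "facet_normal K2 e = - facet_normal K1 e" by (simp add: nA nB)
  have "ball x r \<subseteq> closure \<Omega>"
  proof
    fix y assume "y \<in> ball x r"
    then have y: "y \<in> ball x r1" "y \<in> ball x r2" by (auto simp: r_def)
    have "y \<in> K1 \<or> y \<in> K2"
      unfolding r1(2)[OF y(1)] r2(2)[OF y(2)] bA[of y] bB[of y] opp using gA gB
      by (simp add: mult_le_0_iff zero_le_mult_iff) linarith
    then show "y \<in> closure \<Omega>" using K Union_T by blast
  qed
  then have "x \<in> interior (closure \<Omega>)" using rpos by (meson centre_in_ball in_mono interior_maximal open_ball)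
  then have "x \<in> \<Omega>" by (simp add: regular_\<Omega>)
  then have "x \<notin> frontier \<Omega>" using open_\<Omega> by (simp add: frontier_def interior_open)
  then show "\<not> e \<subseteq> frontier \<Omega>" using x rel_interior_subset by blast
qed

text \<open>A third element would have a normal opposite to each of two normals that are already
  opposite to one another.\<close>

lemma interior_face_two:
  assumes "e \<in> interior_faces T"
  obtains K1 K2 where "K1 \<in> T" "K2 \<in> T" "K1 \<noteq> K2" "{K \<in> T. e facet_of K} = {K1, K2}"
    "facet_normal K2 e = - facet_normal K1 e" "norm (facet_normal K1 e) = 1"
proof -
  obtain K1 K2 where K: "K1 \<in> T" "K2 \<in> T" "K1 \<noteq> K2" "e facet_of K1" "e facet_of K2"
    using assms by (auto simp: interior_faces_def)
  interpret A: full_simplex "verts K1" using full_simplex_K[OF K(1)] .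
  obtain p where p: "p \<in> verts K1" "e = convex hull (verts K1 - {p})" using K facet_iff[OF K(1)] by blast
  have n1: "norm (facet_normal K1 e) = 1"
    using A.facet_normal_eq[OF p(1)] p(2) hull_verts[OF K(1)] A.norm_normal[OF p(1)] by simp
  have "K = K1 \<or> K = K2" if "K \<in> T" "e facet_of K" for K
  proof (rule ccontr)
    assume "\<not> (K = K1 \<or> K = K2)"
    then have "facet_normal K e = - facet_normal K1 e" "facet_normal K e = - facet_normal K2 e"
      "facet_normal K2 e = - facet_normal K1 e"
      using shared_facet(1)[of K1 K e] shared_facet(1)[of K2 K e] shared_facet(1)[of K1 K2 e] K that by auto
    then have "facet_normal K1 e = - facet_normal K1 e" by simp
    then have "facet_normal K1 e + facet_normal K1 e = 0" by (metis add.right_inverse)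
    then have "2 *\<^sub>R facet_normal K1 e = 0" by (simp only: scaleR_2)
    then show False using n1 by simp
  qed
  then have "{K \<in> T. e facet_of K} = {K1, K2}" using K by auto
  then show thesis using that K shared_facet(1)[OF K] n1 by blast
qed

lemma facet_cases:
  assumes "K \<in> T" "e facet_of K"
  shows "e \<subseteq> frontier \<Omega> \<longleftrightarrow> e \<notin> interior_faces T"
proof
  assume "e \<subseteq> frontier \<Omega>"
  then show "e \<notin> interior_faces T" using shared_facet(2) by (auto simp: interior_faces_def)
next
  assume "e \<notin> interior_faces T"
  then have "K' = K" if "K' \<in> T" "e facet_of K'" for K'
    using assms that by (auto simp: interior_faces_def)
  then show "e \<subseteq> frontier \<Omega>" using unshared_facet_subset_frontier[OF assms] by blast
qed

lemma finite_facets: "K \<in> T \<Longrightarrow> finite {e. e facet_of K}"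
  using full_simplex.finite_C[OF full_simplex_K] facet_iff by simp

lemma finite_interior_faces: "finite (interior_faces T)"
proof -
  have "interior_faces T \<subseteq> (\<Union>K\<in>T. {e. e facet_of K})" by (auto simp: interior_faces_def)
  then show ?thesis using finite_facets finite_T by (meson finite_UN_I finite_subset)
qed

end

section \<open>Square-integrable functions\<close>

text \<open>The discriminant of a nonnegative quadratic, including the degenerate linear case. With
  the integrals of the squares and of the product of two moduli as coefficients it is the
  Cauchy-Schwarz inequality.\<close>

lemma square_le_of_quadratic_nonneg:
  fixes a b c :: real
  assumes "\<And>t. 0 \<le> a * t\<^sup>2 - 2 * c * t + b" "0 \<le> c" "0 \<le> a" "0 \<le> b"
  shows "c \<le> sqrt a * sqrt b"
proof (cases "a = 0")
  case True
  have "c = 0"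
  proof (rule ccontr)
    assume "c \<noteq> 0"
    then have "2 * c * ((b + 1) / (2 * c)) = b + 1" by simp
    then show False using assms(1)[of "(b + 1) / (2 * c)"] True by simp
  qed
  then show ?thesis using True by simp
next
  case False
  then have a: "a > 0" using assms by simp
  have "a * (c / a)\<^sup>2 - 2 * c * (c / a) + b = b - c\<^sup>2 / a"
    using a by (simp add: power2_eq_square field_simps)
  then have "c\<^sup>2 / a \<le> b" using assms(1)[of "c / a"] by linarith
  then have "c\<^sup>2 \<le> a * b" using a by (simp add: pos_divide_le_eq mult.commute)
  then have "sqrt (c\<^sup>2) \<le> sqrt (a * b)" by (rule real_sqrt_le_mono)
  then show ?thesis using assms by (simp add: real_sqrt_mult)
qed

lemma L2_integrable_mult:
  fixes u v :: "'a \<Rightarrow> complex"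
  assumes u: "u \<in> L2 M" and v: "v \<in> L2 M"
  shows "integrable M (\<lambda>x. u x * cnj (v x))" "integrable M (\<lambda>x. norm (u x) * norm (v x))"
proof -
  have m: "u \<in> borel_measurable M" "v \<in> borel_measurable M"
    and i: "integrable M (\<lambda>x. (norm (u x))\<^sup>2)" "integrable M (\<lambda>x. (norm (v x))\<^sup>2)"
    using u v by (auto simp: L2_def)
  have le: "norm (u x) * norm (v x) \<le> (norm (u x))\<^sup>2 + (norm (v x))\<^sup>2" for x
    using sum_squares_bound[of "norm (u x)" "norm (v x)"] zero_le_power2[of "norm (u x)"] zero_le_power2[of "norm (v x)"] by linarith
  note s = Bochner_Integration.integrable_add[OF i]
  note [measurable] = m
  show "integrable M (\<lambda>x. u x * cnj (v x))"
  proof (rule Bochner_Integration.integrable_bound[OF s])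
    have "(\<lambda>x. cnj (v x)) \<in> borel_measurable M"
      by (rule borel_measurable_continuous_on[OF _ m(2)]) (intro continuous_intros)
    then show "(\<lambda>x. u x * cnj (v x)) \<in> borel_measurable M" by measurable
  qed (use le in \<open>auto simp: norm_mult\<close>)
  show "integrable M (\<lambda>x. norm (u x) * norm (v x))"
    by (rule Bochner_Integration.integrable_bound[OF s]) (use le in auto)
qed

lemma L2_norm_square: "(L2_norm M u)\<^sup>2 = (LINT x|M. (norm (u x))\<^sup>2)"
  unfolding L2_norm_def by (rule real_sqrt_pow2) (simp add: integral_nonneg_AE)

lemma L2_norm_nonneg: "0 \<le> L2_norm M u"
  unfolding L2_norm_def by (simp add: integral_nonneg_AE)

lemma L2_inner_le:
  fixes u v :: "'a \<Rightarrow> complex"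
  assumes u: "u \<in> L2 M" and v: "v \<in> L2 M"
  shows "norm (L2_inner M u v) \<le> L2_norm M u * L2_norm M v"
proof -
  have i: "integrable M (\<lambda>x. (norm (u x))\<^sup>2)" "integrable M (\<lambda>x. (norm (v x))\<^sup>2)"
    "integrable M (\<lambda>x. norm (u x) * norm (v x))"
    using u v L2_integrable_mult[OF u v] by (auto simp: L2_def)
  have "norm (L2_inner M u v) \<le> (LINT x|M. norm (u x * cnj (v x)))"
    unfolding L2_inner_def by (rule integral_norm_bound)
  also have "\<dots> = (LINT x|M. norm (u x) * norm (v x))" by (simp add: norm_mult)
  also have "\<dots> \<le> sqrt (LINT x|M. (norm (u x))\<^sup>2) * sqrt (LINT x|M. (norm (v x))\<^sup>2)"
  proof (rule square_le_of_quadratic_nonneg)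
    fix t :: real
    have "0 \<le> (LINT x|M. (t * norm (u x) - norm (v x))\<^sup>2)" by (simp add: integral_nonneg_AE)
    also have "\<dots> = (LINT x|M. t\<^sup>2 * (norm (u x))\<^sup>2 - (2 * t) * (norm (u x) * norm (v x)) + (norm (v x))\<^sup>2)"
      by (intro Bochner_Integration.integral_cong refl) (simp add: power2_eq_square algebra_simps)
    also have "\<dots> = t\<^sup>2 * (LINT x|M. (norm (u x))\<^sup>2) - (2 * t) * (LINT x|M. norm (u x) * norm (v x)) + (LINT x|M. (norm (v x))\<^sup>2)"
      using i by simp
    finally show "0 \<le> (LINT x|M. (norm (u x))\<^sup>2) * t\<^sup>2 - 2 * (LINT x|M. norm (u x) * norm (v x)) * t + (LINT x|M. (norm (v x))\<^sup>2)"
      by (simp add: ac_simps)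
  qed (auto simp: integral_nonneg_AE)
  finally show ?thesis by (simp add: L2_norm_def)
qed

section \<open>Piecewise affine functions\<close>

text \<open>No conjugation: this is the derivative in the real direction \<open>t\<close> of a
  complex affine function with gradient \<open>b\<close>.\<close>

definition bdot :: "complex^'n \<Rightarrow> real^'n \<Rightarrow> complex" where
  "bdot b t = (\<Sum>i\<in>UNIV. b $ i * of_real (t $ i))"

text \<open>Differences with step 1 are exact for affine functions, so their constant gradient is
  obtained without a limit.\<close>

definition cgrad :: "(real^'n \<Rightarrow> complex) \<Rightarrow> complex^'n" where
  "cgrad f = (\<chi> i. f (axis i 1) - f 0)"

lemma complex_affine_bdot:
  assumes "complex_affine f" shows "f x = f 0 + bdot (cgrad f) x"
proof -
  obtain g h where gh: "g \<in> P1" "h \<in> P1" "f = (\<lambda>x. Complex (g x) (h x))"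
    using assms by (auto simp: complex_affine_def)
  obtain a b where g: "g = (\<lambda>x. a + b \<bullet> x)" using gh(1) by (auto simp: P1_def)
  obtain a' b' where h: "h = (\<lambda>x. a' + b' \<bullet> x)" using gh(2) by (auto simp: P1_def)
  have "cgrad f $ i = Complex (b $ i) (b' $ i)" for i
    by (simp add: gh(3) g h complex_eq_iff cgrad_def inner_axis)
  then show ?thesis
    by (simp add: gh(3) g h complex_eq_iff bdot_def inner_vec_def)
qed

lemma bdot_diff_right: "bdot b (s - t) = bdot b s - bdot b t"
  and bdot_add_left: "bdot (a + b) t = bdot a t + bdot b t"
  and bdot_diff_left: "bdot (a - b) t = bdot a t - bdot b t"
  by (simp_all add: bdot_def algebra_simps sum.distrib sum_subtractf sum_distrib_left sum_negf)

lemma bdot_axis: "bdot b (axis i 1) = b $ i"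
proof -
  have "b $ j * of_real (axis i 1 $ j) = (if j = i then b $ i else 0)" for j
    by (simp add: axis_def)
  then show ?thesis by (simp add: bdot_def)
qed

lemma complex_affine_diff_bdot:
  assumes "complex_affine f" shows "f x - f y = bdot (cgrad f) (x - y)"
  using complex_affine_bdot[OF assms, of x] complex_affine_bdot[OF assms, of y]
  by (simp add: bdot_diff_right)

lemma complex_affine_bdotI: "complex_affine (\<lambda>x. bdot b (x - y))"
proof -
  have *: "of_real ((x - y) $ i) = complex_of_real (axis i 1 \<bullet> x) - of_real (y $ i)" for x y :: "real^'n" and i
    by (simp add: inner_axis inner_commute)
  show ?thesis unfolding bdot_def *
    by (intro complex_affine_sum complex_affine_scale complex_affine_diff complex_affine_inner complex_affine_const)
qed

lemma complex_affine_bdot_field: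
  assumes "\<And>i. complex_affine (\<lambda>x. s x $ i)" shows "complex_affine (\<lambda>x. bdot (s x) t)"
proof -
  have "complex_affine (\<lambda>x. \<Sum>i\<in>UNIV. of_real (t $ i) * s x $ i)"
    by (intro complex_affine_sum complex_affine_scale assms)
  then show ?thesis by (simp add: bdot_def mult.commute)
qed

lemma cgrad_bdot: "cgrad (\<lambda>x. bdot b (x - y)) = b"
  by (simp add: cgrad_def vec_eq_iff bdot_diff_right bdot_axis) (simp add: bdot_def)

lemma bdot_has_derivative:
  assumes "complex_affine f"
  shows "(f has_derivative bdot (cgrad f)) (at x)"
proof -
  have "bounded_linear (bdot (cgrad f))"
    unfolding bdot_def
    by (intro bounded_linear_sum bounded_linear_const_mult
        bounded_linear_compose[OF bounded_linear_of_real bounded_linear_vec_nth])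
  then have "((\<lambda>x. f 0 + bdot (cgrad f) x) has_derivative bdot (cgrad f)) (at x)"
    by (auto intro!: derivative_eq_intros bounded_linear_imp_has_derivative)
  moreover have "f = (\<lambda>x. f 0 + bdot (cgrad f) x)" using complex_affine_bdot[OF assms] by blast
  ultimately show ?thesis by simp
qed

lemma grad_eq:
  assumes f: "complex_affine f" and x: "x \<in> interior K" and v: "\<And>y. y \<in> interior K \<Longrightarrow> v y = f y"
  shows "grad v x = cgrad f"
proof -
  have "(v has_derivative bdot (cgrad f)) (at x)"
    by (rule has_derivative_transform_within_open[OF bdot_has_derivative[OF f] open_interior x]) (simp add: v)
  then have "frechet_derivative v (at x) = bdot (cgrad f)" by (rule frechet_derivative_at[symmetric])
  then show ?thesis by (simp add: grad_def vec_eq_iff bdot_axis)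
qed

text \<open>An affine function on the whole space that agrees with \<open>v\<close> inside the
  element, so that one-sided traces become plain values.\<close>

definition piece :: "('a::euclidean_space \<Rightarrow> complex) \<Rightarrow> 'a set \<Rightarrow> 'a \<Rightarrow> complex" where
  "piece v K = (SOME f. complex_affine f \<and> (\<forall>x\<in>interior K. v x = f x))"

definition vpiece :: "('a::euclidean_space \<Rightarrow> complex^'n) \<Rightarrow> 'a set \<Rightarrow> 'a \<Rightarrow> complex^'n" where
  "vpiece \<tau> K x = (\<chi> i. piece (\<lambda>y. \<tau> y $ i) K x)"

lemma piece:
  assumes "v \<in> V\<^sub>h T" "K \<in> T"
  shows "complex_affine (piece v K)" "x \<in> interior K \<Longrightarrow> v x = piece v K x"
proof -
  obtain p q where pq: "p \<in> P1" "q \<in> P1" "\<forall>x\<in>interior K. v x = Complex (p x) (q x)"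
    using assms by (auto simp: V\<^sub>h_def)
  then have "\<exists>f. complex_affine f \<and> (\<forall>x\<in>interior K. v x = f x)"
    unfolding complex_affine_def by (intro exI[of _ "\<lambda>x. Complex (p x) (q x)"]) auto
  then have *: "complex_affine (piece v K) \<and> (\<forall>x\<in>interior K. v x = piece v K x)"
    unfolding piece_def by (rule someI_ex)
  then show "complex_affine (piece v K)" "x \<in> interior K \<Longrightarrow> v x = piece v K x" by auto
qed

lemma vpiece:
  assumes "\<tau> \<in> \<Sigma>\<^sub>h T" "K \<in> T"
  shows "complex_affine (\<lambda>x. vpiece \<tau> K x $ i)" "x \<in> interior K \<Longrightarrow> \<tau> x = vpiece \<tau> K x"
  using piece[of "\<lambda>y. \<tau> y $ i" T K for i] assms
  by (auto simp: vpiece_def \<Sigma>\<^sub>h_def vec_eq_iff)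

lemma continuous_vec: "continuous_on S s" if "\<And>i. continuous_on S (\<lambda>x. s x $ i)"
  using that continuous_on_vec_lambda[of S "\<lambda>i x. s x $ i"] by simp

text \<open>Completeness makes arbitrary values on a null set harmless; members of the discrete
  spaces are unrestricted on the mesh skeleton.\<close>

lemma lebesgue_measurable_spike:
  fixes f g :: "'a::euclidean_space \<Rightarrow> 'b::real_normed_vector"
  assumes g: "g \<in> borel_measurable lebesgue" and N: "negligible N" and eq: "\<And>x. x \<notin> N \<Longrightarrow> f x = g x"
  shows "f \<in> borel_measurable lebesgue"
proof (rule measurableI)
  fix A :: "'b set" assume A: "A \<in> sets borel"
  have f: "f -` A = (g -` A - (N \<inter> g -` A)) \<union> (N \<inter> f -` A)" using eq by auto
  have gA: "g -` A \<in> sets lebesgue" using measurable_sets[OF g A] by simp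
  have n: "negligible (N \<inter> g -` A)" "negligible (N \<inter> f -` A)"
    using N negligible_subset by blast+
  have "f -` A \<in> sets lebesgue"
    by (subst f) (rule sets.Un[OF sets.Diff[OF gA negligible_imp_sets[OF n(1)]] negligible_imp_sets[OF n(2)]])
  then show "f -` A \<inter> space lebesgue \<in> sets lebesgue" by simp
qed simp

section \<open>Splitting integrals over the domain into elements\<close>

context mesh
begin

lemma K_subset_closure: "K \<in> T \<Longrightarrow> K \<subseteq> closure \<Omega>"
  using Union_T by blast

text \<open>Frontiers of the convex elements are negligible. Off them every point of the domain lies
  in exactly one element, and in its interior.\<close>

lemma integral_pieces:
  fixes F :: "'a \<Rightarrow> 'b::{banach,second_countable_topology}"
  assumes F: "\<And>K x. K \<in> T \<Longrightarrow> x \<in> interior K \<Longrightarrow> F x = G K x"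
    and G: "\<And>K. K \<in> T \<Longrightarrow> integrable (lebesgue_on K) (G K)"
  shows "integrable (lebesgue_on \<Omega>) F"
    and "(LINT x|lebesgue_on \<Omega>. F x) = (\<Sum>K\<in>T. LINT x|lebesgue_on K. G K x)"
proof -
  let ?N = "\<Union>K\<in>T. frontier K"
  have N: "negligible ?N"
    using finite_T K_convex by (intro negligible_Union) (auto intro: negligible_convex_frontier)
  have K_sets: "K \<in> sets lebesgue" if "K \<in> T" for K
    using K_compact[OF that] by (intro lmeasurable_compact fmeasurableD)
  have \<Omega>_sets: "\<Omega> \<in> sets lebesgue" using open_\<Omega> by simp
  let ?H = "\<lambda>x. \<Sum>K\<in>T. indicator K x *\<^sub>R G K x"
  have Gi: "integrable lebesgue (\<lambda>x. indicator K x *\<^sub>R G K x)" if "K \<in> T" for K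
    using G[OF that] integrable_restrict_space[of K lebesgue "G K"] K_sets[OF that] by simp
  then have Hi: "integrable lebesgue ?H" by (rule Bochner_Integration.integrable_sum)
  have eq: "indicator \<Omega> x *\<^sub>R F x = ?H x" if x: "x \<notin> ?N" for x
  proof -
    have int: "x \<in> interior K" if "K \<in> T" "x \<in> K" for K
    proof -
      have "x \<notin> frontier K" using x that(1) by blast
      then show ?thesis using that(2) closure_subset[of K] by (auto simp: frontier_def)
    qed
    show ?thesis
    proof (cases "x \<in> \<Omega>")
      case True
      then obtain K where K: "K \<in> T" "x \<in> K" using Union_T closure_subset[of \<Omega>] by blast
      then have xi: "x \<in> interior K" using int by blast
      have "x \<notin> K'" if "K' \<in> T" "K' \<noteq> K" for K' using interior_disjoint[of K K'] K(1) that xi by blast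
      then have "?H x = (\<Sum>K'\<in>T. if K' = K then G K x else 0)"
        using K by (intro sum.cong) auto
      then show ?thesis using finite_T K F[OF K(1) xi] True by simp
    next
      case False
      then have "x \<notin> K" if "K \<in> T" for K using int[OF that] interior_subset_\<Omega>[OF that] by blast
      then show ?thesis using False by simp
    qed
  qed
  have m: "(\<lambda>x. indicator \<Omega> x *\<^sub>R F x) \<in> borel_measurable lebesgue"
    by (rule lebesgue_measurable_spike[OF borel_measurable_integrable[OF Hi] N eq])
  have ae: "AE x in lebesgue. indicator \<Omega> x *\<^sub>R F x = ?H x"
    by (rule AE_I'[of ?N]) (use N eq in \<open>auto simp: negligible_iff_null_sets\<close>)
  have \<Omega>i: "integrable lebesgue (\<lambda>x. indicator \<Omega> x *\<^sub>R F x)"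
    using integrable_cong_AE[OF m borel_measurable_integrable[OF Hi] ae] Hi by simp
  then show "integrable (lebesgue_on \<Omega>) F"
    using integrable_restrict_space[of \<Omega> lebesgue F] \<Omega>_sets by simp
  have "(LINT x|lebesgue_on \<Omega>. F x) = (LINT x|lebesgue. indicator \<Omega> x *\<^sub>R F x)"
    by (rule integral_restrict_space) (simp add: \<Omega>_sets)
  also have "\<dots> = (LINT x|lebesgue. ?H x)"
    by (rule integral_cong_AE[OF m borel_measurable_integrable[OF Hi] ae])
  also have "\<dots> = (\<Sum>K\<in>T. LINT x|lebesgue. indicator K x *\<^sub>R G K x)"
    by (rule Bochner_Integration.integral_sum[OF Gi])
  also have "\<dots> = (\<Sum>K\<in>T. LINT x|lebesgue_on K. G K x)"
    by (intro sum.cong refl integral_restrict_space[symmetric]) (simp add: K_sets)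
  finally show "(LINT x|lebesgue_on \<Omega>. F x) = (\<Sum>K\<in>T. LINT x|lebesgue_on K. G K x)" .
qed

lemma trace_eq:
  assumes "K \<in> T" "\<And>y. y \<in> interior K \<Longrightarrow> v y = f y" "continuous_on UNIV f" "x \<in> K"
  shows "trace_from K v x = (f x :: 'b::t2_space)"
  using full_simplex.trace_from_affine[OF full_simplex_K[OF assms(1)], of v f x] assms hull_verts[OF assms(1)] by simp

lemma compact_measures:
  assumes "K \<in> T"
  shows "compact_measure (lebesgue_on K)" "e facet_of K \<Longrightarrow> compact_measure (face_measure e)"
proof -
  interpret full_simplex "verts K" using full_simplex_K[OF assms] .
  show "compact_measure (lebesgue_on K)" using compact_measure_K hull_verts[OF assms] by simp
  assume "e facet_of K"
  then obtain p where "p \<in> verts K" "e = convex hull (verts K - {p})"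
    unfolding facet_iff[OF assms] by blast
  then show "compact_measure (face_measure e)" using compact_measure_facet by simp
qed

lemma facet_subset: "e facet_of K \<Longrightarrow> e \<subseteq> K"
  using facet_of_imp_subset by blast

end

lemma (in compact_measure) L2_continuous:
  fixes f :: "'a \<Rightarrow> complex"
  assumes "continuous_on UNIV f" shows "f \<in> L2 M"
proof -
  have "integrable M (\<lambda>x. (norm (f x))\<^sup>2)"
    using assms by (intro integrable_continuous_real continuous_intros)
  moreover have "f \<in> borel_measurable M"
    using assms by (intro borel_imp borel_measurable_continuous_onI)
  ultimately show ?thesis by (simp add: L2_def)
qed

section \<open>The method in terms of affine pieces\<close>

lemma cdot_of_real_right: "cdot a (\<chi> i. c * of_real (n $ i)) = bdot a n * cnj c"
  by (simp add: cdot_def bdot_def sum_distrib_left ac_simps)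

lemma bdot_of_real_left: "bdot (\<chi> i. c * of_real (n $ i)) n = c * of_real ((norm n)\<^sup>2)"
proof -
  have "of_real ((norm n)\<^sup>2) = (\<Sum>i\<in>UNIV. complex_of_real (n $ i) * of_real (n $ i))"
    unfolding power2_norm_eq_inner inner_vec_def by simp
  then show ?thesis by (simp add: bdot_def sum_distrib_left mult.assoc)
qed

lemma cdot_of_real_left: "cdot (\<chi> i. c * of_real (n $ i)) a = c * cnj (bdot a n)"
  by (simp add: cdot_def bdot_def sum_distrib_left ac_simps)

lemma bdot_scale_left: "bdot (c *s a) t = c * bdot a t"
  by (simp add: bdot_def sum_distrib_left mult.assoc)

lemma bdot_scaleR_left: "bdot (c *\<^sub>R a) t = of_real c * bdot a t"
  by (simp add: bdot_def sum_distrib_left scaleR_conv_of_real[symmetric])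

lemma continuous_cdot: "continuous_on S s \<Longrightarrow> continuous_on S t \<Longrightarrow> continuous_on S (\<lambda>x. cdot (s x) (t x))"
  unfolding cdot_def by (intro continuous_intros)

locale vmesh = mesh \<Omega> T for \<Omega> :: "(real^'n) set" and T :: "(real^'n) set set"
begin

definition represents :: "(real^'n \<Rightarrow> complex) \<Rightarrow> ((real^'n) set \<Rightarrow> real^'n \<Rightarrow> complex) \<Rightarrow> bool" where
  "represents u U \<longleftrightarrow> (\<forall>K\<in>T. complex_affine (U K) \<and> (\<forall>x\<in>interior K. u x = U K x))"

definition vrepresents :: "(real^'n \<Rightarrow> complex^'n) \<Rightarrow> ((real^'n) set \<Rightarrow> real^'n \<Rightarrow> complex^'n) \<Rightarrow> bool" where
  "vrepresents \<sigma> S \<longleftrightarrow> (\<forall>K\<in>T. (\<forall>i. complex_affine (\<lambda>x. S K x $ i)) \<and> (\<forall>x\<in>interior K. \<sigma> x = S K x))"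

definition bfaces :: "(real^'n) set \<Rightarrow> (real^'n) set set" where
  "bfaces K = {e. e facet_of K \<and> e \<subseteq> frontier \<Omega>}"

text \<open>An arbitrary but fixed order of the two elements at a face, and thereby an orientation:
  \<open>nrm\<close> points from the first side into the second.\<close>

definition sides :: "(real^'n) set \<Rightarrow> (real^'n) set \<times> (real^'n) set" where
  "sides e = (SOME P. fst P \<noteq> snd P \<and> {K \<in> T. e facet_of K} = {fst P, snd P})"

abbreviation "side1 e \<equiv> fst (sides e)"
abbreviation "side2 e \<equiv> snd (sides e)"

definition nrm :: "(real^'n) set \<Rightarrow> real^'n" where
  "nrm e = facet_normal (side1 e) e"

lemma sides:
  assumes "e \<in> interior_faces T"
  shows "side1 e \<in> T" "side2 e \<in> T" "side1 e \<noteq> side2 e" "{K \<in> T. e facet_of K} = {side1 e, side2 e}"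
    "facet_normal (side2 e) e = - nrm e" "norm (nrm e) = 1" "e facet_of side1 e" "e facet_of side2 e"
proof -
  obtain K1 K2 where "K1 \<noteq> K2" "{K \<in> T. e facet_of K} = {K1, K2}"
    using interior_face_two[OF assms] by metis
  then have "\<exists>P. fst P \<noteq> snd P \<and> {K \<in> T. e facet_of K} = {fst P, snd P}"
    by (intro exI[of _ "(K1, K2)"]) simp
  then have *: "side1 e \<noteq> side2 e \<and> {K \<in> T. e facet_of K} = {side1 e, side2 e}"
    unfolding sides_def by (rule someI_ex)
  then show 1: "side1 e \<noteq> side2 e" "{K \<in> T. e facet_of K} = {side1 e, side2 e}" by auto
  then show 2: "side1 e \<in> T" "side2 e \<in> T" "e facet_of side1 e" "e facet_of side2 e" by auto
  show "facet_normal (side2 e) e = - nrm e"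
    unfolding nrm_def by (rule shared_facet(1)[OF 2(1,2) 1(1) 2(3,4)])
  interpret A: full_simplex "verts (side1 e)" using full_simplex_K[OF 2(1)] .
  obtain p where p: "p \<in> verts (side1 e)" "e = convex hull (verts (side1 e) - {p})"
    using 2(3) unfolding facet_iff[OF 2(1)] by blast
  show "norm (nrm e) = 1"
    unfolding nrm_def using A.facet_normal_eq[OF p(1)] p(2) hull_verts[OF 2(1)] A.norm_normal[OF p(1)] by simp
qed

text \<open>Scalar jumps are parallel to the normal, so only coefficients with respect to \<open>nrm e\<close> occur.\<close>

definition jmp :: "((real^'n) set \<Rightarrow> real^'n \<Rightarrow> complex) \<Rightarrow> (real^'n) set \<Rightarrow> real^'n \<Rightarrow> complex" where
  "jmp U e x = U (side1 e) x - U (side2 e) x"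

definition avn :: "((real^'n) set \<Rightarrow> real^'n \<Rightarrow> complex^'n) \<Rightarrow> (real^'n) set \<Rightarrow> real^'n \<Rightarrow> complex" where
  "avn S e x = (bdot (S (side1 e) x) (nrm e) + bdot (S (side2 e) x) (nrm e)) / 2"

definition jmn :: "((real^'n) set \<Rightarrow> real^'n \<Rightarrow> complex^'n) \<Rightarrow> (real^'n) set \<Rightarrow> real^'n \<Rightarrow> complex" where
  "jmn S e x = bdot (S (side1 e) x) (nrm e) - bdot (S (side2 e) x) (nrm e)"

abbreviation "ipK K \<equiv> L2_inner (lebesgue_on K)"
abbreviation "ipF e \<equiv> L2_inner (face_measure e)"
abbreviation "vipK K \<equiv> L2_vinner (lebesgue_on K)"

text \<open>The terms of \<open>B\<^sub>h\<close> that contain \<open>v\<close>;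
  \<open>vector_form\<close> has those that contain \<open>\<tau>\<close>. The two test functions
  vary independently, so each form satisfies an equation of its own.\<close>

definition scalar_form where
  "scalar_form k \<beta> U S V =
     (\<Sum>K\<in>T. vipK K (S K) (\<lambda>_. cgrad (V K)))
     - complex_of_real (k\<^sup>2) * (\<Sum>K\<in>T. ipK K (U K) (V K))
     + \<i> * complex_of_real k * (\<Sum>K\<in>T. \<Sum>e\<in>bfaces K. ipF e (U K) (V K))
     - (\<Sum>e\<in>interior_faces T. ipF e (\<lambda>x. avn S e x - \<i> * complex_of_real \<beta> * jmp U e x) (jmp V e))"

definition vector_form where
  "vector_form \<delta> U S W =
     - (\<Sum>e\<in>interior_faces T. \<i> * complex_of_real \<delta> * ipF e (jmn S e) (jmn W e) - ipF e (jmp U e) (avn W e))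
     + (\<Sum>K\<in>T. vipK K (S K) (W K)) - (\<Sum>K\<in>T. vipK K (\<lambda>_. cgrad (U K)) (W K))"

lemma represents_trace:
  assumes "represents u U" "K \<in> T" "x \<in> K" shows "trace_from K u x = U K x"
  using assms by (intro trace_eq) (auto simp: represents_def complex_affine_continuous)

lemma vcontinuous: "\<forall>i. complex_affine (\<lambda>x. s x $ i) \<Longrightarrow> continuous_on S s" for s :: "real^'n \<Rightarrow> complex^'n"
  by (intro continuous_vec complex_affine_continuous) auto

lemma vrepresents_trace:
  assumes "vrepresents \<sigma> S" "K \<in> T" "x \<in> K" shows "trace_from K \<sigma> x = S K x"
  using assms by (intro trace_eq vcontinuous) (auto simp: vrepresents_def)

lemma represents_grad:
  assumes "represents u U" "K \<in> T" "x \<in> interior K" shows "grad u x = cgrad (U K)"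
  using assms by (intro grad_eq) (auto simp: represents_def)

lemma represents_grad_trace:
  assumes "represents u U" "K \<in> T" "x \<in> K" shows "trace_from K (grad u) x = cgrad (U K)"
  using trace_eq[of K "grad u" "\<lambda>_. cgrad (U K)" x] represents_grad[OF assms(1,2)] assms by simp

lemma L2_inner_pieces:
  assumes "represents u U" "represents v V"
  shows "L2_inner (lebesgue_on \<Omega>) u v = (\<Sum>K\<in>T. ipK K (U K) (V K))"
  unfolding L2_inner_def
proof (rule integral_pieces(2))
  show "integrable (lebesgue_on K) (\<lambda>x. U K x * cnj (V K x))" if "K \<in> T" for K
    using that assms
    by (intro compact_measure.integrable_continuous[OF compact_measures(1)[OF that]] continuous_intros
        complex_affine_continuous) (auto simp: represents_def)
qed (use assms in \<open>auto simp: represents_def\<close>)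

lemma L2_vinner_pieces:
  assumes F: "\<And>K x. K \<in> T \<Longrightarrow> x \<in> interior K \<Longrightarrow> \<sigma> x = S K x \<and> \<tau> x = W K x"
    and c: "\<And>K. K \<in> T \<Longrightarrow> continuous_on UNIV (S K) \<and> continuous_on UNIV (W K)"
  shows "L2_vinner (lebesgue_on \<Omega>) \<sigma> \<tau> = (\<Sum>K\<in>T. vipK K (S K) (W K))"
  unfolding L2_vinner_def
proof (rule integral_pieces(2))
  show "integrable (lebesgue_on K) (\<lambda>x. cdot (S K x) (W K x))" if "K \<in> T" for K
    using c[OF that]
    by (intro compact_measure.integrable_continuous[OF compact_measures(1)[OF that]] continuous_cdot) auto
qed (use F in auto)

lemma boundary_integral_pieces:
  assumes "\<And>K e x. K \<in> T \<Longrightarrow> e facet_of K \<Longrightarrow> x \<in> e \<Longrightarrow> F K x = G K x"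
  shows "boundary_integral \<Omega> T F = (\<Sum>K\<in>T. \<Sum>e\<in>bfaces K. LINT x|face_measure e. G K x)"
  unfolding boundary_integral_def bfaces_def
  by (intro sum.cong refl Bochner_Integration.integral_cong) (auto simp: space_face_measure assms)

lemma sum_sides:
  assumes "e \<in> interior_faces T"
  shows "(\<Sum>K | K \<in> T \<and> e facet_of K. f K) = f (side1 e) + f (side2 e)"
proof -
  have "(\<Sum>K | K \<in> T \<and> e facet_of K. f K) = sum f {side1 e, side2 e}"
    using sides(4)[OF assms] by simp
  then show ?thesis using sides(3)[OF assms] by simp
qed

lemma face_subsets:
  assumes "e \<in> interior_faces T" "x \<in> e" shows "x \<in> side1 e" "x \<in> side2 e"
  using sides[OF assms(1)] assms(2) facet_subset by blast+

lemma jump_eq: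
  assumes "represents u U" "e \<in> interior_faces T" "x \<in> e"
  shows "jump T e u x = (\<chi> i. jmp U e x * of_real (nrm e $ i))"
  using represents_trace[OF assms(1) sides(1)[OF assms(2)] face_subsets(1)[OF assms(2,3)]]
    represents_trace[OF assms(1) sides(2)[OF assms(2)] face_subsets(2)[OF assms(2,3)]]
  unfolding jump_def sum_sides[OF assms(2)] sides(5)[OF assms(2)] nrm_def[symmetric]
  by (simp add: vec_eq_iff jmp_def left_diff_distrib)

lemma vjump_eq:
  assumes "vrepresents \<sigma> S" "e \<in> interior_faces T" "x \<in> e"
  shows "vjump T e \<sigma> x = jmn S e x"
  using vrepresents_trace[OF assms(1) sides(1)[OF assms(2)] face_subsets(1)[OF assms(2,3)]]
    vrepresents_trace[OF assms(1) sides(2)[OF assms(2)] face_subsets(2)[OF assms(2,3)]]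
  unfolding vjump_def sum_sides[OF assms(2)] sides(5)[OF assms(2)] nrm_def[symmetric]
  by (simp add: jmn_def bdot_def sum_negf)

lemma average_eq:
  assumes "vrepresents \<sigma> S" "e \<in> interior_faces T" "x \<in> e"
  shows "average T e \<sigma> x = (1/2) *\<^sub>R (S (side1 e) x + S (side2 e) x)"
  using vrepresents_trace[OF assms(1) sides(1)[OF assms(2)] face_subsets(1)[OF assms(2,3)]]
    vrepresents_trace[OF assms(1) sides(2)[OF assms(2)] face_subsets(2)[OF assms(2,3)]]
  unfolding average_def sum_sides[OF assms(2)] by simp

lemma B\<^sub>h_eq:
  assumes u: "represents u U" and \<sigma>: "vrepresents \<sigma> S" and v: "represents v V" and \<tau>: "vrepresents \<tau> W"
  shows "B\<^sub>h \<Omega> T k \<beta> \<delta> u \<sigma> v \<tau> = scalar_form k \<beta> U S V + vector_form \<delta> U S W"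
proof -
  have S: "continuous_on UNIV (S K)" and W: "continuous_on UNIV (W K)" if "K \<in> T" for K
    using \<sigma> \<tau> that by (auto simp: vrepresents_def intro: vcontinuous)
  have 1: "L2_vinner (lebesgue_on \<Omega>) \<sigma> (grad v) = (\<Sum>K\<in>T. vipK K (S K) (\<lambda>_. cgrad (V K)))"
    using \<sigma> represents_grad[OF v] S by (intro L2_vinner_pieces) (auto simp: vrepresents_def)
  have 2: "L2_inner (lebesgue_on \<Omega>) u v = (\<Sum>K\<in>T. ipK K (U K) (V K))"
    by (rule L2_inner_pieces[OF u v])
  have 3: "boundary_integral \<Omega> T (\<lambda>K x. trace_from K u x * cnj (trace_from K v x))
      = (\<Sum>K\<in>T. \<Sum>e\<in>bfaces K. ipF e (U K) (V K))"
    unfolding L2_inner_def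
    by (rule boundary_integral_pieces) (use represents_trace[OF u] represents_trace[OF v] facet_subset in \<open>metis subsetD\<close>)
  have 4: "L2_vinner (face_measure e)
            (\<lambda>x. average T e \<sigma> x - (\<i> * complex_of_real \<beta>) *s jump T e u x) (jump T e v)
      = ipF e (\<lambda>x. avn S e x - \<i> * complex_of_real \<beta> * jmp U e x) (jmp V e)" if e: "e \<in> interior_faces T" for e
    unfolding L2_vinner_def L2_inner_def
  proof (rule Bochner_Integration.integral_cong[OF refl])
    fix x assume "x \<in> space (face_measure e)"
    then have x: "x \<in> e" by (simp add: space_face_measure)
    show "cdot (average T e \<sigma> x - (\<i> * complex_of_real \<beta>) *s jump T e u x) (jump T e v x) =
       (avn S e x - \<i> * complex_of_real \<beta> * jmp U e x) * cnj (jmp V e x)"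
      unfolding jump_eq[OF v e x] cdot_of_real_right jump_eq[OF u e x] average_eq[OF \<sigma> e x]
        bdot_diff_left bdot_scale_left bdot_of_real_left sides(6)[OF e]
      by (simp add: avn_def bdot_scaleR_left bdot_add_left)
  qed
  have 5: "L2_inner (face_measure e) (vjump T e \<sigma>) (vjump T e \<tau>) = ipF e (jmn S e) (jmn W e)"
    if e: "e \<in> interior_faces T" for e
    unfolding L2_inner_def
    by (intro Bochner_Integration.integral_cong refl)
      (simp add: space_face_measure vjump_eq[OF \<sigma> e] vjump_eq[OF \<tau> e])
  have 6: "L2_vinner (face_measure e) (jump T e u) (average T e \<tau>) = ipF e (jmp U e) (avn W e)"
    if e: "e \<in> interior_faces T" for e
    unfolding L2_vinner_def L2_inner_def
  proof (rule Bochner_Integration.integral_cong[OF refl])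
    fix x assume "x \<in> space (face_measure e)"
    then have x: "x \<in> e" by (simp add: space_face_measure)
    show "cdot (jump T e u x) (average T e \<tau> x) = jmp U e x * cnj (avn W e x)"
      unfolding jump_eq[OF u e x] average_eq[OF \<tau> e x] cdot_of_real_left
      by (simp add: avn_def bdot_scaleR_left bdot_add_left)
  qed
  have 7: "L2_vinner (lebesgue_on \<Omega>) \<sigma> \<tau> = (\<Sum>K\<in>T. vipK K (S K) (W K))"
    using \<sigma> \<tau> S W by (intro L2_vinner_pieces) (auto simp: vrepresents_def)
  have 8: "L2_vinner (lebesgue_on \<Omega>) (grad u) \<tau> = (\<Sum>K\<in>T. vipK K (\<lambda>_. cgrad (U K)) (W K))"
    using \<tau> W represents_grad[OF u] by (intro L2_vinner_pieces) (auto simp: vrepresents_def)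
  have s4: "(\<Sum>e\<in>interior_faces T. L2_vinner (face_measure e)
            (\<lambda>x. average T e \<sigma> x - (\<i> * complex_of_real \<beta>) *s jump T e u x) (jump T e v)) =
     (\<Sum>e\<in>interior_faces T. ipF e (\<lambda>x. avn S e x - \<i> * complex_of_real \<beta> * jmp U e x) (jmp V e))"
    by (intro sum.cong refl 4)
  have s5: "(\<Sum>e\<in>interior_faces T. \<i> * complex_of_real \<delta> * L2_inner (face_measure e) (vjump T e \<sigma>) (vjump T e \<tau>)
       - L2_vinner (face_measure e) (jump T e u) (average T e \<tau>)) =
     (\<Sum>e\<in>interior_faces T. \<i> * complex_of_real \<delta> * ipF e (jmn S e) (jmn W e) - ipF e (jmp U e) (avn W e))"
    by (intro sum.cong refl) (simp add: 5 6)
  show ?thesis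
    unfolding B\<^sub>h_def 1 2 3 s4 s5 7 8 scalar_form_def vector_form_def by simp
qed

definition affine_family :: "((real^'n) set \<Rightarrow> real^'n \<Rightarrow> complex) \<Rightarrow> bool" where
  "affine_family V \<longleftrightarrow> (\<forall>K\<in>T. complex_affine (V K))"

definition affine_vfamily :: "((real^'n) set \<Rightarrow> real^'n \<Rightarrow> complex^'n) \<Rightarrow> bool" where
  "affine_vfamily S \<longleftrightarrow> (\<forall>K\<in>T. \<forall>i. complex_affine (\<lambda>x. S K x $ i))"

text \<open>Interiors of distinct elements are disjoint, so the choice is forced inside each
  element. On the skeleton the value is arbitrary, as it may be for members of the discrete
  spaces.\<close>

definition glue :: "((real^'n) set \<Rightarrow> real^'n \<Rightarrow> 'c) \<Rightarrow> real^'n \<Rightarrow> 'c" where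
  "glue V x = V (SOME K. K \<in> T \<and> x \<in> interior K) x"

lemma glue_eq: assumes "K \<in> T" "x \<in> interior K" shows "glue V x = V K x"
proof -
  have "(SOME K. K \<in> T \<and> x \<in> interior K) \<in> T \<and> x \<in> interior (SOME K. K \<in> T \<and> x \<in> interior K)"
    using assms by (intro someI_ex[of "\<lambda>K. K \<in> T \<and> x \<in> interior K"]) blast
  then have "(SOME K. K \<in> T \<and> x \<in> interior K) = K"
    using interior_disjoint[of K] assms interior_subset by blast
  then show ?thesis by (simp add: glue_def)
qed

lemma represents_glue: "affine_family V \<Longrightarrow> represents (glue V) V"
  by (simp add: represents_def affine_family_def glue_eq)

lemma vrepresents_glue: "affine_vfamily S \<Longrightarrow> vrepresents (glue S) S"
  by (simp add: vrepresents_def affine_vfamily_def glue_eq)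

lemma represents_imp_V\<^sub>h: assumes "represents v V" shows "v \<in> V\<^sub>h T"
  unfolding V\<^sub>h_def
proof (intro CollectI ballI)
  fix K assume "K \<in> T"
  then have "complex_affine (V K)" and eq: "\<forall>x\<in>interior K. v x = V K x"
    using assms by (auto simp: represents_def)
  then obtain p q where "p \<in> P1" "q \<in> P1" "V K = (\<lambda>x. Complex (p x) (q x))"
    by (auto simp: complex_affine_def)
  then show "\<exists>p\<in>P1. \<exists>q\<in>P1. \<forall>x\<in>interior K. v x = Complex (p x) (q x)" using eq by metis
qed

lemma vrepresents_imp_\<Sigma>\<^sub>h: assumes "vrepresents \<tau> W" shows "\<tau> \<in> \<Sigma>\<^sub>h T"
  unfolding \<Sigma>\<^sub>h_def
proof (intro CollectI allI)
  fix i
  have "represents (\<lambda>x. \<tau> x $ i) (\<lambda>K x. W K x $ i)"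
    using assms by (simp add: represents_def vrepresents_def)
  then show "(\<lambda>x. \<tau> x $ i) \<in> V\<^sub>h T" by (rule represents_imp_V\<^sub>h)
qed

lemma represents_piece: "u \<in> V\<^sub>h T \<Longrightarrow> represents u (piece u)"
  using piece by (auto simp: represents_def)

lemma vrepresents_vpiece: "\<sigma> \<in> \<Sigma>\<^sub>h T \<Longrightarrow> vrepresents \<sigma> (vpiece \<sigma>)"
  using vpiece by (auto simp: vrepresents_def)

abbreviation "sqK K f \<equiv> (LINT x|lebesgue_on K. (norm (f x))\<^sup>2)"
abbreviation "sqF e f \<equiv> (LINT x|face_measure e. (norm (f x))\<^sup>2)"

definition volume_square :: "((real^'n) set \<Rightarrow> real^'n \<Rightarrow> 'c::{banach,second_countable_topology}) \<Rightarrow> real" where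
  "volume_square V = (\<Sum>K\<in>T. sqK K (V K))"

definition boundary_square :: "((real^'n) set \<Rightarrow> real^'n \<Rightarrow> 'c::{banach,second_countable_topology}) \<Rightarrow> real" where
  "boundary_square V = (\<Sum>K\<in>T. \<Sum>e\<in>bfaces K. sqF e (V K))"

lemma volume_square_nonneg: "0 \<le> volume_square V"
  by (simp add: volume_square_def sum_nonneg integral_nonneg_AE)

lemma boundary_square_nonneg: "0 \<le> boundary_square V"
  by (simp add: boundary_square_def sum_nonneg integral_nonneg_AE)

lemma L2_norm_pieces:
  fixes u :: "real^'n \<Rightarrow> 'c::{banach,second_countable_topology}"
  assumes "\<And>K x. K \<in> T \<Longrightarrow> x \<in> interior K \<Longrightarrow> u x = U K x"
    and "\<And>K. K \<in> T \<Longrightarrow> continuous_on UNIV (U K)"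
  shows "integrable (lebesgue_on \<Omega>) (\<lambda>x. (norm (u x))\<^sup>2)"
    and "(L2_norm (lebesgue_on \<Omega>) u)\<^sup>2 = volume_square U"
  unfolding L2_norm_square volume_square_def
  using assms
  by (intro integral_pieces[where G = "\<lambda>K x. (norm (U K x))\<^sup>2"]
      compact_measure.integrable_continuous_real[OF compact_measures(1)] continuous_intros; simp)+

lemma glue_in_L2: assumes "affine_family V" shows "glue V \<in> L2 (lebesgue_on \<Omega>)"
proof -
  have c: "continuous_on UNIV (V K)" if "K \<in> T" for K
    using assms that by (auto simp: affine_family_def intro: complex_affine_continuous)
  have "integrable (lebesgue_on \<Omega>) (glue V)"
    using c by (intro integral_pieces(1)[where G = V] glue_eq
      compact_measure.integrable_continuous[OF compact_measures(1)])
  moreover have "integrable (lebesgue_on \<Omega>) (\<lambda>x. (norm (glue V x))\<^sup>2)"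
    using c by (intro L2_norm_pieces(1)[where U = V] glue_eq)
  ultimately show ?thesis by (auto simp: L2_def)
qed

lemma finite_bfaces: "K \<in> T \<Longrightarrow> finite (bfaces K)"
  using finite_facets[of K] by (rule rev_finite_subset) (auto simp: bfaces_def)

lemma double_sum_L2_le:
  assumes T: "finite A" "\<And>K. K \<in> A \<Longrightarrow> finite (B K)"
    and nn: "\<And>K e. K \<in> A \<Longrightarrow> e \<in> B K \<Longrightarrow> 0 \<le> a K e \<and> 0 \<le> b K e"
  shows "(\<Sum>K\<in>A. \<Sum>e\<in>B K. a K e * b K e) \<le>
     sqrt (\<Sum>K\<in>A. \<Sum>e\<in>B K. (a K e)\<^sup>2) * sqrt (\<Sum>K\<in>A. \<Sum>e\<in>B K. (b K e)\<^sup>2)"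
proof -
  have "(\<Sum>(K, e)\<in>Sigma A B. \<bar>a K e\<bar> * \<bar>b K e\<bar>) \<le>
      L2_set (\<lambda>(K, e). a K e) (Sigma A B) * L2_set (\<lambda>(K, e). b K e) (Sigma A B)"
    using L2_set_mult_ineq[of "\<lambda>(K, e). a K e" "\<lambda>(K, e). b K e" "Sigma A B"]
    by (simp add: case_prod_unfold)
  moreover have "(\<Sum>(K, e)\<in>Sigma A B. \<bar>a K e\<bar> * \<bar>b K e\<bar>) = (\<Sum>K\<in>A. \<Sum>e\<in>B K. a K e * b K e)"
    using T nn by (subst sum.Sigma[symmetric]) (auto intro!: sum.cong)
  ultimately show ?thesis
    using T by (simp add: L2_set_def case_prod_unfold sum.Sigma)
qed

text \<open>The right-hand side enters the estimate through the bound on \<open>\<l>\<close> only.\<close>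

lemma discrete_equations:
  assumes f: "f \<in> L2 (lebesgue_on \<Omega>)" and g: "g \<in> L2_boundary \<Omega> T"
    and u: "represents u U" and \<sigma>: "vrepresents \<sigma> S"
    and sol: "\<forall>v\<in>V\<^sub>h T. \<forall>\<tau>\<in>\<Sigma>\<^sub>h T. B\<^sub>h \<Omega> T k \<beta> \<delta> u \<sigma> v \<tau> = LDG_rhs \<Omega> T f g v"
  obtains l :: "((real^'n) set \<Rightarrow> real^'n \<Rightarrow> complex) \<Rightarrow> complex"
  where "\<And>V. affine_family V \<Longrightarrow> scalar_form k \<beta> U S V = l V"
    and "\<And>W. affine_vfamily W \<Longrightarrow> vector_form \<delta> U S W = 0"
    and "\<And>V. affine_family V \<Longrightarrow> norm (l V) \<le> L2_norm (lebesgue_on \<Omega>) f * sqrt (volume_square V)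
       + L2_boundary_norm \<Omega> T g * sqrt (boundary_square V)"
proof -
  let ?l = "\<lambda>V. LDG_rhs \<Omega> T f g (glue V)"
  have eq: "scalar_form k \<beta> U S V + vector_form \<delta> U S W = ?l V" if V: "affine_family V" and W: "affine_vfamily W" for V W
    using B\<^sub>h_eq[OF u \<sigma> represents_glue[OF V] vrepresents_glue[OF W]] sol
      represents_imp_V\<^sub>h[OF represents_glue[OF V]] vrepresents_imp_\<Sigma>\<^sub>h[OF vrepresents_glue[OF W]] by metis
  have Z: "affine_family (\<lambda>K x. 0)" "affine_vfamily (\<lambda>K x. 0)"
    by (auto simp: affine_family_def affine_vfamily_def complex_affine_const)
  have v0: "vector_form \<delta> U S (\<lambda>K x. 0) = 0"
    by (simp add: vector_form_def L2_vinner_def L2_inner_def cdot_def jmn_def avn_def bdot_def)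
  show thesis
  proof (rule that[of ?l])
    show *: "scalar_form k \<beta> U S V = ?l V" if "affine_family V" for V using eq[OF that Z(2)] v0 by simp
    \<comment> \<open>At \<open>V = 0\<close> the scalar equation cancels the right-hand side and
      leaves the vector form alone.\<close>
    show "vector_form \<delta> U S W = 0" if "affine_vfamily W" for W
      using eq[OF Z(1) that] *[OF Z(1)] by simp
    fix V assume V: "affine_family V"
    have c: "continuous_on UNIV (V K)" if "K \<in> T" for K
      using V that by (auto simp: affine_family_def intro: complex_affine_continuous)
    have vol: "L2_norm (lebesgue_on \<Omega>) (glue V) = sqrt (volume_square V)"
      using L2_norm_pieces(2)[of "glue V" V] c glue_eq L2_norm_nonneg
      by (metis real_sqrt_unique)
    have 1: "norm (L2_inner (lebesgue_on \<Omega>) f (glue V)) \<le> L2_norm (lebesgue_on \<Omega>) f * sqrt (volume_square V)"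
      using L2_inner_le[OF f glue_in_L2[OF V]] by (simp only: vol)
    have "boundary_integral \<Omega> T (\<lambda>K x. g x * cnj (trace_from K (glue V) x))
       = (\<Sum>K\<in>T. \<Sum>e\<in>bfaces K. ipF e g (V K))"
      unfolding L2_inner_def
      by (rule boundary_integral_pieces) (use represents_trace[OF represents_glue[OF V]] facet_subset in \<open>metis subsetD\<close>)
    also have "norm \<dots> \<le> (\<Sum>K\<in>T. \<Sum>e\<in>bfaces K. L2_norm (face_measure e) g * L2_norm (face_measure e) (V K))"
    proof (intro order_trans[OF norm_sum] sum_mono order_trans[OF norm_sum])
      fix K e assume K: "K \<in> T" "e \<in> bfaces K"
      then have e: "e facet_of K" "e \<subseteq> frontier \<Omega>" by (auto simp: bfaces_def)
      show "norm (ipF e g (V K)) \<le> L2_norm (face_measure e) g * L2_norm (face_measure e) (V K)"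
        using g K(1) e c[OF K(1)] compact_measure.L2_continuous[OF compact_measures(2)[OF K(1) e(1)]]
        by (intro L2_inner_le) (auto simp: L2_boundary_def)
    qed
    also have "\<dots> \<le> sqrt (\<Sum>K\<in>T. \<Sum>e\<in>bfaces K. (L2_norm (face_measure e) g)\<^sup>2) *
        sqrt (\<Sum>K\<in>T. \<Sum>e\<in>bfaces K. (L2_norm (face_measure e) (V K))\<^sup>2)"
      by (intro double_sum_L2_le finite_T finite_bfaces) (auto simp: L2_norm_nonneg)
    also have "sqrt (\<Sum>K\<in>T. \<Sum>e\<in>bfaces K. (L2_norm (face_measure e) g)\<^sup>2) = L2_boundary_norm \<Omega> T g"
      unfolding L2_boundary_norm_def L2_norm_square
      by (subst boundary_integral_pieces[where G = "\<lambda>K x. (norm (g x))\<^sup>2"]) auto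
    finally have 2: "norm (boundary_integral \<Omega> T (\<lambda>K x. g x * cnj (trace_from K (glue V) x)))
       \<le> L2_boundary_norm \<Omega> T g * sqrt (boundary_square V)"
      by (simp add: L2_norm_square boundary_square_def)
    show "norm (?l V) \<le> L2_norm (lebesgue_on \<Omega>) f * sqrt (volume_square V)
       + L2_boundary_norm \<Omega> T g * sqrt (boundary_square V)"
      unfolding LDG_rhs_def using norm_triangle_ineq 1 2 by (meson add_mono order_trans)
  qed
qed

lemma DG_norm_eq:
  assumes u: "represents u U" and \<sigma>: "vrepresents \<sigma> S"
  shows "DG_norm \<Omega> c T k u \<sigma> = sqrt (k\<^sup>2 * volume_square U + k\<^sup>2 * boundary_square U
      + volume_square S + c * boundary_square (\<lambda>K _. cgrad (U K)))"
proof -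
  have 1: "(L2_norm (lebesgue_on \<Omega>) u)\<^sup>2 = volume_square U"
    using u by (intro L2_norm_pieces) (auto simp: represents_def complex_affine_continuous)
  have 2: "(L2_norm (lebesgue_on \<Omega>) \<sigma>)\<^sup>2 = volume_square S"
    using \<sigma> by (intro L2_norm_pieces) (auto simp: vrepresents_def intro: vcontinuous)
  have 3: "boundary_integral \<Omega> T (\<lambda>K x. (norm (trace_from K u x))\<^sup>2) = boundary_square U"
    unfolding boundary_square_def
    by (rule boundary_integral_pieces) (use represents_trace[OF u] facet_subset in \<open>metis subsetD\<close>)
  have 4: "boundary_integral \<Omega> T (\<lambda>K x. (norm (trace_from K (grad u) x))\<^sup>2) = boundary_square (\<lambda>K _. cgrad (U K))"
    unfolding boundary_square_def
    by (rule boundary_integral_pieces) (use represents_grad_trace[OF u] facet_subset in \<open>metis subsetD\<close>)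
  show ?thesis unfolding DG_norm_def 1 2 3 4 ..
qed

end

section \<open>Complex pairings, facet weights and element estimates in mesh form\<close>

lemma norm_bdot_le: "norm (bdot b t) \<le> norm b * norm t"
proof -
  have "norm (bdot b t) \<le> (\<Sum>i\<in>UNIV. \<bar>norm (b $ i)\<bar> * \<bar>norm (t $ i)\<bar>)"
    unfolding bdot_def by (rule order_trans[OF norm_sum]) (simp add: norm_mult)
  also have "\<dots> \<le> L2_set (\<lambda>i. norm (b $ i)) UNIV * L2_set (\<lambda>i. norm (t $ i)) UNIV"
    by (rule L2_set_mult_ineq)
  finally show ?thesis by (simp add: norm_vec_def)
qed

lemma cdot_self: "cdot a a = of_real ((norm a)\<^sup>2)"
proof -
  have "(norm a)\<^sup>2 = (\<Sum>i\<in>UNIV. (norm (a $ i))\<^sup>2)"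
    by (simp add: norm_vec_def L2_set_def sum_nonneg)
  then show ?thesis by (simp add: cdot_def complex_norm_square del: of_real_power)
qed

lemma cdot_commute: "cdot b a = cnj (cdot a b)"
  by (simp add: cdot_def mult.commute)

lemma cdot_add_left: "cdot (a + b) c = cdot a c + cdot b c"
  and cdot_diff_left: "cdot (a - b) c = cdot a c - cdot b c"
  and cdot_add_right: "cdot c (a + b) = cdot c a + cdot c b"
  and cdot_diff_right: "cdot c (a - b) = cdot c a - cdot c b"
  by (simp_all add: cdot_def algebra_simps sum.distrib sum_subtractf)

lemma norm_cdot_le: "norm (cdot a b) \<le> norm a * norm b"
proof -
  have "norm (cdot a b) \<le> (\<Sum>i\<in>UNIV. \<bar>norm (a $ i)\<bar> * \<bar>norm (b $ i)\<bar>)"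
    unfolding cdot_def by (rule order_trans[OF norm_sum]) (simp add: norm_mult)
  also have "\<dots> \<le> L2_set (\<lambda>i. norm (a $ i)) UNIV * L2_set (\<lambda>i. norm (b $ i)) UNIV"
    by (rule L2_set_mult_ineq)
  finally show ?thesis by (simp add: norm_vec_def)
qed

context vmesh
begin

text \<open>The signed distance of the hyperplane of \<open>e\<close> from \<open>x0\<close> along
  the outward normal; by \<open>off_eq\<close> every point of \<open>e\<close> gives the same value.
  It is the facet weight of the Rellich identity, and star-shapedness bounds it from below on the
  boundary.\<close>

definition off :: "real^'n \<Rightarrow> (real^'n) set \<Rightarrow> (real^'n) set \<Rightarrow> real" where
  "off x0 K e = facet_normal K e \<bullet> ((SOME y. y \<in> e) - x0)"

definition farea :: "(real^'n) set \<Rightarrow> real" where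
  "farea e = measure (face_measure e) e"

lemma farea_nonneg: "farea e \<ge> 0" by (simp add: farea_def)

lemma facetE:
  assumes K: "K \<in> T" and e: "e facet_of K"
  obtains p where "p \<in> verts K" "e = convex hull (verts K - {p})"
    "facet_normal K e = full_simplex.normal (verts K) p"
    "\<And>y x0. y \<in> e \<Longrightarrow> facet_normal K e \<bullet> (y - x0) = bary (verts K) p x0 / norm (bgrad (verts K) p)"
    "\<And>x0. off x0 K e = bary (verts K) p x0 / norm (bgrad (verts K) p)"
proof -
  interpret full_simplex "verts K" using full_simplex_K[OF K] .
  obtain p where p: "p \<in> verts K" "e = convex hull (verts K - {p})"
    using e unfolding facet_iff[OF K] by blast
  have n: "facet_normal K e = normal p"
    using facet_normal_eq[OF p(1)] hull_verts[OF K] p(2) by simp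
  have o: "facet_normal K e \<bullet> (y - x0) = bary (verts K) p x0 / norm (bgrad (verts K) p)" if "y \<in> e" for y x0
  proof -
    have "bary (verts K) p y = 0" using that mem_facet_iff[OF p(1), of y] p(2) by simp
    then show ?thesis using normal_inner[OF p(1), of y x0] by (simp add: n)
  qed
  have "e \<noteq> {}" using e by (simp add: facet_of_def)
  then have "(SOME y. y \<in> e) \<in> e" by (rule some_in_eq[THEN iffD2])
  then have "off x0 K e = bary (verts K) p x0 / norm (bgrad (verts K) p)" for x0
    unfolding off_def by (rule o)
  then show thesis using that p n o by blast
qed

lemma off_eq:
  assumes "K \<in> T" "e facet_of K" "y \<in> e" shows "facet_normal K e \<bullet> (y - x0) = off x0 K e"
proof (rule facetE[OF assms(1,2)])
  fix p
  assume "\<And>y x0. y \<in> e \<Longrightarrow> facet_normal K e \<bullet> (y - x0) = bary (verts K) p x0 / norm (bgrad (verts K) p)"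
    and "\<And>x0. off x0 K e = bary (verts K) p x0 / norm (bgrad (verts K) p)"
  then show ?thesis by (simp only: assms(3))
qed

lemma off_sides:
  assumes e: "e \<in> interior_faces T" shows "off x0 (side2 e) e = - off x0 (side1 e) e"
  by (simp add: off_def sides(5)[OF e] nrm_def)

lemma sum_facets:
  assumes K: "K \<in> T"
  shows "(\<Sum>e | e facet_of K. f e) = (\<Sum>p\<in>verts K. f (convex hull (verts K - {p})))"
proof -
  interpret full_simplex "verts K" using full_simplex_K[OF K] .
  have "{e. e facet_of K} = facet ` verts K"
    using facet_of_K unfolding hull_verts[OF K] by blast
  moreover have "inj_on facet (verts K)" using facet_inj by (auto intro!: inj_onI)
  ultimately show ?thesis by (simp add: sum.reindex)
qed

lemma rellich_mesh:
  assumes K: "K \<in> T" and f: "complex_affine f"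
  shows "(\<Sum>e | e facet_of K. off x0 K e * sqF e f) =
    real CARD('n) * sqK K f + 2 * Re (ipK K f (\<lambda>x. bdot (cgrad f) (x - x0)))"
proof -
  interpret full_simplex "verts K" using full_simplex_K[OF K] .
  have *: "off x0 K (facet p) = bary (verts K) p x0 / norm (bgrad (verts K) p)" if "p \<in> verts K" for p
  proof -
    have fe: "facet p facet_of K" using facet_of_K that unfolding hull_verts[OF K] by blast
    show ?thesis
    proof (rule facetE[OF K fe])
      fix q assume q: "q \<in> verts K" "facet p = facet q"
        and o: "\<And>x0. off x0 K (facet p) = bary (verts K) q x0 / norm (bgrad (verts K) q)"
      show ?thesis using facet_inj[OF that q] o by simp
    qed
  qed
  have "(\<Sum>e | e facet_of K. off x0 K e * sqF e f) =
     (\<Sum>p\<in>verts K. bary (verts K) p x0 / norm (bgrad (verts K) p) * sqF (facet p) f)"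
    unfolding sum_facets[OF K] by (intro sum.cong refl) (simp only: *)
  also have "\<dots> = real CARD('n) * sqK K f + 2 * Re (LINT x|lebesgue_on K. f x * cnj (f x - f x0))"
    using rellich_identity[OF f, of x0] by (simp add: hull_verts[OF K])
  finally show ?thesis unfolding L2_inner_def complex_affine_diff_bdot[OF f] .
qed

lemma sqF_const: "sqF e (\<lambda>_. b) = farea e * (norm b)\<^sup>2"
  by (simp add: farea_def space_face_measure)

lemma sqK_const: "sqK K (\<lambda>_. b) = measure lebesgue K * (norm b)\<^sup>2" if "K \<in> T"
  using K_compact[OF that] by (simp add: measure_restrict_space lmeasurable_compact fmeasurableD)

text \<open>The Rellich identity for the constant 1, whose gradient vanishes, writes the dimension
  times the volume as a sum over facets; both sides are then scaled by
  \<open>(norm b)\<^sup>2\<close>.\<close>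

lemma divergence_constant:
  assumes K: "K \<in> T"
  shows "(\<Sum>e | e facet_of K. off x0 K e * sqF e (\<lambda>_. b)) = real CARD('n) * sqK K (\<lambda>_. b)"
proof -
  have "(\<Sum>e | e facet_of K. off x0 K e * farea e) = real CARD('n) * measure lebesgue K"
  proof -
    have "ipK K (\<lambda>_. 1) (\<lambda>x. bdot (cgrad (\<lambda>_. 1)) (x - x0)) = 0"
      by (simp add: L2_inner_def cgrad_def bdot_def)
    then show ?thesis
      using rellich_mesh[OF K complex_affine_const[of 1], of x0] unfolding sqF_const sqK_const[OF K] by simp
  qed
  then show ?thesis
    unfolding sqF_const sqK_const[OF K]
    by (simp add: mult.assoc[symmetric] sum_distrib_right[symmetric])
qed

lemma trace_mesh:
  assumes K: "K \<in> T" and e: "e facet_of K" and f: "complex_affine f"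
    and g: "\<And>p. p \<in> verts K \<Longrightarrow> norm (bgrad (verts K) p) \<le> g"
  shows "sqF e f \<le> (real CARD('n) + 1) * (real CARD('n) + 2) * g * sqK K f"
proof -
  interpret full_simplex "verts K" using full_simplex_K[OF K] .
  obtain p where p: "p \<in> verts K" "e = convex hull (verts K - {p})"
    using e unfolding facet_iff[OF K] by blast
  have "sqF e f \<le> (real CARD('n) + 1) * (real CARD('n) + 2) * norm (bgrad (verts K) p) * sqK K f"
    using trace_inequality[OF p(1) f] by (simp add: p(2) hull_verts[OF K])
  also have "\<dots> \<le> (real CARD('n) + 1) * (real CARD('n) + 2) * g * sqK K f"
    using g[OF p(1)] by (intro mult_right_mono mult_left_mono) (auto simp: integral_nonneg_AE)
  finally show ?thesis .
qed

lemma tangential_mesh: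
  assumes K: "K \<in> T" and e: "e facet_of K" and f: "complex_affine f" and t: "facet_normal K e \<bullet> t = 0"
    and g: "\<And>p. p \<in> verts K \<Longrightarrow> norm (bgrad (verts K) p) \<le> g"
  shows "farea e * (norm (bdot (cgrad f) t))\<^sup>2 \<le>
     (real CARD('n))\<^sup>2 * (real CARD('n) + 1) * g\<^sup>2 * (norm t)\<^sup>2 * sqF e f"
proof -
  interpret full_simplex "verts K" using full_simplex_K[OF K] .
  obtain p where p: "p \<in> verts K" "e = convex hull (verts K - {p})"
    using e unfolding facet_iff[OF K] by blast
  have n: "facet_normal K e = normal p"
    using facet_normal_eq[OF p(1)] hull_verts[OF K] p(2) by simp
  have t0: "bgrad (verts K) p \<bullet> t = 0" using t bgrad_nonzero[OF p(1)] by (simp add: n normal_def)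
  have "(\<Sum>q\<in>verts K - {p}. (norm (bgrad (verts K) q))\<^sup>2) \<le> (\<Sum>q\<in>verts K - {p}. g\<^sup>2)"
    using g by (intro sum_mono power_mono) auto
  also have "\<dots> = real CARD('n) * g\<^sup>2" using card_facet[OF p(1)] by simp
  finally have s: "(\<Sum>q\<in>verts K - {p}. (norm (bgrad (verts K) q))\<^sup>2) \<le> real CARD('n) * g\<^sup>2" .
  have ar: "farea e = full_simplex.area (verts K) p"
    using measure_facet[OF p(1)] by (simp add: farea_def p(2))
  have "farea e * (norm (bdot (cgrad f) t))\<^sup>2 = full_simplex.area (verts K) p * (norm (f (0 + t) - f 0))\<^sup>2"
    unfolding ar complex_affine_diff_bdot[OF f] by simp
  also have "\<dots> \<le> real CARD('n) * (real CARD('n) + 1) * (\<Sum>q\<in>verts K - {p}. (norm (bgrad (verts K) q))\<^sup>2)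
      * (norm t)\<^sup>2 * sqF e f"
    using tangential_inverse_inequality[OF p(1) f t0, of 0] unfolding p(2)[symmetric] by simp
  also have "\<dots> \<le> real CARD('n) * (real CARD('n) + 1) * (real CARD('n) * g\<^sup>2) * (norm t)\<^sup>2 * sqF e f"
    using s by (intro mult_right_mono mult_left_mono) (auto simp: integral_nonneg_AE)
  finally show ?thesis by (simp add: power2_eq_square ac_simps)
qed

definition ifaces :: "(real^'n) set \<Rightarrow> (real^'n) set set" where
  "ifaces K = {e \<in> interior_faces T. e facet_of K}"

lemma finite_ifaces: "K \<in> T \<Longrightarrow> finite (ifaces K)"
  using finite_interior_faces by (simp add: ifaces_def)

lemma facets_split:
  assumes K: "K \<in> T"
  shows "(\<Sum>e | e facet_of K. f e) = (\<Sum>e\<in>bfaces K. f e) + (\<Sum>e\<in>ifaces K. f e)"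
proof -
  have "{e. e facet_of K} = bfaces K \<union> ifaces K"
    using facet_cases[OF K] by (auto simp: bfaces_def ifaces_def)
  moreover have "bfaces K \<inter> ifaces K = {}"
    using facet_cases[OF K] by (auto simp: bfaces_def ifaces_def)
  ultimately show ?thesis using finite_bfaces[OF K] finite_ifaces[OF K] by (simp add: sum.union_disjoint)
qed

lemma card_ifaces: assumes K: "K \<in> T" shows "card (ifaces K) \<le> CARD('n) + 1"
proof -
  interpret full_simplex "verts K" using full_simplex_K[OF K] .
  have "ifaces K \<subseteq> facet ` verts K" using facet_iff[OF K] by (auto simp: ifaces_def)
  then have "card (ifaces K) \<le> card (verts K)" using finite_C by (meson card_image_le card_mono finite_imageI order_trans)
  then show ?thesis using card_C by simp
qed

text \<open>Exchanging summation over faces with summation over elements is what turns face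
  estimates into volume estimates and back.\<close>

lemma sum_both_sides:
  "(\<Sum>e\<in>interior_faces T. F (side1 e) e + F (side2 e) e) = (\<Sum>K\<in>T. \<Sum>e\<in>ifaces K. F K e)"
proof -
  have "(\<Sum>e\<in>interior_faces T. F (side1 e) e + F (side2 e) e) =
      (\<Sum>e\<in>interior_faces T. \<Sum>K | K \<in> T \<and> e facet_of K. F K e)"
    by (intro sum.cong refl sum_sides[symmetric])
  also have "\<dots> = (\<Sum>e\<in>interior_faces T. \<Sum>K\<in>T. if e facet_of K then F K e else 0)"
    by (rule sum.cong[OF refl], rule sum.inter_filter[OF finite_T])
  also have "\<dots> = (\<Sum>K\<in>T. \<Sum>e\<in>interior_faces T. if e facet_of K then F K e else 0)"
    by (rule sum.swap)
  also have "\<dots> = (\<Sum>K\<in>T. \<Sum>e\<in>ifaces K. F K e)"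
    unfolding ifaces_def by (rule sum.cong[OF refl], rule sum.inter_filter[OF finite_interior_faces, symmetric])
  finally show ?thesis .
qed

text \<open>A simplex has \<open>CARD('n) + 1\<close> facets, so no element is counted more often
  than that.\<close>

lemma bounded_sides:
  fixes F :: "(real^'n) set \<Rightarrow> real"
  assumes "\<And>K. K \<in> T \<Longrightarrow> 0 \<le> F K"
  shows "(\<Sum>e\<in>interior_faces T. F (side1 e) + F (side2 e)) \<le> (real CARD('n) + 1) * (\<Sum>K\<in>T. F K)"
proof -
  have "(\<Sum>e\<in>interior_faces T. F (side1 e) + F (side2 e)) = (\<Sum>K\<in>T. \<Sum>e\<in>ifaces K. F K)"
    by (rule sum_both_sides[where F = "\<lambda>K e. F K"])
  also have "\<dots> \<le> (\<Sum>K\<in>T. (real CARD('n) + 1) * F K)"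
  proof (intro sum_mono)
    fix K assume K: "K \<in> T"
    have "real (card (ifaces K)) \<le> real CARD('n) + 1" using card_ifaces[OF K] by simp
    then show "(\<Sum>e\<in>ifaces K. F K) \<le> (real CARD('n) + 1) * F K"
      using assms[OF K] by (simp add: mult_right_mono)
  qed
  finally show ?thesis by (simp add: sum_distrib_left)
qed

end

text \<open>Without interior faces all facets of an element lie on the boundary, so
  \<open>norm2_K_le_facets\<close> bounds the interior by boundary values.\<close>

lemma (in vmesh) volume_square_le_boundary_square:
  assumes none: "interior_faces T = {}" and U: "affine_family U"
    and E: "\<And>x y. x \<in> closure \<Omega> \<Longrightarrow> y \<in> closure \<Omega> \<Longrightarrow> norm (x - y) \<le> E"
  shows "volume_square U \<le> E * boundary_square U"
  unfolding volume_square_def boundary_square_def sum_distrib_left[of E _ T]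
proof (rule sum_mono)
  fix K assume K: "K \<in> T"
  interpret full_simplex "verts K" using full_simplex_K[OF K] .
  have "verts K \<subseteq> closure \<Omega>" using hull_subset[of "verts K" convex] hull_verts[OF K] K_subset_closure[OF K] by blast
  then have "norm (p - q) \<le> E" if "p \<in> verts K" "q \<in> verts K" for p q using E that by blast
  moreover have "complex_affine (U K)" using U K by (simp add: affine_family_def)
  ultimately have "sqK K (U K) \<le> E * (\<Sum>p\<in>verts K. sqF (facet p) (U K))"
    using norm2_K_le_facets[of "U K" E] unfolding hull_verts[OF K] by blast
  also have "(\<Sum>p\<in>verts K. sqF (facet p) (U K)) = (\<Sum>e\<in>bfaces K. sqF e (U K))"
    using sum_facets[OF K, of "\<lambda>e. sqF e (U K)"] facets_split[OF K, of "\<lambda>e. sqF e (U K)"] by (simp add: ifaces_def none)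
  finally show "sqK K (U K) \<le> E * (\<Sum>e\<in>bfaces K. sqF e (U K))" .
qed

section \<open>The identities behind the stability estimate\<close>

context compact_measure
begin

lemma L2_inner_add_left:
  assumes "continuous_on UNIV f" "continuous_on UNIV g" "continuous_on UNIV h"
  shows "L2_inner M (\<lambda>x. f x + g x) h = L2_inner M f h + L2_inner M g h"
  using assms unfolding L2_inner_def distrib_right
  by (intro Bochner_Integration.integral_add integrable_continuous continuous_intros)

lemma L2_inner_scale_left: "L2_inner M (\<lambda>x. c * f x) h = c * L2_inner M f h"
  by (simp add: L2_inner_def mult.assoc)

lemma L2_vinner_add_left:
  fixes f g h :: "'a \<Rightarrow> complex^'n"
  assumes "continuous_on UNIV f" "continuous_on UNIV g" "continuous_on UNIV h"
  shows "L2_vinner M (\<lambda>x. f x + g x) h = L2_vinner M f h + L2_vinner M g h"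
  using assms unfolding L2_vinner_def cdot_add_left
  by (intro Bochner_Integration.integral_add integrable_continuous continuous_cdot)

end

lemma L2_inner_commute: "L2_inner M g f = cnj (L2_inner M f g)"
proof -
  have "cnj (L2_inner M f g) = (LINT x|M. cnj (f x * cnj (g x)))"
    unfolding L2_inner_def by (rule Bochner_Integration.integral_cnj[symmetric])
  then show ?thesis by (simp add: L2_inner_def mult.commute del: Bochner_Integration.integral_cnj)
qed

lemma L2_vinner_commute: "L2_vinner M g f = cnj (L2_vinner M f g)"
proof -
  have "cnj (L2_vinner M f g) = (LINT x|M. cnj (cdot (f x) (g x)))"
    unfolding L2_vinner_def by (rule Bochner_Integration.integral_cnj[symmetric])
  then show ?thesis by (simp add: L2_vinner_def cdot_commute[symmetric] del: Bochner_Integration.integral_cnj)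
qed

lemma L2_inner_self: "L2_inner M f f = of_real (LINT x|M. (norm (f x))\<^sup>2)"
  unfolding L2_inner_def integral_complex_of_real[symmetric] complex_norm_square ..

lemma L2_vinner_self: "L2_vinner M f f = of_real (LINT x|M. (norm (f x))\<^sup>2)"
  unfolding L2_vinner_def integral_complex_of_real[symmetric] cdot_self ..

lemma cdot_scaleR_left: "cdot (c *\<^sub>R a) b = of_real c * cdot a b"
  and cdot_scaleR_right: "cdot a (c *\<^sub>R b) = of_real c * cdot a b"
  by (simp_all add: cdot_def sum_distrib_left scaleR_conv_of_real[symmetric])

text \<open>The normal components of the jump cancel between the two terms on the left.\<close>

lemma tangential_jump_bound:
  fixes b1 b2 :: "complex^'n" and n w :: "real^'n"
  assumes n: "norm n = 1" and o: "n \<bullet> w = o'" and D: "norm w \<le> D"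
  defines "m \<equiv> (1/2) *\<^sub>R (b1 + b2)" and "t \<equiv> b1 - b2"
  defines "\<tau> \<equiv> t - (\<chi> i. bdot t n * of_real (n $ i))"
  shows "\<bar>2 * Re (bdot m n * cnj (bdot t w)) - o' * ((norm b1)\<^sup>2 - (norm b2)\<^sup>2)\<bar> \<le> 4 * D * (norm m * norm \<tau>)"
    and "bdot \<tau> n = 0"
proof -
  have t: "t = \<tau> + (\<chi> i. bdot t n * of_real (n $ i))" by (simp add: \<tau>_def)
  have proj: "bdot (\<chi> i. c * of_real (n $ i)) w = c * of_real (n \<bullet> w)" for c
    by (simp add: bdot_def inner_vec_def sum_distrib_left mult.assoc)
  have 1: "bdot t w = bdot \<tau> w + bdot t n * of_real o'"
    by (subst (1) t) (simp add: bdot_add_left proj o)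
  \<comment> \<open>Polarisation: \<open>m\<close> is the mean and \<open>t\<close> the difference
    of the two gradients.\<close>
  have "of_real ((norm b1)\<^sup>2 - (norm b2)\<^sup>2) = cdot m t + cdot t m"
    unfolding of_real_diff cdot_self[symmetric] m_def t_def
    by (simp add: cdot_scaleR_left cdot_scaleR_right cdot_add_left cdot_add_right cdot_diff_left cdot_diff_right
        field_simps)
  also have "\<dots> = of_real (2 * Re (cdot m t))" unfolding cdot_commute[of t m] by (simp add: complex_eq_iff)
  finally have 2: "(norm b1)\<^sup>2 - (norm b2)\<^sup>2 = 2 * Re (cdot m t)" unfolding of_real_eq_iff .
  have 3: "cdot m t = cdot m \<tau> + bdot m n * cnj (bdot t n)"
    by (subst (1) t) (simp add: cdot_add_right cdot_of_real_right)
  \<comment> \<open>The normal contribution \<open>o' * bdot m n * cnj (bdot t n)\<close> occurs in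
    both terms with the same factor and drops out; only \<open>\<tau>\<close> is left.\<close>
  have eq: "2 * Re (bdot m n * cnj (bdot t w)) - o' * ((norm b1)\<^sup>2 - (norm b2)\<^sup>2) =
      2 * Re (bdot m n * cnj (bdot \<tau> w)) - 2 * o' * Re (cdot m \<tau>)"
    unfolding 1 2 3 by (simp add: algebra_simps)
  have "\<bar>Re (bdot m n * cnj (bdot \<tau> w))\<bar> \<le> norm (bdot m n) * norm (bdot \<tau> w)"
    using abs_Re_le_cmod[of "bdot m n * cnj (bdot \<tau> w)"] by (simp add: norm_mult)
  also have "\<dots> \<le> norm m * (norm \<tau> * D)"
  proof (intro mult_mono)
    show "norm (bdot m n) \<le> norm m" using norm_bdot_le[of m n] n by simp
    have "norm \<tau> * norm w \<le> norm \<tau> * D" using D by (intro mult_left_mono) auto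
    then show "norm (bdot \<tau> w) \<le> norm \<tau> * D" using norm_bdot_le[of \<tau> w] by linarith
  qed auto
  finally have 4: "\<bar>Re (bdot m n * cnj (bdot \<tau> w))\<bar> \<le> D * (norm m * norm \<tau>)" by (simp add: ac_simps)
  have "\<bar>o'\<bar> \<le> norm n * norm w" unfolding o[symmetric] by (rule Cauchy_Schwarz_ineq2)
  then have "\<bar>o'\<bar> \<le> D" using n D by simp
  moreover have "\<bar>Re (cdot m \<tau>)\<bar> \<le> norm m * norm \<tau>"
    using abs_Re_le_cmod[of "cdot m \<tau>"] norm_cdot_le[of m \<tau>] by linarith
  ultimately have "\<bar>o'\<bar> * \<bar>Re (cdot m \<tau>)\<bar> \<le> D * (norm m * norm \<tau>)" by (intro mult_mono) auto
  then have 5: "\<bar>o' * Re (cdot m \<tau>)\<bar> \<le> D * (norm m * norm \<tau>)" by (simp add: abs_mult)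
  show "\<bar>2 * Re (bdot m n * cnj (bdot t w)) - o' * ((norm b1)\<^sup>2 - (norm b2)\<^sup>2)\<bar> \<le> 4 * D * (norm m * norm \<tau>)"
    unfolding eq using 4 5 by linarith
  show "bdot \<tau> n = 0"
    unfolding \<tau>_def bdot_diff_left bdot_of_real_left by (simp add: n)
qed

text \<open>From here on the geometry enters through these inequalities only. A single constant
  \<open>\<Lambda>\<close> bounds the dimension, the extent of the domain, the shape constants and
  the reciprocal of the star-shapedness constant; its powers are enlarged freely later.\<close>

locale regular_mesh = vmesh \<Omega> T for \<Omega> :: "(real^'n) set" and T +
  fixes x0 :: "real^'n" and \<Lambda> :: real
  assumes dim_le: "real CARD('n) + 1 \<le> \<Lambda>"
    and dist_le: "\<And>x. x \<in> closure \<Omega> \<Longrightarrow> norm (x - x0) \<le> \<Lambda>"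
    and diam_pos: "\<And>K e. K \<in> T \<Longrightarrow> e facet_of K \<Longrightarrow> diameter e > 0"
    and diam_le: "\<And>K e e'. K \<in> T \<Longrightarrow> e facet_of K \<Longrightarrow> e' facet_of K \<Longrightarrow> diameter e \<le> \<Lambda> * diameter e'"
    and trace_le: "\<And>K e f. K \<in> T \<Longrightarrow> e facet_of K \<Longrightarrow> complex_affine f \<Longrightarrow>
      (LINT x|face_measure e. (norm (f x))\<^sup>2) \<le> \<Lambda> / diameter e * (LINT x|lebesgue_on K. (norm (f x))\<^sup>2)"
    and tangential_le: "\<And>K e f t. K \<in> T \<Longrightarrow> e facet_of K \<Longrightarrow> complex_affine f \<Longrightarrow> facet_normal K e \<bullet> t = 0 \<Longrightarrow>
      measure (face_measure e) e * (norm (bdot (cgrad f) t))\<^sup>2 \<le>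
        \<Lambda> / (diameter e)\<^sup>2 * (norm t)\<^sup>2 * (LINT x|face_measure e. (norm (f x))\<^sup>2)"
    and star: "\<And>K e. K \<in> T \<Longrightarrow> e facet_of K \<Longrightarrow> e \<subseteq> frontier \<Omega> \<Longrightarrow>
      1 \<le> \<Lambda> * (facet_normal K e \<bullet> ((SOME y. y \<in> e) - x0))"

locale discrete_solution = regular_mesh \<Omega> T x0 \<Lambda> for \<Omega> :: "(real^'n) set" and T x0 \<Lambda> +
  fixes k \<beta> \<delta> :: real
    and U :: "(real^'n) set \<Rightarrow> real^'n \<Rightarrow> complex" and S :: "(real^'n) set \<Rightarrow> real^'n \<Rightarrow> complex^'n"
    and l :: "((real^'n) set \<Rightarrow> real^'n \<Rightarrow> complex) \<Rightarrow> complex"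
  assumes pos: "k > 0" "\<beta> > 0" "\<delta> > 0"
    and U: "affine_family U" and S: "affine_vfamily S"
    and scalar_eq: "\<And>V. affine_family V \<Longrightarrow> scalar_form k \<beta> U S V = l V"
    and vector_eq: "\<And>W. affine_vfamily W \<Longrightarrow> vector_form \<delta> U S W = 0"
begin

definition B :: "(real^'n) set \<Rightarrow> real^'n \<Rightarrow> complex^'n" where "B K x = cgrad (U K)"
definition R :: "(real^'n) set \<Rightarrow> real^'n \<Rightarrow> complex^'n" where "R K x = S K x - B K x"
definition V :: "(real^'n) set \<Rightarrow> real^'n \<Rightarrow> complex" where "V K x = bdot (cgrad (U K)) (x - x0)"

definition P where "P e = sqF e (jmp U e)"
definition Sg where "Sg e = sqF e (jmn S e)"
text \<open>The terms of the method that carry a factor \<open>\<i>\<close>: boundary values and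
  both penalties. These are what the imaginary part of the energy identity sees.\<close>

definition J where "J = k * boundary_square U + (\<Sum>e\<in>interior_faces T. \<beta> * P e + \<delta> * Sg e)"

abbreviation "vsU \<equiv> volume_square U"
abbreviation "vsB \<equiv> volume_square B"
abbreviation "vsR \<equiv> volume_square R"
abbreviation "bsU \<equiv> boundary_square U"
abbreviation "bsB \<equiv> boundary_square B"

definition rB where "rB = (\<Sum>K\<in>T. vipK K (R K) (B K))"
definition aB where "aB W = (\<Sum>e\<in>interior_faces T. ipF e (avn B e) (jmp W e))"
definition aR where "aR W = (\<Sum>e\<in>interior_faces T. ipF e (avn R e) (jmp W e))"
definition bU where "bU W = (\<Sum>e\<in>interior_faces T. ipF e (jmp U e) (jmp W e))"
definition gU where "gU W = (\<Sum>K\<in>T. \<Sum>e\<in>bfaces K. ipF e (U K) (W K))"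

lemma affine_B: "affine_vfamily B"
  by (simp add: affine_vfamily_def B_def complex_affine_const)

lemma affine_R: "affine_vfamily R"
  using S affine_B by (auto simp: affine_vfamily_def R_def intro: complex_affine_diff)

lemma affine_V: "affine_family V"
  by (simp add: affine_family_def V_def[abs_def] complex_affine_bdotI)

lemma affine_jmp: "affine_family W \<Longrightarrow> e \<in> interior_faces T \<Longrightarrow> complex_affine (jmp W e)"
  using sides unfolding jmp_def affine_family_def by (intro complex_affine_diff) blast+

lemma affine_bdot_side:
  "affine_vfamily W \<Longrightarrow> K \<in> T \<Longrightarrow> complex_affine (\<lambda>x. bdot (W K x) t)"
  unfolding affine_vfamily_def by (intro complex_affine_bdot_field) blast

lemma affine_jmn:
  assumes "affine_vfamily W" "e \<in> interior_faces T" shows "complex_affine (jmn W e)"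
  unfolding jmn_def by (intro complex_affine_diff affine_bdot_side[OF assms(1)] sides(1,2)[OF assms(2)])

lemma affine_avn: assumes "affine_vfamily W" "e \<in> interior_faces T" shows "complex_affine (avn W e)"
proof -
  have "complex_affine (\<lambda>x. (1/2) * (bdot (W (side1 e) x) (nrm e) + bdot (W (side2 e) x) (nrm e)))"
    by (intro complex_affine_scale complex_affine_add affine_bdot_side[OF assms(1)] sides(1,2)[OF assms(2)])
  then show ?thesis by (simp add: avn_def[abs_def])
qed

lemma face_compact_measure: "e \<in> interior_faces T \<Longrightarrow> compact_measure (face_measure e)"
  using compact_measures(2) sides by blast

lemma vfamily_continuous: "affine_vfamily W \<Longrightarrow> K \<in> T \<Longrightarrow> continuous_on UNIV (W K)"
  unfolding affine_vfamily_def by (intro vcontinuous) blast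

lemma family_continuous: "affine_family W \<Longrightarrow> K \<in> T \<Longrightarrow> continuous_on UNIV (W K)"
  unfolding affine_family_def by (intro complex_affine_continuous) blast

lemma S_split: "S K = (\<lambda>x. B K x + R K x)"
  by (simp add: R_def)

lemma vip_split:
  assumes "K \<in> T" "continuous_on UNIV g"
  shows "vipK K (S K) g = vipK K (B K) g + vipK K (R K) g"
proof -
  have "vipK K (\<lambda>x. B K x + R K x) g = vipK K (B K) g + vipK K (R K) g"
    by (rule compact_measure.L2_vinner_add_left[OF compact_measures(1)[OF assms(1)]
        vfamily_continuous[OF affine_B assms(1)] vfamily_continuous[OF affine_R assms(1)] assms(2)])
  then show ?thesis by (simp only: S_split[symmetric])
qed

lemma avn_split: "avn S e x = avn B e x + avn R e x"
  by (simp add: avn_def R_def bdot_diff_left add_divide_distrib diff_divide_distrib)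

text \<open>The flux is written as gradient plus residual, so that the residual terms appear as
  perturbations of a form in \<open>u\<close> alone.\<close>

lemma scalar_form_split:
  assumes W: "affine_family W"
  shows "scalar_form k \<beta> U S W =
    (\<Sum>K\<in>T. vipK K (B K) (\<lambda>_. cgrad (W K))) + (\<Sum>K\<in>T. vipK K (R K) (\<lambda>_. cgrad (W K)))
     - of_real (k\<^sup>2) * (\<Sum>K\<in>T. ipK K (U K) (W K)) + \<i> * of_real k * gU W
     - aB W - aR W + \<i> * of_real \<beta> * bU W"
proof -
  have "ipF e (\<lambda>x. avn S e x - \<i> * of_real \<beta> * jmp U e x) (jmp W e) =
      ipF e (avn B e) (jmp W e) + ipF e (avn R e) (jmp W e) - \<i> * of_real \<beta> * ipF e (jmp U e) (jmp W e)"
    if e: "e \<in> interior_faces T" for e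
  proof -
    interpret compact_measure "face_measure e" by (rule face_compact_measure[OF e])
    have c: "continuous_on UNIV (avn B e)" "continuous_on UNIV (avn R e)" "continuous_on UNIV (jmp U e)"
      "continuous_on UNIV (jmp W e)"
      using affine_avn[OF affine_B e] affine_avn[OF affine_R e] affine_jmp[OF U e] affine_jmp[OF W e]
      by (auto intro: complex_affine_continuous)
    have eq: "(\<lambda>x. avn S e x - \<i> * of_real \<beta> * jmp U e x) =
      (\<lambda>x. avn B e x + (avn R e x + (- \<i> * of_real \<beta>) * jmp U e x))"
      by (simp add: avn_split algebra_simps)
    have c': "continuous_on UNIV (\<lambda>x. (- \<i> * of_real \<beta>) * jmp U e x)"
      by (rule continuous_on_mult_left[OF c(3)])
    have *: "ipF e (\<lambda>x. avn S e x - \<i> * of_real \<beta> * jmp U e x) (jmp W e) = ipF e (avn B e) (jmp W e) +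
        (ipF e (avn R e) (jmp W e) + (- \<i> * of_real \<beta>) * ipF e (jmp U e) (jmp W e))"
      unfolding eq L2_inner_add_left[OF c(1) continuous_on_add[OF c(2) c'] c(4)]
        L2_inner_add_left[OF c(2) c' c(4)] L2_inner_scale_left by (rule refl)
    have "a + (b + (- \<i> * of_real \<beta>) * c) = a + b - \<i> * of_real \<beta> * c" for a b c by (simp add: algebra_simps)
    then show ?thesis unfolding * .
  qed
  then have 1: "(\<Sum>e\<in>interior_faces T. ipF e (\<lambda>x. avn S e x - \<i> * of_real \<beta> * jmp U e x) (jmp W e)) =
      aB W + aR W - \<i> * of_real \<beta> * bU W"
    unfolding aB_def aR_def bU_def sum_distrib_left sum.distrib[symmetric] sum_subtractf[symmetric]
    by (rule sum.cong[OF refl])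
  have 2: "(\<Sum>K\<in>T. vipK K (S K) (\<lambda>_. cgrad (W K))) =
      (\<Sum>K\<in>T. vipK K (B K) (\<lambda>_. cgrad (W K))) + (\<Sum>K\<in>T. vipK K (R K) (\<lambda>_. cgrad (W K)))"
    unfolding sum.distrib[symmetric] by (intro sum.cong refl vip_split) auto
  show ?thesis unfolding scalar_form_def 1 2 gU_def by simp
qed

text \<open>The two volume terms of the vector equation combine to the residual, which is thereby
  expressed through face terms with jumps of the solution.\<close>

lemma vector_form_split:
  assumes W: "affine_vfamily W"
  shows "(\<Sum>K\<in>T. vipK K (R K) (W K)) =
    (\<Sum>e\<in>interior_faces T. \<i> * of_real \<delta> * ipF e (jmn S e) (jmn W e) - ipF e (jmp U e) (avn W e))"
proof -
  have 2: "(\<Sum>K\<in>T. vipK K (S K) (W K)) = (\<Sum>K\<in>T. vipK K (\<lambda>_. cgrad (U K)) (W K)) + (\<Sum>K\<in>T. vipK K (R K) (W K))"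
    unfolding sum.distrib[symmetric]
  proof (intro sum.cong refl)
    fix K assume K: "K \<in> T"
    have "(\<lambda>_. cgrad (U K)) = B K" by (simp add: B_def fun_eq_iff)
    then show "vipK K (S K) (W K) = vipK K (\<lambda>_. cgrad (U K)) (W K) + vipK K (R K) (W K)"
      using vip_split[OF K vfamily_continuous[OF W K]] by simp
  qed
  show ?thesis using vector_eq[OF W] unfolding vector_form_def 2 by (simp add: algebra_simps)
qed

lemma vsB_eq: "(\<Sum>K\<in>T. vipK K (B K) (\<lambda>_. cgrad (U K))) = of_real vsB"
  unfolding volume_square_def of_real_sum L2_vinner_self[symmetric] by (simp add: B_def[abs_def])

lemma rB_eq: "(\<Sum>K\<in>T. vipK K (R K) (\<lambda>_. cgrad (U K))) = rB"
  by (simp add: rB_def B_def[abs_def])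

lemma avS_split: "e \<in> interior_faces T \<Longrightarrow> ipF e (jmp U e) (avn S e) = cnj (ipF e (avn B e) (jmp U e) + ipF e (avn R e) (jmp U e))"
proof -
  assume e: "e \<in> interior_faces T"
  interpret compact_measure "face_measure e" by (rule face_compact_measure[OF e])
  have "ipF e (avn S e) (jmp U e) = ipF e (avn B e) (jmp U e) + ipF e (avn R e) (jmp U e)"
    unfolding avn_split[abs_def]
    using affine_avn[OF affine_B e] affine_avn[OF affine_R e] affine_jmp[OF U e]
    by (intro L2_inner_add_left) (auto intro: complex_affine_continuous)
  then show ?thesis using L2_inner_commute[of "face_measure e" "jmp U e" "avn S e"] by simp
qed

lemma scalar_U:
  "of_real vsB + rB - of_real (k\<^sup>2 * vsU) + \<i> * of_real (k * bsU) - aB U - aR U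
     + \<i> * of_real (\<beta> * (\<Sum>e\<in>interior_faces T. P e)) = l U"
proof -
  have "(\<Sum>K\<in>T. ipK K (U K) (U K)) = of_real vsU" "gU U = of_real bsU" "bU U = of_real (\<Sum>e\<in>interior_faces T. P e)"
    by (simp_all add: L2_inner_self volume_square_def boundary_square_def gU_def bU_def P_def)
  then show ?thesis
    using scalar_form_split[OF U] scalar_eq[OF U] unfolding vsB_eq rB_eq by simp
qed

text \<open>Testing with \<open>(u, -\<sigma>)\<close>.\<close>

lemma J_identity: "J = Im (l U)"
proof -
  have "(\<Sum>K\<in>T. vipK K (R K) (S K)) = (\<Sum>e\<in>interior_faces T. \<i> * of_real \<delta> * of_real (Sg e) -
      cnj (ipF e (avn B e) (jmp U e) + ipF e (avn R e) (jmp U e)))"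
    unfolding vector_form_split[OF S] by (intro sum.cong refl) (simp add: avS_split Sg_def L2_inner_self)
  also have "\<dots> = \<i> * of_real (\<delta> * (\<Sum>e\<in>interior_faces T. Sg e)) - cnj (aB U + aR U)"
    by (simp add: sum_subtractf sum.distrib aB_def aR_def sum_distrib_left mult.assoc)
  finally have 1: "(\<Sum>K\<in>T. vipK K (R K) (S K)) = \<i> * of_real (\<delta> * (\<Sum>e\<in>interior_faces T. Sg e)) - cnj (aB U + aR U)" .
  have "vipK K (R K) (S K) = vipK K (R K) (B K) + of_real (sqK K (R K))" if "K \<in> T" for K
  proof -
    have "vipK K (R K) (S K) = cnj (vipK K (S K) (R K))" by (rule L2_vinner_commute)
    also have "vipK K (S K) (R K) = vipK K (B K) (R K) + of_real (sqK K (R K))"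
      unfolding L2_vinner_self[symmetric] by (rule vip_split[OF that vfamily_continuous[OF affine_R that]])
    also have "vipK K (B K) (R K) = cnj (vipK K (R K) (B K))" by (rule L2_vinner_commute)
    finally show ?thesis by simp
  qed
  then have "(\<Sum>K\<in>T. vipK K (R K) (S K)) = rB + of_real vsR"
    by (simp add: rB_def volume_square_def sum.distrib)
  \<comment> \<open>Conjugation flips the imaginary parts of \<open>aB U\<close> and
    \<open>aR U\<close>, so they cancel once this is inserted into the imaginary part of the scalar
    equation.\<close>
  then have "Im rB = \<delta> * (\<Sum>e\<in>interior_faces T. Sg e) + Im (aB U) + Im (aR U)"
    using arg_cong[OF 1, of Im] by simp
  moreover have "Im (l U) = Im rB + k * bsU - Im (aB U) - Im (aR U) + \<beta> * (\<Sum>e\<in>interior_faces T. P e)"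
    using scalar_U by (auto simp: complex_eq_iff)
  ultimately show ?thesis by (simp add: J_def sum.distrib sum_distrib_left)
qed

lemma energy_identity: "vsB = k\<^sup>2 * vsU - Re rB + Re (aB U) + Re (aR U) + Re (l U)"
  using arg_cong[OF scalar_U, of Re] by simp

text \<open>The weight \<open>off\<close> has opposite signs on the two sides of an interior face,
  so only differences remain there.\<close>

lemma sum_facets_split:
  "(\<Sum>K\<in>T. \<Sum>e | e facet_of K. off x0 K e * F K e) =
    (\<Sum>K\<in>T. \<Sum>e\<in>bfaces K. off x0 K e * F K e) +
    (\<Sum>e\<in>interior_faces T. off x0 (side1 e) e * (F (side1 e) e - F (side2 e) e))"
proof -
  have "(\<Sum>K\<in>T. \<Sum>e | e facet_of K. off x0 K e * F K e) =
    (\<Sum>K\<in>T. \<Sum>e\<in>bfaces K. off x0 K e * F K e) + (\<Sum>K\<in>T. \<Sum>e\<in>ifaces K. off x0 K e * F K e)"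
    unfolding sum.distrib[symmetric] by (intro sum.cong refl facets_split)
  also have "(\<Sum>K\<in>T. \<Sum>e\<in>ifaces K. off x0 K e * F K e) =
     (\<Sum>e\<in>interior_faces T. off x0 (side1 e) e * F (side1 e) e + off x0 (side2 e) e * F (side2 e) e)"
    by (rule sum_both_sides[where F = "\<lambda>K e. off x0 K e * F K e", symmetric])
  also have "\<dots> = (\<Sum>e\<in>interior_faces T. off x0 (side1 e) e * (F (side1 e) e - F (side2 e) e))"
    by (intro sum.cong refl) (simp add: off_sides right_diff_distrib)
  finally show ?thesis .
qed

text \<open>The interior-face remainder of the Rellich identity: consistency term minus weighted
  jump of the squared gradient. Each of the two contains the normal jump of the gradient, which
  jumps of \<open>u\<close> do not control, and so they must be estimated together.\<close>

definition Z where
  "Z e = 2 * Re (ipF e (avn B e) (jmp V e)) - off x0 (side1 e) e * (sqF e (B (side1 e)) - sqF e (B (side2 e)))"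

text \<open>Twice the real part of the scalar equation at \<open>V\<close>. The divergence
  identities for the squared moduli of \<open>u\<close> and of its elementwise constant gradient
  turn the term with \<open>k\<^sup>2\<close> and \<open>real CARD('n)\<close> copies of the
  gradient norm into facet sums; this explains the two coefficients on the left.\<close>

lemma rellich_global:
  "real CARD('n) * k\<^sup>2 * vsU + (2 - real CARD('n)) * vsB
      + (\<Sum>K\<in>T. \<Sum>e\<in>bfaces K. off x0 K e * sqF e (B K)) =
    k\<^sup>2 * (\<Sum>K\<in>T. \<Sum>e\<in>bfaces K. off x0 K e * sqF e (U K))
      + k\<^sup>2 * (\<Sum>e\<in>interior_faces T. off x0 (side1 e) e * (sqF e (U (side1 e)) - sqF e (U (side2 e))))
      + 2 * k * Im (gU V) + (\<Sum>e\<in>interior_faces T. Z e) + 2 * Re (aR V) + 2 * \<beta> * Im (bU V)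
      - 2 * Re rB + 2 * Re (l V)"
proof -
  let ?d = "real CARD('n)"
  have "(\<Sum>K\<in>T. \<Sum>e | e facet_of K. off x0 K e * sqF e (U K)) = (\<Sum>K\<in>T. ?d * sqK K (U K) + 2 * Re (ipK K (U K) (V K)))"
    unfolding V_def[abs_def] using U by (intro sum.cong refl rellich_mesh) (auto simp: affine_family_def)
  also have "\<dots> = ?d * vsU + 2 * Re (\<Sum>K\<in>T. ipK K (U K) (V K))"
    by (simp add: sum.distrib volume_square_def sum_distrib_left)
  finally have 1: "2 * Re (\<Sum>K\<in>T. ipK K (U K) (V K)) = (\<Sum>K\<in>T. \<Sum>e | e facet_of K. off x0 K e * sqF e (U K)) - ?d * vsU"
    by simp
  have "(\<Sum>K\<in>T. \<Sum>e | e facet_of K. off x0 K e * sqF e (B K)) = (\<Sum>K\<in>T. ?d * sqK K (B K))"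
    unfolding B_def[abs_def] by (intro sum.cong refl divergence_constant)
  then have 2: "?d * vsB = (\<Sum>K\<in>T. \<Sum>e | e facet_of K. off x0 K e * sqF e (B K))"
    by (simp add: volume_square_def sum_distrib_left)
  have cg: "cgrad (V K) = cgrad (U K)" for K unfolding V_def[abs_def] by (rule cgrad_bdot)
  have "of_real vsB + rB - of_real (k\<^sup>2) * (\<Sum>K\<in>T. ipK K (U K) (V K)) + \<i> * of_real k * gU V
     - aB V - aR V + \<i> * of_real \<beta> * bU V = l V"
    using scalar_form_split[OF affine_V] scalar_eq[OF affine_V] unfolding cg vsB_eq rB_eq by simp
  from arg_cong[OF this, of Re]
  have 3: "2 * vsB + 2 * Re rB - k\<^sup>2 * (2 * Re (\<Sum>K\<in>T. ipK K (U K) (V K))) - 2 * k * Im (gU V)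
     - 2 * Re (aB V) - 2 * Re (aR V) - 2 * \<beta> * Im (bU V) = 2 * Re (l V)"
    by (simp del: Re_sum)
  have 4: "(\<Sum>e\<in>interior_faces T. Z e) = 2 * Re (aB V) -
     (\<Sum>e\<in>interior_faces T. off x0 (side1 e) e * (sqF e (B (side1 e)) - sqF e (B (side2 e))))"
    by (simp add: Z_def aB_def sum_subtractf sum_distrib_left)
  note 2 = 2[unfolded sum_facets_split] and 1 = 1[unfolded sum_facets_split]
  show ?thesis using 3 4 2 unfolding 1 by (simp add: algebra_simps)
qed

end

section \<open>The stability estimate\<close>

lemma norm_add_square_le:
  fixes a b :: "'a::real_inner"
  shows "(norm (a + b))\<^sup>2 \<le> 2 * ((norm a)\<^sup>2 + (norm b)\<^sup>2)" "(norm (a - b))\<^sup>2 \<le> 2 * ((norm a)\<^sup>2 + (norm b)\<^sup>2)"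
proof -
  have "(norm (a + b))\<^sup>2 + (norm (a - b))\<^sup>2 = 2 * ((norm a)\<^sup>2 + (norm b)\<^sup>2)"
    unfolding power2_norm_eq_inner by (simp add: algebra_simps)
  then show "(norm (a + b))\<^sup>2 \<le> 2 * ((norm a)\<^sup>2 + (norm b)\<^sup>2)" "(norm (a - b))\<^sup>2 \<le> 2 * ((norm a)\<^sup>2 + (norm b)\<^sup>2)"
    using zero_le_power2[of "norm (a + b)"] zero_le_power2[of "norm (a - b)"] by linarith+
qed

text \<open>Each inequality bounds one unknown by the other. Young's inequality first removes
  \<open>Y * y\<close> from the bound for \<open>y\<^sup>2\<close>, then two quarters of
  \<open>X\<^sup>2\<close> are absorbed in the bound for \<open>X\<^sup>2\<close>; inserting the
  former into the latter leaves a mixed term \<open>Y * X\<close>, which is absorbed in the same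
  way.\<close>

lemma quadratic_bootstrap:
  fixes X y Y C :: real
  assumes nn: "0 \<le> X" "0 \<le> y" "0 \<le> Y" and C: "1 \<le> C"
    and y: "y\<^sup>2 \<le> Y * (X + y)" and X: "X\<^sup>2 \<le> C * (y * X + y\<^sup>2 + Y * X + Y * y)"
  shows "X\<^sup>2 \<le> 144 * C ^ 4 * Y\<^sup>2" "y\<^sup>2 \<le> 100 * C ^ 4 * Y\<^sup>2"
proof -
  have C2: "1 \<le> C\<^sup>2" using C by (simp add: one_le_power)
  have C4: "C\<^sup>2 \<le> C ^ 4" using C by (intro power_increasing) auto
  have CC: "C \<le> C\<^sup>2" using C by (simp add: power2_eq_square)
  have "0 \<le> (y - Y)\<^sup>2" by simp
  then have Yy: "2 * (Y * y) \<le> y\<^sup>2 + Y\<^sup>2" by (simp add: power2_eq_square algebra_simps)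
  then have y2: "y\<^sup>2 \<le> 2 * (Y * X) + Y\<^sup>2" using y by (simp add: algebra_simps)
  have "0 \<le> (X / 2 - C * y)\<^sup>2" by simp
  then have 1: "C * (y * X) \<le> X\<^sup>2 / 4 + C\<^sup>2 * y\<^sup>2" by (simp add: power2_eq_square algebra_simps)
  have "0 \<le> (X / 2 - C * Y)\<^sup>2" by simp
  then have 2: "C * (Y * X) \<le> X\<^sup>2 / 4 + C\<^sup>2 * Y\<^sup>2" by (simp add: power2_eq_square algebra_simps)
  have 3: "C * y\<^sup>2 \<le> C\<^sup>2 * y\<^sup>2" using CC by (intro mult_right_mono) auto
  have "C * (Y * y) \<le> C * ((y\<^sup>2 + Y\<^sup>2) / 2)" using Yy C by (intro mult_left_mono) auto
  also have "\<dots> \<le> C\<^sup>2 * ((y\<^sup>2 + Y\<^sup>2) / 2)" using CC by (intro mult_right_mono) auto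
  finally have 4: "2 * (C * (Y * y)) \<le> C\<^sup>2 * y\<^sup>2 + C\<^sup>2 * Y\<^sup>2" by (simp add: algebra_simps)
  have "C * (y * X + y\<^sup>2 + Y * X + Y * y) = C * (y * X) + C * y\<^sup>2 + C * (Y * X) + C * (Y * y)"
    by (simp add: algebra_simps)
  then have X2: "X\<^sup>2 \<le> 5 * (C\<^sup>2 * y\<^sup>2) + 3 * (C\<^sup>2 * Y\<^sup>2)" using X 1 2 3 4 by linarith
  \<comment> \<open>The factor 10 is 5 from \<open>X2\<close> times 2 from
    \<open>y2\<close>.\<close>
  have "0 \<le> (X / 2 - 10 * C\<^sup>2 * Y)\<^sup>2" by simp
  then have 5: "10 * (C\<^sup>2 * (Y * X)) \<le> X\<^sup>2 / 4 + 100 * (C ^ 4 * Y\<^sup>2)"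
    by (simp add: power2_eq_square power_numeral_reduce algebra_simps)
  have "C\<^sup>2 * y\<^sup>2 \<le> C\<^sup>2 * (2 * (Y * X) + Y\<^sup>2)" using y2 by (intro mult_left_mono) auto
  then have 6: "5 * (C\<^sup>2 * y\<^sup>2) \<le> 10 * (C\<^sup>2 * (Y * X)) + 5 * (C\<^sup>2 * Y\<^sup>2)" by (simp add: algebra_simps)
  have 7: "C\<^sup>2 * Y\<^sup>2 \<le> C ^ 4 * Y\<^sup>2" using C4 by (intro mult_right_mono) auto
  \<comment> \<open>The right-hand side collects 100 + 5 + 3, and dividing by 3/4 gives 144.\<close>
  have 8: "X\<^sup>2 * 3 / 4 \<le> 108 * (C ^ 4 * Y\<^sup>2)" using X2 5 6 7 by linarith
  then show XX: "X\<^sup>2 \<le> 144 * C ^ 4 * Y\<^sup>2" by linarith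
  have "0 \<le> (X / 2 - 2 * Y)\<^sup>2" by simp
  then have "2 * (Y * X) \<le> X\<^sup>2 / 4 + 4 * Y\<^sup>2" by (simp add: power2_eq_square algebra_simps)
  moreover have "Y\<^sup>2 \<le> C ^ 4 * Y\<^sup>2"
    using mult_right_mono[of 1 "C ^ 4" "Y\<^sup>2"] C2 C4 by simp
  moreover have "X\<^sup>2 \<le> 144 * (C ^ 4 * Y\<^sup>2)" using 8 by linarith
  moreover have "0 \<le> C ^ 4 * Y\<^sup>2" by simp
  ultimately have "y\<^sup>2 \<le> 100 * (C ^ 4 * Y\<^sup>2)" using y2 by linarith
  then show "y\<^sup>2 \<le> 100 * C ^ 4 * Y\<^sup>2" by (simp only: mult.assoc)
qed

section \<open>Integral inequalities on elements and facets\<close>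

context compact_measure
begin

lemma norm2_integrable:
  fixes f :: "'a \<Rightarrow> 'c::real_normed_vector"
  assumes "continuous_on UNIV f" shows "integrable M (\<lambda>x. (norm (f x))\<^sup>2)"
  using assms by (intro integrable_continuous_real continuous_intros)

lemma norm2_mono:
  fixes f :: "'a \<Rightarrow> 'c::real_normed_vector" and g :: "'a \<Rightarrow> 'd::real_normed_vector"
  assumes "continuous_on UNIV f" "continuous_on UNIV g" "\<And>x. x \<in> space M \<Longrightarrow> norm (f x) \<le> c * norm (g x)" "0 \<le> c"
  shows "(LINT x|M. (norm (f x))\<^sup>2) \<le> c\<^sup>2 * (LINT x|M. (norm (g x))\<^sup>2)"
proof -
  have "(LINT x|M. (norm (f x))\<^sup>2) \<le> (LINT x|M. c\<^sup>2 * (norm (g x))\<^sup>2)"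
  proof (rule integral_mono)
    fix x assume "x \<in> space M"
    then have "(norm (f x))\<^sup>2 \<le> (c * norm (g x))\<^sup>2" using assms by (intro power_mono) auto
    then show "(norm (f x))\<^sup>2 \<le> c\<^sup>2 * (norm (g x))\<^sup>2" by (simp add: power_mult_distrib)
  qed (use assms norm2_integrable in auto)
  then show ?thesis by simp
qed

lemma norm2_two:
  fixes f g :: "'a \<Rightarrow> 'c::real_inner"
  assumes f: "continuous_on UNIV f" and g: "continuous_on UNIV g"
  shows "(LINT x|M. (norm (f x + g x))\<^sup>2) \<le> 2 * ((LINT x|M. (norm (f x))\<^sup>2) + (LINT x|M. (norm (g x))\<^sup>2))"
    and "(LINT x|M. (norm (f x - g x))\<^sup>2) \<le> 2 * ((LINT x|M. (norm (f x))\<^sup>2) + (LINT x|M. (norm (g x))\<^sup>2))"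
proof -
  have i: "integrable M (\<lambda>x. (norm (f x))\<^sup>2)" "integrable M (\<lambda>x. (norm (g x))\<^sup>2)"
    "integrable M (\<lambda>x. (norm (f x + g x))\<^sup>2)" "integrable M (\<lambda>x. (norm (f x - g x))\<^sup>2)"
    using f g by (auto intro!: norm2_integrable continuous_on_add continuous_on_diff)
  have e: "2 * ((LINT x|M. (norm (f x))\<^sup>2) + (LINT x|M. (norm (g x))\<^sup>2)) = (LINT x|M. 2 * ((norm (f x))\<^sup>2 + (norm (g x))\<^sup>2))"
    using i by simp
  show "(LINT x|M. (norm (f x + g x))\<^sup>2) \<le> 2 * ((LINT x|M. (norm (f x))\<^sup>2) + (LINT x|M. (norm (g x))\<^sup>2))"
    unfolding e using i by (intro integral_mono norm_add_square_le) auto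
  show "(LINT x|M. (norm (f x - g x))\<^sup>2) \<le> 2 * ((LINT x|M. (norm (f x))\<^sup>2) + (LINT x|M. (norm (g x))\<^sup>2))"
    unfolding e using i by (intro integral_mono norm_add_square_le) auto
qed

lemma L2_inner_square_le:
  assumes "continuous_on UNIV f" "continuous_on UNIV g"
  shows "(norm (L2_inner M f g))\<^sup>2 \<le> (LINT x|M. (norm (f x))\<^sup>2) * (LINT x|M. (norm (g x))\<^sup>2)"
proof -
  have "norm (L2_inner M f g) \<le> L2_norm M f * L2_norm M g"
    using assms by (intro L2_inner_le L2_continuous)
  then have "(norm (L2_inner M f g))\<^sup>2 \<le> (L2_norm M f * L2_norm M g)\<^sup>2" by (intro power_mono) auto
  then show ?thesis by (simp add: power_mult_distrib L2_norm_square)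
qed

text \<open>Reduced to the scalar inequality for the functions \<open>norm (f x)\<close> and
  \<open>norm (g x)\<close>.\<close>

lemma L2_vinner_square_le:
  fixes f g :: "'a \<Rightarrow> complex^'n"
  assumes f: "continuous_on UNIV f" and g: "continuous_on UNIV g"
  shows "(norm (L2_vinner M f g))\<^sup>2 \<le> (LINT x|M. (norm (f x))\<^sup>2) * (LINT x|M. (norm (g x))\<^sup>2)"
proof -
  let ?f = "\<lambda>x. complex_of_real (norm (f x))" and ?g = "\<lambda>x. complex_of_real (norm (g x))"
  have c: "continuous_on UNIV ?f" "continuous_on UNIV ?g" using f g by (auto intro!: continuous_intros)
  have i: "integrable M (\<lambda>x. norm (f x) * norm (g x))"
    using f g by (intro integrable_continuous_real continuous_intros)
  have ic: "integrable M (\<lambda>x. cdot (f x) (g x))" using f g by (intro integrable_continuous continuous_cdot)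
  have "norm (L2_vinner M f g) \<le> (LINT x|M. norm (cdot (f x) (g x)))"
    unfolding L2_vinner_def by (rule integral_norm_bound)
  also have "\<dots> \<le> (LINT x|M. norm (f x) * norm (g x))"
    using i ic by (intro integral_mono norm_cdot_le) auto
  also have "\<dots> = norm (L2_inner M ?f ?g)"
  proof -
    have "L2_inner M ?f ?g = of_real (LINT x|M. norm (f x) * norm (g x))"
      unfolding L2_inner_def integral_complex_of_real[symmetric] by simp
    then show ?thesis by (simp add: integral_nonneg_AE)
  qed
  finally have "(norm (L2_vinner M f g))\<^sup>2 \<le> (norm (L2_inner M ?f ?g))\<^sup>2" by (intro power_mono) auto
  also have "\<dots> \<le> (LINT x|M. (norm (f x))\<^sup>2) * (LINT x|M. (norm (g x))\<^sup>2)"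
    using L2_inner_square_le[OF c] by simp
  finally show ?thesis .
qed

end

context regular_mesh
begin

lemma \<Lambda>_ge_1: "1 \<le> \<Lambda>"
  using dim_le by (meson le_add_same_cancel2 of_nat_0_le_iff order_trans)

lemma off_le: assumes "K \<in> T" "e facet_of K" shows "\<bar>off x0 K e\<bar> \<le> \<Lambda>"
proof -
  have "e \<noteq> {}" using assms(2) by (simp add: facet_of_def)
  then obtain y where y: "y \<in> e" by blast
  then have "y \<in> closure \<Omega>" using facet_subset[OF assms(2)] K_subset_closure[OF assms(1)] by blast
  then have d: "norm (y - x0) \<le> \<Lambda>" by (rule dist_le)
  have "norm (facet_normal K e) = 1"
  proof (rule facetE[OF assms])
    fix p assume "p \<in> verts K" "facet_normal K e = full_simplex.normal (verts K) p"
    then show ?thesis using full_simplex.norm_normal[OF full_simplex_K[OF assms(1)]] by simp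
  qed
  then have "\<bar>facet_normal K e \<bullet> (y - x0)\<bar> \<le> norm (y - x0)"
    using Cauchy_Schwarz_ineq2[of "facet_normal K e" "y - x0"] by simp
  then show ?thesis using d off_eq[OF assms y, of x0] by simp
qed

text \<open>The scalar trace inequality for the constant function \<open>norm b\<close>.\<close>

lemma vector_trace_le:
  assumes "K \<in> T" "e facet_of K" shows "farea e * (norm (b::complex^'n))\<^sup>2 \<le> \<Lambda> / diameter e * sqK K (\<lambda>_. b)"
  using trace_le[OF assms complex_affine_const[of "of_real (norm b)"]] by (simp add: farea_def space_face_measure)

end

text \<open>Here \<open>\<gamma>\<close> is a parameter: a mesh without interior faces and with
  small \<open>k\<close> is treated with the value 1. The assumption \<open>\<gamma>_lower\<close>
  allows a factor \<open>\<gamma>\<close> to be supplied, at the cost of \<open>\<Lambda>\<close>,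
  where an estimate does not produce one.\<close>

locale stability = discrete_solution \<Omega> T x0 \<Lambda> k \<beta> \<delta> U S l
  for \<Omega> :: "(real^'n) set" and T x0 \<Lambda> k \<beta> \<delta> U S l +
  fixes \<gamma> F G :: real
  assumes k_le: "k \<le> \<gamma>"
    and \<gamma>_ge: "\<And>e. e \<in> interior_faces T \<Longrightarrow> (k\<^sup>2 + 1) / (\<beta> * diameter e) + (\<beta> + \<delta>) / diameter e
       + \<delta> / diameter e ^ 3 + 1 / (\<beta> * diameter e ^ 3) \<le> \<gamma>"
    and \<gamma>_lower: "1 \<le> \<Lambda> * \<gamma>"
    and FG: "0 \<le> F" "0 \<le> G"
    and l_le: "\<And>W. affine_family W \<Longrightarrow> norm (l W) \<le> F * sqrt (volume_square W) + G * sqrt (boundary_square W)"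
begin

text \<open>\<open>y\<close> collects what the imaginary part of the energy identity controls, \<open>X\<close> what the Rellich identity
  controls, and \<open>Y\<close> is the bound to be proved for both.\<close>

definition y where "y = sqrt (\<gamma> * J)"
definition X where "X = sqrt (k\<^sup>2 * vsU + vsB + bsB)"
definition Y where "Y = \<gamma> / k * (F + G)"

lemma \<gamma>_pos: "\<gamma> > 0" using k_le pos by linarith

lemma diam: "e \<in> interior_faces T \<Longrightarrow> diameter e > 0"
  using diam_pos sides by blast

lemma P_nonneg: "0 \<le> P e" and Sg_nonneg: "0 \<le> Sg e"
  by (simp_all add: P_def Sg_def integral_nonneg_AE)

lemma jump_nonneg: "0 \<le> \<beta> * P e + \<delta> * Sg e"
  using pos P_nonneg Sg_nonneg by simp

lemma J_nonneg: "0 \<le> J"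
  unfolding J_def using pos boundary_square_nonneg[of U] sum_nonneg[OF jump_nonneg] by (intro add_nonneg_nonneg mult_nonneg_nonneg) auto

lemma y_square: "y\<^sup>2 = \<gamma> * J" and y_nonneg: "0 \<le> y"
  using \<gamma>_pos J_nonneg by (auto simp: y_def)

lemma X_square: "X\<^sup>2 = k\<^sup>2 * vsU + vsB + bsB" and X_nonneg: "0 \<le> X"
  using volume_square_nonneg[of U] volume_square_nonneg[of B] boundary_square_nonneg[of B] by (auto simp: X_def)

lemma parts_le_X: "sqrt (k\<^sup>2 * vsU) \<le> X" "sqrt vsB \<le> X" "sqrt bsB \<le> X"
  using volume_square_nonneg[of U] volume_square_nonneg[of B] boundary_square_nonneg[of B] by (auto simp: X_def)

lemma sum_le_y2:
  assumes "\<And>e. e \<in> interior_faces T \<Longrightarrow> f e \<le> \<gamma> * (\<beta> * P e + \<delta> * Sg e)"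
  shows "(\<Sum>e\<in>interior_faces T. f e) \<le> y\<^sup>2"
proof -
  have "(\<Sum>e\<in>interior_faces T. f e) \<le> \<gamma> * (\<Sum>e\<in>interior_faces T. \<beta> * P e + \<delta> * Sg e)"
    unfolding sum_distrib_left by (intro sum_mono assms)
  also have "\<dots> \<le> \<gamma> * J"
    unfolding J_def using \<gamma>_pos pos boundary_square_nonneg[of U] by (intro mult_left_mono) auto
  finally show ?thesis by (simp add: y_square)
qed

text \<open>Each term of \<open>\<gamma>\<close> pays for its own weights:
  \<open>(k\<^sup>2 + 1) / (\<beta> * h)\<close> for \<open>k\<^sup>2 / h\<close> and
  \<open>1 / h\<close>, the term \<open>1 / (\<beta> * h ^ 3)\<close> for \<open>1 / h ^ 3\<close>,
  the term \<open>(\<beta> + \<delta>) / h\<close> for the squared penalties over \<open>h\<close>,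
  and \<open>\<delta> / h ^ 3\<close> for \<open>\<delta>\<^sup>2 / h ^ 3\<close>. The missing
  factor \<beta> or \<delta> comes from the penalised jump itself.\<close>

lemma weights:
  assumes e: "e \<in> interior_faces T"
  defines "h \<equiv> diameter e"
  shows "k\<^sup>2 / h * P e \<le> \<gamma> * (\<beta> * P e + \<delta> * Sg e)"
    and "1 / h * P e \<le> \<gamma> * (\<beta> * P e + \<delta> * Sg e)"
    and "1 / h ^ 3 * P e \<le> \<gamma> * (\<beta> * P e + \<delta> * Sg e)"
    and "\<beta>\<^sup>2 / h * P e \<le> \<gamma> * (\<beta> * P e + \<delta> * Sg e)"
    and "1 / h * (\<delta>\<^sup>2 * Sg e + P e) \<le> \<gamma> * (\<beta> * P e + \<delta> * Sg e)"
    and "1 / h ^ 3 * (\<delta>\<^sup>2 * Sg e + P e) \<le> \<gamma> * (\<beta> * P e + \<delta> * Sg e)"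
proof -
  have h: "h > 0" using diam[OF e] by (simp add: h_def)
  have b: "\<beta> > 0" and d: "\<delta> > 0" using pos by auto
  have nn: "0 \<le> (k\<^sup>2 + 1) / (\<beta> * h)" "0 \<le> (\<beta> + \<delta>) / h" "0 \<le> \<delta> / h ^ 3" "0 \<le> 1 / (\<beta> * h ^ 3)"
    using h b d by (auto intro!: divide_nonneg_nonneg)
  have s: "(k\<^sup>2 + 1) / (\<beta> * h) + (\<beta> + \<delta>) / h + \<delta> / h ^ 3 + 1 / (\<beta> * h ^ 3) \<le> \<gamma>"
    using \<gamma>_ge[OF e] by (simp add: h_def)
  have a: "(k\<^sup>2 + 1) / (\<beta> * h) \<le> \<gamma>" "(\<beta> + \<delta>) / h \<le> \<gamma>" "\<delta> / h ^ 3 \<le> \<gamma>" "1 / (\<beta> * h ^ 3) \<le> \<gamma>"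
    using nn s by linarith+
  have "k\<^sup>2 / h \<le> (k\<^sup>2 + 1) / h" "1 / h \<le> (k\<^sup>2 + 1) / h" using h by (auto intro!: divide_right_mono)
  moreover have "(k\<^sup>2 + 1) / h \<le> \<gamma> * \<beta>" using a(1) b h by (simp add: field_simps)
  ultimately have 1: "k\<^sup>2 / h \<le> \<gamma> * \<beta>" and 2: "1 / h \<le> \<gamma> * \<beta>" by linarith+
  have 3: "1 / h ^ 3 \<le> \<gamma> * \<beta>" using a(4) b h by (simp add: field_simps)
  have bd: "\<beta> / h \<le> \<gamma>" "\<delta> / h \<le> \<gamma>" using a(2) b d h by (auto simp: field_simps)
  have 4: "\<beta>\<^sup>2 / h \<le> \<gamma> * \<beta>" using mult_right_mono[OF bd(1), of \<beta>] b by (simp add: power2_eq_square)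
  have 5: "\<delta>\<^sup>2 / h \<le> \<gamma> * \<delta>" using mult_right_mono[OF bd(2), of \<delta>] d by (simp add: power2_eq_square)
  have 6: "\<delta>\<^sup>2 / h ^ 3 \<le> \<gamma> * \<delta>" using mult_right_mono[OF a(3), of \<delta>] d by (simp add: power2_eq_square)
  have P: "c * P e \<le> \<gamma> * (\<beta> * P e + \<delta> * Sg e)" if "c \<le> \<gamma> * \<beta>" for c
  proof -
    have "c * P e \<le> \<gamma> * \<beta> * P e" using that P_nonneg by (rule mult_right_mono)
    moreover have "0 \<le> \<gamma> * (\<delta> * Sg e)" using \<gamma>_pos d Sg_nonneg by simp
    ultimately show ?thesis by (simp add: algebra_simps)
  qed
  show "k\<^sup>2 / h * P e \<le> \<gamma> * (\<beta> * P e + \<delta> * Sg e)" "1 / h * P e \<le> \<gamma> * (\<beta> * P e + \<delta> * Sg e)"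
    "1 / h ^ 3 * P e \<le> \<gamma> * (\<beta> * P e + \<delta> * Sg e)" "\<beta>\<^sup>2 / h * P e \<le> \<gamma> * (\<beta> * P e + \<delta> * Sg e)"
    by (rule P[OF 1], rule P[OF 2], rule P[OF 3], rule P[OF 4])
  have "\<delta>\<^sup>2 / h * Sg e + 1 / h * P e \<le> \<gamma> * \<delta> * Sg e + \<gamma> * \<beta> * P e"
    using mult_right_mono[OF 5 Sg_nonneg] mult_right_mono[OF 2 P_nonneg] by (rule add_mono)
  then show "1 / h * (\<delta>\<^sup>2 * Sg e + P e) \<le> \<gamma> * (\<beta> * P e + \<delta> * Sg e)" by (simp add: algebra_simps)
  have "\<delta>\<^sup>2 / h ^ 3 * Sg e + 1 / h ^ 3 * P e \<le> \<gamma> * \<delta> * Sg e + \<gamma> * \<beta> * P e"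
    using mult_right_mono[OF 6 Sg_nonneg] mult_right_mono[OF 3 P_nonneg] by (rule add_mono)
  then show "1 / h ^ 3 * (\<delta>\<^sup>2 * Sg e + P e) \<le> \<gamma> * (\<beta> * P e + \<delta> * Sg e)" by (simp add: algebra_simps)
qed

text \<open>Cauchy-Schwarz over the faces in the form shared by the face terms: \<open>p\<close>
  holds small quantities such as weighted jumps, \<open>Q\<close> holds element norms. Counting an
  element once for each of its interior faces produces the factor \<open>\<Lambda>\<close>.\<close>

lemma face_sum_le:
  assumes z: "\<And>e. e \<in> interior_faces T \<Longrightarrow> (z e)\<^sup>2 \<le> c\<^sup>2 * p e * (Q (side1 e) + Q (side2 e))"
    and p: "\<And>e. e \<in> interior_faces T \<Longrightarrow> 0 \<le> p e" and Q: "\<And>K. K \<in> T \<Longrightarrow> 0 \<le> Q K"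
    and sp: "(\<Sum>e\<in>interior_faces T. p e) \<le> a\<^sup>2" and sQ: "(\<Sum>K\<in>T. Q K) \<le> b\<^sup>2" and nn: "0 \<le> c" "0 \<le> a" "0 \<le> b"
  shows "(\<Sum>e\<in>interior_faces T. z e) \<le> c * \<Lambda> * (a * b)"
proof -
  let ?q = "\<lambda>e. Q (side1 e) + Q (side2 e)"
  have q: "0 \<le> ?q e" if "e \<in> interior_faces T" for e using Q sides(1,2)[OF that] by simp
  have "z e \<le> c * (\<bar>sqrt (p e)\<bar> * \<bar>sqrt (?q e)\<bar>)" if e: "e \<in> interior_faces T" for e
  proof -
    have "\<bar>z e\<bar> = sqrt ((z e)\<^sup>2)" by simp
    also have "\<dots> \<le> sqrt (c\<^sup>2 * p e * ?q e)" by (rule real_sqrt_le_mono[OF z[OF e]])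
    also have "\<dots> = c * (sqrt (p e) * sqrt (?q e))" using nn by (simp add: real_sqrt_mult mult.assoc)
    finally show ?thesis using p[OF e] q[OF e] by simp
  qed
  then have "(\<Sum>e\<in>interior_faces T. z e) \<le> c * (\<Sum>e\<in>interior_faces T. \<bar>sqrt (p e)\<bar> * \<bar>sqrt (?q e)\<bar>)"
    unfolding sum_distrib_left by (rule sum_mono)
  also have "\<dots> \<le> c * (L2_set (\<lambda>e. sqrt (p e)) (interior_faces T) * L2_set (\<lambda>e. sqrt (?q e)) (interior_faces T))"
    using nn by (intro mult_left_mono L2_set_mult_ineq)
  finally have 1: "(\<Sum>e\<in>interior_faces T. z e) \<le> c * (L2_set (\<lambda>e. sqrt (p e)) (interior_faces T) * L2_set (\<lambda>e. sqrt (?q e)) (interior_faces T))" .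
  have 2: "L2_set (\<lambda>e. sqrt (p e)) (interior_faces T) \<le> a"
  proof -
    have "L2_set (\<lambda>e. sqrt (p e)) (interior_faces T) = sqrt (\<Sum>e\<in>interior_faces T. p e)"
      unfolding L2_set_def using p by (intro arg_cong[where f = sqrt] sum.cong) auto
    then show ?thesis using sp nn by (simp add: real_le_lsqrt)
  qed
  have 3: "L2_set (\<lambda>e. sqrt (?q e)) (interior_faces T) \<le> \<Lambda> * b"
  proof -
    have "L2_set (\<lambda>e. sqrt (?q e)) (interior_faces T) = sqrt (\<Sum>e\<in>interior_faces T. ?q e)"
      unfolding L2_set_def using q by (intro arg_cong[where f = sqrt] sum.cong) auto
    moreover have "(\<Sum>e\<in>interior_faces T. ?q e) \<le> (\<Lambda> * b)\<^sup>2"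
    proof -
      have "(\<Sum>e\<in>interior_faces T. ?q e) \<le> (real CARD('n) + 1) * (\<Sum>K\<in>T. Q K)" by (rule bounded_sides[OF Q])
      also have "\<dots> \<le> \<Lambda> * b\<^sup>2" using dim_le sQ Q by (intro mult_mono sum_nonneg) auto
      also have "\<dots> \<le> \<Lambda>\<^sup>2 * b\<^sup>2" using \<Lambda>_ge_1 by (intro mult_right_mono) (auto simp: power2_eq_square)
      finally show ?thesis by (simp add: power_mult_distrib)
    qed
    ultimately show ?thesis using nn \<Lambda>_ge_1 by (simp add: real_le_lsqrt)
  qed
  have "(\<Sum>e\<in>interior_faces T. z e) \<le> c * (a * (\<Lambda> * b))"
    by (rule order_trans[OF 1 mult_left_mono[OF mult_mono[OF 2 3 nn(2) L2_set_nonneg] nn(1)]])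
  then show ?thesis by (simp add: ac_simps)
qed

lemma sqK_nonneg: "0 \<le> (LINT x|M. (norm (f x))\<^sup>2)"
  by (simp add: integral_nonneg_AE)

lemma normal_component_le:
  assumes W: "affine_vfamily W" and e: "e \<in> interior_faces T" and K: "K \<in> T" "e facet_of K"
  shows "sqF e (\<lambda>x. bdot (W K x) (nrm e)) \<le> \<Lambda> / diameter e * sqK K (W K)"
proof -
  have a: "complex_affine (\<lambda>x. bdot (W K x) (nrm e))" by (rule affine_bdot_side[OF W K(1)])
  have "sqF e (\<lambda>x. bdot (W K x) (nrm e)) \<le> \<Lambda> / diameter e * sqK K (\<lambda>x. bdot (W K x) (nrm e))"
    by (rule trace_le[OF K a])
  also have "\<dots> \<le> \<Lambda> / diameter e * (1\<^sup>2 * sqK K (W K))"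
  proof (rule mult_left_mono)
    show "sqK K (\<lambda>x. bdot (W K x) (nrm e)) \<le> 1\<^sup>2 * sqK K (W K)"
    proof (rule compact_measure.norm2_mono[OF compact_measures(1)[OF K(1)]])
      show "norm (bdot (W K x) (nrm e)) \<le> 1 * norm (W K x)" for x
        using norm_bdot_le[of "W K x" "nrm e"] sides(6)[OF e] by simp
    qed (auto intro: complex_affine_continuous[OF a] vfamily_continuous[OF W K(1)])
    show "0 \<le> \<Lambda> / diameter e" using \<Lambda>_ge_1 diam[OF e] by simp
  qed
  finally show ?thesis by simp
qed

lemma jmp_le:
  assumes W: "affine_family W" and e: "e \<in> interior_faces T"
  shows "sqF e (jmp W e) \<le> 2 * (\<Lambda> / diameter e) * (sqK (side1 e) (W (side1 e)) + sqK (side2 e) (W (side2 e)))"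
proof -
  note s = sides[OF e]
  have a: "complex_affine (W (side1 e))" "complex_affine (W (side2 e))"
    using W s(1,2) by (auto simp: affine_family_def)
  have "sqF e (jmp W e) \<le> 2 * (sqF e (W (side1 e)) + sqF e (W (side2 e)))"
    unfolding jmp_def
    by (rule compact_measure.norm2_two(2)[OF face_compact_measure[OF e]]) (auto intro: a complex_affine_continuous)
  moreover have "sqF e (W (side1 e)) \<le> \<Lambda> / diameter e * sqK (side1 e) (W (side1 e))"
    by (rule trace_le[OF s(1,7) a(1)])
  moreover have "sqF e (W (side2 e)) \<le> \<Lambda> / diameter e * sqK (side2 e) (W (side2 e))"
    by (rule trace_le[OF s(2,8) a(2)])
  ultimately show ?thesis unfolding distrib_left mult.assoc by linarith
qed

lemma avn_le:
  assumes W: "affine_vfamily W" and e: "e \<in> interior_faces T"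
  shows "sqF e (avn W e) \<le> \<Lambda> / diameter e * (sqK (side1 e) (W (side1 e)) + sqK (side2 e) (W (side2 e)))"
proof -
  note s = sides[OF e]
  let ?a = "\<lambda>x. bdot (W (side1 e) x) (nrm e)" and ?b = "\<lambda>x. bdot (W (side2 e) x) (nrm e)"
  have c: "continuous_on UNIV ?a" "continuous_on UNIV ?b"
    using affine_bdot_side[OF W s(1)] affine_bdot_side[OF W s(2)] by (auto intro: complex_affine_continuous)
  have "sqF e (avn W e) = sqF e (\<lambda>x. ?a x + ?b x) / 4"
    by (simp add: avn_def norm_divide power_divide)
  also have "sqF e (\<lambda>x. ?a x + ?b x) \<le> 2 * (sqF e ?a + sqF e ?b)"
    by (rule compact_measure.norm2_two(1)[OF face_compact_measure[OF e] c])
  finally have "sqF e (avn W e) \<le> (sqF e ?a + sqF e ?b) / 2" by simp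
  also have "\<dots> \<le> sqF e ?a + sqF e ?b" using sqK_nonneg[of "face_measure e" ?a] sqK_nonneg[of "face_measure e" ?b] by simp
  also have "\<dots> \<le> \<Lambda> / diameter e * sqK (side1 e) (W (side1 e)) + \<Lambda> / diameter e * sqK (side2 e) (W (side2 e))"
    by (intro add_mono normal_component_le W e s)
  finally show ?thesis by (simp add: algebra_simps)
qed

lemma face_CS:
  assumes "e \<in> interior_faces T" "complex_affine f" "complex_affine g"
  shows "(norm (ipF e f g))\<^sup>2 \<le> sqF e f * sqF e g"
  by (rule compact_measure.L2_inner_square_le[OF face_compact_measure[OF assms(1)]])
    (auto intro: assms complex_affine_continuous)

text \<open>The residual \<open>\<sigma>\<^sub>h - \<nabla>\<^sub>h u\<^sub>h\<close> is a discrete vector field, so it can be tested with itself on one element.\<close>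

lemma residual_le:
  assumes K: "K \<in> T"
  shows "sqK K (R K) \<le> 2 * \<Lambda>\<^sup>2 * (\<Sum>e\<in>ifaces K. 1 / diameter e * (\<delta>\<^sup>2 * Sg e + P e))"
proof -
  define W where "W = (\<lambda>K'. if K' = K then R K else (\<lambda>_. 0))"
  have W: "affine_vfamily W"
    using affine_R by (auto simp: affine_vfamily_def W_def complex_affine_const)
  let ?\<rho> = "sqK K (R K)" and ?G = "\<lambda>e. 1 / diameter e * (\<delta>\<^sup>2 * Sg e + P e)"
  let ?t = "\<lambda>e. \<i> * of_real \<delta> * ipF e (jmn S e) (jmn W e) - ipF e (jmp U e) (avn W e)"
  have "(\<Sum>K'\<in>T. vipK K' (R K') (W K')) = (\<Sum>K'\<in>T. if K' = K then vipK K (R K) (R K) else 0)"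
    by (intro sum.cong refl) (auto simp: W_def L2_vinner_def cdot_def)
  also have "\<dots> = of_real ?\<rho>" using finite_T K by (simp add: L2_vinner_self)
  finally have lhs: "of_real ?\<rho> = (\<Sum>e\<in>interior_faces T. ?t e)" using vector_form_split[OF W] by simp
  have zero: "?t e = 0" if e: "e \<in> interior_faces T" "\<not> e facet_of K" for e
  proof -
    have "side1 e \<noteq> K" "side2 e \<noteq> K" using sides(7,8)[OF e(1)] e(2) by auto
    then have "jmn W e = (\<lambda>x. 0)" "avn W e = (\<lambda>x. 0)"
      by (auto simp: jmn_def avn_def W_def bdot_def fun_eq_iff)
    then show ?thesis by (simp add: L2_inner_def)
  qed
  have "(\<Sum>e\<in>interior_faces T. ?t e) = (\<Sum>e\<in>ifaces K. ?t e)"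
    using finite_interior_faces zero by (intro sum.mono_neutral_right) (auto simp: ifaces_def)
  then have "complex_of_real ?\<rho> = (\<Sum>e\<in>ifaces K. ?t e)" using lhs by simp
  then have "\<bar>?\<rho>\<bar> = norm (\<Sum>e\<in>ifaces K. ?t e)" by (metis norm_of_real)
  also have "\<dots> \<le> (\<Sum>e\<in>ifaces K. 1 * norm (?t e))" by (simp add: norm_sum)
  finally have 1: "?\<rho> \<le> (\<Sum>e\<in>ifaces K. 1 * norm (?t e))" by simp
  have on_face: "(norm (?t e))\<^sup>2 \<le> 2 * \<Lambda> * ?\<rho> * ?G e" if "e \<in> ifaces K" for e
  proof -
    have e: "e \<in> interior_faces T" "e facet_of K" using that by (auto simp: ifaces_def)
    let ?r = "\<lambda>x. bdot (R K x) (nrm e)"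
    have K12: "K = side1 e \<or> K = side2 e" using sides(4)[OF e(1)] K e(2) by blast
    have ne: "side1 e \<noteq> side2 e" by (rule sides(3)[OF e(1)])
    \<comment> \<open>Only one side of the face carries \<open>W\<close>, so its normal jump is the
      normal trace of the residual up to sign, and its average is half of that.\<close>
    have n: "norm (jmn W e x) = norm (?r x)" "norm (avn W e x) = norm (?r x) / 2" for x
      using K12 ne by (auto simp: jmn_def avn_def W_def bdot_def norm_divide norm_minus_cancel)
    have sq: "sqF e (jmn W e) = sqF e ?r" "sqF e (avn W e) = sqF e ?r / 4"
      unfolding n by (simp_all add: power_divide)
    have r0: "0 \<le> sqF e ?r" by (rule sqK_nonneg)
    have "(norm (ipF e (jmn S e) (jmn W e)))\<^sup>2 \<le> Sg e * sqF e ?r"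
      using face_CS[OF e(1) affine_jmn[OF S e(1)] affine_jmn[OF W e(1)]] by (simp add: Sg_def sq)
    then have 1: "(norm (\<i> * of_real \<delta> * ipF e (jmn S e) (jmn W e)))\<^sup>2 \<le> \<delta>\<^sup>2 * (Sg e * sqF e ?r)"
      by (simp add: norm_mult power_mult_distrib mult_left_mono)
    have "(norm (ipF e (jmp U e) (avn W e)))\<^sup>2 \<le> P e * (sqF e ?r / 4)"
      using face_CS[OF e(1) affine_jmp[OF U e(1)] affine_avn[OF W e(1)]] by (simp add: P_def sq)
    also have "\<dots> \<le> P e * sqF e ?r" using P_nonneg r0 by (intro mult_left_mono) auto
    finally have 2: "(norm (ipF e (jmp U e) (avn W e)))\<^sup>2 \<le> P e * sqF e ?r" .
    have "(norm (?t e))\<^sup>2 \<le> 2 * (\<delta>\<^sup>2 * (Sg e * sqF e ?r) + P e * sqF e ?r)"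
      by (rule order_trans[OF norm_add_square_le(2) mult_left_mono[OF add_mono[OF 1 2]]]) simp
    also have "\<dots> = 2 * (\<delta>\<^sup>2 * Sg e + P e) * sqF e ?r" by (simp add: algebra_simps)
    also have "\<dots> \<le> 2 * (\<delta>\<^sup>2 * Sg e + P e) * (\<Lambda> / diameter e * ?\<rho>)"
      using P_nonneg Sg_nonneg by (intro mult_left_mono normal_component_le affine_R e K) auto
    also have "\<dots> = 2 * \<Lambda> * ?\<rho> * ?G e"
    proof -
      have "2 * a * (b / h * c) = 2 * b * c * (1 / h * a)" for a b c h :: real by simp
      then show ?thesis .
    qed
    finally show ?thesis .
  qed
  show ?thesis
  proof (cases "?\<rho> = 0")
    case True
    have "0 \<le> ?G e" if "e \<in> ifaces K" for e
      using that diam[of e] P_nonneg[of e] Sg_nonneg[of e] by (auto simp: ifaces_def intro!: divide_nonneg_pos)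
    then have "0 \<le> (\<Sum>e\<in>ifaces K. ?G e)" by (rule sum_nonneg)
    then show ?thesis unfolding True by (rule mult_nonneg_nonneg[rotated]) simp
  next
    case False
    then have \<rho>: "?\<rho> > 0" using sqK_nonneg[of "lebesgue_on K" "R K"] by linarith
    \<comment> \<open>Squaring puts one factor \<open>?\<rho>\<close> on the right-hand side, which
      is then divided out.\<close>
    have "?\<rho>\<^sup>2 \<le> (\<Sum>e\<in>ifaces K. 1 * norm (?t e))\<^sup>2" using 1 \<rho> by (intro power_mono) auto
    also have "\<dots> \<le> (\<Sum>e\<in>ifaces K. 1\<^sup>2) * (\<Sum>e\<in>ifaces K. (norm (?t e))\<^sup>2)" by (rule Cauchy_Schwarz_ineq_sum)
    also have "\<dots> \<le> \<Lambda> * (\<Sum>e\<in>ifaces K. 2 * \<Lambda> * ?\<rho> * ?G e)"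
    proof (intro mult_mono sum_mono on_face)
      have "real (card (ifaces K)) \<le> real CARD('n) + 1" using card_ifaces[OF K] by simp
      then show "(\<Sum>e\<in>ifaces K. 1\<^sup>2) \<le> \<Lambda>" using dim_le by simp
    qed (use \<Lambda>_ge_1 in \<open>auto intro!: sum_nonneg\<close>)
    also have "\<dots> = ?\<rho> * (2 * \<Lambda>\<^sup>2 * (\<Sum>e\<in>ifaces K. ?G e))"
      by (simp only: sum_distrib_left[symmetric]) (simp add: power2_eq_square ac_simps)
    finally have "?\<rho> * ?\<rho> \<le> ?\<rho> * (2 * \<Lambda>\<^sup>2 * (\<Sum>e\<in>ifaces K. ?G e))" by (simp add: power2_eq_square)
    then show ?thesis using \<rho> by (rule mult_left_le_imp_le)
  qed
qed

lemma G_nonneg: "e \<in> interior_faces T \<Longrightarrow> 0 \<le> 1 / diameter e ^ j * (\<delta>\<^sup>2 * Sg e + P e)"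
  using diam[of e] P_nonneg[of e] Sg_nonneg[of e] by simp

lemma vsR_le: "vsR \<le> (2 * \<Lambda> * y)\<^sup>2"
proof -
  have "vsR \<le> (\<Sum>K\<in>T. 2 * \<Lambda>\<^sup>2 * (\<Sum>e\<in>ifaces K. 1 / diameter e * (\<delta>\<^sup>2 * Sg e + P e)))"
    unfolding volume_square_def by (intro sum_mono residual_le)
  also have "\<dots> = 2 * \<Lambda>\<^sup>2 * (\<Sum>e\<in>interior_faces T. 1 / diameter e * (\<delta>\<^sup>2 * Sg e + P e) + 1 / diameter e * (\<delta>\<^sup>2 * Sg e + P e))"
    unfolding sum_distrib_left[symmetric] sum_both_sides[where F = "\<lambda>K e. 1 / diameter e * (\<delta>\<^sup>2 * Sg e + P e)", symmetric] ..
  also have "\<dots> \<le> 2 * \<Lambda>\<^sup>2 * (y\<^sup>2 + y\<^sup>2)"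
    unfolding sum.distrib by (intro mult_left_mono add_mono sum_le_y2 weights(5)) auto
  finally show ?thesis by (simp add: power_mult_distrib)
qed

text \<open>In \<open>aR V\<close> neither factor is a jump of \<open>u\<close>, and each of the two
  squared traces costs \<open>1 / h\<close>; the residual has to absorb the whole weight. This needs
  \<open>residual_le\<close> element by element and comparable facet diameters within an
  element.\<close>

lemma weighted_residual_le:
  "(\<Sum>e\<in>interior_faces T. 1 / (diameter e)\<^sup>2 * (sqK (side1 e) (R (side1 e)) + sqK (side2 e) (R (side2 e)))) \<le> (2 * \<Lambda> ^ 3 * y)\<^sup>2"
proof -
  let ?G = "\<lambda>e. 1 / diameter e ^ 3 * (\<delta>\<^sup>2 * Sg e + P e)"
  have K: "(\<Sum>e\<in>ifaces K. 1 / (diameter e)\<^sup>2 * sqK K (R K)) \<le> 2 * \<Lambda> ^ 5 * (\<Sum>e\<in>ifaces K. ?G e)" if K: "K \<in> T" for K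
  proof -
    have "1 / (diameter e)\<^sup>2 * sqK K (R K) \<le> 2 * \<Lambda> ^ 4 * (\<Sum>e'\<in>ifaces K. ?G e')" if "e \<in> ifaces K" for e
    proof -
      have e: "e \<in> interior_faces T" "e facet_of K" using that by (auto simp: ifaces_def)
      have h: "diameter e > 0" by (rule diam[OF e(1)])
      have "1 / (diameter e)\<^sup>2 * sqK K (R K) \<le> 1 / (diameter e)\<^sup>2 * (2 * \<Lambda>\<^sup>2 * (\<Sum>e'\<in>ifaces K. 1 / diameter e' * (\<delta>\<^sup>2 * Sg e' + P e')))"
        using h by (intro mult_left_mono residual_le K) auto
      also have "\<dots> = 2 * \<Lambda>\<^sup>2 * (\<Sum>e'\<in>ifaces K. 1 / (diameter e)\<^sup>2 * (1 / diameter e' * (\<delta>\<^sup>2 * Sg e' + P e')))"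
        by (simp add: sum_distrib_left ac_simps)
      also have "\<dots> \<le> 2 * \<Lambda>\<^sup>2 * (\<Sum>e'\<in>ifaces K. \<Lambda>\<^sup>2 * ?G e')"
      proof (intro mult_left_mono sum_mono)
        fix e' assume "e' \<in> ifaces K"
        then have e': "e' \<in> interior_faces T" "e' facet_of K" by (auto simp: ifaces_def)
        have h': "diameter e' > 0" by (rule diam[OF e'(1)])
        have "(diameter e')\<^sup>2 \<le> (\<Lambda> * diameter e)\<^sup>2"
          using diam_le[OF K e'(2) e(2)] h' by (intro power_mono) auto
        then have "1 / (diameter e)\<^sup>2 \<le> \<Lambda>\<^sup>2 * (1 / (diameter e')\<^sup>2)"
          using h h' by (simp add: power_mult_distrib divide_simps)
        moreover have "0 \<le> 1 / diameter e' * (\<delta>\<^sup>2 * Sg e' + P e')" using G_nonneg[OF e'(1), of 1] by simp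
        ultimately have "1 / (diameter e)\<^sup>2 * (1 / diameter e' * (\<delta>\<^sup>2 * Sg e' + P e'))
            \<le> \<Lambda>\<^sup>2 * (1 / (diameter e')\<^sup>2) * (1 / diameter e' * (\<delta>\<^sup>2 * Sg e' + P e'))" by (rule mult_right_mono)
        also have "\<dots> = \<Lambda>\<^sup>2 * ?G e'" using h' by (simp add: power2_eq_square power3_eq_cube)
        finally show "1 / (diameter e)\<^sup>2 * (1 / diameter e' * (\<delta>\<^sup>2 * Sg e' + P e')) \<le> \<Lambda>\<^sup>2 * ?G e'" .
      qed simp
      also have "\<dots> = 2 * (\<Lambda>\<^sup>2 * \<Lambda>\<^sup>2) * (\<Sum>e'\<in>ifaces K. ?G e')"
        by (simp only: sum_distrib_left[symmetric] mult.assoc)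
      also have "\<Lambda>\<^sup>2 * \<Lambda>\<^sup>2 = \<Lambda> ^ 4" by (simp flip: power_add)
      finally show ?thesis .
    qed
    then have "(\<Sum>e\<in>ifaces K. 1 / (diameter e)\<^sup>2 * sqK K (R K)) \<le> real (card (ifaces K)) * (2 * \<Lambda> ^ 4 * (\<Sum>e'\<in>ifaces K. ?G e'))"
      using sum_mono[of "ifaces K" _ "\<lambda>_. 2 * \<Lambda> ^ 4 * (\<Sum>e'\<in>ifaces K. ?G e')"] by simp
    also have "\<dots> \<le> \<Lambda> * (2 * \<Lambda> ^ 4 * (\<Sum>e'\<in>ifaces K. ?G e'))"
    proof (rule mult_right_mono)
      have "real (card (ifaces K)) \<le> real CARD('n) + 1" using card_ifaces[OF K] by simp
      then show "real (card (ifaces K)) \<le> \<Lambda>" using dim_le by simp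
      have "0 \<le> (\<Sum>e'\<in>ifaces K. ?G e')" by (intro sum_nonneg G_nonneg) (simp add: ifaces_def)
      then show "0 \<le> 2 * \<Lambda> ^ 4 * (\<Sum>e'\<in>ifaces K. ?G e')" by simp
    qed
    finally show ?thesis by (simp add: power_numeral_reduce ac_simps)
  qed
  have "(\<Sum>e\<in>interior_faces T. 1 / (diameter e)\<^sup>2 * (sqK (side1 e) (R (side1 e)) + sqK (side2 e) (R (side2 e))))
    = (\<Sum>K\<in>T. \<Sum>e\<in>ifaces K. 1 / (diameter e)\<^sup>2 * sqK K (R K))"
    unfolding distrib_left by (rule sum_both_sides[where F = "\<lambda>K e. 1 / (diameter e)\<^sup>2 * sqK K (R K)"])
  also have "\<dots> \<le> (\<Sum>K\<in>T. 2 * \<Lambda> ^ 5 * (\<Sum>e\<in>ifaces K. ?G e))" by (intro sum_mono K)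
  also have "\<dots> = 2 * \<Lambda> ^ 5 * (\<Sum>e\<in>interior_faces T. ?G e + ?G e)"
    unfolding sum_distrib_left[symmetric] sum_both_sides[where F = "\<lambda>K e. ?G e", symmetric] ..
  also have "\<dots> \<le> 2 * \<Lambda> ^ 5 * (y\<^sup>2 + y\<^sup>2)"
    unfolding sum.distrib using \<Lambda>_ge_1 by (intro mult_left_mono add_mono sum_le_y2 weights(6)) auto
  also have "\<dots> = 4 * \<Lambda> ^ 5 * y\<^sup>2" by simp
  \<comment> \<open>The exponent is raised to an even number so that the bound is a square.\<close>
  also have "\<dots> \<le> 4 * \<Lambda> ^ 6 * y\<^sup>2"
    using \<Lambda>_ge_1 by (intro mult_right_mono mult_left_mono power_increasing) auto
  also have "\<dots> = (2 * \<Lambda> ^ 3 * y)\<^sup>2" by (simp add: power_mult_distrib flip: power_mult)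
  finally show ?thesis .
qed

lemma norm_sum_face_le:
  assumes "\<And>e. e \<in> interior_faces T \<Longrightarrow> (norm (z e :: complex))\<^sup>2 \<le> c\<^sup>2 * p e * (Q (side1 e) + Q (side2 e))"
    and "\<And>e. e \<in> interior_faces T \<Longrightarrow> 0 \<le> p e" and "\<And>K. K \<in> T \<Longrightarrow> 0 \<le> Q K"
    and "(\<Sum>e\<in>interior_faces T. p e) \<le> a\<^sup>2" and "(\<Sum>K\<in>T. Q K) \<le> b\<^sup>2" and "0 \<le> c" "0 \<le> a" "0 \<le> b"
  shows "norm (\<Sum>e\<in>interior_faces T. z e) \<le> c * \<Lambda> * (a * b)"
  by (rule order_trans[OF norm_sum face_sum_le]) (use assms in auto)

lemma pow_\<Lambda>: "i \<le> j \<Longrightarrow> \<Lambda> ^ i \<le> \<Lambda> ^ j"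
  by (rule power_increasing[OF _ \<Lambda>_ge_1])

lemma power2_le_of_abs: "\<bar>a\<bar> \<le> b \<Longrightarrow> a\<^sup>2 \<le> b\<^sup>2" for a b :: real
  using power_mono[of "\<bar>a\<bar>" b 2] by simp

lemma pow_3_le_4: "2 * \<Lambda> ^ 3 \<le> 4 * \<Lambda> ^ 4"
proof -
  have "0 \<le> \<Lambda> ^ 4" using \<Lambda>_ge_1 by simp
  then show ?thesis using pow_\<Lambda>[of 3 4] by linarith
qed

lemma vsB_le: "(\<Sum>K\<in>T. sqK K (B K)) \<le> X\<^sup>2"
  using X_square volume_square_nonneg[of U] boundary_square_nonneg[of B] by (simp add: volume_square_def)

lemma weight_nonneg: "e \<in> interior_faces T \<Longrightarrow> 0 \<le> c \<Longrightarrow> 0 \<le> c / diameter e ^ j * P e"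
  using diam[of e] P_nonneg[of e] by simp

section \<open>Bounds for the face terms of the energy and Rellich identities\<close>

lemma aB_U_le: "norm (aB U) \<le> \<Lambda> * \<Lambda> * (y * X)"
  unfolding aB_def
proof (rule norm_sum_face_le[where p = "\<lambda>e. 1 / diameter e * P e" and Q = "\<lambda>K. sqK K (B K)"])
  fix e assume e: "e \<in> interior_faces T"
  let ?q = "sqK (side1 e) (B (side1 e)) + sqK (side2 e) (B (side2 e))"
  have q: "0 \<le> ?q" by (simp add: sqK_nonneg)
  have "(norm (ipF e (avn B e) (jmp U e)))\<^sup>2 \<le> sqF e (avn B e) * P e"
    using face_CS[OF e affine_avn[OF affine_B e] affine_jmp[OF U e]] by (simp add: P_def)
  also have "\<dots> \<le> \<Lambda> / diameter e * ?q * P e"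
    by (intro mult_right_mono avn_le affine_B e P_nonneg)
  also have "\<dots> = \<Lambda> * (1 / diameter e * P e) * ?q"
  proof -
    have "a / h * q * p = a * (1 / h * p) * q" for a h p q :: real by simp
    then show ?thesis .
  qed
  also have "\<dots> \<le> \<Lambda>\<^sup>2 * (1 / diameter e * P e) * ?q"
    using weight_nonneg[OF e, of 1 1] q \<Lambda>_ge_1 by (intro mult_right_mono) (auto simp: power2_eq_square)
  finally show "(norm (ipF e (avn B e) (jmp U e)))\<^sup>2 \<le> \<Lambda>\<^sup>2 * (1 / diameter e * P e) * ?q" .
  show "0 \<le> 1 / diameter e * P e" using weight_nonneg[OF e, of 1 1] by simp
next
  show "(\<Sum>e\<in>interior_faces T. 1 / diameter e * P e) \<le> y\<^sup>2" by (intro sum_le_y2 weights(2))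
qed (use sqK_nonneg vsB_le X_nonneg y_nonneg \<Lambda>_ge_1 in auto)

lemma aR_U_le: "norm (aR U) \<le> \<Lambda> * \<Lambda> * (y * (2 * \<Lambda> * y))"
  unfolding aR_def
proof (rule norm_sum_face_le[where p = "\<lambda>e. 1 / diameter e * P e" and Q = "\<lambda>K. sqK K (R K)"])
  fix e assume e: "e \<in> interior_faces T"
  let ?q = "sqK (side1 e) (R (side1 e)) + sqK (side2 e) (R (side2 e))"
  have q: "0 \<le> ?q" by (simp add: sqK_nonneg)
  have "(norm (ipF e (avn R e) (jmp U e)))\<^sup>2 \<le> sqF e (avn R e) * P e"
    using face_CS[OF e affine_avn[OF affine_R e] affine_jmp[OF U e]] by (simp add: P_def)
  also have "\<dots> \<le> \<Lambda> / diameter e * ?q * P e"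
    by (intro mult_right_mono avn_le affine_R e P_nonneg)
  also have "\<dots> = \<Lambda> * (1 / diameter e * P e) * ?q"
  proof -
    have "a / h * q * p = a * (1 / h * p) * q" for a h p q :: real by simp
    then show ?thesis .
  qed
  also have "\<dots> \<le> \<Lambda>\<^sup>2 * (1 / diameter e * P e) * ?q"
    using weight_nonneg[OF e, of 1 1] q \<Lambda>_ge_1 by (intro mult_right_mono) (auto simp: power2_eq_square)
  finally show "(norm (ipF e (avn R e) (jmp U e)))\<^sup>2 \<le> \<Lambda>\<^sup>2 * (1 / diameter e * P e) * ?q" .
  show "0 \<le> 1 / diameter e * P e" using weight_nonneg[OF e, of 1 1] by simp
next
  show "(\<Sum>e\<in>interior_faces T. 1 / diameter e * P e) \<le> y\<^sup>2" by (intro sum_le_y2 weights(2))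
  show "(\<Sum>K\<in>T. sqK K (R K)) \<le> (2 * \<Lambda> * y)\<^sup>2" using vsR_le by (simp add: volume_square_def)
qed (use sqK_nonneg y_nonneg \<Lambda>_ge_1 in auto)

lemma V_le: assumes "K \<in> T" "x \<in> K" shows "norm (V K x) \<le> \<Lambda> * norm (B K x)"
proof -
  have "x \<in> closure \<Omega>" using K_subset_closure[OF assms(1)] assms(2) by blast
  then have d: "norm (x - x0) \<le> \<Lambda>" by (rule dist_le)
  have "norm (V K x) \<le> norm (B K x) * norm (x - x0)" by (simp add: V_def B_def norm_bdot_le)
  also have "\<dots> \<le> norm (B K x) * \<Lambda>" using d by (intro mult_left_mono) auto
  finally show ?thesis by (simp add: mult.commute)
qed

lemma sqK_V_le: assumes "K \<in> T" shows "sqK K (V K) \<le> \<Lambda>\<^sup>2 * sqK K (B K)"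
  by (rule compact_measure.norm2_mono[OF compact_measures(1)[OF assms]])
    (use V_le[OF assms] \<Lambda>_ge_1 family_continuous[OF affine_V assms] vfamily_continuous[OF affine_B assms] in auto)

lemma sqF_V_le: assumes "K \<in> T" "e facet_of K" shows "sqF e (V K) \<le> \<Lambda>\<^sup>2 * sqF e (B K)"
  by (rule compact_measure.norm2_mono[OF compact_measures(2)[OF assms]])
    (use V_le[OF assms(1)] facet_subset[OF assms(2)] \<Lambda>_ge_1 family_continuous[OF affine_V assms(1)]
      vfamily_continuous[OF affine_B assms(1)] in \<open>auto simp: space_face_measure\<close>)

lemma jmp_V_le:
  assumes e: "e \<in> interior_faces T"
  shows "sqF e (jmp V e) \<le> 2 * (\<Lambda> ^ 3 / diameter e) * (sqK (side1 e) (B (side1 e)) + sqK (side2 e) (B (side2 e)))"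
proof -
  have "sqF e (jmp V e) \<le> 2 * (\<Lambda> / diameter e) * (sqK (side1 e) (V (side1 e)) + sqK (side2 e) (V (side2 e)))"
    by (rule jmp_le[OF affine_V e])
  also have "\<dots> \<le> 2 * (\<Lambda> / diameter e) * (\<Lambda>\<^sup>2 * sqK (side1 e) (B (side1 e)) + \<Lambda>\<^sup>2 * sqK (side2 e) (B (side2 e)))"
    using diam[OF e] \<Lambda>_ge_1 by (intro mult_left_mono add_mono sqK_V_le sides(1,2)[OF e]) auto
  also have "\<dots> = 2 * (\<Lambda> ^ 3 / diameter e) * (sqK (side1 e) (B (side1 e)) + sqK (side2 e) (B (side2 e)))"
    by (simp add: power2_eq_square power3_eq_cube algebra_simps)
  finally show ?thesis .
qed

lemma aR_V_le: "norm (aR V) \<le> (2 * \<Lambda>\<^sup>2) * \<Lambda> * (2 * \<Lambda> ^ 3 * y * X)"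
  unfolding aR_def
proof (rule norm_sum_face_le[where p = "\<lambda>e. 1 / (diameter e)\<^sup>2 * (sqK (side1 e) (R (side1 e)) + sqK (side2 e) (R (side2 e)))"
    and Q = "\<lambda>K. sqK K (B K)"])
  fix e assume e: "e \<in> interior_faces T"
  let ?q = "sqK (side1 e) (B (side1 e)) + sqK (side2 e) (B (side2 e))"
  let ?r = "sqK (side1 e) (R (side1 e)) + sqK (side2 e) (R (side2 e))"
  have h: "diameter e > 0" by (rule diam[OF e])
  have q: "0 \<le> ?q" and r: "0 \<le> ?r" by (simp_all add: sqK_nonneg)
  have "(norm (ipF e (avn R e) (jmp V e)))\<^sup>2 \<le> sqF e (avn R e) * sqF e (jmp V e)"
    by (rule face_CS[OF e affine_avn[OF affine_R e] affine_jmp[OF affine_V e]])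
  also have "\<dots> \<le> (\<Lambda> / diameter e * ?r) * (2 * (\<Lambda> ^ 3 / diameter e) * ?q)"
    using h r \<Lambda>_ge_1 by (intro mult_mono avn_le affine_R e jmp_V_le sqK_nonneg) auto
  also have "\<dots> = 2 * \<Lambda> ^ 4 * (1 / (diameter e)\<^sup>2 * ?r) * ?q"
  proof -
    have "(a / h * r) * (2 * (a ^ 3 / h) * q) = 2 * a ^ 4 * (1 / h\<^sup>2 * r) * q" for a h r q :: real
      by (simp add: power2_eq_square power_numeral_reduce)
    then show ?thesis .
  qed
  also have "\<dots> \<le> 4 * \<Lambda> ^ 4 * (1 / (diameter e)\<^sup>2 * ?r) * ?q"
    using q r \<Lambda>_ge_1 by (intro mult_right_mono) auto
  also have "4 * \<Lambda> ^ 4 = (2 * \<Lambda>\<^sup>2)\<^sup>2" by (simp add: power_mult_distrib flip: power_mult)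
  finally show "(norm (ipF e (avn R e) (jmp V e)))\<^sup>2 \<le> (2 * \<Lambda>\<^sup>2)\<^sup>2 * (1 / (diameter e)\<^sup>2 * ?r) * ?q" .
  show "0 \<le> 1 / (diameter e)\<^sup>2 * ?r" using r by simp
next
  show "(\<Sum>e\<in>interior_faces T. 1 / (diameter e)\<^sup>2 * (sqK (side1 e) (R (side1 e)) + sqK (side2 e) (R (side2 e)))) \<le> (2 * \<Lambda> ^ 3 * y)\<^sup>2"
    by (rule weighted_residual_le)
qed (use sqK_nonneg vsB_le X_nonneg y_nonneg \<Lambda>_ge_1 in auto)

lemma bU_V_le: "norm (of_real \<beta> * bU V) \<le> (2 * \<Lambda>\<^sup>2) * \<Lambda> * (y * X)"
  unfolding bU_def sum_distrib_left
proof (rule norm_sum_face_le[where p = "\<lambda>e. \<beta>\<^sup>2 / diameter e * P e" and Q = "\<lambda>K. sqK K (B K)"])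
  fix e assume e: "e \<in> interior_faces T"
  let ?q = "sqK (side1 e) (B (side1 e)) + sqK (side2 e) (B (side2 e))"
  have q: "0 \<le> ?q" by (simp add: sqK_nonneg)
  have "(norm (ipF e (jmp U e) (jmp V e)))\<^sup>2 \<le> P e * sqF e (jmp V e)"
    using face_CS[OF e affine_jmp[OF U e] affine_jmp[OF affine_V e]] by (simp add: P_def)
  also have "\<dots> \<le> P e * (2 * (\<Lambda> ^ 3 / diameter e) * ?q)"
    by (intro mult_left_mono jmp_V_le e P_nonneg)
  finally have "(norm (ipF e (jmp U e) (jmp V e)))\<^sup>2 \<le> P e * (2 * (\<Lambda> ^ 3 / diameter e) * ?q)" .
  then have "\<beta>\<^sup>2 * (norm (ipF e (jmp U e) (jmp V e)))\<^sup>2 \<le> \<beta>\<^sup>2 * (P e * (2 * (\<Lambda> ^ 3 / diameter e) * ?q))"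
    by (rule mult_left_mono) simp
  also have "\<beta>\<^sup>2 * (norm (ipF e (jmp U e) (jmp V e)))\<^sup>2 = (norm (of_real \<beta> * ipF e (jmp U e) (jmp V e)))\<^sup>2"
    by (simp add: norm_mult power_mult_distrib)
  finally have "(norm (of_real \<beta> * ipF e (jmp U e) (jmp V e)))\<^sup>2 \<le> \<beta>\<^sup>2 * (P e * (2 * (\<Lambda> ^ 3 / diameter e) * ?q))" .
  also have "\<dots> = 2 * \<Lambda> ^ 3 * (\<beta>\<^sup>2 / diameter e * P e) * ?q"
  proof -
    have "b * (p * (2 * (a / h) * q)) = 2 * a * (b / h * p) * q" for a b h p q :: real by simp
    then show ?thesis .
  qed
  also have "\<dots> \<le> (4 * \<Lambda> ^ 4) * (\<beta>\<^sup>2 / diameter e * P e) * ?q"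
    using weight_nonneg[OF e, of "\<beta>\<^sup>2" 1] q by (intro mult_right_mono pow_3_le_4) auto
  also have "4 * \<Lambda> ^ 4 = (2 * \<Lambda>\<^sup>2)\<^sup>2" by (simp add: power_mult_distrib flip: power_mult)
  finally show "(norm (of_real \<beta> * ipF e (jmp U e) (jmp V e)))\<^sup>2 \<le> (2 * \<Lambda>\<^sup>2)\<^sup>2 * (\<beta>\<^sup>2 / diameter e * P e) * ?q" .
  show "0 \<le> \<beta>\<^sup>2 / diameter e * P e" using weight_nonneg[OF e, of "\<beta>\<^sup>2" 1] by simp
next
  show "(\<Sum>e\<in>interior_faces T. \<beta>\<^sup>2 / diameter e * P e) \<le> y\<^sup>2" by (intro sum_le_y2 weights(4))
qed (use sqK_nonneg vsB_le X_nonneg y_nonneg \<Lambda>_ge_1 in auto)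

text \<open>A difference of squared moduli is the real part of the jump times the conjugate of the
  sum, so one factor is a jump of \<open>u\<close>. After squaring, \<open>k ^ 4\<close> is shared
  between the jump weight \<open>k\<^sup>2 / h\<close> and the element norms, which with
  \<open>k\<^sup>2\<close> are part of \<open>X\<close>.\<close>

lemma square_jump_le:
  "k\<^sup>2 * (\<Sum>e\<in>interior_faces T. off x0 (side1 e) e * (sqF e (U (side1 e)) - sqF e (U (side2 e))))
    \<le> (2 * \<Lambda>\<^sup>2) * \<Lambda> * (y * X)"
  unfolding sum_distrib_left
proof (rule face_sum_le[where p = "\<lambda>e. k\<^sup>2 / diameter e * P e" and Q = "\<lambda>K. k\<^sup>2 * sqK K (U K)"])
  fix e assume e: "e \<in> interior_faces T"
  note s = sides[OF e]
  let ?U1 = "U (side1 e)" and ?U2 = "U (side2 e)"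
  let ?q = "sqK (side1 e) ?U1 + sqK (side2 e) ?U2"
  have q: "0 \<le> ?q" by (simp add: sqK_nonneg)
  have a: "complex_affine ?U1" "complex_affine ?U2" using U s by (auto simp: affine_family_def)
  have c: "continuous_on UNIV ?U1" "continuous_on UNIV ?U2" using a by (auto intro: complex_affine_continuous)
  interpret M: compact_measure "face_measure e" by (rule face_compact_measure[OF e])
  have i: "integrable (face_measure e) (\<lambda>x. (norm (?U1 x))\<^sup>2)" "integrable (face_measure e) (\<lambda>x. (norm (?U2 x))\<^sup>2)"
    using c by (auto intro: M.norm2_integrable)
  have ic: "integrable (face_measure e) (\<lambda>x. jmp U e x * cnj (?U1 x + ?U2 x))"
    using c complex_affine_continuous[OF affine_jmp[OF U e]]
    by (intro M.integrable_continuous continuous_intros)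
  have "sqF e ?U1 - sqF e ?U2 = (LINT x|face_measure e. (norm (?U1 x))\<^sup>2 - (norm (?U2 x))\<^sup>2)"
    using i by simp
  also have "\<dots> = (LINT x|face_measure e. Re (jmp U e x * cnj (?U1 x + ?U2 x)))"
  proof (intro Bochner_Integration.integral_cong refl)
    have "(norm a)\<^sup>2 - (norm b)\<^sup>2 = Re ((a - b) * cnj (a + b))" for a b :: complex
      unfolding cmod_power2 by (simp add: power2_eq_square algebra_simps)
    then show "(norm (?U1 x))\<^sup>2 - (norm (?U2 x))\<^sup>2 = Re (jmp U e x * cnj (?U1 x + ?U2 x))" for x
      unfolding jmp_def .
  qed
  also have "\<dots> = Re (ipF e (jmp U e) (\<lambda>x. ?U1 x + ?U2 x))"
    unfolding L2_inner_def by (rule integral_Re[OF ic])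
  finally have eq: "sqF e ?U1 - sqF e ?U2 = Re (ipF e (jmp U e) (\<lambda>x. ?U1 x + ?U2 x))" .
  have "\<bar>sqF e ?U1 - sqF e ?U2\<bar> \<le> norm (ipF e (jmp U e) (\<lambda>x. ?U1 x + ?U2 x))"
    unfolding eq by (rule abs_Re_le_cmod)
  then have "(sqF e ?U1 - sqF e ?U2)\<^sup>2 \<le> (norm (ipF e (jmp U e) (\<lambda>x. ?U1 x + ?U2 x)))\<^sup>2"
    by (rule power2_le_of_abs)
  also have "\<dots> \<le> P e * sqF e (\<lambda>x. ?U1 x + ?U2 x)"
    unfolding P_def by (intro face_CS e affine_jmp U complex_affine_add a)
  also have "\<dots> \<le> P e * (2 * (\<Lambda> / diameter e * sqK (side1 e) ?U1 + \<Lambda> / diameter e * sqK (side2 e) ?U2))"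
    by (rule mult_left_mono[OF order_trans[OF M.norm2_two(1)[OF c]
        mult_left_mono[OF add_mono[OF trace_le[OF s(1,7) a(1)] trace_le[OF s(2,8) a(2)]]]] P_nonneg]) simp
  also have "\<dots> = 2 * (\<Lambda> / diameter e) * P e * ?q"
  proof -
    have "p * (2 * (w * u + w * v)) = 2 * w * p * (u + v)" for p w u v :: real by (simp add: algebra_simps)
    then show ?thesis .
  qed
  finally have d: "(sqF e ?U1 - sqF e ?U2)\<^sup>2 \<le> 2 * (\<Lambda> / diameter e) * P e * ?q" .
  have "(off x0 (side1 e) e)\<^sup>2 \<le> \<Lambda>\<^sup>2"
    by (rule power2_le_of_abs[OF off_le[OF s(1,7)]])
  then have "(off x0 (side1 e) e)\<^sup>2 * (sqF e ?U1 - sqF e ?U2)\<^sup>2 \<le> \<Lambda>\<^sup>2 * (2 * (\<Lambda> / diameter e) * P e * ?q)"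
    using d by (intro mult_mono) auto
  then have "k ^ 4 * ((off x0 (side1 e) e)\<^sup>2 * (sqF e ?U1 - sqF e ?U2)\<^sup>2) \<le> k ^ 4 * (\<Lambda>\<^sup>2 * (2 * (\<Lambda> / diameter e) * P e * ?q))"
    by (intro mult_left_mono) auto
  also have "\<dots> = 2 * \<Lambda> ^ 3 * (k\<^sup>2 / diameter e * P e) * (k\<^sup>2 * ?q)"
  proof -
    have "k ^ 4 * (a\<^sup>2 * (2 * (a / h) * p * q)) = 2 * a ^ 3 * (k\<^sup>2 / h * p) * (k\<^sup>2 * q)" for a h p q k :: real
      by (simp add: power2_eq_square power_numeral_reduce)
    then show ?thesis .
  qed
  also have "\<dots> \<le> (4 * \<Lambda> ^ 4) * (k\<^sup>2 / diameter e * P e) * (k\<^sup>2 * ?q)"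
    by (rule mult_right_mono[OF mult_right_mono[OF pow_3_le_4]])
      (use weight_nonneg[OF e, of "k\<^sup>2" 1] q in auto)
  also have "4 * \<Lambda> ^ 4 = (2 * \<Lambda>\<^sup>2)\<^sup>2" by (simp add: power_mult_distrib flip: power_mult)
  finally have "k ^ 4 * ((off x0 (side1 e) e)\<^sup>2 * (sqF e ?U1 - sqF e ?U2)\<^sup>2) \<le>
    (2 * \<Lambda>\<^sup>2)\<^sup>2 * (k\<^sup>2 / diameter e * P e) * (k\<^sup>2 * ?q)" .
  moreover have "k ^ 4 * (a\<^sup>2 * b\<^sup>2) = (k\<^sup>2 * (a * b))\<^sup>2" for a b
    by (simp add: power_mult_distrib flip: power_mult)
  ultimately show "(k\<^sup>2 * (off x0 (side1 e) e * (sqF e ?U1 - sqF e ?U2)))\<^sup>2 \<le>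
     (2 * \<Lambda>\<^sup>2)\<^sup>2 * (k\<^sup>2 / diameter e * P e) * (k\<^sup>2 * sqK (side1 e) ?U1 + k\<^sup>2 * sqK (side2 e) ?U2)"
    by (simp only: distrib_left)
  show "0 \<le> k\<^sup>2 / diameter e * P e" using weight_nonneg[OF e, of "k\<^sup>2" 1] by simp
next
  show "(\<Sum>e\<in>interior_faces T. k\<^sup>2 / diameter e * P e) \<le> y\<^sup>2" by (intro sum_le_y2 weights(1))
  show "(\<Sum>K\<in>T. k\<^sup>2 * sqK K (U K)) \<le> X\<^sup>2"
    using X_square volume_square_nonneg[of B] boundary_square_nonneg[of B]
    by (simp add: volume_square_def sum_distrib_left)
qed (use sqK_nonneg X_nonneg y_nonneg \<Lambda>_ge_1 in auto)

lemma complex_vector_Re_Im: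
  fixes t :: "complex^'n"
  shows "(norm t)\<^sup>2 = (norm (\<chi> i. Re (t $ i)))\<^sup>2 + (norm (\<chi> i. Im (t $ i)))\<^sup>2"
proof -
  have "(norm t)\<^sup>2 = (\<Sum>i\<in>UNIV. (norm (t $ i))\<^sup>2)" by (simp add: norm_vec_def L2_set_def sum_nonneg)
  also have "\<dots> = (\<Sum>i\<in>UNIV. (Re (t $ i))\<^sup>2) + (\<Sum>i\<in>UNIV. (Im (t $ i))\<^sup>2)"
    by (simp add: cmod_power2 sum.distrib)
  finally show ?thesis by (simp add: norm_vec_def L2_set_def sum_nonneg)
qed

text \<open>The inverse estimate is stated for real tangential directions. It is applied along the
  real and along the imaginary part of \<open>\<tau>\<close>, and the two parts together give the
  factor 2.\<close>

lemma tangential_jump_gradient_le: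
  assumes e: "e \<in> interior_faces T"
  defines "t \<equiv> cgrad (jmp U e)"
  defines "\<tau> \<equiv> t - (\<chi> i. bdot t (nrm e) * of_real (nrm e $ i))"
  shows "farea e * (norm \<tau>)\<^sup>2 \<le> 2 * (\<Lambda> / (diameter e)\<^sup>2) * P e"
proof -
  note s = sides[OF e]
  let ?n = "nrm e" and ?c = "\<Lambda> / (diameter e)\<^sup>2 * P e"
  have c0: "0 \<le> ?c" using \<Lambda>_ge_1 P_nonneg by simp
  have \<tau>n: "bdot \<tau> ?n = 0"
    unfolding \<tau>_def bdot_diff_left bdot_of_real_left by (simp add: s(6))
  have real_part: "farea e * (norm r)\<^sup>2 \<le> ?c"
    if r: "?n \<bullet> r = 0" and d: "(norm r)\<^sup>2 \<le> norm (bdot \<tau> r)" for r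
  proof (cases "r = 0")
    case True then show ?thesis using c0 by simp
  next
    case False
    have "bdot (\<chi> i. bdot t ?n * of_real (?n $ i)) r = bdot t ?n * of_real (?n \<bullet> r)"
      by (simp add: bdot_def inner_vec_def sum_distrib_left mult.assoc)
    then have "bdot \<tau> r = bdot t r" by (simp add: \<tau>_def bdot_diff_left r)
    then have "((norm r)\<^sup>2)\<^sup>2 \<le> (norm (bdot t r))\<^sup>2" using d by (intro power_mono) auto
    then have "farea e * ((norm r)\<^sup>2)\<^sup>2 \<le> farea e * (norm (bdot t r))\<^sup>2"
      by (intro mult_left_mono farea_nonneg)
    also have "\<dots> \<le> \<Lambda> / (diameter e)\<^sup>2 * (norm r)\<^sup>2 * P e"
      unfolding farea_def P_def t_def
      by (rule tangential_le[OF s(1,7) affine_jmp[OF U e]]) (use r in \<open>simp add: nrm_def\<close>)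
    finally have "(norm r)\<^sup>2 * (farea e * (norm r)\<^sup>2) \<le> (norm r)\<^sup>2 * ?c"
      by (simp add: power2_eq_square[of "(norm r)\<^sup>2"] ac_simps)
    moreover have "0 < (norm r)\<^sup>2" using False by simp
    ultimately show ?thesis by (rule mult_left_le_imp_le)
  qed
  let ?re = "\<chi> i. Re (\<tau> $ i)" and ?im = "\<chi> i. Im (\<tau> $ i)"
  have "Re (bdot \<tau> ?n) = ?n \<bullet> ?re" "Im (bdot \<tau> ?n) = ?n \<bullet> ?im"
    by (simp_all add: bdot_def inner_vec_def mult.commute)
  then have o: "?n \<bullet> ?re = 0" "?n \<bullet> ?im = 0" using \<tau>n by auto
  have "(norm ?re)\<^sup>2 = Re (bdot \<tau> ?re)" "(norm ?im)\<^sup>2 = Im (bdot \<tau> ?im)"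
    unfolding power2_norm_eq_inner by (simp_all add: bdot_def inner_vec_def)
  then have d: "(norm ?re)\<^sup>2 \<le> norm (bdot \<tau> ?re)" "(norm ?im)\<^sup>2 \<le> norm (bdot \<tau> ?im)"
    using complex_Re_le_cmod[of "bdot \<tau> ?re"] abs_Im_le_cmod[of "bdot \<tau> ?im"] by linarith+
  show ?thesis
    using real_part[OF o(1) d(1)] real_part[OF o(2) d(2)]
    unfolding complex_vector_Re_Im[of \<tau>] distrib_left mult.assoc by linarith
qed

text \<open>By \<open>tangential_jump_bound\<close> the integrand is at most a multiple of averaged
  gradient times tangential jump. In squared form the former costs \<open>1 / h\<close> by the trace
  inequality and the latter \<open>1 / h\<^sup>2\<close> by the inverse estimate, in total the
  weight \<open>1 / h ^ 3\<close>.\<close>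

lemma Z_bound:
  assumes e: "e \<in> interior_faces T"
  shows "(Z e)\<^sup>2 \<le> (6 * \<Lambda>\<^sup>2)\<^sup>2 * (1 / diameter e ^ 3 * P e) * (sqK (side1 e) (B (side1 e)) + sqK (side2 e) (B (side2 e)))"
proof -
  note s = sides[OF e]
  let ?b1 = "cgrad (U (side1 e))" and ?b2 = "cgrad (U (side2 e))" and ?n = "nrm e" and ?h = "diameter e"
  define o' where "o' = off x0 (side1 e) e"
  define m where "m = (1/2) *\<^sub>R (?b1 + ?b2)"
  define t where "t = ?b1 - ?b2"
  define \<tau> where "\<tau> = t - (\<chi> i. bdot t ?n * of_real (?n $ i))"
  let ?q = "sqK (side1 e) (B (side1 e)) + sqK (side2 e) (B (side2 e))"
  let ?g = "\<lambda>x. 2 * Re (bdot m ?n * cnj (bdot t (x - x0))) - o' * ((norm ?b1)\<^sup>2 - (norm ?b2)\<^sup>2)"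
  have h: "?h > 0" by (rule diam[OF e])
  have q0: "0 \<le> ?q" by (simp add: sqK_nonneg)
  interpret M: compact_measure "face_measure e" by (rule face_compact_measure[OF e])
  have ct: "continuous_on UNIV (\<lambda>x. bdot t (x - x0))"
    by (intro complex_affine_continuous complex_affine_bdotI)
  have ic: "integrable (face_measure e) (\<lambda>x. bdot m ?n * cnj (bdot t (x - x0)))"
    using ct by (intro M.integrable_continuous continuous_intros)
  have av: "avn B e = (\<lambda>x. bdot m ?n)"
    by (simp add: fun_eq_iff avn_def B_def m_def bdot_scaleR_left bdot_add_left)
  have jV: "jmp V e = (\<lambda>x. bdot t (x - x0))"
    by (simp add: fun_eq_iff jmp_def V_def t_def bdot_diff_left)
  have "ipF e (avn B e) (jmp V e) = (LINT x|face_measure e. bdot m ?n * cnj (bdot t (x - x0)))"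
    by (simp add: av jV L2_inner_def)
  then have 1: "Re (ipF e (avn B e) (jmp V e)) = (LINT x|face_measure e. Re (bdot m ?n * cnj (bdot t (x - x0))))"
    by (simp only: integral_Re[OF ic])
  have iR: "integrable (face_measure e) (\<lambda>x. Re (bdot m ?n * cnj (bdot t (x - x0))))"
    by (rule integrable_Re[OF ic])
  have iconst: "integrable (face_measure e) (\<lambda>x. o' * ((norm ?b1)\<^sup>2 - (norm ?b2)\<^sup>2))"
    by (rule M.integrable_const)
  have B12: "sqF e (B (side1 e)) - sqF e (B (side2 e)) = farea e * ((norm ?b1)\<^sup>2 - (norm ?b2)\<^sup>2)"
    unfolding B_def sqF_const by (simp add: right_diff_distrib)
  have "(LINT x|face_measure e. ?g x) = (LINT x|face_measure e. 2 * Re (bdot m ?n * cnj (bdot t (x - x0))))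
      - (LINT x|face_measure e. o' * ((norm ?b1)\<^sup>2 - (norm ?b2)\<^sup>2))"
    by (rule Bochner_Integration.integral_diff[OF integrable_mult_right[OF iR] iconst])
  also have "(LINT x|face_measure e. o' * ((norm ?b1)\<^sup>2 - (norm ?b2)\<^sup>2)) = o' * (farea e * ((norm ?b1)\<^sup>2 - (norm ?b2)\<^sup>2))"
    by (simp add: farea_def space_face_measure)
  also have "(LINT x|face_measure e. 2 * Re (bdot m ?n * cnj (bdot t (x - x0)))) = 2 * Re (ipF e (avn B e) (jmp V e))"
    unfolding 1 by (rule integral_mult_right_zero)
  finally have ZI: "Z e = (LINT x|face_measure e. ?g x)"
    unfolding Z_def B12 o'_def[symmetric] by simp
  have ig: "integrable (face_measure e) ?g"
    by (rule Bochner_Integration.integrable_diff[OF integrable_mult_right[OF iR] iconst])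
  have "\<bar>Z e\<bar> \<le> (LINT x|face_measure e. norm (?g x))"
    unfolding ZI real_norm_def[symmetric] by (rule integral_norm_bound)
  also have "\<dots> \<le> (LINT x|face_measure e. 4 * \<Lambda> * (norm m * norm \<tau>))"
  proof (rule integral_mono)
    fix x assume "x \<in> space (face_measure e)"
    then have x: "x \<in> e" by (simp add: space_face_measure)
    have "x \<in> closure \<Omega>" using x facet_subset[OF s(7)] K_subset_closure[OF s(1)] by blast
    then have d: "norm (x - x0) \<le> \<Lambda>" by (rule dist_le)
    have o: "?n \<bullet> (x - x0) = o'" unfolding nrm_def o'_def by (rule off_eq[OF s(1,7) x])
    show "norm (?g x) \<le> 4 * \<Lambda> * (norm m * norm \<tau>)"
      unfolding real_norm_def m_def t_def \<tau>_def by (rule tangential_jump_bound(1)[OF s(6) o d])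
  qed (use ig in auto)
  also have "\<dots> = 4 * \<Lambda> * (norm m * norm \<tau>) * farea e"
    by (simp add: farea_def space_face_measure)
  finally have "(Z e)\<^sup>2 \<le> (4 * \<Lambda> * (norm m * norm \<tau>) * farea e)\<^sup>2" by (rule power2_le_of_abs)
  also have "\<dots> = 16 * \<Lambda>\<^sup>2 * ((farea e * (norm m)\<^sup>2) * (farea e * (norm \<tau>)\<^sup>2))"
    by (simp add: power2_eq_square)
  also have "\<dots> \<le> 16 * \<Lambda>\<^sup>2 * ((\<Lambda> / ?h * ?q) * (2 * (\<Lambda> / ?h\<^sup>2) * P e))"
  proof (rule mult_left_mono[OF mult_mono])
    have "cgrad (jmp U e) = t"
      by (simp add: vec_eq_iff cgrad_def jmp_def t_def)
    then show "farea e * (norm \<tau>)\<^sup>2 \<le> 2 * (\<Lambda> / ?h\<^sup>2) * P e"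
      using tangential_jump_gradient_le[OF e] by (simp add: \<tau>_def)
    have "(norm m)\<^sup>2 = (norm (?b1 + ?b2))\<^sup>2 / 4" by (simp add: m_def power_divide)
    also have "\<dots> \<le> (norm ?b1)\<^sup>2 + (norm ?b2)\<^sup>2"
    proof -
      have "a / 4 \<le> b + c" if "a \<le> 2 * (b + c)" "0 \<le> b" "0 \<le> c" for a b c :: real
        using that by (simp add: field_simps)
      then show ?thesis using norm_add_square_le(1)[of ?b1 ?b2] zero_le_power2 by blast
    qed
    finally have "farea e * (norm m)\<^sup>2 \<le> farea e * ((norm ?b1)\<^sup>2 + (norm ?b2)\<^sup>2)"
      by (intro mult_left_mono farea_nonneg)
    also have "\<dots> \<le> \<Lambda> / ?h * sqK (side1 e) (B (side1 e)) + \<Lambda> / ?h * sqK (side2 e) (B (side2 e))"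
      unfolding distrib_left B_def by (intro add_mono vector_trace_le s)
    finally show "farea e * (norm m)\<^sup>2 \<le> \<Lambda> / ?h * ?q" by (simp only: distrib_left)
    show "0 \<le> \<Lambda> / ?h * ?q" using h \<Lambda>_ge_1 q0 by (intro mult_nonneg_nonneg) auto
  qed (use farea_nonneg in auto)
  also have "\<dots> = 32 * \<Lambda> ^ 4 * (1 / ?h ^ 3 * P e) * ?q"
  proof -
    have "16 * a\<^sup>2 * ((a / d * q) * (2 * (a / d\<^sup>2) * p)) = 32 * a ^ 4 * (1 / d ^ 3 * p) * q" for a d q p :: real
      by (simp add: power2_eq_square power_numeral_reduce)
    then show ?thesis .
  qed
  also have "\<dots> \<le> (6 * \<Lambda>\<^sup>2)\<^sup>2 * (1 / ?h ^ 3 * P e) * ?q"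
  proof (rule mult_right_mono[OF mult_right_mono])
    \<comment> \<open>The constant 32 is rounded up to the square 36, because
      \<open>face_sum_le\<close> works with a squared constant.\<close>
    show "32 * \<Lambda> ^ 4 \<le> (6 * \<Lambda>\<^sup>2)\<^sup>2" by (simp add: power_mult_distrib flip: power_mult)
    show "0 \<le> 1 / ?h ^ 3 * P e" by (rule weight_nonneg[OF e]) simp
  qed (rule q0)
  finally show ?thesis .
qed

lemma Z_le: "(\<Sum>e\<in>interior_faces T. Z e) \<le> (6 * \<Lambda>\<^sup>2) * \<Lambda> * (y * X)"
proof (rule face_sum_le[where p = "\<lambda>e. 1 / diameter e ^ 3 * P e" and Q = "\<lambda>K. sqK K (B K)"])
  show "(\<Sum>e\<in>interior_faces T. 1 / diameter e ^ 3 * P e) \<le> y\<^sup>2" by (intro sum_le_y2 weights(3))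
qed (use Z_bound sqK_nonneg vsB_le X_nonneg y_nonneg \<Lambda>_ge_1 weight_nonneg[of _ 1 3] in auto)

section \<open>Boundary terms, the residual pairing and the data\<close>

lemma bsU_le: "k\<^sup>2 * bsU \<le> y\<^sup>2"
proof -
  have "k * bsU \<le> J" unfolding J_def using jump_nonneg by (simp add: sum_nonneg)
  \<comment> \<open>One of the two factors \<open>k\<close> is traded for \<open>\<gamma>\<close>;
    the other one belongs to \<open>J\<close>.\<close>
  then have "k * (k * bsU) \<le> \<gamma> * J"
    using k_le pos boundary_square_nonneg[of U] \<gamma>_pos by (intro mult_mono) auto
  then show ?thesis unfolding y_square by (simp add: power2_eq_square mult.assoc)
qed

lemma bsV_le: "boundary_square V \<le> \<Lambda>\<^sup>2 * bsB"
  unfolding boundary_square_def sum_distrib_left by (intro sum_mono sqF_V_le) (auto simp: bfaces_def)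

lemma vsV_le: "volume_square V \<le> \<Lambda>\<^sup>2 * vsB"
  unfolding volume_square_def sum_distrib_left by (intro sum_mono sqK_V_le)

lemma sqrt_scaled_le: "0 \<le> c \<Longrightarrow> a \<le> c\<^sup>2 * b \<Longrightarrow> sqrt b \<le> d \<Longrightarrow> sqrt a \<le> c * d"
  using real_sqrt_le_mono[of a "c\<^sup>2 * b"] mult_left_mono[of "sqrt b" d c] by (simp add: real_sqrt_mult)

lemma gU_V_CS: "norm (gU V) \<le> sqrt bsU * sqrt (boundary_square V)"
proof -
  have "norm (gU V) \<le> (\<Sum>K\<in>T. \<Sum>e\<in>bfaces K. L2_norm (face_measure e) (U K) * L2_norm (face_measure e) (V K))"
    unfolding gU_def
  proof (intro order_trans[OF norm_sum] sum_mono order_trans[OF norm_sum])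
    fix K e assume K: "K \<in> T" "e \<in> bfaces K"
    then have e: "e facet_of K" by (simp add: bfaces_def)
    note L = compact_measure.L2_continuous[OF compact_measures(2)[OF K(1) e]]
    show "norm (ipF e (U K) (V K)) \<le> L2_norm (face_measure e) (U K) * L2_norm (face_measure e) (V K)"
      by (intro L2_inner_le L family_continuous[OF U K(1)] family_continuous[OF affine_V K(1)])
  qed
  also have "\<dots> \<le> sqrt (\<Sum>K\<in>T. \<Sum>e\<in>bfaces K. (L2_norm (face_measure e) (U K))\<^sup>2) *
        sqrt (\<Sum>K\<in>T. \<Sum>e\<in>bfaces K. (L2_norm (face_measure e) (V K))\<^sup>2)"
    by (intro double_sum_L2_le finite_T finite_bfaces) (auto simp: L2_norm_nonneg)
  also have "\<dots> = sqrt bsU * sqrt (boundary_square V)" by (simp add: L2_norm_square boundary_square_def)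
  finally show ?thesis .
qed

lemma gU_V_le: "k * norm (gU V) \<le> \<Lambda> * (y * X)"
proof -
  have "k * norm (gU V) \<le> k * (sqrt bsU * sqrt (boundary_square V))"
    using pos by (intro mult_left_mono gU_V_CS) auto
  also have "\<dots> = sqrt (k\<^sup>2 * bsU) * sqrt (boundary_square V)" using pos by (simp add: real_sqrt_mult)
  also have "\<dots> \<le> y * (\<Lambda> * X)"
  proof (rule mult_mono)
    show "sqrt (k\<^sup>2 * bsU) \<le> y" using bsU_le y_nonneg by (simp add: real_le_lsqrt)
    show "sqrt (boundary_square V) \<le> \<Lambda> * X"
      by (rule sqrt_scaled_le[OF _ bsV_le parts_le_X(3)]) (use \<Lambda>_ge_1 in simp)
  qed (use y_nonneg boundary_square_nonneg[of V] in auto)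
  finally show ?thesis by (simp add: ac_simps)
qed

lemma rB_le: "norm rB \<le> 2 * \<Lambda> * (y * X)"
proof -
  have "norm rB \<le> (\<Sum>K\<in>T. \<bar>sqrt (sqK K (R K))\<bar> * \<bar>sqrt (sqK K (B K))\<bar>)"
    unfolding rB_def
  proof (intro order_trans[OF norm_sum] sum_mono)
    fix K assume K: "K \<in> T"
    have "(norm (vipK K (R K) (B K)))\<^sup>2 \<le> sqK K (R K) * sqK K (B K)"
      by (rule compact_measure.L2_vinner_square_le[OF compact_measures(1)[OF K]
          vfamily_continuous[OF affine_R K] vfamily_continuous[OF affine_B K]])
    then have "norm (vipK K (R K) (B K)) \<le> sqrt (sqK K (R K) * sqK K (B K))" by (rule real_le_rsqrt)
    then show "norm (vipK K (R K) (B K)) \<le> \<bar>sqrt (sqK K (R K))\<bar> * \<bar>sqrt (sqK K (B K))\<bar>"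
      by (simp add: real_sqrt_mult sqK_nonneg)
  qed
  also have "\<dots> \<le> L2_set (\<lambda>K. sqrt (sqK K (R K))) T * L2_set (\<lambda>K. sqrt (sqK K (B K))) T"
    by (rule L2_set_mult_ineq)
  also have "\<dots> = sqrt vsR * sqrt vsB" by (simp add: L2_set_def volume_square_def sqK_nonneg)
  also have "\<dots> \<le> (2 * \<Lambda> * y) * X"
  proof (rule mult_mono)
    show "sqrt vsR \<le> 2 * \<Lambda> * y" using vsR_le y_nonneg \<Lambda>_ge_1 by (simp add: real_le_lsqrt)
  qed (use parts_le_X y_nonneg \<Lambda>_ge_1 volume_square_nonneg[of B] in auto)
  finally show ?thesis by (simp add: ac_simps)
qed

lemma l_V_le: "norm (l V) \<le> \<Lambda> * ((F + G) * X)"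
proof -
  have "norm (l V) \<le> F * sqrt (volume_square V) + G * sqrt (boundary_square V)" by (rule l_le[OF affine_V])
  also have "\<dots> \<le> F * (\<Lambda> * X) + G * (\<Lambda> * X)"
    using FG \<Lambda>_ge_1
    by (intro add_mono mult_left_mono sqrt_scaled_le[OF _ vsV_le parts_le_X(2)] sqrt_scaled_le[OF _ bsV_le parts_le_X(3)]) auto
  finally show ?thesis by (simp add: algebra_simps)
qed

text \<open>\<open>X\<close> and \<open>y\<close> control \<open>u\<close> only together with a
  factor \<open>k\<close>; this is the origin of \<open>1 / k\<close> in the final bound.\<close>

lemma l_U_le: "k * norm (l U) \<le> (F + G) * (X + y)"
proof -
  have "k * norm (l U) \<le> k * (F * sqrt vsU + G * sqrt bsU)"
    using l_le[OF U] pos by (intro mult_left_mono) auto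
  also have "\<dots> = F * sqrt (k\<^sup>2 * vsU) + G * sqrt (k\<^sup>2 * bsU)" using pos by (simp add: real_sqrt_mult algebra_simps)
  also have "\<dots> \<le> F * X + G * y"
  proof (intro add_mono mult_left_mono parts_le_X(1) FG)
    show "sqrt (k\<^sup>2 * bsU) \<le> y" using bsU_le y_nonneg by (simp add: real_le_lsqrt)
  qed
  also have "\<dots> \<le> (F + G) * (X + y)"
    using mult_nonneg_nonneg[OF FG(1) y_nonneg] mult_nonneg_nonneg[OF FG(2) X_nonneg] by (simp add: algebra_simps)
  finally show ?thesis .
qed

text \<open>\<open>J\<close> equals the imaginary part of \<open>l U\<close>. The factor
  \<open>\<gamma>\<close> in the definition of \<open>y\<close> and the \<open>1 / k\<close> from
  the data combine to \<open>Y\<close>.\<close>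

lemma y2_le: "y\<^sup>2 \<le> Y * (X + y)"
proof -
  have "J \<le> norm (l U)" unfolding J_identity by (rule order_trans[OF abs_ge_self abs_Im_le_cmod])
  then have "k * J \<le> (F + G) * (X + y)" using l_U_le pos by (meson less_imp_le mult_left_mono order_trans)
  then have "\<gamma> * J \<le> \<gamma> * ((F + G) * (X + y) / k)"
    using \<gamma>_pos pos by (intro mult_left_mono) (auto simp: pos_le_divide_eq mult.commute)
  then show ?thesis by (simp add: y_square Y_def)
qed

lemma FG_le_Y: "F + G \<le> Y"
proof -
  have "1 * (F + G) \<le> \<gamma> / k * (F + G)" using k_le pos FG by (intro mult_right_mono) auto
  then show ?thesis by (simp add: Y_def)
qed

lemma Y_nonneg: "0 \<le> Y" using FG_le_Y FG by linarith

text \<open>The energy identity has no factor \<open>\<gamma>\<close> in front of the data term, so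
  here the lower bound on \<open>\<gamma>\<close> supplies one.\<close>

lemma l_U_le_Y: "norm (l U) \<le> \<Lambda> * (Y * (X + y))"
proof -
  have "norm (l U) \<le> (F + G) * (X + y) / k" using l_U_le pos by (simp add: pos_le_divide_eq mult.commute)
  also have "\<dots> = 1 * ((F + G) * (X + y) / k)" by simp
  also have "\<dots> \<le> (\<Lambda> * \<gamma>) * ((F + G) * (X + y) / k)"
    using \<gamma>_lower FG X_nonneg y_nonneg pos by (intro mult_right_mono) auto
  also have "\<dots> = \<Lambda> * (Y * (X + y))" by (simp add: Y_def)
  finally show ?thesis .
qed

lemma boundary_gradient_le: "bsB \<le> \<Lambda> * (\<Sum>K\<in>T. \<Sum>e\<in>bfaces K. off x0 K e * sqF e (B K))"
  unfolding boundary_square_def sum_distrib_left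
proof (intro sum_mono)
  fix K e assume K: "K \<in> T" "e \<in> bfaces K"
  then have "1 \<le> \<Lambda> * off x0 K e" unfolding off_def by (intro star) (auto simp: bfaces_def)
  then have "1 * sqF e (B K) \<le> \<Lambda> * off x0 K e * sqF e (B K)" by (intro mult_right_mono sqK_nonneg)
  then show "sqF e (B K) \<le> \<Lambda> * (off x0 K e * sqF e (B K))" by (simp add: mult.assoc)
qed

lemma boundary_values_le: "k\<^sup>2 * (\<Sum>K\<in>T. \<Sum>e\<in>bfaces K. off x0 K e * sqF e (U K)) \<le> \<Lambda> * y\<^sup>2"
proof -
  have "(\<Sum>K\<in>T. \<Sum>e\<in>bfaces K. off x0 K e * sqF e (U K)) \<le> \<Lambda> * bsU"
    unfolding boundary_square_def sum_distrib_left
  proof (intro sum_mono mult_right_mono sqK_nonneg)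
    fix K e assume "K \<in> T" "e \<in> bfaces K"
    then show "off x0 K e \<le> \<Lambda>" using off_le[of K e] by (simp add: bfaces_def)
  qed
  then have "k\<^sup>2 * (\<Sum>K\<in>T. \<Sum>e\<in>bfaces K. off x0 K e * sqF e (U K)) \<le> k\<^sup>2 * (\<Lambda> * bsU)"
    by (rule mult_left_mono) simp
  also have "\<dots> = \<Lambda> * (k\<^sup>2 * bsU)" by simp
  also have "\<dots> \<le> \<Lambda> * y\<^sup>2" using \<Lambda>_ge_1 bsU_le by (intro mult_left_mono) auto
  finally show ?thesis .
qed

text \<open>The \<open>(d - 1)\<close>-fold energy identity is added to the Rellich identity, so that both
  \<open>k\<^sup>2 \<bar>u\<bar>\<^sup>2\<close> and \<open>\<bar>\<nabla>u\<bar>\<^sup>2\<close> appear on the left with coefficient 1.\<close>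

lemma X2_le: "X\<^sup>2 \<le> 29 * \<Lambda> ^ 8 * (y * X + y\<^sup>2 + Y * X + Y * y)"
proof -
  \<comment> \<open>The sixth power is the largest one among the single terms; it comes from
    \<open>aR_V_le\<close>.\<close>
  let ?d = "real CARD('n)" and ?L = "\<Lambda> ^ 6"
  define A where "A = (\<Sum>K\<in>T. \<Sum>e\<in>bfaces K. off x0 K e * sqF e (B K))"
  define D where "D = vsB - k\<^sup>2 * vsU"
  define q where "q = y * X"
  define r where "r = Y * X"
  define w where "w = Y * y"
  have q0: "0 \<le> q" and r0: "0 \<le> r" and w0: "0 \<le> w" and y0: "0 \<le> y\<^sup>2"
    using y_nonneg X_nonneg Y_nonneg by (auto simp: q_def r_def w_def)
  have L1: "1 \<le> \<Lambda>" by (rule \<Lambda>_ge_1)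
  have up: "\<Lambda> ^ i * a \<le> ?L * a" if "i \<le> 6" "0 \<le> a" for i a
    using that pow_\<Lambda>[of i 6] by (intro mult_right_mono) auto
  note up1 = up[of 1, simplified] and up2 = up[of 2, simplified] and up3 = up[of 3, simplified]
  have Re_le: "\<bar>Re z\<bar> \<le> c" if "norm z \<le> c" for z c using abs_Re_le_cmod[of z] that by linarith
  have T1: "k\<^sup>2 * (\<Sum>K\<in>T. \<Sum>e\<in>bfaces K. off x0 K e * sqF e (U K)) \<le> ?L * y\<^sup>2"
    using boundary_values_le up1[OF y0] by linarith
  have T2: "k\<^sup>2 * (\<Sum>e\<in>interior_faces T. off x0 (side1 e) e * (sqF e (U (side1 e)) - sqF e (U (side2 e)))) \<le> 2 * (?L * q)"
    using square_jump_le up3[OF q0] by (simp add: q_def power_numeral_reduce ac_simps)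
  have T3: "2 * k * Im (gU V) \<le> 2 * (?L * q)"
  proof -
    have "k * Im (gU V) \<le> k * norm (gU V)"
      using pos abs_Im_le_cmod[of "gU V"] by (intro mult_left_mono) auto
    then show ?thesis using gU_V_le up1[OF q0] by (simp add: q_def)
  qed
  have T4: "(\<Sum>e\<in>interior_faces T. Z e) \<le> 6 * (?L * q)"
    using Z_le up3[OF q0] by (simp add: q_def power_numeral_reduce ac_simps)
  have T5: "2 * Re (aR V) \<le> 8 * (?L * q)"
    using Re_le[OF aR_V_le] by (simp add: q_def power_numeral_reduce ac_simps)
  have T6: "2 * \<beta> * Im (bU V) \<le> 4 * (?L * q)"
  proof -
    have "\<beta> * Im (bU V) = Im (of_real \<beta> * bU V)" by simp
    also have "\<dots> \<le> (2 * \<Lambda>\<^sup>2) * \<Lambda> * (y * X)" using abs_Im_le_cmod[of "of_real \<beta> * bU V"] bU_V_le by linarith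
    finally show ?thesis using up3[OF q0] by (simp add: q_def power_numeral_reduce ac_simps)
  qed
  have T7: "\<bar>Re rB\<bar> \<le> 2 * (?L * q)"
    using Re_le[OF rB_le] up1[OF q0] by (simp add: q_def ac_simps)
  have T8: "2 * Re (l V) \<le> 2 * (?L * r)"
  proof -
    have "(F + G) * X \<le> r" unfolding r_def using FG_le_Y X_nonneg by (rule mult_right_mono)
    then have "\<Lambda> * ((F + G) * X) \<le> \<Lambda> * r" using L1 by (intro mult_left_mono) auto
    then show ?thesis using Re_le[OF l_V_le] up1[OF r0] by linarith
  qed
  \<comment> \<open>The coefficient 26 is 2 + 2 + 6 + 8 + 4 from \<open>T2\<close> to
    \<open>T6\<close> and 4 from twice \<open>T7\<close>.\<close>
  have rel: "?d * k\<^sup>2 * vsU + (2 - ?d) * vsB + A \<le> ?L * (y\<^sup>2 + 26 * q + 2 * r)"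
    unfolding A_def rellich_global using T1 T2 T3 T4 T5 T6 T7 T8 unfolding distrib_left by linarith
  have e1: "Re (aB U) \<le> ?L * q"
    using Re_le[OF aB_U_le] up2[OF q0] by (simp add: q_def power2_eq_square)
  have e2: "Re (aR U) \<le> 2 * (?L * y\<^sup>2)"
    using Re_le[OF aR_U_le] up3[OF y0] by (simp add: power2_eq_square power_numeral_reduce ac_simps)
  have e3: "Re (l U) \<le> ?L * (r + w)"
  proof -
    have "\<Lambda> * (r + w) \<le> ?L * (r + w)" using r0 w0 by (intro up1) auto
    then show ?thesis using Re_le[OF l_U_le_Y] by (simp add: r_def w_def distrib_left)
  qed
  \<comment> \<open>The coefficient 3 of \<open>q\<close> is 2 from \<open>T7\<close> and 1 from
    \<open>e1\<close>; with the 26 above it makes up the 29 in the result.\<close>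
  have en: "D \<le> ?L * (2 * y\<^sup>2 + 3 * q + r + w)"
    unfolding D_def energy_identity using e1 e2 e3 T7 unfolding distrib_left by linarith
  have en0: "0 \<le> ?L * (2 * y\<^sup>2 + 3 * q + r + w)" using L1 y0 q0 r0 w0 by simp
  have "(?d - 1) * D \<le> (?d - 1) * (?L * (2 * y\<^sup>2 + 3 * q + r + w))"
    using en by (intro mult_left_mono) auto
  also have "\<dots> \<le> \<Lambda> * (?L * (2 * y\<^sup>2 + 3 * q + r + w))"
    using en0 dim_le by (intro mult_right_mono) auto
  finally have en': "(?d - 1) * D \<le> \<Lambda> * (?L * (2 * y\<^sup>2 + 3 * q + r + w))" .
  have "?L * (y\<^sup>2 + 26 * q + 2 * r) \<le> \<Lambda> * (?L * (y\<^sup>2 + 26 * q + 2 * r))"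
  proof -
    have "0 \<le> ?L * (y\<^sup>2 + 26 * q + 2 * r)" using L1 y0 q0 r0 by simp
    then show ?thesis using L1 mult_right_mono[of 1 \<Lambda>] by simp
  qed
  then have "k\<^sup>2 * vsU + vsB + A \<le> \<Lambda> * (?L * (y\<^sup>2 + 26 * q + 2 * r)) + \<Lambda> * (?L * (2 * y\<^sup>2 + 3 * q + r + w))"
    using rel en' by (simp add: D_def algebra_simps)
  also have "\<dots> = \<Lambda> ^ 7 * (3 * y\<^sup>2 + 29 * q + 3 * r + w)"
    by (simp add: power_numeral_reduce algebra_simps)
  also have "\<dots> \<le> \<Lambda> ^ 7 * (29 * (q + y\<^sup>2 + r + w))"
    using L1 y0 q0 r0 w0 by (intro mult_left_mono) auto
  finally have main: "k\<^sup>2 * vsU + vsB + A \<le> \<Lambda> ^ 7 * (29 * (q + y\<^sup>2 + r + w))" .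
  have nn: "0 \<le> k\<^sup>2 * vsU" "0 \<le> vsB" using volume_square_nonneg[of U] volume_square_nonneg[of B] by auto
  \<comment> \<open>Star-shapedness bounds the boundary gradient by its weighted sum
    \<open>A\<close> at the cost of one more factor \<open>\<Lambda>\<close>.\<close>
  have "X\<^sup>2 \<le> k\<^sup>2 * vsU + vsB + \<Lambda> * A" using boundary_gradient_le by (simp add: X_square A_def)
  also have "\<dots> \<le> \<Lambda> * (k\<^sup>2 * vsU) + \<Lambda> * vsB + \<Lambda> * A"
    using mult_right_mono[OF L1 nn(1)] mult_right_mono[OF L1 nn(2)] by simp
  also have "\<dots> = \<Lambda> * (k\<^sup>2 * vsU + vsB + A)" by (simp add: distrib_left)
  also have "\<dots> \<le> \<Lambda> * (\<Lambda> ^ 7 * (29 * (q + y\<^sup>2 + r + w)))" using L1 main by (intro mult_left_mono) auto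
  also have "\<dots> = 29 * \<Lambda> ^ 8 * (q + y\<^sup>2 + r + w)" by (simp add: power_numeral_reduce)
  finally show ?thesis by (simp only: q_def r_def w_def)
qed

lemma vsS_le: "volume_square S \<le> 2 * (vsB + vsR)"
  unfolding volume_square_def sum.distrib[symmetric] sum_distrib_left
proof (rule sum_mono)
  fix K assume K: "K \<in> T"
  have "sqK K (\<lambda>x. B K x + R K x) \<le> 2 * (sqK K (B K) + sqK K (R K))"
    by (rule compact_measure.norm2_two(1)[OF compact_measures(1)[OF K]
        vfamily_continuous[OF affine_B K] vfamily_continuous[OF affine_R K]])
  then show "sqK K (S K) \<le> 2 * (sqK K (B K) + sqK K (R K))" by (simp add: R_def)
qed

theorem stability_estimate:
  assumes c: "0 \<le> c"
  shows "k\<^sup>2 * vsU + k\<^sup>2 * bsU + volume_square S + c * bsB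
    \<le> 144 * (29 * \<Lambda> ^ 8) ^ 4 * (4 + c + 8 * \<Lambda>\<^sup>2) * Y\<^sup>2"
proof -
  define N where "N = 144 * (29 * \<Lambda> ^ 8) ^ 4 * Y\<^sup>2"
  have C: "1 \<le> 29 * \<Lambda> ^ 8" using one_le_power[OF \<Lambda>_ge_1, of 8] by linarith
  note q = quadratic_bootstrap[OF X_nonneg y_nonneg Y_nonneg C y2_le X2_le]
  have XN: "X\<^sup>2 \<le> N" using q(1) by (simp add: N_def)
  have "100 * (29 * \<Lambda> ^ 8) ^ 4 * Y\<^sup>2 \<le> N" unfolding N_def using \<Lambda>_ge_1 by (intro mult_right_mono) auto
  then have yN: "y\<^sup>2 \<le> N" using q(2) by linarith
  have nn: "0 \<le> k\<^sup>2 * vsU" "0 \<le> vsB" "0 \<le> bsB"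
    using volume_square_nonneg[of U] volume_square_nonneg[of B] boundary_square_nonneg[of B] by auto
  have p: "vsB \<le> N" "bsB \<le> N" "k\<^sup>2 * vsU + vsB \<le> N" using XN nn unfolding X_square by linarith+
  have "vsR \<le> 4 * \<Lambda>\<^sup>2 * y\<^sup>2" using vsR_le by (simp add: power_mult_distrib)
  also have "\<dots> \<le> 4 * \<Lambda>\<^sup>2 * N" using yN by (intro mult_left_mono) auto
  finally have r: "vsR \<le> 4 * \<Lambda>\<^sup>2 * N" .
  have b: "c * bsB \<le> c * N" using p(2) c by (rule mult_left_mono)
  have s: "volume_square S \<le> 2 * vsB + 2 * vsR" using vsS_le by simp
  have "k\<^sup>2 * bsU \<le> N" using bsU_le yN by linarith
  then have "k\<^sup>2 * vsU + k\<^sup>2 * bsU + volume_square S + c * bsB \<le> 4 * N + c * N + 2 * (4 * \<Lambda>\<^sup>2 * N)"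
    using p(1,3) r b s nn(2) by linarith
  also have "\<dots> = (144 * (29 * \<Lambda> ^ 8) ^ 4) * (4 + c + 8 * \<Lambda>\<^sup>2) * Y\<^sup>2"
    unfolding N_def by (simp add: algebra_simps)
  finally show ?thesis .
qed

text \<open>Without interior faces \<open>\<gamma>\<^sub>2 = k\<close>, which gives no control for small \<open>k\<close> in the general estimate;
  here the boundary term already bounds \<open>k \<bar>u\<bar>\<close>.\<close>

lemma single_element_estimate:
  assumes none: "interior_faces T = {}" and k1: "k \<le> 1" and vb: "vsU \<le> \<Lambda>\<^sup>2 * bsU" and c: "0 \<le> c"
  shows "k\<^sup>2 * vsU + k\<^sup>2 * bsU + volume_square S + c * bsB
    \<le> (\<Lambda> ^ 4 + \<Lambda>\<^sup>2 + 18 * \<Lambda> ^ 6 + 9 * c * \<Lambda> ^ 8) * (F + G)\<^sup>2"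
proof -
  define M where "M = F + G"
  define b where "b = sqrt bsU"
  define v where "v = sqrt vsU"
  define s where "s = sqrt vsB"
  have L1: "1 \<le> \<Lambda>" by (rule \<Lambda>_ge_1)
  have L0: "0 \<le> \<Lambda>" using L1 by linarith
  have M0: "0 \<le> M" "F \<le> M" "G \<le> M" using FG by (auto simp: M_def)
  have b0: "0 \<le> b" "b\<^sup>2 = bsU" using boundary_square_nonneg[of U] by (auto simp: b_def)
  have v0: "0 \<le> v" "v\<^sup>2 = vsU" using volume_square_nonneg[of U] by (auto simp: v_def)
  have s0: "0 \<le> s" "s\<^sup>2 = vsB" using volume_square_nonneg[of B] by (auto simp: s_def)
  have vLb: "v \<le> \<Lambda> * b" unfolding v_def b_def by (rule sqrt_scaled_le[OF L0 vb]) simp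
  \<comment> \<open>Without interior faces \<open>J\<close> consists of the boundary term
    alone.\<close>
  have "k * b\<^sup>2 = Im (l U)" using J_identity by (simp add: J_def none b0)
  also have "\<dots> \<le> norm (l U)" by (rule order_trans[OF abs_ge_self abs_Im_le_cmod])
  also have "\<dots> \<le> F * v + G * b" using l_le[OF U] by (simp add: v_def b_def)
  also have "\<dots> \<le> F * (\<Lambda> * b) + G * (\<Lambda> * b)"
    using vLb FG mult_right_mono[OF L1 b0(1)] by (intro add_mono mult_left_mono) auto
  finally have "k * b\<^sup>2 \<le> \<Lambda> * M * b" by (simp add: M_def algebra_simps)
  then have "b * (k * b) \<le> b * (\<Lambda> * M)" by (simp add: power2_eq_square ac_simps)
  then have kb: "k * b \<le> \<Lambda> * M"
    using b0(1) L0 M0 by (cases "b = 0") (auto dest: mult_left_le_imp_le)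
  have "k * v \<le> k * (\<Lambda> * b)" using vLb pos by (intro mult_left_mono) auto
  also have "\<dots> = \<Lambda> * (k * b)" by simp
  also have "\<dots> \<le> \<Lambda> * (\<Lambda> * M)" using kb L0 by (rule mult_left_mono)
  finally have kv: "k * v \<le> \<Lambda>\<^sup>2 * M" by (simp add: power2_eq_square mult.assoc)
  \<comment> \<open>Without interior faces the bound in \<open>residual_le\<close> is an empty sum,
    so the residual vanishes in norm.\<close>
  have R0: "sqK K (R K) = 0" if "K \<in> T" for K
    using residual_le[OF that] sqK_nonneg[of "lebesgue_on K" "R K"] by (simp add: ifaces_def none)
  then have vsR0: "vsR = 0" by (simp add: volume_square_def)
  have "vipK K (R K) (B K) = 0" if K: "K \<in> T" for K
    using compact_measure.L2_vinner_square_le[OF compact_measures(1)[OF K]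
        vfamily_continuous[OF affine_R K] vfamily_continuous[OF affine_B K]] R0[OF K] by simp
  then have rB0: "rB = 0" by (simp add: rB_def)
  have cg: "cgrad (V K) = cgrad (U K)" for K unfolding V_def[abs_def] by (rule cgrad_bdot)
  let ?u = "\<Sum>K\<in>T. ipK K (U K) (V K)"
  have "of_real vsB = l V + of_real (k\<^sup>2) * ?u - \<i> * of_real k * gU V"
    using scalar_form_split[OF affine_V] scalar_eq[OF affine_V] unfolding cg vsB_eq rB_eq rB0
    by (simp add: aB_def aR_def bU_def none)
  then have "norm (of_real vsB :: complex) \<le> norm (l V) + norm (of_real (k\<^sup>2) * ?u) + norm (\<i> * of_real k * gU V)"
    using norm_triangle_ineq[of "l V" "of_real (k\<^sup>2) * ?u"]
      norm_triangle_ineq4[of "l V + of_real (k\<^sup>2) * ?u" "\<i> * of_real k * gU V"] by simp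
  then have n: "s\<^sup>2 \<le> norm (l V) + k\<^sup>2 * norm ?u + k * norm (gU V)"
    using pos by (simp add: norm_mult s0 norm_power)
  \<comment> \<open>The gradient is constant on each element and all facets lie on the boundary, so
    the divergence identity bounds its boundary norm by its volume norm.\<close>
  have bB: "bsB \<le> \<Lambda>\<^sup>2 * vsB"
  proof -
    have "(\<Sum>K\<in>T. \<Sum>e\<in>bfaces K. off x0 K e * sqF e (B K)) = (\<Sum>K\<in>T. \<Sum>e | e facet_of K. off x0 K e * sqF e (B K))"
      unfolding sum_facets_split by (simp add: none)
    also have "\<dots> = (\<Sum>K\<in>T. real CARD('n) * sqK K (B K))"
      unfolding B_def[abs_def] by (intro sum.cong refl divergence_constant)
    also have "\<dots> = real CARD('n) * vsB" by (simp add: volume_square_def sum_distrib_left)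
    also have "\<dots> \<le> \<Lambda> * vsB" using dim_le volume_square_nonneg[of B] by (intro mult_right_mono) auto
    finally have "\<Lambda> * (\<Sum>K\<in>T. \<Sum>e\<in>bfaces K. off x0 K e * sqF e (B K)) \<le> \<Lambda> * (\<Lambda> * vsB)"
      using L0 by (rule mult_left_mono)
    then show ?thesis using boundary_gradient_le by (simp add: power2_eq_square mult.assoc)
  qed
  have sV: "sqrt (volume_square V) \<le> \<Lambda> * s" unfolding s_def by (rule sqrt_scaled_le[OF L0 vsV_le]) simp
  have sB: "sqrt bsB \<le> \<Lambda> * s" unfolding s_def by (rule sqrt_scaled_le[OF L0 bB]) simp
  have bV: "sqrt (boundary_square V) \<le> \<Lambda> * (\<Lambda> * s)" by (rule sqrt_scaled_le[OF L0 bsV_le sB])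
  have up: "\<Lambda> * s \<le> \<Lambda> * (\<Lambda> * s)" using L1 L0 s0(1) mult_right_mono[OF L1, of "\<Lambda> * s"] by simp
  have t1: "norm (l V) \<le> M * (\<Lambda>\<^sup>2 * s)"
  proof -
    have "norm (l V) \<le> F * (\<Lambda> * (\<Lambda> * s)) + G * (\<Lambda> * (\<Lambda> * s))"
      using l_le[OF affine_V] mult_left_mono[OF order_trans[OF sV up] FG(1)] mult_left_mono[OF bV FG(2)] by linarith
    then show ?thesis by (simp add: M_def power2_eq_square algebra_simps)
  qed
  have u: "norm ?u \<le> v * (\<Lambda> * s)"
  proof -
    have "norm ?u \<le> (\<Sum>K\<in>T. \<bar>sqrt (sqK K (U K))\<bar> * \<bar>sqrt (sqK K (V K))\<bar>)"
    proof (intro order_trans[OF norm_sum] sum_mono)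
      fix K assume K: "K \<in> T"
      have "(norm (ipK K (U K) (V K)))\<^sup>2 \<le> sqK K (U K) * sqK K (V K)"
        by (rule compact_measure.L2_inner_square_le[OF compact_measures(1)[OF K]
            family_continuous[OF U K] family_continuous[OF affine_V K]])
      then have "norm (ipK K (U K) (V K)) \<le> sqrt (sqK K (U K) * sqK K (V K))" by (rule real_le_rsqrt)
      then show "norm (ipK K (U K) (V K)) \<le> \<bar>sqrt (sqK K (U K))\<bar> * \<bar>sqrt (sqK K (V K))\<bar>"
        by (simp add: real_sqrt_mult sqK_nonneg)
    qed
    also have "\<dots> \<le> L2_set (\<lambda>K. sqrt (sqK K (U K))) T * L2_set (\<lambda>K. sqrt (sqK K (V K))) T"
      by (rule L2_set_mult_ineq)
    also have "\<dots> = v * sqrt (volume_square V)" by (simp add: L2_set_def volume_square_def sqK_nonneg v_def)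
    also have "\<dots> \<le> v * (\<Lambda> * s)" by (rule mult_left_mono[OF sV v0(1)])
    finally show ?thesis .
  qed
  \<comment> \<open>One factor \<open>k\<close> is used for \<open>kv\<close>; the other is at most
    1 by assumption.\<close>
  have t2: "k\<^sup>2 * norm ?u \<le> \<Lambda> ^ 3 * M * s"
  proof -
    have "k\<^sup>2 * norm ?u \<le> k\<^sup>2 * (v * (\<Lambda> * s))" by (rule mult_left_mono[OF u]) simp
    also have "\<dots> = k * ((k * v) * (\<Lambda> * s))" by (simp add: power2_eq_square)
    also have "\<dots> \<le> 1 * ((\<Lambda>\<^sup>2 * M) * (\<Lambda> * s))"
      by (rule mult_mono[OF k1 mult_right_mono[OF kv]]) (use pos s0 v0 L0 in simp_all)
    finally show ?thesis by (simp add: power2_eq_square power3_eq_cube ac_simps)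
  qed
  have t3: "k * norm (gU V) \<le> \<Lambda> ^ 3 * M * s"
  proof -
    have "norm (gU V) \<le> b * (\<Lambda> * (\<Lambda> * s))"
      using gU_V_CS mult_left_mono[OF bV b0(1)] by (simp add: b_def)
    then have "k * norm (gU V) \<le> k * (b * (\<Lambda> * (\<Lambda> * s)))" using pos by (intro mult_left_mono) auto
    also have "\<dots> = (k * b) * (\<Lambda> * (\<Lambda> * s))" by simp
    also have "\<dots> \<le> (\<Lambda> * M) * (\<Lambda> * (\<Lambda> * s))" using kb L0 s0 by (intro mult_right_mono) auto
    finally show ?thesis by (simp add: power3_eq_cube ac_simps)
  qed
  have "M * (\<Lambda>\<^sup>2 * s) \<le> M * (\<Lambda> ^ 3 * s)"
    using pow_\<Lambda>[of 2 3] M0 s0 by (intro mult_left_mono mult_right_mono) auto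
  then have "s * s \<le> s * (3 * (\<Lambda> ^ 3 * M))" using n t1 t2 t3 by (simp add: power2_eq_square ac_simps)
  then have "s \<le> 3 * (\<Lambda> ^ 3 * M)"
    using s0(1) L0 M0 by (cases "s = 0") (auto dest: mult_left_le_imp_le)
  then have "s\<^sup>2 \<le> (3 * (\<Lambda> ^ 3 * M))\<^sup>2" using s0(1) by (rule power_mono)
  then have vB: "vsB \<le> 9 * \<Lambda> ^ 6 * M\<^sup>2" by (simp add: s0 power_mult_distrib flip: power_mult)
  have "bsB \<le> \<Lambda>\<^sup>2 * (9 * \<Lambda> ^ 6 * M\<^sup>2)" using bB mult_left_mono[OF vB, of "\<Lambda>\<^sup>2"] by simp
  then have bB': "c * bsB \<le> c * (\<Lambda>\<^sup>2 * (9 * \<Lambda> ^ 6 * M\<^sup>2))" using c by (rule mult_left_mono)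
  have "(k * v)\<^sup>2 \<le> (\<Lambda>\<^sup>2 * M)\<^sup>2" "(k * b)\<^sup>2 \<le> (\<Lambda> * M)\<^sup>2"
    using kv kb pos v0 b0 by (auto intro!: power_mono)
  then have e: "k\<^sup>2 * vsU \<le> \<Lambda> ^ 4 * M\<^sup>2" "k\<^sup>2 * bsU \<le> \<Lambda>\<^sup>2 * M\<^sup>2"
    by (simp_all add: power_mult_distrib v0 b0 flip: power_mult)
  have "volume_square S \<le> 2 * (9 * \<Lambda> ^ 6 * M\<^sup>2)" using vsS_le vB vsR0 by simp
  then have "k\<^sup>2 * vsU + k\<^sup>2 * bsU + volume_square S + c * bsB
    \<le> \<Lambda> ^ 4 * M\<^sup>2 + \<Lambda>\<^sup>2 * M\<^sup>2 + 2 * (9 * \<Lambda> ^ 6 * M\<^sup>2) + c * (\<Lambda>\<^sup>2 * (9 * \<Lambda> ^ 6 * M\<^sup>2))"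
    using e bB' by linarith
  also have "\<dots> = (\<Lambda> ^ 4 + \<Lambda>\<^sup>2 + 18 * \<Lambda> ^ 6 + 9 * c * \<Lambda> ^ 8) * M\<^sup>2"
    by (simp add: power_numeral_reduce algebra_simps)
  finally show ?thesis by (simp only: M_def)
qed

end

section \<open>Constants of the mesh and assembly of the theorem\<close>

lemma (in vmesh) regular_meshI:
  assumes dim: "CARD('n) = 2 \<or> CARD('n) = 3" and star: "strictly_star_shaped \<Omega> x0 c"
    and \<theta>: "0 < \<theta>" "\<theta> \<le> pi / 2" and ang: "\<And>K. K \<in> T \<Longrightarrow> angles_ge \<theta> K"
    and D: "\<And>x. x \<in> closure \<Omega> \<Longrightarrow> norm (x - x0) \<le> \<Lambda>"
    and \<Lambda>: "real CARD('n) + 1 \<le> \<Lambda>" "1 / (sin \<theta>)\<^sup>2 \<le> \<Lambda>"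
      "(real CARD('n) + 1) * (real CARD('n) + 2) / (sin \<theta>) ^ 4 \<le> \<Lambda>"
      "(real CARD('n))\<^sup>2 * (real CARD('n) + 1) / (sin \<theta>) ^ 8 \<le> \<Lambda>" "1 / c \<le> \<Lambda>"
  shows "regular_mesh \<Omega> T x0 \<Lambda>"
proof -
  let ?s = "sin \<theta>"
  have s: "0 < ?s" using \<theta> by (auto intro!: sin_gt_zero)
  have c: "0 < c" using star by (simp add: strictly_star_shaped_def)
  have dim': "DIM(real^'n) = 2 \<or> DIM(real^'n) = 3" using dim by simp
  \<comment> \<open>The inverse heights of an element are bounded relative to the diameter of each
    of its facets. The trace inequality uses this bound once and the tangential inverse inequality
    uses its square, whence the powers 4 and 8 of the sine in the assumptions on
    \<open>\<Lambda>\<close>.\<close>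
  have reg: "diameter e > 0"
    "e' facet_of K \<Longrightarrow> ?s\<^sup>2 * diameter e \<le> diameter e'"
    "p \<in> verts K \<Longrightarrow> norm (bgrad (verts K) p) \<le> 1 / (?s ^ 4 * diameter e)"
    if K: "K \<in> T" and e: "e facet_of K" for K e e' p
  proof -
    interpret full_simplex "verts K" using full_simplex_K[OF K] .
    note sr = shape_regular[of \<theta> e, unfolded hull_verts[OF K], OF ang[OF K] \<theta> dim' e]
    show h: "diameter e > 0" by (rule sr(3))
    show "e' facet_of K \<Longrightarrow> ?s\<^sup>2 * diameter e \<le> diameter e'" by (rule sr(2))
    show "p \<in> verts K \<Longrightarrow> norm (bgrad (verts K) p) \<le> 1 / (?s ^ 4 * diameter e)"
      using sr(1)[of p] h s by (simp add: field_simps)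
  qed
  show ?thesis
  proof (intro regular_mesh.intro vmesh_axioms regular_mesh_axioms.intro)
    show "real CARD('n) + 1 \<le> \<Lambda>" by (rule \<Lambda>)
    show "norm (x - x0) \<le> \<Lambda>" if "x \<in> closure \<Omega>" for x using D[OF that] .
  next
    fix K e assume K: "K \<in> T" and e: "e facet_of K"
    show h: "diameter e > 0" using reg(1)[OF K e] .
    show "diameter e \<le> \<Lambda> * diameter e'" if e': "e' facet_of K" for e'
    proof -
      have "diameter e \<le> 1 / ?s\<^sup>2 * diameter e'" using reg(2)[OF K e e'] s by (simp add: field_simps)
      also have "\<dots> \<le> \<Lambda> * diameter e'" using \<Lambda>(2) reg(1)[OF K e'] by (intro mult_right_mono) auto
      finally show ?thesis .
    qed
    fix f :: "real^'n \<Rightarrow> complex" assume f: "complex_affine f"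
    have "sqF e f \<le> (real CARD('n) + 1) * (real CARD('n) + 2) * (1 / (?s ^ 4 * diameter e)) * sqK K f"
      using reg(3)[OF K e] by (rule trace_mesh[OF K e f])
    also have "\<dots> = (real CARD('n) + 1) * (real CARD('n) + 2) / ?s ^ 4 / diameter e * sqK K f" by simp
    also have "\<dots> \<le> \<Lambda> / diameter e * sqK K f"
      using \<Lambda>(3) h by (intro mult_right_mono divide_right_mono) (auto simp: integral_nonneg_AE)
    finally show "sqF e f \<le> \<Lambda> / diameter e * sqK K f" .
    fix t assume t: "facet_normal K e \<bullet> t = 0"
    have "farea e * (norm (bdot (cgrad f) t))\<^sup>2
      \<le> (real CARD('n))\<^sup>2 * (real CARD('n) + 1) * (1 / (?s ^ 4 * diameter e))\<^sup>2 * (norm t)\<^sup>2 * sqF e f"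
      using reg(3)[OF K e] by (rule tangential_mesh[OF K e f t])
    also have "\<dots> = (real CARD('n))\<^sup>2 * (real CARD('n) + 1) / ?s ^ 8 / (diameter e)\<^sup>2 * (norm t)\<^sup>2 * sqF e f"
      by (simp add: power_divide power_mult_distrib flip: power_mult)
    also have "\<dots> \<le> \<Lambda> / (diameter e)\<^sup>2 * (norm t)\<^sup>2 * sqF e f"
      using \<Lambda>(4) h by (intro mult_right_mono divide_right_mono) (auto simp: integral_nonneg_AE)
    finally show "measure (face_measure e) e * (norm (bdot (cgrad f) t))\<^sup>2
      \<le> \<Lambda> / (diameter e)\<^sup>2 * (norm t)\<^sup>2 * sqF e f" unfolding farea_def .
  next
    fix K e assume K: "K \<in> T" and e: "e facet_of K" and b: "e \<subseteq> frontier \<Omega>"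
    \<comment> \<open>A facet contained in the boundary is unshared, so its normal is the outward
      normal of the domain at relative interior points. Star-shapedness applies at one such point,
      and the weight is constant on the facet.\<close>
    then have only: "K' = K" if "K' \<in> T" "e facet_of K'" for K'
      using facet_cases[OF K e] that by (auto simp: interior_faces_def)
    obtain x where x: "x \<in> rel_interior e" using rel_interior_facet[OF K e] by blast
    have xe: "x \<in> e" using x rel_interior_subset by blast
    have "c \<le> (x - x0) \<bullet> facet_normal K e"
      using star boundary_facet_normal[OF K e x only] by (auto simp: strictly_star_shaped_def)
    also have "\<dots> = facet_normal K e \<bullet> ((SOME y. y \<in> e) - x0)"
      using off_eq[OF K e xe, of x0] by (simp add: off_def inner_commute)
    finally have o: "c \<le> facet_normal K e \<bullet> ((SOME y. y \<in> e) - x0)" .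
    have "1 = 1 / c * c" using c by simp
    also have "\<dots> \<le> \<Lambda> * (facet_normal K e \<bullet> ((SOME y. y \<in> e) - x0))"
      using \<Lambda>(1,5) o c by (intro mult_mono) auto
    finally show "1 \<le> \<Lambda> * (facet_normal K e \<bullet> ((SOME y. y \<in> e) - x0))" .
  qed
qed

text \<open>If \<open>\<beta> * h\<close> is at least 1 the first term suffices, otherwise the
  second does; no choice of penalty makes both small. The assumption
  \<open>h\<^sup>2 \<le> \<Lambda>\<close> comes from the boundedness of the domain.\<close>

lemma penalty_lower_bound:
  fixes \<beta> h \<Lambda> :: real
  assumes "0 < \<beta>" "0 < h" "h\<^sup>2 \<le> \<Lambda>"
  shows "1 \<le> \<Lambda> * (\<beta> / h + 1 / (\<beta> * h ^ 3))"
proof -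
  have "1 \<le> \<beta> * h + 1 / (\<beta> * h)"
    using assms by (cases "1 \<le> \<beta> * h") (auto simp: field_simps add_increasing add_increasing2)
  also have "\<dots> = h\<^sup>2 * (\<beta> / h + 1 / (\<beta> * h ^ 3))"
    using assms by (simp add: field_simps power2_eq_square power3_eq_cube)
  also have "\<dots> \<le> \<Lambda> * (\<beta> / h + 1 / (\<beta> * h ^ 3))"
    using assms by (intro mult_right_mono) auto
  finally show ?thesis .
qed

lemma L2_boundary_norm_nonneg: "0 \<le> L2_boundary_norm \<Omega> T g"
  by (simp add: L2_boundary_norm_def boundary_integral_def sum_nonneg integral_nonneg_AE)

text \<open>With an interior face or with \<open>k\<close> at least 1 the factor
  \<open>\<gamma>\<^sub>2\<close> is bounded below and the general estimate applies. Otherwise it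
  equals \<open>k\<close>, which may be arbitrarily small, and the estimate without interior faces
  takes over. The constant adds up both cases.\<close>

lemma (in regular_mesh) DG_norm_le:
  assumes diam: "\<And>e. e \<in> interior_faces T \<Longrightarrow> (diameter e)\<^sup>2 \<le> \<Lambda>" and c: "0 \<le> c"
    and pos: "0 < k" "0 < \<beta>" "0 < \<delta>"
    and f: "f \<in> L2 (lebesgue_on \<Omega>)" and g: "g \<in> L2_boundary \<Omega> T"
    and u: "u \<in> V\<^sub>h T" and \<sigma>: "\<sigma> \<in> \<Sigma>\<^sub>h T"
    and sol: "\<forall>v\<in>V\<^sub>h T. \<forall>\<tau>\<in>\<Sigma>\<^sub>h T. B\<^sub>h \<Omega> T k \<beta> \<delta> u \<sigma> v \<tau> = LDG_rhs \<Omega> T f g v"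
  shows "DG_norm \<Omega> c T k u \<sigma>
    \<le> sqrt (144 * (29 * \<Lambda> ^ 8) ^ 4 * (4 + c + 8 * \<Lambda>\<^sup>2) + (\<Lambda> ^ 4 + \<Lambda>\<^sup>2 + 18 * \<Lambda> ^ 6 + 9 * c * \<Lambda> ^ 8))
      * (\<gamma>\<^sub>2 T k \<beta> \<delta> / k * (L2_norm (lebesgue_on \<Omega>) f + L2_boundary_norm \<Omega> T g))"
    (is "_ \<le> sqrt (?A + ?B) * (\<gamma>\<^sub>2 T k \<beta> \<delta> / k * (?F + ?G))")
proof -
  define U where "U = piece u"
  define S where "S = vpiece \<sigma>"
  have rU: "represents u U" and rS: "vrepresents \<sigma> S"
    using represents_piece[OF u] vrepresents_vpiece[OF \<sigma>] by (simp_all add: U_def S_def)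
  have U: "affine_family U" and S: "affine_vfamily S"
    using rU rS by (auto simp: represents_def vrepresents_def affine_family_def affine_vfamily_def)
  obtain l where l: "\<And>V. affine_family V \<Longrightarrow> scalar_form k \<beta> U S V = l V"
    "\<And>W. affine_vfamily W \<Longrightarrow> vector_form \<delta> U S W = 0"
    "\<And>V. affine_family V \<Longrightarrow> norm (l V) \<le> ?F * sqrt (volume_square V) + ?G * sqrt (boundary_square V)"
    using discrete_equations[OF f g rU rS sol] by blast
  interpret ds: discrete_solution \<Omega> T x0 \<Lambda> k \<beta> \<delta> U S l
    using regular_mesh_axioms pos U S l(1,2) by (simp add: discrete_solution_def discrete_solution_axioms_def)
  let ?t = "\<lambda>e. (k\<^sup>2 + 1) / (\<beta> * diameter e) + (\<beta> + \<delta>) / diameter e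
       + \<delta> / diameter e ^ 3 + 1 / (\<beta> * diameter e ^ 3)"
  let ?m = "Max (insert 0 (?t ` interior_faces T))"
  have m: "?t e \<le> ?m" if "e \<in> interior_faces T" for e
    using that finite_interior_faces by (intro Max_ge) auto
  have m0: "0 \<le> ?m" using finite_interior_faces by (intro Max_ge) auto
  have FG: "0 \<le> ?F" "0 \<le> ?G" by (rule L2_norm_nonneg, rule L2_boundary_norm_nonneg)
  have \<Lambda>2: "2 \<le> \<Lambda>" using dim_le zero_less_card_finite[where 'a='n] by linarith
  define Q where "Q = k\<^sup>2 * volume_square U + k\<^sup>2 * boundary_square U + volume_square S + c * boundary_square ds.B"
  have DG: "DG_norm \<Omega> c T k u \<sigma> = sqrt Q"
    unfolding DG_norm_eq[OF rU rS] Q_def ds.B_def[abs_def] ..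
  have AB: "0 \<le> ?A" "0 \<le> ?B" using \<Lambda>2 c by auto
  have "Q \<le> (?A + ?B) * (\<gamma>\<^sub>2 T k \<beta> \<delta> / k * (?F + ?G))\<^sup>2"
  proof (cases "interior_faces T \<noteq> {} \<or> 1 \<le> k")
    case True
    have lower: "1 \<le> \<Lambda> * (k + ?m)"
    proof (cases "1 \<le> k")
      case True
      then have "1 * 1 \<le> \<Lambda> * (k + ?m)" using \<Lambda>2 m0 by (intro mult_mono) auto
      then show ?thesis by simp
    next
      case False
      then obtain e where e: "e \<in> interior_faces T" using True by blast
      then obtain K where "K \<in> T" "e facet_of K" by (auto simp: interior_faces_def)
      then have h: "0 < diameter e" by (rule diam_pos)
      have "1 \<le> \<Lambda> * (\<beta> / diameter e + 1 / (\<beta> * diameter e ^ 3))"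
        by (rule penalty_lower_bound[OF pos(2) h diam[OF e]])
      also have "\<dots> \<le> \<Lambda> * (k + ?m)"
      proof (rule mult_left_mono)
        have "0 \<le> (k\<^sup>2 + 1) / (\<beta> * diameter e)" "0 \<le> \<delta> / diameter e" "0 \<le> \<delta> / diameter e ^ 3"
          using pos h by auto
        then have "\<beta> / diameter e + 1 / (\<beta> * diameter e ^ 3) \<le> ?t e"
          by (simp add: add_divide_distrib)
        then show "\<beta> / diameter e + 1 / (\<beta> * diameter e ^ 3) \<le> k + ?m" using m[OF e] pos(1) by linarith
      qed (use \<Lambda>2 in simp)
      finally show ?thesis .
    qed
    interpret st: stability \<Omega> T x0 \<Lambda> k \<beta> \<delta> U S l "\<gamma>\<^sub>2 T k \<beta> \<delta>" ?F ?G
    proof unfold_locales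
      show "?t e \<le> \<gamma>\<^sub>2 T k \<beta> \<delta>" if "e \<in> interior_faces T" for e
        using m[OF that] pos(1) unfolding \<gamma>\<^sub>2_def by linarith
    qed (use m0 lower FG l(3) in \<open>simp_all only: \<gamma>\<^sub>2_def le_add_same_cancel1\<close>)
    have "Q \<le> ?A * (\<gamma>\<^sub>2 T k \<beta> \<delta> / k * (?F + ?G))\<^sup>2"
      using st.stability_estimate[OF c] by (simp only: Q_def st.Y_def)
    also have "\<dots> \<le> (?A + ?B) * (\<gamma>\<^sub>2 T k \<beta> \<delta> / k * (?F + ?G))\<^sup>2"
      using AB by (intro mult_right_mono) auto
    finally show ?thesis .
  next
    case False
    then have none: "interior_faces T = {}" and k1: "k \<le> 1" by auto
    \<comment> \<open>With no faces the penalty constraint on \<open>\<gamma>\<close> is empty, and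
      \<open>k \<le> 1\<close> makes the value 1 admissible.\<close>
    interpret st: stability \<Omega> T x0 \<Lambda> k \<beta> \<delta> U S l 1 ?F ?G
      by unfold_locales (use none k1 \<Lambda>2 FG l(3) in simp_all)
    have "volume_square U \<le> \<Lambda>\<^sup>2 * boundary_square U"
    proof (rule volume_square_le_boundary_square[OF none U])
      fix x y assume xy: "x \<in> closure \<Omega>" "y \<in> closure \<Omega>"
      have "norm (x - y) \<le> norm (x - x0) + norm (y - x0)"
        using norm_triangle_ineq4[of "x - x0" "y - x0"] by simp
      also have "\<dots> \<le> 2 * \<Lambda>" using dist_le[OF xy(1)] dist_le[OF xy(2)] by simp
      also have "\<dots> \<le> \<Lambda>\<^sup>2" unfolding power2_eq_square using \<Lambda>2 by (intro mult_right_mono) auto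
      finally show "norm (x - y) \<le> \<Lambda>\<^sup>2" .
    qed
    then have "Q \<le> ?B * (?F + ?G)\<^sup>2"
      unfolding Q_def by (rule st.single_element_estimate[OF none k1 _ c])
    \<comment> \<open>Without interior faces the maximum in \<open>\<gamma>\<^sub>2\<close> is read
      as 0, so \<open>\<gamma>\<^sub>2\<close> divided by \<open>k\<close> is 1.\<close>
    also have "?F + ?G = \<gamma>\<^sub>2 T k \<beta> \<delta> / k * (?F + ?G)" using pos(1) by (simp add: \<gamma>\<^sub>2_def none)
    also have "?B * (\<gamma>\<^sub>2 T k \<beta> \<delta> / k * (?F + ?G))\<^sup>2 \<le> (?A + ?B) * (\<gamma>\<^sub>2 T k \<beta> \<delta> / k * (?F + ?G))\<^sup>2"
      using AB by (intro mult_right_mono) auto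
    finally show ?thesis .
  qed
  then have "sqrt Q \<le> sqrt ((?A + ?B) * (\<gamma>\<^sub>2 T k \<beta> \<delta> / k * (?F + ?G))\<^sup>2)" by (rule real_sqrt_le_mono)
  also have "\<dots> = sqrt (?A + ?B) * (\<gamma>\<^sub>2 T k \<beta> \<delta> / k * (?F + ?G))"
  proof -
    have "0 \<le> \<gamma>\<^sub>2 T k \<beta> \<delta> / k * (?F + ?G)" using m0 pos(1) FG unfolding \<gamma>\<^sub>2_def by simp
    then show ?thesis by (simp only: real_sqrt_mult real_sqrt_abs abs_of_nonneg)
  qed
  finally show ?thesis unfolding DG .
qed

theorem theorem3p3:
  fixes \<Omega> :: "(real^'n) set" and x\<^sub>\<Omega> :: "real^'n" and c\<^sub>\<Omega> :: real
    and \<T> :: "(real^'n) set set set"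
  assumes "CARD('n) = 2 \<or> CARD('n) = 3"
    and "bounded_domain \<Omega>"
    and "strictly_star_shaped \<Omega> x\<^sub>\<Omega> c\<^sub>\<Omega>"
    and "\<forall>T\<in>\<T>. mesh_of \<Omega> T"
    and "minimal_angle_condition \<T>"
  shows "\<exists>C>0. \<forall>T\<in>\<T>. \<forall>k>0. \<forall>\<beta>>0. \<forall>\<delta>>0.
     \<forall>f\<in>L2 (lebesgue_on \<Omega>). \<forall>g\<in>L2_boundary \<Omega> T.
     \<forall>u\<in>V\<^sub>h T. \<forall>\<sigma>\<in>\<Sigma>\<^sub>h T.
       (\<forall>v\<in>V\<^sub>h T. \<forall>\<tau>\<in>\<Sigma>\<^sub>h T. B\<^sub>h \<Omega> T k \<beta> \<delta> u \<sigma> v \<tau> = LDG_rhs \<Omega> T f g v) \<longrightarrow>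
       DG_norm \<Omega> c\<^sub>\<Omega> T k u \<sigma>
         \<le> C * (\<gamma>\<^sub>2 T k \<beta> \<delta> / k
                * (L2_norm (lebesgue_on \<Omega>) f + L2_boundary_norm \<Omega> T g))"
proof -
  obtain \<theta>0 where \<theta>0: "0 < \<theta>0" "\<And>T K. T \<in> \<T> \<Longrightarrow> K \<in> T \<Longrightarrow> angles_ge \<theta>0 K"
    using assms(5) unfolding minimal_angle_condition_def by blast
  \<comment> \<open>A smaller lower bound for the angles remains valid, and the estimates by sines
    are stated for angles up to \<open>pi / 2\<close>.\<close>
  define \<theta> where "\<theta> = min \<theta>0 (pi / 2)"
  have \<theta>: "0 < \<theta>" "\<theta> \<le> pi / 2" "\<theta> \<le> \<theta>0" using \<theta>0 by (auto simp: \<theta>_def)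
  have ang: "angles_ge \<theta> K" if "T \<in> \<T>" "K \<in> T" for T K
    using \<theta>0(2)[OF that] \<theta>(3) unfolding angles_ge_def by (meson order_trans)
  have s: "0 < sin \<theta>" using \<theta> by (auto intro!: sin_gt_zero)
  have c: "0 < c\<^sub>\<Omega>" using assms(3) by (simp add: strictly_star_shaped_def)
  obtain D where D: "0 < D" "\<And>x. x \<in> closure \<Omega> \<Longrightarrow> norm x \<le> D"
    using assms(2) bounded_closure bounded_pos by (metis bounded_domain_def)
  let ?d = "real CARD('n)"
  \<comment> \<open>A sum of nonnegative terms dominates each of them: dimension, distance from
    \<open>x\<^sub>\<Omega>\<close>, squared facet diameters, shape constants and star-shapedness.
    Only the domain and the minimal angle enter, neither the single mesh nor \<open>k\<close>, the
    penalties or the data.\<close>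
  define \<Lambda> where "\<Lambda> = (?d + 1) + (D + norm x\<^sub>\<Omega>) + (2 * D)\<^sup>2 + 1 / (sin \<theta>)\<^sup>2
    + (?d + 1) * (?d + 2) / (sin \<theta>) ^ 4 + ?d\<^sup>2 * (?d + 1) / (sin \<theta>) ^ 8 + 1 / c\<^sub>\<Omega>"
  have p: "0 \<le> ?d + 1" "0 \<le> D + norm x\<^sub>\<Omega>" "0 \<le> (2 * D)\<^sup>2" "0 \<le> 1 / (sin \<theta>)\<^sup>2"
    "0 \<le> (?d + 1) * (?d + 2) / (sin \<theta>) ^ 4" "0 \<le> ?d\<^sup>2 * (?d + 1) / (sin \<theta>) ^ 8" "0 \<le> 1 / c\<^sub>\<Omega>"
    using D(1) s c by auto
  have \<Lambda>: "?d + 1 \<le> \<Lambda>" "D + norm x\<^sub>\<Omega> \<le> \<Lambda>" "(2 * D)\<^sup>2 \<le> \<Lambda>" "1 / (sin \<theta>)\<^sup>2 \<le> \<Lambda>"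
    "(?d + 1) * (?d + 2) / (sin \<theta>) ^ 4 \<le> \<Lambda>" "?d\<^sup>2 * (?d + 1) / (sin \<theta>) ^ 8 \<le> \<Lambda>" "1 / c\<^sub>\<Omega> \<le> \<Lambda>"
    unfolding \<Lambda>_def using p by linarith+
  define C where "C = sqrt (144 * (29 * \<Lambda> ^ 8) ^ 4 * (4 + c\<^sub>\<Omega> + 8 * \<Lambda>\<^sup>2)
    + (\<Lambda> ^ 4 + \<Lambda>\<^sup>2 + 18 * \<Lambda> ^ 6 + 9 * c\<^sub>\<Omega> * \<Lambda> ^ 8))"
  have "0 < \<Lambda>" using \<Lambda>(1) by linarith
  then have "0 < C" unfolding C_def using c by (intro real_sqrt_gt_zero add_pos_pos mult_pos_pos) auto
  moreover have "DG_norm \<Omega> c\<^sub>\<Omega> T k u \<sigma>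
      \<le> C * (\<gamma>\<^sub>2 T k \<beta> \<delta> / k * (L2_norm (lebesgue_on \<Omega>) f + L2_boundary_norm \<Omega> T g))"
    if T: "T \<in> \<T>" and pos: "0 < k" "0 < \<beta>" "0 < \<delta>"
      and data: "f \<in> L2 (lebesgue_on \<Omega>)" "g \<in> L2_boundary \<Omega> T" "u \<in> V\<^sub>h T" "\<sigma> \<in> \<Sigma>\<^sub>h T"
      and sol: "\<forall>v\<in>V\<^sub>h T. \<forall>\<tau>\<in>\<Sigma>\<^sub>h T. B\<^sub>h \<Omega> T k \<beta> \<delta> u \<sigma> v \<tau> = LDG_rhs \<Omega> T f g v"
    for T k \<beta> \<delta> f g u \<sigma>
  proof -
    interpret vmesh \<Omega> T using assms(2,4) T by unfold_locales auto
    interpret regular_mesh \<Omega> T x\<^sub>\<Omega> \<Lambda>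
    proof (rule regular_meshI[OF assms(1,3) \<theta>(1,2) ang[OF T] _ \<Lambda>(1,4,5,6,7)])
      fix x assume "x \<in> closure \<Omega>"
      then show "norm (x - x\<^sub>\<Omega>) \<le> \<Lambda>"
        using norm_triangle_ineq4[of x x\<^sub>\<Omega>] D(2)[of x] \<Lambda>(2) by linarith
    qed
    have diam: "(diameter e)\<^sup>2 \<le> \<Lambda>" if e: "e \<in> interior_faces T" for e
    proof -
      obtain K where K: "K \<in> T" "e facet_of K" using e by (auto simp: interior_faces_def)
      have sub: "e \<subseteq> closure \<Omega>" using facet_subset[OF K(2)] K_subset_closure[OF K(1)] by blast
      have "diameter e \<le> 2 * D"
      proof (rule diameter_le)
        fix x y assume "x \<in> e" "y \<in> e"
        then show "norm (x - y) \<le> 2 * D"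
          using norm_triangle_ineq4[of x y] D(2)[of x] D(2)[of y] sub by force
      qed (use D(1) in simp)
      then have "(diameter e)\<^sup>2 \<le> (2 * D)\<^sup>2" using diam_pos[OF K] by (intro power_mono) auto
      then show ?thesis using \<Lambda>(3) by linarith
    qed
    show ?thesis
      unfolding C_def by (rule DG_norm_le[OF diam less_imp_le[OF c] pos data sol])
  qed
  ultimately show ?thesis by blast
qed

end
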